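(* Let $f\colon X\to Y$ be a continuous map between finite topological spaces. The functor $\mathbb{L}f_!\colon D(X)\to D(Y)$ has a left adjoint $f^\#\colon D(Y)\to D(X)$.
   Context: A finite topological space $X$ is regarded as a preordered set: $p\le q$ iff $\overline{\{p\}}\subseteq\overline{\{q\}}$; $C_p=\{q: q\le p\}$ is the closure of $p$. An abelian data $F$ on $X$ is a functor from the preorder $X$ to abelian groups ($F_p$, with $r_{pq}\colon F_p\to F_q$ for $p\le q$). $D(X)$ is the (unbounded) derived category of the abelian category of abelian data on $X$. For $f\colon X\to Y$ continuous, $f_!F$ is the abelian data on $Y$ given by $(f_!F)_y=\varinjlim_{x\in f^{-1}(C_y)}F_x$; it is a right exact functor, with left derived functor $\mathbb{L}f_!\colon D(X)\to D(Y)$. *)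

theory Defs
  imports
    "HOL-Algebra.Coset"
    "HOL-Analysis.Abstract_Topology"
    "HOL-Library.FuncSet"
    "HOL-Library.Infinite_Typeclass"
begin

section \<open>Categories, functors, adjunctions\<close>

text \<open>
  A category consists of a set of objects, hom-sets, identities and a composition;
  \<open>Cmp C a b c g f\<close> is the composite of \<open>f : a \<rightarrow> b\<close> followed by \<open>g : b \<rightarrow> c\<close>.
  Arrows do not carry their endpoints (the hom-sets need not be disjoint), hence every operation
  on arrows takes the endpoints as arguments.
\<close>

record ('o, 'm) cat =
  Ob  :: "'o set"
  Hom :: "'o \<Rightarrow> 'o \<Rightarrow> 'm set"
  Idn :: "'o \<Rightarrow> 'm"
  Cmp :: "'o \<Rightarrow> 'o \<Rightarrow> 'o \<Rightarrow> 'm \<Rightarrow> 'm \<Rightarrow> 'm"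

definition is_category :: "('o, 'm) cat \<Rightarrow> bool" where
  "is_category C \<longleftrightarrow>
     (\<forall>a\<in>Ob C. Idn C a \<in> Hom C a a) \<and>
     (\<forall>a\<in>Ob C. \<forall>b\<in>Ob C. \<forall>c\<in>Ob C. \<forall>f\<in>Hom C a b. \<forall>g\<in>Hom C b c. Cmp C a b c g f \<in> Hom C a c) \<and>
     (\<forall>a\<in>Ob C. \<forall>b\<in>Ob C. \<forall>f\<in>Hom C a b.
        Cmp C a a b f (Idn C a) = f \<and> Cmp C a b b (Idn C b) f = f) \<and>
     (\<forall>a\<in>Ob C. \<forall>b\<in>Ob C. \<forall>c\<in>Ob C. \<forall>d\<in>Ob C.
        \<forall>f\<in>Hom C a b. \<forall>g\<in>Hom C b c. \<forall>h\<in>Hom C c d.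
          Cmp C a c d h (Cmp C a b c g f) = Cmp C a b d (Cmp C b c d h g) f)"

definition is_iso :: "('o, 'm) cat \<Rightarrow> 'o \<Rightarrow> 'o \<Rightarrow> 'm \<Rightarrow> bool" where
  "is_iso C a b f \<longleftrightarrow> f \<in> Hom C a b \<and>
     (\<exists>g\<in>Hom C b a. Cmp C a b a g f = Idn C a \<and> Cmp C b a b f g = Idn C b)"

record ('o, 'm, 'p, 'n) ftor =
  fob :: "'o \<Rightarrow> 'p"
  far :: "'o \<Rightarrow> 'o \<Rightarrow> 'm \<Rightarrow> 'n"

definition is_functor :: "('o, 'm) cat \<Rightarrow> ('p, 'n) cat \<Rightarrow> ('o, 'm, 'p, 'n) ftor \<Rightarrow> bool" where
  "is_functor C D F \<longleftrightarrow>
     (\<forall>a\<in>Ob C. fob F a \<in> Ob D) \<and>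
     (\<forall>a\<in>Ob C. \<forall>b\<in>Ob C. \<forall>f\<in>Hom C a b. far F a b f \<in> Hom D (fob F a) (fob F b)) \<and>
     (\<forall>a\<in>Ob C. far F a a (Idn C a) = Idn D (fob F a)) \<and>
     (\<forall>a\<in>Ob C. \<forall>b\<in>Ob C. \<forall>c\<in>Ob C. \<forall>f\<in>Hom C a b. \<forall>g\<in>Hom C b c.
        far F a c (Cmp C a b c g f) = Cmp D (fob F a) (fob F b) (fob F c) (far F b c g) (far F a b f))"

definition comp_ftor :: "('p, 'n, 'q, 'l) ftor \<Rightarrow> ('o, 'm, 'p, 'n) ftor \<Rightarrow> ('o, 'm, 'q, 'l) ftor" where
  "comp_ftor G F =
     \<lparr>fob = \<lambda>a. fob G (fob F a), far = \<lambda>a b f. far G (fob F a) (fob F b) (far F a b f)\<rparr>"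

text \<open>Natural transformations are extensional families, so that equality of transformations is
  equality of functions.\<close>

definition nat_trans ::
  "('o, 'm) cat \<Rightarrow> ('p, 'n) cat \<Rightarrow> ('o, 'm, 'p, 'n) ftor \<Rightarrow> ('o, 'm, 'p, 'n) ftor \<Rightarrow> ('o \<Rightarrow> 'n) \<Rightarrow> bool"
  where
  "nat_trans C D F G \<eta> \<longleftrightarrow>
     \<eta> \<in> (\<Pi>\<^sub>E a\<in>Ob C. Hom D (fob F a) (fob G a)) \<and>
     (\<forall>a\<in>Ob C. \<forall>b\<in>Ob C. \<forall>f\<in>Hom C a b.
        Cmp D (fob F a) (fob F b) (fob G b) (\<eta> b) (far F a b f) =
        Cmp D (fob F a) (fob G a) (fob G b) (far G a b f) (\<eta> a))"

text \<open>\<open>L : C \<rightarrow> D\<close> is left adjoint to \<open>R : D \<rightarrow> C\<close>, by means of bijections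
  \<open>Hom D (L c) d \<rightarrow> Hom C c (R d)\<close> natural in both variables.\<close>

definition left_adjoint ::
  "('o, 'm) cat \<Rightarrow> ('p, 'n) cat \<Rightarrow> ('o, 'm, 'p, 'n) ftor \<Rightarrow> ('p, 'n, 'o, 'm) ftor \<Rightarrow> bool" where
  "left_adjoint C D L R \<longleftrightarrow> is_functor C D L \<and> is_functor D C R \<and>
     (\<exists>\<Phi>. (\<forall>c\<in>Ob C. \<forall>d\<in>Ob D. bij_betw (\<Phi> c d) (Hom D (fob L c) d) (Hom C c (fob R d))) \<and>
       (\<forall>c\<in>Ob C. \<forall>c'\<in>Ob C. \<forall>d\<in>Ob D. \<forall>d'\<in>Ob D.
          \<forall>u\<in>Hom C c' c. \<forall>v\<in>Hom D d d'. \<forall>h\<in>Hom D (fob L c) d.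
            \<Phi> c' d' (Cmp D (fob L c') d d' v (Cmp D (fob L c') (fob L c) d h (far L c' c u))) =
            Cmp C c' (fob R d) (fob R d') (far R d d' v) (Cmp C c' c (fob R d) (\<Phi> c d h) u)))"


section \<open>Localization and left derived functors\<close>

text \<open>
  The Gabriel--Zisman localization \<open>C[W\<inverse>]\<close>: the objects are those of \<open>C\<close>; the arrows from
  \<open>a\<close> to \<open>b\<close> are zigzags of arrows of \<open>C\<close> and of formal inverses of arrows in \<open>W\<close>,
  modulo the smallest congruence that makes \<open>C \<rightarrow> C[W\<inverse>]\<close> a functor and the formal inverses
  inverses. \<open>Fwd a b f\<close> is a step from \<open>a\<close> to \<open>b\<close> along \<open>f : a \<rightarrow> b\<close>, and
  \<open>Bwd a b w\<close> is a step from \<open>a\<close> to \<open>b\<close> along \<open>w : b \<rightarrow> a\<close> taken backwards.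
\<close>

datatype ('o, 'm) zstep = Fwd 'o 'o 'm | Bwd 'o 'o 'm

inductive zigzag ::
  "('o, 'm) cat \<Rightarrow> ('o \<Rightarrow> 'o \<Rightarrow> 'm set) \<Rightarrow> 'o \<Rightarrow> 'o \<Rightarrow> ('o, 'm) zstep list \<Rightarrow> bool"
  for C W where
  zigzag_Nil: "a \<in> Ob C \<Longrightarrow> zigzag C W a a []"
| zigzag_Fwd: "a \<in> Ob C \<Longrightarrow> b \<in> Ob C \<Longrightarrow> f \<in> Hom C a b \<Longrightarrow> zigzag C W b c p \<Longrightarrow>
    zigzag C W a c (Fwd a b f # p)"
| zigzag_Bwd: "a \<in> Ob C \<Longrightarrow> b \<in> Ob C \<Longrightarrow> w \<in> W b a \<Longrightarrow> zigzag C W b c p \<Longrightarrow>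
    zigzag C W a c (Bwd a b w # p)"

inductive zigzag_eq ::
  "('o, 'm) cat \<Rightarrow> ('o \<Rightarrow> 'o \<Rightarrow> 'm set) \<Rightarrow> 'o \<Rightarrow> 'o \<Rightarrow>
    ('o, 'm) zstep list \<Rightarrow> ('o, 'm) zstep list \<Rightarrow> bool"
  for C W where
  zz_refl: "zigzag C W a b p \<Longrightarrow> zigzag_eq C W a b p p"
| zz_sym: "zigzag_eq C W a b p q \<Longrightarrow> zigzag_eq C W a b q p"
| zz_trans: "zigzag_eq C W a b p q \<Longrightarrow> zigzag_eq C W a b q r \<Longrightarrow> zigzag_eq C W a b p r"
| zz_append: "zigzag_eq C W a b p p' \<Longrightarrow> zigzag_eq C W b c q q' \<Longrightarrow>
    zigzag_eq C W a c (p @ q) (p' @ q')"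
| zz_Idn: "a \<in> Ob C \<Longrightarrow> zigzag_eq C W a a [Fwd a a (Idn C a)] []"
| zz_Cmp: "a \<in> Ob C \<Longrightarrow> b \<in> Ob C \<Longrightarrow> c \<in> Ob C \<Longrightarrow> f \<in> Hom C a b \<Longrightarrow> g \<in> Hom C b c \<Longrightarrow>
    zigzag_eq C W a c [Fwd a b f, Fwd b c g] [Fwd a c (Cmp C a b c g f)]"
| zz_inv1: "a \<in> Ob C \<Longrightarrow> b \<in> Ob C \<Longrightarrow> w \<in> W a b \<Longrightarrow> w \<in> Hom C a b \<Longrightarrow>
    zigzag_eq C W a a [Fwd a b w, Bwd b a w] []"
| zz_inv2: "a \<in> Ob C \<Longrightarrow> b \<in> Ob C \<Longrightarrow> w \<in> W a b \<Longrightarrow> w \<in> Hom C a b \<Longrightarrow>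
    zigzag_eq C W b b [Bwd b a w, Fwd a b w] []"

definition localization ::
  "('o, 'm) cat \<Rightarrow> ('o \<Rightarrow> 'o \<Rightarrow> 'm set) \<Rightarrow> ('o, ('o, 'm) zstep list set) cat" where
  "localization C W =
     \<lparr>Ob = Ob C,
      Hom = \<lambda>a b. {p. zigzag C W a b p} // {(p, q). zigzag_eq C W a b p q},
      Idn = \<lambda>a. {p. zigzag_eq C W a a [] p},
      Cmp = \<lambda>a b c \<beta> \<alpha>. {r. \<exists>p\<in>\<alpha>. \<exists>q\<in>\<beta>. zigzag_eq C W a c (p @ q) r}\<rparr>"

definition loc_ftor ::
  "('o, 'm) cat \<Rightarrow> ('o \<Rightarrow> 'o \<Rightarrow> 'm set) \<Rightarrow> ('o, 'm, 'o, ('o, 'm) zstep list set) ftor" where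
  "loc_ftor C W = \<lparr>fob = \<lambda>a. a, far = \<lambda>a b f. {p. zigzag_eq C W a b [Fwd a b f] p}\<rparr>"

text \<open>
  Let \<open>S : C \<rightarrow> D\<close> be a functor and let \<open>V\<close>, \<open>W\<close> be classes of arrows of \<open>C\<close>, \<open>D\<close>.
  A (total) left derived functor of \<open>S\<close> is a functor \<open>L : C[V\<inverse>] \<rightarrow> D[W\<inverse>]\<close> with a
  transformation \<open>\<epsilon> : L \<circ> Q\<^sub>C \<rightarrow> Q\<^sub>D \<circ> S\<close> that is terminal among all such pairs, where
  \<open>Q\<^sub>C\<close>, \<open>Q\<^sub>D\<close> are the localization functors.
\<close>

definition is_left_derived ::
  "('o, 'm) cat \<Rightarrow> ('o \<Rightarrow> 'o \<Rightarrow> 'm set) \<Rightarrow> ('p, 'n) cat \<Rightarrow> ('p \<Rightarrow> 'p \<Rightarrow> 'n set) \<Rightarrow>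
    ('o, 'm, 'p, 'n) ftor \<Rightarrow>
    ('o, ('o, 'm) zstep list set, 'p, ('p, 'n) zstep list set) ftor \<Rightarrow>
    ('o \<Rightarrow> ('p, 'n) zstep list set) \<Rightarrow> bool" where
  "is_left_derived C V D W S L \<epsilon> \<longleftrightarrow>
     is_functor (localization C V) (localization D W) L \<and>
     nat_trans C (localization D W) (comp_ftor L (loc_ftor C V)) (comp_ftor (loc_ftor D W) S) \<epsilon> \<and>
     (\<forall>G \<gamma>. is_functor (localization C V) (localization D W) G \<longrightarrow>
        nat_trans C (localization D W) (comp_ftor G (loc_ftor C V)) (comp_ftor (loc_ftor D W) S) \<gamma> \<longrightarrow>
        (\<exists>!\<delta>. nat_trans (localization C V) (localization D W) G L \<delta> \<and>
           (\<forall>a\<in>Ob C. Cmp (localization D W) (fob G a) (fob L a) (fob S a) (\<epsilon> a) (\<delta> a) = \<gamma> a)))"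


section \<open>Abelian data\<close>

definition spec_le :: "'a topology \<Rightarrow> 'a \<Rightarrow> 'a \<Rightarrow> bool" where
  "spec_le X p q \<longleftrightarrow>
     p \<in> topspace X \<and> q \<in> topspace X \<and> X closure_of {p} \<subseteq> X closure_of {q}"

text \<open>The closure of \<open>q\<close> is the set \<open>C\<^sub>q\<close> of all points below \<open>q\<close>.\<close>

lemma closure_of_eq_spec_le:
  assumes "q \<in> topspace X"
  shows "X closure_of {q} = {p. spec_le X p q}"
proof -
  have "spec_le X p q" if "p \<in> X closure_of {q}" for p
    using that assms closure_of_minimal[of "{p}" "X closure_of {q}" X]
    by (auto simp: spec_le_def in_closure_of)
  moreover have "p \<in> X closure_of {q}" if "spec_le X p q" for p
    using that closure_of_subset[of "{p}" X] by (auto simp: spec_le_def)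
  ultimately show ?thesis by blast
qed

text \<open>
  Abelian groups are commutative groups of \<^theory>\<open>HOL-Algebra.Group\<close> (written multiplicatively)
  whose carrier is a set of elements of a type \<open>'u\<close>, which plays the role of the universe;
  for infinite \<open>'u\<close> these groups are closed, up to isomorphism, under finite direct sums and
  quotients, hence under finite colimits. Homomorphisms are extensional.
\<close>

definition ghom :: "'u monoid \<Rightarrow> 'v monoid \<Rightarrow> ('u \<Rightarrow> 'v) set" where
  "ghom G H = hom G H \<inter> extensional (carrier G)"

record ('a, 'u) abdata =
  stalk :: "'a \<Rightarrow> 'u monoid"
  res   :: "'a \<Rightarrow> 'a \<Rightarrow> 'u \<Rightarrow> 'u"

definition abelian_data :: "'a topology \<Rightarrow> ('a, 'u) abdata \<Rightarrow> bool" where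
  "abelian_data X F \<longleftrightarrow>
     (\<forall>p\<in>topspace X. comm_group (stalk F p)) \<and>
     (\<forall>p q. spec_le X p q \<longrightarrow> res F p q \<in> ghom (stalk F p) (stalk F q)) \<and>
     (\<forall>p\<in>topspace X. res F p p = (\<lambda>x\<in>carrier (stalk F p). x)) \<and>
     (\<forall>p q r. spec_le X p q \<longrightarrow> spec_le X q r \<longrightarrow>
        res F p r = compose (carrier (stalk F p)) (res F q r) (res F p q))"

definition abdata_cat :: "'a topology \<Rightarrow> (('a, 'u) abdata, 'a \<Rightarrow> 'u \<Rightarrow> 'u) cat" where
  "abdata_cat X =
     \<lparr>Ob = {F. abelian_data X F},
      Hom = \<lambda>F G. {\<phi> \<in> (\<Pi>\<^sub>E p\<in>topspace X. ghom (stalk F p) (stalk G p)).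
         \<forall>p q. spec_le X p q \<longrightarrow>
           compose (carrier (stalk F p)) (res G p q) (\<phi> p) =
           compose (carrier (stalk F p)) (\<phi> q) (res F p q)},
      Idn = \<lambda>F. \<lambda>p\<in>topspace X. \<lambda>x\<in>carrier (stalk F p). x,
      Cmp = \<lambda>F G H \<psi> \<phi>. \<lambda>p\<in>topspace X. compose (carrier (stalk F p)) (\<psi> p) (\<phi> p)\<rparr>"

definition zero_mor :: "'a topology \<Rightarrow> ('a, 'u) abdata \<Rightarrow> ('a, 'u) abdata \<Rightarrow> 'a \<Rightarrow> 'u \<Rightarrow> 'u" where
  "zero_mor X F G = (\<lambda>p\<in>topspace X. \<lambda>x\<in>carrier (stalk F p). \<one>\<^bsub>stalk G p\<^esub>)"


section \<open>Unbounded cochain complexes and the derived category\<close>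

record ('a, 'u) cochain =
  cterm :: "int \<Rightarrow> ('a, 'u) abdata"
  cdiff :: "int \<Rightarrow> 'a \<Rightarrow> 'u \<Rightarrow> 'u"

type_synonym ('a, 'u) cmor = "int \<Rightarrow> 'a \<Rightarrow> 'u \<Rightarrow> 'u"

definition complex_cat :: "'a topology \<Rightarrow> (('a, 'u) cochain, ('a, 'u) cmor) cat" where
  "complex_cat X =
     \<lparr>Ob = {K. \<forall>n. cterm K n \<in> Ob (abdata_cat X) \<and>
         cdiff K n \<in> Hom (abdata_cat X) (cterm K n) (cterm K (n + 1)) \<and>
         Cmp (abdata_cat X) (cterm K n) (cterm K (n + 1)) (cterm K (n + 1 + 1))
           (cdiff K (n + 1)) (cdiff K n) = zero_mor X (cterm K n) (cterm K (n + 1 + 1))},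
      Hom = \<lambda>K L. {\<phi>. \<forall>n. \<phi> n \<in> Hom (abdata_cat X) (cterm K n) (cterm L n) \<and>
         Cmp (abdata_cat X) (cterm K n) (cterm L n) (cterm L (n + 1)) (cdiff L n) (\<phi> n) =
         Cmp (abdata_cat X) (cterm K n) (cterm K (n + 1)) (cterm L (n + 1)) (\<phi> (n + 1)) (cdiff K n)},
      Idn = \<lambda>K n. Idn (abdata_cat X) (cterm K n),
      Cmp = \<lambda>K L M \<psi> \<phi> n. Cmp (abdata_cat X) (cterm K n) (cterm L n) (cterm M n) (\<psi> n) (\<phi> n)\<rparr>"

definition cocycles :: "('a, 'u) cochain \<Rightarrow> int \<Rightarrow> 'a \<Rightarrow> 'u set" where
  "cocycles K n p = kernel (stalk (cterm K n) p) (stalk (cterm K (n + 1)) p) (cdiff K n p)"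

definition coboundaries :: "('a, 'u) cochain \<Rightarrow> int \<Rightarrow> 'a \<Rightarrow> 'u set" where
  "coboundaries K n p = cdiff K (n - 1) p ` carrier (stalk (cterm K (n - 1)) p)"

definition cohomology_group :: "('a, 'u) cochain \<Rightarrow> int \<Rightarrow> 'a \<Rightarrow> 'u set monoid" where
  "cohomology_group K n p =
     (stalk (cterm K n) p)\<lparr>carrier := cocycles K n p\<rparr> Mod coboundaries K n p"

text \<open>
  The map induced by \<open>h\<close> from a group \<open>Q\<close> of cosets to cosets of \<open>B\<close> in \<open>H\<close>. If \<open>h\<close> is a
  homomorphism that maps the subgroup in the source into \<open>B\<close>, then all members of the union are
  equal.
\<close>

definition coset_map :: "'u set monoid \<Rightarrow> 'u monoid \<Rightarrow> 'u set \<Rightarrow> ('u \<Rightarrow> 'u) \<Rightarrow> 'u set \<Rightarrow> 'u set" where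
  "coset_map Q H B h = (\<lambda>S\<in>carrier Q. \<Union>x\<in>S. B #>\<^bsub>H\<^esub> h x)"

text \<open>The cohomology of a complex of abelian data is itself an abelian data (kernels and cokernels
  are formed pointwise).\<close>

definition cohomology :: "('a, 'u) cochain \<Rightarrow> int \<Rightarrow> ('a, 'u set) abdata" where
  "cohomology K n =
     \<lparr>stalk = cohomology_group K n,
      res = \<lambda>p q. coset_map (cohomology_group K n p) (stalk (cterm K n) q) (coboundaries K n q)
                   (res (cterm K n) p q)\<rparr>"

definition cohomology_mor ::
  "'a topology \<Rightarrow> ('a, 'u) cochain \<Rightarrow> ('a, 'u) cochain \<Rightarrow> int \<Rightarrow> ('a, 'u) cmor \<Rightarrow>
    'a \<Rightarrow> 'u set \<Rightarrow> 'u set" where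
  "cohomology_mor X K L n \<phi> =
     (\<lambda>p\<in>topspace X. coset_map (cohomology_group K n p) (stalk (cterm L n) p)
        (coboundaries L n p) (\<phi> n p))"

definition quasi_isos ::
  "'a topology \<Rightarrow> ('a, 'u) cochain \<Rightarrow> ('a, 'u) cochain \<Rightarrow> ('a, 'u) cmor set" where
  "quasi_isos X K L = {\<phi> \<in> Hom (complex_cat X) K L.
     \<forall>n. is_iso (abdata_cat X) (cohomology K n) (cohomology L n) (cohomology_mor X K L n \<phi>)}"

type_synonym ('a, 'u) dmor = "(('a, 'u) cochain, ('a, 'u) cmor) zstep list set"

definition derived_cat :: "'a topology \<Rightarrow> (('a, 'u) cochain, ('a, 'u) dmor) cat" where
  "derived_cat X = localization (complex_cat X) (quasi_isos X)"


section \<open>The functor \<open>f\<^sub>!\<close> and its left derived functor\<close>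

definition is_cocone ::
  "'a topology \<Rightarrow> 'a set \<Rightarrow> ('a, 'u) abdata \<Rightarrow> 'u monoid \<Rightarrow> ('a \<Rightarrow> 'u \<Rightarrow> 'u) \<Rightarrow> bool" where
  "is_cocone X I F A \<iota> \<longleftrightarrow> comm_group A \<and>
     (\<forall>p\<in>I. \<iota> p \<in> ghom (stalk F p) A) \<and>
     (\<forall>p\<in>I. \<forall>q\<in>I. spec_le X p q \<longrightarrow> compose (carrier (stalk F p)) (\<iota> q) (res F p q) = \<iota> p)"

definition cocone_map ::
  "'a set \<Rightarrow> ('a, 'u) abdata \<Rightarrow> 'u monoid \<Rightarrow> ('a \<Rightarrow> 'u \<Rightarrow> 'u) \<Rightarrow> 'u monoid \<Rightarrow> ('a \<Rightarrow> 'u \<Rightarrow> 'u) \<Rightarrow>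
    ('u \<Rightarrow> 'u) \<Rightarrow> bool" where
  "cocone_map I F A \<iota> B \<kappa> h \<longleftrightarrow>
     h \<in> ghom A B \<and> (\<forall>p\<in>I. compose (carrier (stalk F p)) h (\<iota> p) = \<kappa> p)"

definition is_colimit ::
  "'a topology \<Rightarrow> 'a set \<Rightarrow> ('a, 'u) abdata \<Rightarrow> 'u monoid \<Rightarrow> ('a \<Rightarrow> 'u \<Rightarrow> 'u) \<Rightarrow> bool" where
  "is_colimit X I F A \<iota> \<longleftrightarrow> is_cocone X I F A \<iota> \<and>
     (\<forall>B \<kappa>. is_cocone X I F B \<kappa> \<longrightarrow> (\<exists>!h. cocone_map I F A \<iota> B \<kappa> h))"

text \<open>A chosen colimit of \<open>F\<close> over \<open>I\<close>, its structure maps, and the map out of it that is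
  determined by a cocone.\<close>

definition colim_obj :: "'a topology \<Rightarrow> 'a set \<Rightarrow> ('a, 'u) abdata \<Rightarrow> 'u monoid" where
  "colim_obj X I F = (SOME A. \<exists>\<iota>. is_colimit X I F A \<iota>)"

definition colim_in :: "'a topology \<Rightarrow> 'a set \<Rightarrow> ('a, 'u) abdata \<Rightarrow> 'a \<Rightarrow> 'u \<Rightarrow> 'u" where
  "colim_in X I F = (SOME \<iota>. is_colimit X I F (colim_obj X I F) \<iota>)"

definition colim_desc ::
  "'a topology \<Rightarrow> 'a set \<Rightarrow> ('a, 'u) abdata \<Rightarrow> 'u monoid \<Rightarrow> ('a \<Rightarrow> 'u \<Rightarrow> 'u) \<Rightarrow> 'u \<Rightarrow> 'u" where
  "colim_desc X I F B \<kappa> = (THE h. cocone_map I F (colim_obj X I F) (colim_in X I F) B \<kappa> h)"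

definition fibre_below :: "'a topology \<Rightarrow> 'b topology \<Rightarrow> ('a \<Rightarrow> 'b) \<Rightarrow> 'b \<Rightarrow> 'a set" where
  "fibre_below X Y f y = {x \<in> topspace X. f x \<in> Y closure_of {y}}"

definition lower_shriek ::
  "'a topology \<Rightarrow> 'b topology \<Rightarrow> ('a \<Rightarrow> 'b) \<Rightarrow>
    (('a, 'u) abdata, 'a \<Rightarrow> 'u \<Rightarrow> 'u, ('b, 'u) abdata, 'b \<Rightarrow> 'u \<Rightarrow> 'u) ftor" where
  "lower_shriek X Y f =
     \<lparr>fob = \<lambda>F.
        \<lparr>stalk = \<lambda>y. colim_obj X (fibre_below X Y f y) F,
         res = \<lambda>y y'. colim_desc X (fibre_below X Y f y) F
           (colim_obj X (fibre_below X Y f y') F) (colim_in X (fibre_below X Y f y') F)\<rparr>,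
      far = \<lambda>F G \<phi>. \<lambda>y\<in>topspace Y. colim_desc X (fibre_below X Y f y) F
        (colim_obj X (fibre_below X Y f y) G)
        (\<lambda>x. compose (carrier (stalk F x)) (colim_in X (fibre_below X Y f y) G x) (\<phi> x))\<rparr>"

definition lower_shriek_complex ::
  "'a topology \<Rightarrow> 'b topology \<Rightarrow> ('a \<Rightarrow> 'b) \<Rightarrow>
    (('a, 'u) cochain, ('a, 'u) cmor, ('b, 'u) cochain, ('b, 'u) cmor) ftor" where
  "lower_shriek_complex X Y f =
     \<lparr>fob = \<lambda>K.
        \<lparr>cterm = \<lambda>n. fob (lower_shriek X Y f) (cterm K n),
         cdiff = \<lambda>n. far (lower_shriek X Y f) (cterm K n) (cterm K (n + 1)) (cdiff K n)\<rparr>,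
      far = \<lambda>K L \<phi> n. far (lower_shriek X Y f) (cterm K n) (cterm L n) (\<phi> n)\<rparr>"

text \<open>A left derived functor is unique up to a unique isomorphism; one of them is chosen.\<close>

definition L_lower_shriek ::
  "'a topology \<Rightarrow> 'b topology \<Rightarrow> ('a \<Rightarrow> 'b) \<Rightarrow>
    (('a, 'u) cochain, ('a, 'u) dmor, ('b, 'u) cochain, ('b, 'u) dmor) ftor" where
  "L_lower_shriek X Y f =
     (SOME L. \<exists>\<epsilon>. is_left_derived (complex_cat X) (quasi_isos X) (complex_cat Y) (quasi_isos Y)
        (lower_shriek_complex X Y f) L \<epsilon>)"


section \<open>Well-definedness\<close>

lemma spec_le_refl: "p \<in> topspace X \<Longrightarrow> spec_le X p p" by (simp add: spec_le_def)
lemma spec_leD: "spec_le X p q \<Longrightarrow> p \<in> topspace X \<and> q \<in> topspace X" by (simp add: spec_le_def)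

lemma Hom_abdata_cat_iff: "\<phi> \<in> Hom (abdata_cat X) F G \<longleftrightarrow> \<phi> \<in> extensional (topspace X) \<and>
   (\<forall>p\<in>topspace X. \<phi> p \<in> ghom (stalk F p) (stalk G p)) \<and>
   (\<forall>p q. spec_le X p q \<longrightarrow> (\<forall>x\<in>carrier (stalk F p). res G p q (\<phi> p x) = \<phi> q (res F p q x)))"
  by (auto simp: abdata_cat_def PiE_def Pi_def compose_def fun_eq_iff restrict_def)

lemma ghom_iff: "f \<in> ghom A B \<longleftrightarrow> f \<in> extensional (carrier A) \<and> (\<forall>x\<in>carrier A. f x \<in> carrier B) \<and>
  (\<forall>x\<in>carrier A. \<forall>y\<in>carrier A. f (x \<otimes>\<^bsub>A\<^esub> y) = f x \<otimes>\<^bsub>B\<^esub> f y)"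
  by (auto simp: ghom_def hom_def)

lemma compose_ghom_assoc: assumes "f \<in> ghom A B" shows
 "compose (carrier A) h (compose (carrier A) g f) = compose (carrier A) (compose (carrier B) h g) f"
  using assms by (auto simp: ghom_iff compose_def fun_eq_iff)


lemma ghom_compose: assumes "comm_group A" "f \<in> ghom A B" "g \<in> ghom B C" shows "compose (carrier A) g f \<in> ghom A C"
proof -
  have "x \<otimes>\<^bsub>A\<^esub> y \<in> carrier A" if "x \<in> carrier A" "y \<in> carrier A" for x y
    using assms(1) that by (simp add: comm_group_def comm_monoid_def monoid.m_closed)
  then show ?thesis using assms by (simp add: ghom_iff compose_def)
qed

lemma ghom_id: assumes "comm_group A" shows "(\<lambda>x\<in>carrier A. x) \<in> ghom A A"
proof -
  have "x \<otimes>\<^bsub>A\<^esub> y \<in> carrier A" if "x \<in> carrier A" "y \<in> carrier A" for x y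
    using assms(1) that by (simp add: comm_group_def comm_monoid_def monoid.m_closed)
  then show ?thesis by (simp add: ghom_iff)
qed

lemma is_category_abdata_cat: "is_category (abdata_cat X)"
proof -
  have 1: "Idn (abdata_cat X) F \<in> Hom (abdata_cat X) F F" if F: "abelian_data X F" for F
  proof -
    have "res F p q \<in> ghom (stalk F p) (stalk F q)" if "spec_le X p q" for p q using F that by (simp add: abelian_data_def)
    then have "\<forall>p q. spec_le X p q \<longrightarrow> (\<forall>x\<in>carrier (stalk F p). res F p q x \<in> carrier (stalk F q))"
      by (simp add: ghom_iff)
    then show ?thesis using F spec_leD[of X] unfolding Hom_abdata_cat_iff
      by (simp add: abdata_cat_def abelian_data_def ghom_id)
  qed
  have 2: "Cmp (abdata_cat X) F G H g f \<in> Hom (abdata_cat X) F H"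
    if F: "abelian_data X F" "f \<in> Hom (abdata_cat X) F G" "g \<in> Hom (abdata_cat X) G H" for F G H f g
  proof -
    have r: "res F p q \<in> ghom (stalk F p) (stalk F q)" if "spec_le X p q" for p q using F that by (simp add: abelian_data_def)
    have g: "f p \<in> ghom (stalk F p) (stalk G p)" "g p \<in> ghom (stalk G p) (stalk H p)" "comm_group (stalk F p)"
      if "p \<in> topspace X" for p
      using F that by (auto simp add: Hom_abdata_cat_iff abelian_data_def)
    have n: "res G p q (f p x) = f q (res F p q x)" if "spec_le X p q" "x \<in> carrier (stalk F p)" for p q x
      using F that by (auto simp add: Hom_abdata_cat_iff)
    have n2: "res H p q (g p x) = g q (res G p q x)" if "spec_le X p q" "x \<in> carrier (stalk G p)" for p q x
      using F that by (auto simp add: Hom_abdata_cat_iff)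
    have m: "f p x \<in> carrier (stalk G p)" if "p \<in> topspace X" "x \<in> carrier (stalk F p)" for p x
      using g(1)[OF that(1)] that by (simp add: ghom_iff)
    have m': "res F p q x \<in> carrier (stalk F q)" if "spec_le X p q" "x \<in> carrier (stalk F p)" for p q x
      using r[OF that(1)] that by (simp add: ghom_iff)
    show ?thesis unfolding Hom_abdata_cat_iff using spec_leD[of X]
      by (simp add: abdata_cat_def ghom_compose[OF g(3) g(1) g(2)] compose_def n n2 m m')
        (use ghom_compose[OF g(3) g(1) g(2)] in \<open>simp add: compose_def\<close>)
  qed
  have 3: "Cmp (abdata_cat X) F F G f (Idn (abdata_cat X) F) = f"
     "Cmp (abdata_cat X) F G G (Idn (abdata_cat X) G) f = f" if "f \<in> Hom (abdata_cat X) F G" for F G f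
    using that unfolding Hom_abdata_cat_iff
    by (auto simp: abdata_cat_def fun_eq_iff compose_def restrict_def ghom_iff extensional_def)
  have 4: "Cmp (abdata_cat X) a c d h (Cmp (abdata_cat X) a b c g f) = Cmp (abdata_cat X) a b d (Cmp (abdata_cat X) b c d h g) f"
    if "f \<in> Hom (abdata_cat X) a b" for a b c d f g h
  proof -
    have "compose (carrier (stalk a p)) (h p) (compose (carrier (stalk a p)) (g p) (f p)) =
      compose (carrier (stalk a p)) (compose (carrier (stalk b p)) (h p) (g p)) (f p)" if "p \<in> topspace X" for p
      by (rule compose_ghom_assoc) (use that \<open>f \<in> _\<close> in \<open>simp add: Hom_abdata_cat_iff\<close>)
    then show ?thesis by (simp add: abdata_cat_def restrict_def fun_eq_iff)
  qed
  have ob: "Ob (abdata_cat X) = {F. abelian_data X F}" by (simp add: abdata_cat_def)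
  show ?thesis unfolding is_category_def ob
    apply (intro conjI ballI)
    subgoal by (simp add: 1)
    subgoal by (rule 2) simp_all
    subgoal by (rule 3)
    subgoal by (rule 3)
    subgoal by (rule 4)
    done
qed

lemma is_category_complex_cat: "is_category (complex_cat X)"
proof -
  let ?A = "abdata_cat X"
  have c: "\<And>a. a \<in> Ob ?A \<Longrightarrow> Idn ?A a \<in> Hom ?A a a"
   "\<And>a b c f g. a \<in> Ob ?A \<Longrightarrow> b \<in> Ob ?A \<Longrightarrow> c \<in> Ob ?A \<Longrightarrow> f \<in> Hom ?A a b \<Longrightarrow> g \<in> Hom ?A b c \<Longrightarrow> Cmp ?A a b c g f \<in> Hom ?A a c"
   "\<And>a b f. a \<in> Ob ?A \<Longrightarrow> b \<in> Ob ?A \<Longrightarrow> f \<in> Hom ?A a b \<Longrightarrow> Cmp ?A a a b f (Idn ?A a) = f \<and> Cmp ?A a b b (Idn ?A b) f = f"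
   "\<And>a b c d f g h. a \<in> Ob ?A \<Longrightarrow> b \<in> Ob ?A \<Longrightarrow> c \<in> Ob ?A \<Longrightarrow> d \<in> Ob ?A \<Longrightarrow> f \<in> Hom ?A a b \<Longrightarrow> g \<in> Hom ?A b c \<Longrightarrow> h \<in> Hom ?A c d
     \<Longrightarrow> Cmp ?A a c d h (Cmp ?A a b c g f) = Cmp ?A a b d (Cmp ?A b c d h g) f"
    using is_category_abdata_cat[of X] unfolding is_category_def by blast+
  have 2: "Cmp (complex_cat X) K L M g f \<in> Hom (complex_cat X) K M"
    if "K \<in> Ob (complex_cat X)" "L \<in> Ob (complex_cat X)" "M \<in> Ob (complex_cat X)"
      "f \<in> Hom (complex_cat X) K L" "g \<in> Hom (complex_cat X) L M" for K L M f g
  proof -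
    have "Cmp ?A (cterm K n) (cterm M n) (cterm M (n + 1)) (cdiff M n) (Cmp ?A (cterm K n) (cterm L n) (cterm M n) (g n) (f n))
      = Cmp ?A (cterm K n) (cterm K (n + 1)) (cterm M (n + 1)) (Cmp ?A (cterm K (n+1)) (cterm L (n+1)) (cterm M (n+1)) (g (n + 1)) (f (n+1))) (cdiff K n)" for n
    proof -
      have o: "cterm K m \<in> Ob ?A" "cterm L m \<in> Ob ?A" "cterm M m \<in> Ob ?A"
        "f m \<in> Hom ?A (cterm K m) (cterm L m)" "g m \<in> Hom ?A (cterm L m) (cterm M m)" 
        "cdiff K m \<in> Hom ?A (cterm K m) (cterm K (m+1))"
        "cdiff L m \<in> Hom ?A (cterm L m) (cterm L (m+1))"
        "cdiff M m \<in> Hom ?A (cterm M m) (cterm M (m+1))"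
        "Cmp ?A (cterm K m) (cterm L m) (cterm L (m + 1)) (cdiff L m) (f m) =
         Cmp ?A (cterm K m) (cterm K (m + 1)) (cterm L (m + 1)) (f (m + 1)) (cdiff K m)"
        "Cmp ?A (cterm L m) (cterm M m) (cterm M (m + 1)) (cdiff M m) (g m) =
         Cmp ?A (cterm L m) (cterm L (m + 1)) (cterm M (m + 1)) (g (m + 1)) (cdiff L m)" for m
        using that by (simp_all add: complex_cat_def)
      have "Cmp ?A (cterm K n) (cterm M n) (cterm M (n + 1)) (cdiff M n) (Cmp ?A (cterm K n) (cterm L n) (cterm M n) (g n) (f n))
         = Cmp ?A (cterm K n) (cterm L n) (cterm M (n + 1)) (Cmp ?A (cterm L n) (cterm M n) (cterm M (n + 1)) (cdiff M n) (g n)) (f n)"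
        by (rule c(4)) (rule o)+
      also have "\<dots> = Cmp ?A (cterm K n) (cterm L n) (cterm M (n + 1)) (Cmp ?A (cterm L n) (cterm L (n + 1)) (cterm M (n + 1)) (g (n + 1)) (cdiff L n)) (f n)"
        by (simp only: o(10))
      also have "\<dots> = Cmp ?A (cterm K n) (cterm L (n+1)) (cterm M (n + 1)) (g (n + 1)) (Cmp ?A (cterm K n) (cterm L n) (cterm L (n+1)) (cdiff L n) (f n))"
        by (rule c(4)[symmetric]) (rule o)+
      also have "\<dots> = Cmp ?A (cterm K n) (cterm L (n+1)) (cterm M (n + 1)) (g (n + 1)) (Cmp ?A (cterm K n) (cterm K (n+1)) (cterm L (n+1)) (f (n+1)) (cdiff K n))"
        by (simp only: o(9))
      also have "\<dots> = Cmp ?A (cterm K n) (cterm K (n + 1)) (cterm M (n + 1)) (Cmp ?A (cterm K (n+1)) (cterm L (n+1)) (cterm M (n+1)) (g (n + 1)) (f (n+1))) (cdiff K n)"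
        by (rule c(4)) (rule o)+
      finally show ?thesis .
    qed
    moreover have "Cmp ?A (cterm K n) (cterm L n) (cterm M n) (g n) (f n) \<in> Hom ?A (cterm K n) (cterm M n)" for n
      by (rule c(2)) (use that in \<open>simp_all add: complex_cat_def\<close>)
    ultimately show ?thesis by (simp add: complex_cat_def)
  qed
  note two = 2
  have ob: "cterm K n \<in> Ob ?A" "cdiff K n \<in> Hom ?A (cterm K n) (cterm K (n+1))" if "K \<in> Ob (complex_cat X)" for K n using that by (simp_all add: complex_cat_def)
  have ho: "f n \<in> Hom ?A (cterm K n) (cterm L n)" if "f \<in> Hom (complex_cat X) K L" for K L f n using that by (simp add: complex_cat_def)
  have cc: "Cmp (complex_cat X) K L M g f = (\<lambda>n. Cmp ?A (cterm K n) (cterm L n) (cterm M n) (g n) (f n))"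
    "Idn (complex_cat X) K = (\<lambda>n. Idn ?A (cterm K n))" for K L M g f by (auto simp: complex_cat_def)
  show ?thesis unfolding is_category_def
  proof (intro conjI ballI, goal_cases)
    case (1 a)
    have "\<forall>n. Idn ?A (cterm a n) \<in> Hom ?A (cterm a n) (cterm a n)" using ob[OF 1] c(1) by blast
    moreover have "\<forall>n. Cmp ?A (cterm a n) (cterm a n) (cterm a (n+1)) (cdiff a n) (Idn ?A (cterm a n)) = cdiff a n"
      "\<forall>n. Cmp ?A (cterm a n) (cterm a (n+1)) (cterm a (n+1)) (Idn ?A (cterm a (n+1))) (cdiff a n) = cdiff a n"
       using ob[OF 1] c(3) by blast+
    ultimately show ?case by (simp add: complex_cat_def)
  next
    case (2 a b c f g) then show ?case by (intro two)
  next
    case (3 a b f) then show ?case unfolding cc using ob[OF 3(1)] ob[OF 3(2)] ho[OF 3(3)] c(3) by blast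
  next
    case (4 a b f) then show ?case unfolding cc using ob[OF 4(1)] ob[OF 4(2)] ho[OF 4(3)] c(3) by blast
  next
    case (5 k l m p f g h) show ?case unfolding cc
      by (rule ext, rule c(4)[OF ob(1)[OF 5(1)] ob(1)[OF 5(2)] ob(1)[OF 5(3)] ob(1)[OF 5(4)] ho[OF 5(5)] ho[OF 5(6)] ho[OF 5(7)]])
  qed
qed

lemma zigzag_append: "zigzag C W a b p \<Longrightarrow> zigzag C W b c q \<Longrightarrow> zigzag C W a c (p @ q)"
  by (induction rule: zigzag.induct) (auto intro: zigzag.intros)

lemma zigzag_Ob: "zigzag C W a b p \<Longrightarrow> a \<in> Ob C \<and> b \<in> Ob C"
  by (induction rule: zigzag.induct) auto

lemma zigzag_eq_zigzag: assumes "is_category C" shows "zigzag_eq C W a b p q \<Longrightarrow> zigzag C W a b p \<and> zigzag C W a b q"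
proof (induction rule: zigzag_eq.induct)
qed (use assms in \<open>auto intro!: zigzag.intros zigzag_append simp: is_category_def\<close>)+

lemma equiv_zigzag_eq: assumes "is_category C" 
  shows "equiv {p. zigzag C W a b p} {(p, q). zigzag_eq C W a b p q}"
  by (intro equivI refl_onI symI transI) (auto dest: zigzag_eq_zigzag[OF assms] intro: zigzag_eq.intros)

lemma is_category_localization: assumes C: "is_category C" shows "is_category (localization C W)"
proof -
  let ?L = "localization C W"
  define cl where "cl a b p = {q. zigzag_eq C W a b p q}" for a b p
  have hom: "\<alpha> \<in> Hom ?L a b \<longleftrightarrow> (\<exists>p. zigzag C W a b p \<and> \<alpha> = cl a b p)" for a b \<alpha>
    by (auto simp: localization_def quotient_def cl_def)

  have zz: "cl a b p = cl a b q" if "zigzag_eq C W a b p q" for a b p q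
    unfolding cl_def by (intro Collect_cong) (meson that zz_sym zz_trans)
  have cmp: "Cmp ?L a b c (cl b c q) (cl a b p) = cl a c (p @ q)" if "zigzag C W a b p" "zigzag C W b c q" for a b c p q
  proof -
    have "zigzag_eq C W a b p p" "zigzag_eq C W b c q q" using that by (auto intro: zz_refl)
    then show ?thesis 
      unfolding localization_def cl_def by simp (meson zz_append zz_trans)
  qed
  have idn: "Idn ?L a = cl a a []" for a by (simp add: localization_def cl_def)
  have ob: "Ob ?L = Ob C" by (simp add: localization_def)
  show ?thesis unfolding is_category_def ob
  proof (intro conjI ballI, goal_cases)
    case (1 a) then show ?case by (auto simp: hom idn intro: zigzag_Nil)
  next
    case (2 a b c f g) then show ?case by (auto simp: hom cmp intro: zigzag_append)
  next
    case (3 a b f) then show ?case by (auto simp: hom idn cmp zigzag_Nil)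
  next
    case (4 a b f) then show ?case by (auto simp: hom idn cmp zigzag_Nil)
  next
    case (5 a b c d f g h) then show ?case by (auto simp: hom cmp zigzag_append)
  qed
qed

lemma coset_map_val:
  assumes A: "comm_group A" and H: "comm_group H" and Z: "subgroup Z A" and B: "subgroup B A" "B \<subseteq> Z"
    and Z': "subgroup Z' H" and B': "subgroup B' H" "B' \<subseteq> Z'"
    and h: "h \<in> hom A H" "h ` Z \<subseteq> Z'" "h ` B \<subseteq> B'" and x: "x \<in> Z"
  shows "coset_map (A\<lparr>carrier := Z\<rparr> Mod B) H B' h (B #>\<^bsub>A\<^esub> x) = B' #>\<^bsub>H\<^esub> h x"
proof -
  interpret A: comm_group A by fact
  interpret H: comm_group H by fact
  have Zc: "Z \<subseteq> carrier A" using Z by (rule subgroup.subset)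
  have Bc: "B' \<subseteq> carrier H" using B' by (simp add: subgroup.subset)
  have c: "B #>\<^bsub>A\<^esub> x \<in> carrier (A\<lparr>carrier := Z\<rparr> Mod B)"
    using x by (auto simp: carrier_FactGroup r_coset_def)
  have "B' #>\<^bsub>H\<^esub> h y = B' #>\<^bsub>H\<^esub> h x" if yB: "y \<in> B #>\<^bsub>A\<^esub> x" for y
  proof -
    obtain b where b: "b \<in> B" "y = b \<otimes>\<^bsub>A\<^esub> x" using yB by (auto simp: r_coset_def)
    have hb: "h b \<in> B'" "h b \<in> carrier H" using h b B'(1) subgroup.subset by blast+
    have hx: "h x \<in> carrier H" using h(1) x Zc by (auto simp: hom_def)
    have "h y = h b \<otimes>\<^bsub>H\<^esub> h x" using h(1) b(1) subsetD[OF B(2) b(1)] x subsetD[OF Zc] unfolding b(2) hom_def by simp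
    then have "B' #>\<^bsub>H\<^esub> h y = (B' #>\<^bsub>H\<^esub> h b) #>\<^bsub>H\<^esub> h x" using H.coset_mult_assoc Bc hb hx by simp
    then show ?thesis using H.coset_join2[OF hb(2) B'(1) hb(1)] by simp
  qed
  moreover have "B #>\<^bsub>A\<^esub> x \<noteq> {}" using B(1) by (auto simp: r_coset_def dest: subgroup.one_closed)
  ultimately show ?thesis using c by (auto simp: coset_map_def)
qed

lemma cohomology_subgroups:
  assumes K: "K \<in> Ob (complex_cat X)" and p: "p \<in> topspace X"
  shows "comm_group (stalk (cterm K n) p)" "subgroup (cocycles K n p) (stalk (cterm K n) p)"
    "subgroup (coboundaries K n p) (stalk (cterm K n) p)" "coboundaries K n p \<subseteq> cocycles K n p"
proof -
  have o: "abelian_data X (cterm K m)" "cdiff K m \<in> Hom (abdata_cat X) (cterm K m) (cterm K (m+1))"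
    "Cmp (abdata_cat X) (cterm K m) (cterm K (m + 1)) (cterm K (m + 1 + 1))
           (cdiff K (m + 1)) (cdiff K m) = zero_mor X (cterm K m) (cterm K (m + 1 + 1))" for m
    using K by (auto simp: complex_cat_def abdata_cat_def)
  have g: "comm_group (stalk (cterm K m) p)" for m using o(1)[of m] p by (simp add: abelian_data_def)
  have d: "cdiff K m p \<in> hom (stalk (cterm K m) p) (stalk (cterm K (m+1)) p)" for m
    using o(2)[of m] p by (simp add: Hom_abdata_cat_iff ghom_def)
  have gh: "group_hom (stalk (cterm K m) p) (stalk (cterm K (m+1)) p) (cdiff K m p)" for m
    using g d by (simp add: group_hom_def group_hom_axioms_def comm_group_def)
  show "comm_group (stalk (cterm K n) p)" by (rule g)
  show "subgroup (cocycles K n p) (stalk (cterm K n) p)" unfolding cocycles_def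
    by (rule group_hom.subgroup_kernel[OF gh])
  show "subgroup (coboundaries K n p) (stalk (cterm K n) p)" unfolding coboundaries_def
    using group_hom.img_is_subgroup[OF gh[of "n-1"]] by simp
  have z: "cdiff K (m+1) p (cdiff K m p x) = \<one>\<^bsub>stalk (cterm K (m+1+1)) p\<^esub>" if "x \<in> carrier (stalk (cterm K m) p)" for m x
    using fun_cong[OF fun_cong[OF o(3)[of m], of p], of x] that p
    by (simp add: abdata_cat_def zero_mor_def compose_def)
  show "coboundaries K n p \<subseteq> cocycles K n p"
    using z[of _ "n-1"] d[of "n-1"] by (auto simp: coboundaries_def cocycles_def kernel_def hom_def)
qed

lemma coset_map_ghom:
  assumes A: "comm_group A" and H: "comm_group H" and Z: "subgroup Z A" and B: "subgroup B A" "B \<subseteq> Z"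
    and Z': "subgroup Z' H" and B': "subgroup B' H" "B' \<subseteq> Z'"
    and h: "h \<in> hom A H" "h ` Z \<subseteq> Z'" "h ` B \<subseteq> B'"
  shows "coset_map (A\<lparr>carrier := Z\<rparr> Mod B) H B' h \<in> ghom (A\<lparr>carrier := Z\<rparr> Mod B) (H\<lparr>carrier := Z'\<rparr> Mod B')"
proof -
  interpret A: comm_group A by fact
  interpret H: comm_group H by fact
  have c: "carrier (A\<lparr>carrier := Z\<rparr> Mod B) = (\<lambda>x. B #>\<^bsub>A\<^esub> x) ` Z"
     "carrier (H\<lparr>carrier := Z'\<rparr> Mod B') = (\<lambda>x. B' #>\<^bsub>H\<^esub> x) ` Z'"
    by (auto simp: carrier_FactGroup r_coset_def)
  have m: "S <#>\<^bsub>A\<lparr>carrier := Z\<rparr>\<^esub> T = S <#>\<^bsub>A\<^esub> T" for S T by (simp add: set_mult_def)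
  have m': "S <#>\<^bsub>H\<lparr>carrier := Z'\<rparr>\<^esub> T = S <#>\<^bsub>H\<^esub> T" for S T by (simp add: set_mult_def)
  note v = coset_map_val[OF assms]
  have nA: "B \<lhd> A" "B' \<lhd> H" using B B' by (auto intro: A.subgroup_imp_normal H.subgroup_imp_normal)
  have Zc: "Z \<subseteq> carrier A" "Z' \<subseteq> carrier H" using Z Z' by (auto dest: subgroup.subset)
  show ?thesis unfolding ghom_iff
  proof (intro conjI ballI)
    show "coset_map (A\<lparr>carrier := Z\<rparr> Mod B) H B' h \<in> extensional (carrier (A\<lparr>carrier := Z\<rparr> Mod B))"
      by (simp add: coset_map_def)
  next
    fix S assume "S \<in> carrier (A\<lparr>carrier := Z\<rparr> Mod B)"
    then show "coset_map (A\<lparr>carrier := Z\<rparr> Mod B) H B' h S \<in> carrier (H\<lparr>carrier := Z'\<rparr> Mod B')"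
      using h(2) by (auto simp: c v)
  next
    fix S T assume "S \<in> carrier (A\<lparr>carrier := Z\<rparr> Mod B)" "T \<in> carrier (A\<lparr>carrier := Z\<rparr> Mod B)"
    then obtain x y where xy: "x \<in> Z" "y \<in> Z" "S = B #>\<^bsub>A\<^esub> x" "T = B #>\<^bsub>A\<^esub> y" by (auto simp: c)
    have xyZ: "x \<otimes>\<^bsub>A\<^esub> y \<in> Z" using xy Z by (simp add: subgroup.m_closed)
    have s: "S <#>\<^bsub>A\<^esub> T = B #>\<^bsub>A\<^esub> (x \<otimes>\<^bsub>A\<^esub> y)"
      using normal.rcos_sum[OF nA(1)] xy Zc by auto
    have "h x \<in> carrier H" "h y \<in> carrier H" using h(2) xy Zc by auto
    then have s': "(B' #>\<^bsub>H\<^esub> h x) <#>\<^bsub>H\<^esub> (B' #>\<^bsub>H\<^esub> h y) = B' #>\<^bsub>H\<^esub> h (x \<otimes>\<^bsub>A\<^esub> y)"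
      using normal.rcos_sum[OF nA(2)] h(1) xy Zc by (auto simp: hom_def subset_iff)
    have e1: "coset_map (A\<lparr>carrier := Z\<rparr> Mod B) H B' h S = B' #>\<^bsub>H\<^esub> h x" using v xy by simp
    have e2: "coset_map (A\<lparr>carrier := Z\<rparr> Mod B) H B' h T = B' #>\<^bsub>H\<^esub> h y" using v xy by simp
    have e3: "coset_map (A\<lparr>carrier := Z\<rparr> Mod B) H B' h (S <#>\<^bsub>A\<^esub> T) = B' #>\<^bsub>H\<^esub> h (x \<otimes>\<^bsub>A\<^esub> y)" unfolding s by (rule v[OF xyZ])
    show "coset_map (A\<lparr>carrier := Z\<rparr> Mod B) H B' h (S \<otimes>\<^bsub>A\<lparr>carrier := Z\<rparr> Mod B\<^esub> T) =
      coset_map (A\<lparr>carrier := Z\<rparr> Mod B) H B' h S \<otimes>\<^bsub>H\<lparr>carrier := Z'\<rparr> Mod B'\<^esub> coset_map (A\<lparr>carrier := Z\<rparr> Mod B) H B' h T"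
      by (simp only: mult_FactGroup m m' e1 e2 e3 s')
  qed
qed

lemma carH: "carrier (cohomology_group K n p) = (\<lambda>x. coboundaries K n p #>\<^bsub>stalk (cterm K n) p\<^esub> x) ` cocycles K n p"
  by (auto simp: cohomology_group_def carrier_FactGroup r_coset_def)

lemma abelian_data_cohomology:
  assumes K: "K \<in> Ob (complex_cat X)" shows "abelian_data X (cohomology K n)"
proof -
  note f = cohomology_subgroups[OF K]
  have o: "abelian_data X (cterm K m)" "cdiff K m \<in> Hom (abdata_cat X) (cterm K m) (cterm K (m+1))" for m
    using K by (auto simp: complex_cat_def abdata_cat_def)
  have r: "res (cterm K m) p q \<in> hom (stalk (cterm K m) p) (stalk (cterm K m) q)" if "spec_le X p q" for p q m
    using o(1)[of m] that by (simp add: abelian_data_def ghom_def)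
  have rd: "res (cterm K (m+1)) p q (cdiff K m p x) = cdiff K m q (res (cterm K m) p q x)"
    if "spec_le X p q" "x \<in> carrier (stalk (cterm K m) p)" for p q m x
    using o(2)[of m] that by (simp add: Hom_abdata_cat_iff)
  have one: "res (cterm K m) p q \<one>\<^bsub>stalk (cterm K m) p\<^esub> = \<one>\<^bsub>stalk (cterm K m) q\<^esub>" if "spec_le X p q" for p q m
    using hom_one[OF r[OF that]] f(1) spec_leD[OF that] by (simp add: comm_group_def)
  have rZ: "res (cterm K n) p q ` cocycles K n p \<subseteq> cocycles K n q" if "spec_le X p q" for p q
  proof -
    have "cdiff K n q (res (cterm K n) p q x) = \<one>\<^bsub>stalk (cterm K (n+1)) q\<^esub>" if x: "x \<in> cocycles K n p" for x
      using x rd[OF \<open>spec_le X p q\<close>, of x n] one[OF \<open>spec_le X p q\<close>] by (simp add: cocycles_def kernel_def)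
    then show ?thesis using r[OF that, of n] by (auto simp: cocycles_def kernel_def hom_def)
  qed
  have rB: "res (cterm K n) p q ` coboundaries K n p \<subseteq> coboundaries K n q" if "spec_le X p q" for p q
    using rd[OF that, of _ "n-1"] r[OF that, of "n-1"] by (auto simp: coboundaries_def hom_def)
  have cg: "comm_group (cohomology_group K n p)" if "p \<in> topspace X" for p
  proof -
    interpret A: comm_group "stalk (cterm K n) p" using f that by simp
    have "comm_group ((stalk (cterm K n) p)\<lparr>carrier := cocycles K n p\<rparr>)"
      using subgroup.subgroup_is_group[OF f(2)[OF that]] A.is_group f(2)[OF that, THEN subgroup.subset]
      by (intro group.group_comm_groupI) (auto intro: A.m_comm)
    moreover have "subgroup (coboundaries K n p) ((stalk (cterm K n) p)\<lparr>carrier := cocycles K n p\<rparr>)"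
      using f that by (simp add: A.subgroup_incl)
    ultimately show ?thesis unfolding cohomology_group_def by (rule comm_group.abelian_FactGroup)
  qed
  have val: "res (cohomology K n) p q (coboundaries K n p #>\<^bsub>stalk (cterm K n) p\<^esub> x) =
    coboundaries K n q #>\<^bsub>stalk (cterm K n) q\<^esub> res (cterm K n) p q x"
    if "spec_le X p q" "x \<in> cocycles K n p" for p q x
    unfolding cohomology_def cohomology_group_def using spec_leD[OF that(1)] that(2)
    by (simp add: coset_map_val[OF f(1) f(1) f(2) f(3) f(4) f(2) f(3) f(4) r[OF that(1)] rZ[OF that(1)] rB[OF that(1)]])
  have ext: "res (cohomology K n) p q \<in> extensional (carrier (cohomology_group K n p))" for p q
    by (simp add: cohomology_def coset_map_def)
  have Zc: "x \<in> carrier (stalk (cterm K n) p)" if "x \<in> cocycles K n p" for x p using that by (simp add: cocycles_def kernel_def)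
  show ?thesis unfolding abelian_data_def
  proof (intro conjI allI ballI impI)
    fix p assume p: "p \<in> topspace X" 
    then show "comm_group (stalk (cohomology K n) p)" by (simp add: cohomology_def cg)
    have "res (cterm K n) p p x = x" if "x \<in> cocycles K n p" for x
      using o(1)[of n] p Zc[OF that] by (simp add: abelian_data_def)
    then show "res (cohomology K n) p p = (\<lambda>x\<in>carrier (stalk (cohomology K n) p). x)"
      using val[OF spec_le_refl[OF p]] ext[of p p] 
      by (intro extensionalityI[of _ "carrier (cohomology_group K n p)"]) (auto simp: cohomology_def carH)
  next
    fix p q assume pq: "spec_le X p q"
    then show "res (cohomology K n) p q \<in> ghom (stalk (cohomology K n) p) (stalk (cohomology K n) q)"
      unfolding cohomology_def cohomology_group_def using spec_leD[OF pq]
      by (simp add: coset_map_ghom[OF f(1) f(1) f(2) f(3) f(4) f(2) f(3) f(4) r[OF pq] rZ[OF pq] rB[OF pq]])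
  next
    fix p q s assume pq: "spec_le X p q" and qs: "spec_le X q s"
    have ps: "spec_le X p s" using pq qs by (auto simp: spec_le_def)
    have "res (cterm K n) p s x = res (cterm K n) q s (res (cterm K n) p q x)" if "x \<in> cocycles K n p" for x
      using o(1)[of n] pq qs Zc[OF that] by (simp add: abelian_data_def compose_def) 
    moreover have "res (cterm K n) p q x \<in> cocycles K n q" if "x \<in> cocycles K n p" for x using rZ[OF pq] that by auto
    ultimately show "res (cohomology K n) p s =
       compose (carrier (stalk (cohomology K n) p)) (res (cohomology K n) q s) (res (cohomology K n) p q)"
      using val[OF pq] val[OF qs] val[OF ps] ext[of p s]
      by (intro extensionalityI[of _ "carrier (cohomology_group K n p)"]) (auto simp: cohomology_def carH compose_def)
  qed
qed

lemma cohomology_mor_Idn: assumes K: "K \<in> Ob (complex_cat X)"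
  shows "cohomology_mor X K K n (Idn (complex_cat X) K) = Idn (abdata_cat X) (cohomology K n)"
proof -
  have "coset_map (cohomology_group K n p) (stalk (cterm K n) p) (coboundaries K n p) (\<lambda>x\<in>carrier (stalk (cterm K n) p). x)
     = (\<lambda>x\<in>carrier (cohomology_group K n p). x)" if p: "p \<in> topspace X" for p
  proof -
    note f = cohomology_subgroups[OF K p, of n]
    have i: "(\<lambda>x\<in>carrier (stalk (cterm K n) p). x) \<in> hom (stalk (cterm K n) p) (stalk (cterm K n) p)"
      using ghom_id[OF f(1)] by (simp add: ghom_def)
    have "(\<lambda>x\<in>carrier (stalk (cterm K n) p). x) ` cocycles K n p \<subseteq> cocycles K n p"
      "(\<lambda>x\<in>carrier (stalk (cterm K n) p). x) ` coboundaries K n p \<subseteq> coboundaries K n p"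
      using f subgroup.subset by (auto simp: restrict_def)
    note v = coset_map_val[OF f(1) f(1) f(2) f(3) f(4) f(2) f(3) f(4) i this]
    have Zc: "x \<in> carrier (stalk (cterm K n) p)" if "x \<in> cocycles K n p" for x using that subgroup.subset[OF f(2)] by auto
    show ?thesis
    proof (rule extensionalityI[of _ "carrier (cohomology_group K n p)"])
      fix S assume S: "S \<in> carrier (cohomology_group K n p)"
      then obtain x where x: "x \<in> cocycles K n p" "S = coboundaries K n p #>\<^bsub>stalk (cterm K n) p\<^esub> x" by (auto simp: carH)
      show "coset_map (cohomology_group K n p) (stalk (cterm K n) p) (coboundaries K n p) (\<lambda>x\<in>carrier (stalk (cterm K n) p). x) S
        = (\<lambda>x\<in>carrier (cohomology_group K n p). x) S"
        using v[OF x(1)] S x Zc[OF x(1)] unfolding cohomology_group_def[symmetric] by simp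
    qed (simp_all add: coset_map_def)
  qed
  note e = this
  have a: "Idn (complex_cat X) K = (\<lambda>n. \<lambda>p\<in>topspace X. \<lambda>x\<in>carrier (stalk (cterm K n) p). x)"
     "Idn (abdata_cat X) (cohomology K n) = (\<lambda>p\<in>topspace X. \<lambda>x\<in>carrier (cohomology_group K n p). x)"
     by (simp_all add: complex_cat_def abdata_cat_def cohomology_def)
  show ?thesis unfolding cohomology_mor_def a by (rule restrict_ext) (simp only: restrict_apply' e)
qed

end

theory Submission
  imports Defs "HOL-Algebra.FiniteProduct"
begin

text \<open>
  The idea is to realise all functors in question by exact functors on complexes. A finite set of
  indices, each with a point and a degree, and an integer matrix \<open>m\<close> with \<open>m\<^sup>2 = 0\<close> (a prekernel)
  define a functor \<open>F \<mapsto> (\<Oplus>\<^sub>i F\<^bsub>x\<^sub>i(y)\<^esub>[s\<^sub>i], \<plusminus>d + m)\<close> from complexes on \<open>X\<close> to complexes on \<open>Y\<close>, which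
  preserves quasi-isomorphisms. If the \<open>i\<close>-th summand is present at \<open>y\<close> exactly when \<open>y \<le> b\<^sub>i\<close>, and is
  then \<open>F\<close> at a point \<open>a\<^sub>i\<close> that does not depend on \<open>y\<close>, the functor has a strict left adjoint: the
  functor of the transposed matrix, with the roles of \<open>a\<close> and \<open>b\<close> exchanged. A general prekernel is
  brought into this form, up to a natural quasi-isomorphism, by its cobar resolution, which is
  indexed by the chains of \<open>Y\<close>. Hence the functor on derived categories given by a prekernel has a
  left adjoint that is again given by a prekernel.

  The inverse image \<open>f\<^sup>*\<close> is of this kind, so it has a left adjoint \<open>L\<close> on derived categories, and \<open>L\<close>
  in turn has a left adjoint. As \<open>f\<^sub>!\<close> is left adjoint to the exact functor \<open>f\<^sup>*\<close> on complexes, \<open>L\<close> is a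
  left derived functor of \<open>f\<^sub>!\<close>.
\<close>

section \<open>Adjunctions and localizations\<close>

text \<open>\<open>L_lower_shriek\<close> is a choice among left derived functors between unbounded
  derived categories, so one has to be exhibited. No projective or injective resolutions enter:
  every group built is a finite product coded inside \<open>'u\<close> or a quotient, and unbounded
  complexes are no obstacle since a finite twisted sum is filtered in finitely many steps. The stalk
  \<open>F_a\<close>, spread over the points below \<open>b\<close>, is a right Kan extension; its
  left adjoint spreads \<open>G_b\<close> over the points above \<open>a\<close>. This is why a
  summand with fixed stalk and a lower set of points has a strict left adjoint. In a general
  prekernel the stalk varies with \<open>y\<close>. A chain separates the two roles of
  \<open>y\<close>: its maximum fixes the stalk, its minimum bounds the points where the summand
  lives. The left adjoint so obtained lives on upper sets, so it is again a prekernel but not of the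
  special form. Hence the cobar resolution must accept all prekernels; then taking left adjoints can
  be iterated, and two rounds suffice.\<close>

lemma cat_Idn: "is_category C \<Longrightarrow> a \<in> Ob C \<Longrightarrow> Idn C a \<in> Hom C a a"
  by (simp add: is_category_def)

lemma cat_Cmp:
  "is_category C \<Longrightarrow> a \<in> Ob C \<Longrightarrow> b \<in> Ob C \<Longrightarrow> c \<in> Ob C \<Longrightarrow> f \<in> Hom C a b \<Longrightarrow> g \<in> Hom C b c \<Longrightarrow>
    Cmp C a b c g f \<in> Hom C a c"
  by (simp add: is_category_def)

lemma cat_left:
  "is_category C \<Longrightarrow> a \<in> Ob C \<Longrightarrow> b \<in> Ob C \<Longrightarrow> f \<in> Hom C a b \<Longrightarrow> Cmp C a b b (Idn C b) f = f"
  by (simp add: is_category_def)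

lemma cat_right:
  "is_category C \<Longrightarrow> a \<in> Ob C \<Longrightarrow> b \<in> Ob C \<Longrightarrow> f \<in> Hom C a b \<Longrightarrow> Cmp C a a b f (Idn C a) = f"
  by (simp add: is_category_def)

lemma cat_assoc:
  "is_category C \<Longrightarrow> a \<in> Ob C \<Longrightarrow> b \<in> Ob C \<Longrightarrow> c \<in> Ob C \<Longrightarrow> d \<in> Ob C \<Longrightarrow>
    f \<in> Hom C a b \<Longrightarrow> g \<in> Hom C b c \<Longrightarrow> h \<in> Hom C c d \<Longrightarrow>
    Cmp C a b d (Cmp C b c d h g) f = Cmp C a c d h (Cmp C a b c g f)"
  by (simp add: is_category_def)

lemma functor_fob: "is_functor C D F \<Longrightarrow> a \<in> Ob C \<Longrightarrow> fob F a \<in> Ob D"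
  by (simp add: is_functor_def)

lemma functor_far:
  "is_functor C D F \<Longrightarrow> a \<in> Ob C \<Longrightarrow> b \<in> Ob C \<Longrightarrow> f \<in> Hom C a b \<Longrightarrow>
    far F a b f \<in> Hom D (fob F a) (fob F b)"
  by (simp add: is_functor_def)

lemma functor_Idn: "is_functor C D F \<Longrightarrow> a \<in> Ob C \<Longrightarrow> far F a a (Idn C a) = Idn D (fob F a)"
  by (simp add: is_functor_def)

lemma functor_Cmp:
  "is_functor C D F \<Longrightarrow> a \<in> Ob C \<Longrightarrow> b \<in> Ob C \<Longrightarrow> c \<in> Ob C \<Longrightarrow> f \<in> Hom C a b \<Longrightarrow> g \<in> Hom C b c \<Longrightarrow>
    far F a c (Cmp C a b c g f) = Cmp D (fob F a) (fob F b) (fob F c) (far F b c g) (far F a b f)"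
  by (simp add: is_functor_def)

lemmas cat_rules = cat_Idn cat_Cmp cat_left cat_right functor_fob functor_far functor_Idn

text \<open>Unlike \<open>nat_trans\<close>, this does not demand extensionality of the family.\<close>

definition natural :: "('o, 'm) cat \<Rightarrow> ('p, 'n) cat \<Rightarrow> ('o, 'm, 'p, 'n) ftor \<Rightarrow> ('o, 'm, 'p, 'n) ftor \<Rightarrow>
    ('o \<Rightarrow> 'n) \<Rightarrow> bool" where
  "natural C D F G \<tau> \<longleftrightarrow> (\<forall>a\<in>Ob C. \<tau> a \<in> Hom D (fob F a) (fob G a)) \<and>
     (\<forall>a\<in>Ob C. \<forall>b\<in>Ob C. \<forall>f\<in>Hom C a b.
        Cmp D (fob F a) (fob F b) (fob G b) (\<tau> b) (far F a b f) =
        Cmp D (fob F a) (fob G a) (fob G b) (far G a b f) (\<tau> a))"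

lemma nat_trans_iff_natural: "nat_trans C D F G \<tau> \<longleftrightarrow> \<tau> \<in> extensional (Ob C) \<and> natural C D F G \<tau>"
  by (auto simp: nat_trans_def natural_def PiE_def Pi_def)

lemma natural_in: "natural C D F G \<tau> \<Longrightarrow> a \<in> Ob C \<Longrightarrow> \<tau> a \<in> Hom D (fob F a) (fob G a)"
  by (simp add: natural_def)

lemma natural_eq: "natural C D F G \<tau> \<Longrightarrow> a \<in> Ob C \<Longrightarrow> b \<in> Ob C \<Longrightarrow> f \<in> Hom C a b \<Longrightarrow>
   Cmp D (fob F a) (fob F b) (fob G b) (\<tau> b) (far F a b f) =
        Cmp D (fob F a) (fob G a) (fob G b) (far G a b f) (\<tau> a)"
  by (simp add: natural_def)

lemma natural_restrict: "natural C D F G \<tau> \<Longrightarrow> nat_trans C D F G (restrict \<tau> (Ob C))"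
  by (simp add: nat_trans_iff_natural natural_def)

lemma comp_ftor_simps [simp]: "fob (comp_ftor G F) a = fob G (fob F a)"
  "far (comp_ftor G F) a b f = far G (fob F a) (fob F b) (far F a b f)"
  by (simp_all add: comp_ftor_def)

definition id_ftor :: "('o, 'm, 'o, 'm) ftor" where
  "id_ftor = \<lparr>fob = \<lambda>a. a, far = \<lambda>a b f. f\<rparr>"

lemma id_ftor_simps [simp]: "fob id_ftor a = a" "far id_ftor a b f = f"
  by (simp_all add: id_ftor_def)

text \<open>The unit-counit form consists of equations between arrows, which every functor
  preserves. It is the form that passes to localizations; hom-set bijections do not transfer
  directly.\<close>

definition adjunction where
  "adjunction C D L R \<eta> \<epsilon> \<longleftrightarrow> is_functor C D L \<and> is_functor D C R \<and>
     natural C C id_ftor (comp_ftor R L) \<eta> \<and> natural D D (comp_ftor L R) id_ftor \<epsilon> \<and>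
     (\<forall>c\<in>Ob C. Cmp D (fob L c) (fob L (fob R (fob L c))) (fob L c) (\<epsilon> (fob L c))
        (far L c (fob R (fob L c)) (\<eta> c)) = Idn D (fob L c)) \<and>
     (\<forall>d\<in>Ob D. Cmp C (fob R d) (fob R (fob L (fob R d))) (fob R d) (far R (fob L (fob R d)) d (\<epsilon> d))
        (\<eta> (fob R d)) = Idn C (fob R d))"

lemma adjunction_imp_left_adjoint:
  assumes C: "is_category C" and D: "is_category D" and adj: "adjunction C D L R \<eta> \<epsilon>"
  shows "left_adjoint C D L R"
proof -
  have L: "is_functor C D L" and R: "is_functor D C R"
    and \<eta>: "natural C C id_ftor (comp_ftor R L) \<eta>" and \<epsilon>: "natural D D (comp_ftor L R) id_ftor \<epsilon>"
    using adj by (auto simp: adjunction_def)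
  note r = cat_rules(1-4)[OF C] cat_rules(1-4)[OF D] functor_fob[OF L] functor_fob[OF R]
    functor_far[OF L] functor_far[OF R]
  have \<eta>i: "\<eta> c \<in> Hom C c (fob R (fob L c))" if "c \<in> Ob C" for c using natural_in[OF \<eta> that] by simp
  have \<epsilon>i: "\<epsilon> d \<in> Hom D (fob L (fob R d)) d" if "d \<in> Ob D" for d using natural_in[OF \<epsilon> that] by simp
  define \<Phi> where "\<Phi> c d h = Cmp C c (fob R (fob L c)) (fob R d) (far R (fob L c) d h) (\<eta> c)" for c d h
  define \<Psi> where "\<Psi> c d k = Cmp D (fob L c) (fob L (fob R d)) d (\<epsilon> d) (far L c (fob R d) k)" for c d k
  have \<Psi>\<Phi>: "\<Psi> c d (\<Phi> c d h) = h" if cd: "c \<in> Ob C" "d \<in> Ob D" "h \<in> Hom D (fob L c) d" for c d h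
  proof -
    let ?LRLc = "fob L (fob R (fob L c))"
    have "\<Psi> c d (\<Phi> c d h) = Cmp D (fob L c) (fob L (fob R d)) d (\<epsilon> d)
       (Cmp D (fob L c) ?LRLc (fob L (fob R d)) (far L (fob R (fob L c)) (fob R d) (far R (fob L c) d h)) (far L c (fob R (fob L c)) (\<eta> c)))"
      unfolding \<Psi>_def \<Phi>_def using cd by (simp add: functor_Cmp[OF L] r \<eta>i)
    also have "\<dots> = Cmp D (fob L c) ?LRLc d (Cmp D ?LRLc (fob L (fob R d)) d (\<epsilon> d) (far L (fob R (fob L c)) (fob R d) (far R (fob L c) d h)))
        (far L c (fob R (fob L c)) (\<eta> c))"
      using cd by (intro cat_assoc[OF D, symmetric]) (auto simp: r \<eta>i \<epsilon>i)
    also have "Cmp D ?LRLc (fob L (fob R d)) d (\<epsilon> d) (far L (fob R (fob L c)) (fob R d) (far R (fob L c) d h)) = Cmp D ?LRLc (fob L c) d h (\<epsilon> (fob L c))"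
      using natural_eq[OF \<epsilon> _ _ cd(3)] cd by (simp add: r)
    also have "Cmp D (fob L c) ?LRLc d (Cmp D ?LRLc (fob L c) d h (\<epsilon> (fob L c))) (far L c (fob R (fob L c)) (\<eta> c))
       = Cmp D (fob L c) (fob L c) d h (Cmp D (fob L c) ?LRLc (fob L c) (\<epsilon> (fob L c)) (far L c (fob R (fob L c)) (\<eta> c)))"
      using cd by (intro cat_assoc[OF D]) (auto simp: r \<eta>i \<epsilon>i)
    also have "\<dots> = h" using adj cd by (simp add: adjunction_def r)
    finally show ?thesis .
  qed
  have \<Phi>\<Psi>: "\<Phi> c d (\<Psi> c d k) = k" if cd: "c \<in> Ob C" "d \<in> Ob D" "k \<in> Hom C c (fob R d)" for c d k
  proof -
    let ?RLRd = "fob R (fob L (fob R d))"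
    have "\<Phi> c d (\<Psi> c d k) = Cmp C c (fob R (fob L c)) (fob R d) (Cmp C (fob R (fob L c)) ?RLRd (fob R d) (far R (fob L (fob R d)) d (\<epsilon> d)) (far R (fob L c) (fob L (fob R d)) (far L c (fob R d) k))) (\<eta> c)"
      unfolding \<Psi>_def \<Phi>_def using cd by (simp add: functor_Cmp[OF R] r \<epsilon>i)
    also have "\<dots> = Cmp C c ?RLRd (fob R d) (far R (fob L (fob R d)) d (\<epsilon> d)) (Cmp C c (fob R (fob L c)) ?RLRd (far R (fob L c) (fob L (fob R d)) (far L c (fob R d) k)) (\<eta> c))"
      using cd by (intro cat_assoc[OF C]) (auto simp: r \<eta>i \<epsilon>i)
    also have "Cmp C c (fob R (fob L c)) ?RLRd (far R (fob L c) (fob L (fob R d)) (far L c (fob R d) k)) (\<eta> c) = Cmp C c (fob R d) ?RLRd (\<eta> (fob R d)) k"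
      using natural_eq[OF \<eta> _ _ cd(3)] cd by (simp add: r)
    also have "Cmp C c ?RLRd (fob R d) (far R (fob L (fob R d)) d (\<epsilon> d)) (Cmp C c (fob R d) ?RLRd (\<eta> (fob R d)) k)
      = Cmp C c (fob R d) (fob R d) (Cmp C (fob R d) ?RLRd (fob R d) (far R (fob L (fob R d)) d (\<epsilon> d)) (\<eta> (fob R d))) k"
      using cd by (intro cat_assoc[OF C, symmetric]) (auto simp: r \<eta>i \<epsilon>i)
    also have "\<dots> = k" using adj cd by (simp add: adjunction_def r)
    finally show ?thesis .
  qed
  have b: "bij_betw (\<Phi> c d) (Hom D (fob L c) d) (Hom C c (fob R d))" if cd: "c \<in> Ob C" "d \<in> Ob D" for c d
  proof (rule bij_betw_byWitness[of _ "\<Psi> c d"])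
    show "\<Phi> c d ` Hom D (fob L c) d \<subseteq> Hom C c (fob R d)" "\<Psi> c d ` Hom C c (fob R d) \<subseteq> Hom D (fob L c) d"
      using cd by (auto simp: \<Phi>_def \<Psi>_def r \<eta>i \<epsilon>i intro!: cat_Cmp[OF C] cat_Cmp[OF D])
  qed (use \<Phi>\<Psi> \<Psi>\<Phi> cd in auto)
  have n: "\<Phi> c' d' (Cmp D (fob L c') d d' v (Cmp D (fob L c') (fob L c) d h (far L c' c u))) =
            Cmp C c' (fob R d) (fob R d') (far R d d' v) (Cmp C c' c (fob R d) (\<Phi> c d h) u)"
    if cd: "c \<in> Ob C" "c' \<in> Ob C" "d \<in> Ob D" "d' \<in> Ob D" "u \<in> Hom C c' c" "v \<in> Hom D d d'" "h \<in> Hom D (fob L c) d"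
    for c c' d d' u v h
  proof -
    let ?e = "far R d d' v" and ?Rh = "far R (fob L c) d h" and ?RLu = "far R (fob L c') (fob L c) (far L c' c u)"
    let ?RLc' = "fob R (fob L c')" and ?RLc = "fob R (fob L c)"
    have t: "?e \<in> Hom C (fob R d) (fob R d')" "?Rh \<in> Hom C ?RLc (fob R d)" "?RLu \<in> Hom C ?RLc' ?RLc" using cd by (auto simp: r)
    have "\<Phi> c' d' (Cmp D (fob L c') d d' v (Cmp D (fob L c') (fob L c) d h (far L c' c u))) =
      Cmp C c' ?RLc' (fob R d') (Cmp C ?RLc' (fob R d) (fob R d') ?e (Cmp C ?RLc' ?RLc (fob R d) ?Rh ?RLu)) (\<eta> c')"
      unfolding \<Phi>_def using cd by (simp add: functor_Cmp[OF R] r)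
    also have "\<dots> = Cmp C c' (fob R d) (fob R d') ?e (Cmp C c' ?RLc' (fob R d) (Cmp C ?RLc' ?RLc (fob R d) ?Rh ?RLu) (\<eta> c'))"
      using cd t by (intro cat_assoc[OF C]) (auto simp: r \<eta>i)
    also have "Cmp C c' ?RLc' (fob R d) (Cmp C ?RLc' ?RLc (fob R d) ?Rh ?RLu) (\<eta> c') = Cmp C c' ?RLc (fob R d) ?Rh (Cmp C c' ?RLc' ?RLc ?RLu (\<eta> c'))"
      using cd t by (intro cat_assoc[OF C]) (auto simp: r \<eta>i)
    also have "Cmp C c' ?RLc' ?RLc ?RLu (\<eta> c') = Cmp C c' c ?RLc (\<eta> c) u" using natural_eq[OF \<eta> cd(2,1,5)] by simp
    also have "Cmp C c' ?RLc (fob R d) ?Rh (Cmp C c' c ?RLc (\<eta> c) u) = Cmp C c' c (fob R d) (\<Phi> c d h) u"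
      unfolding \<Phi>_def using cd t by (intro cat_assoc[OF C, symmetric]) (auto simp: r \<eta>i)
    finally show ?thesis .
  qed
  show ?thesis unfolding left_adjoint_def using L R b n by blast
qed

text \<open>Yoneda: unit and counit correspond to identities under \<open>\<Phi>\<close>. Naturality
  is used in one variable at a time (\<open>n1\<close>, \<open>n2\<close>), and equations between
  arrows of \<open>D\<close> are checked after applying the injective \<open>\<Phi>\<close>.\<close>

lemma left_adjoint_imp_adjunction:
  assumes C: "is_category C" and D: "is_category D" and adj: "left_adjoint C D L R"
  obtains \<eta> \<epsilon> where "adjunction C D L R \<eta> \<epsilon>"
proof -
  have L: "is_functor C D L" and R: "is_functor D C R" using adj by (auto simp: left_adjoint_def)
  note r = cat_rules(1-4)[OF C] cat_rules(1-4)[OF D] functor_fob[OF L] functor_fob[OF R]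
    functor_far[OF L] functor_far[OF R] functor_Idn[OF R] functor_Idn[OF L]
  obtain \<Phi> where b: "\<And>c d. c \<in> Ob C \<Longrightarrow> d \<in> Ob D \<Longrightarrow> bij_betw (\<Phi> c d) (Hom D (fob L c) d) (Hom C c (fob R d))"
    and n: "\<And>c c' d d' u v h. c \<in> Ob C \<Longrightarrow> c' \<in> Ob C \<Longrightarrow> d \<in> Ob D \<Longrightarrow> d' \<in> Ob D \<Longrightarrow>
          u\<in>Hom C c' c \<Longrightarrow> v\<in>Hom D d d' \<Longrightarrow> h\<in>Hom D (fob L c) d \<Longrightarrow>
            \<Phi> c' d' (Cmp D (fob L c') d d' v (Cmp D (fob L c') (fob L c) d h (far L c' c u))) =
            Cmp C c' (fob R d) (fob R d') (far R d d' v) (Cmp C c' c (fob R d) (\<Phi> c d h) u)"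
    using adj unfolding left_adjoint_def by blast
  have \<Phi>i: "\<Phi> c d h \<in> Hom C c (fob R d)" if "c \<in> Ob C" "d \<in> Ob D" "h \<in> Hom D (fob L c) d" for c d h
    using b[OF that(1,2)] that(3) by (auto simp: bij_betw_def)
  have inj: "h = h'" if "c \<in> Ob C" "d \<in> Ob D" "h \<in> Hom D (fob L c) d" "h' \<in> Hom D (fob L c) d" "\<Phi> c d h = \<Phi> c d h'" for c d h h'
    using b[OF that(1,2)] that by (auto simp: bij_betw_def inj_on_def)
  have n1: "\<Phi> c' d (Cmp D (fob L c') (fob L c) d h (far L c' c u)) = Cmp C c' c (fob R d) (\<Phi> c d h) u"
    if "c \<in> Ob C" "c' \<in> Ob C" "d \<in> Ob D" "u\<in>Hom C c' c" "h\<in>Hom D (fob L c) d" for c c' d u h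
    using n[OF that(1-3) that(3) that(4) _ that(5), of "Idn D d"] that by (simp add: r \<Phi>i)
  have n2: "\<Phi> c d' (Cmp D (fob L c) d d' v h) = Cmp C c (fob R d) (fob R d') (far R d d' v) (\<Phi> c d h)"
    if "c \<in> Ob C" "d \<in> Ob D" "d' \<in> Ob D" "v\<in>Hom D d d'" "h\<in>Hom D (fob L c) d" for c d d' v h
    using n[OF that(1) that(1) that(2,3) _ that(4,5), of "Idn C c"] that by (simp add: r \<Phi>i)
  define \<eta> where "\<eta> c = \<Phi> c (fob L c) (Idn D (fob L c))" for c
  define \<epsilon> where "\<epsilon> d = inv_into (Hom D (fob L (fob R d)) d) (\<Phi> (fob R d) d) (Idn C (fob R d))" for d
  have \<epsilon>: "\<epsilon> d \<in> Hom D (fob L (fob R d)) d" "\<Phi> (fob R d) d (\<epsilon> d) = Idn C (fob R d)" if "d \<in> Ob D" for d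
  proof -
    have "Idn C (fob R d) \<in> \<Phi> (fob R d) d ` Hom D (fob L (fob R d)) d" using b[of "fob R d" d] that by (simp add: r bij_betw_def)
    then show "\<epsilon> d \<in> Hom D (fob L (fob R d)) d" "\<Phi> (fob R d) d (\<epsilon> d) = Idn C (fob R d)"
      by (auto simp: \<epsilon>_def inv_into_into f_inv_into_f)
  qed
  have \<eta>: "\<eta> c \<in> Hom C c (fob R (fob L c))" if "c \<in> Ob C" for c
    unfolding \<eta>_def using that by (simp add: \<Phi>i r)
  have "adjunction C D L R \<eta> \<epsilon>" unfolding adjunction_def natural_def
  proof (intro conjI ballI L R)
    fix a b f assume a: "a \<in> Ob C" "b \<in> Ob C" "f \<in> Hom C a b"
    have "\<Phi> a (fob L b) (far L a b f) = Cmp C a b (fob R (fob L b)) (\<eta> b) f"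
      using n1[OF a(2,1) _ a(3), of "fob L b" "Idn D (fob L b)"] a by (simp add: r \<eta>_def)
    moreover have "\<Phi> a (fob L b) (far L a b f) = Cmp C a (fob R (fob L a)) (fob R (fob L b)) (far R (fob L a) (fob L b) (far L a b f)) (\<eta> a)"
      using n2[OF a(1), of "fob L a" "fob L b" "far L a b f" "Idn D (fob L a)"] a by (simp add: r \<eta>_def)
    ultimately show "Cmp C (fob id_ftor a) (fob id_ftor b) (fob (comp_ftor R L) b) (\<eta> b) (far id_ftor a b f) =
       Cmp C (fob id_ftor a) (fob (comp_ftor R L) a) (fob (comp_ftor R L) b) (far (comp_ftor R L) a b f) (\<eta> a)" by simp
  next
    fix a b f assume a: "a \<in> Ob D" "b \<in> Ob D" "f \<in> Hom D a b"
    let ?LR = "\<lambda>a. fob L (fob R a)"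
    have "Cmp D (?LR a) (?LR b) b (\<epsilon> b) (far L (fob R a) (fob R b) (far R a b f)) = Cmp D (?LR a) a b f (\<epsilon> a)"
    proof (rule inj[of "fob R a" b])
      show "\<Phi> (fob R a) b (Cmp D (?LR a) (?LR b) b (\<epsilon> b) (far L (fob R a) (fob R b) (far R a b f))) = \<Phi> (fob R a) b (Cmp D (?LR a) a b f (\<epsilon> a))"
        using n1[of "fob R b" "fob R a" b "far R a b f" "\<epsilon> b"] n2[of "fob R a" a b f "\<epsilon> a"] a by (simp add: r \<epsilon>)
    qed (use a in \<open>auto simp: r \<epsilon> intro!: cat_Cmp[OF D]\<close>)
    then show "Cmp D (fob (comp_ftor L R) a) (fob (comp_ftor L R) b) (fob id_ftor b) (\<epsilon> b) (far (comp_ftor L R) a b f) =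
       Cmp D (fob (comp_ftor L R) a) (fob id_ftor a) (fob id_ftor b) (far id_ftor a b f) (\<epsilon> a)" by simp
  next
    fix c assume c: "c \<in> Ob C"
    show "Cmp D (fob L c) (fob L (fob R (fob L c))) (fob L c) (\<epsilon> (fob L c)) (far L c (fob R (fob L c)) (\<eta> c)) = Idn D (fob L c)"
    proof (rule inj[of c "fob L c"])
      show "\<Phi> c (fob L c) (Cmp D (fob L c) (fob L (fob R (fob L c))) (fob L c) (\<epsilon> (fob L c)) (far L c (fob R (fob L c)) (\<eta> c))) = \<Phi> c (fob L c) (Idn D (fob L c))"
        using n1[of "fob R (fob L c)" c "fob L c" "\<eta> c" "\<epsilon> (fob L c)"] c by (simp add: r \<epsilon> \<eta>) (simp add: \<eta>_def)
    qed (use c in \<open>auto simp: r \<epsilon> \<eta> intro!: cat_Cmp[OF D]\<close>)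
  next
    fix d assume d: "d \<in> Ob D"
    show "Cmp C (fob R d) (fob R (fob L (fob R d))) (fob R d) (far R (fob L (fob R d)) d (\<epsilon> d)) (\<eta> (fob R d)) = Idn C (fob R d)"
      using n2[of "fob R d" "fob L (fob R d)" d "\<epsilon> d" "Idn D (fob L (fob R d))"] d by (simp add: r \<epsilon> \<eta>_def)
  qed (auto simp: \<eta> \<epsilon>)
  then show ?thesis by (rule that)
qed

section \<open>Zigzag classes and naturality on the localization\<close>

definition zclass :: "('o, 'm) cat \<Rightarrow> ('o \<Rightarrow> 'o \<Rightarrow> 'm set) \<Rightarrow> 'o \<Rightarrow> 'o \<Rightarrow>
    ('o, 'm) zstep list \<Rightarrow> ('o, 'm) zstep list set" where
  "zclass C W a b p = {q. zigzag_eq C W a b p q}"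

lemma Ob_localization [simp]: "Ob (localization C W) = Ob C"
  by (simp add: localization_def)

lemma Hom_localization: "\<alpha> \<in> Hom (localization C W) a b \<longleftrightarrow> (\<exists>p. zigzag C W a b p \<and> \<alpha> = zclass C W a b p)"
  by (auto simp: localization_def quotient_def zclass_def)

lemma Idn_localization: "Idn (localization C W) a = zclass C W a a []"
  by (simp add: localization_def zclass_def)

lemma zclass_eq: "zigzag_eq C W a b p q \<Longrightarrow> zclass C W a b p = zclass C W a b q"
  unfolding zclass_def by (intro Collect_cong) (meson zz_sym zz_trans)

lemma Cmp_localization:
  assumes "zigzag C W a b p" "zigzag C W b c q"
  shows "Cmp (localization C W) a b c (zclass C W b c q) (zclass C W a b p) = zclass C W a c (p @ q)"
proof -
  have "zigzag_eq C W a b p p" "zigzag_eq C W b c q q" using assms by (auto intro: zz_refl)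
  then show ?thesis unfolding localization_def zclass_def by simp (meson zz_append zz_trans)
qed

lemma fob_loc_ftor [simp]: "fob (loc_ftor C W) a = a"
  by (simp add: loc_ftor_def)

lemma far_loc_ftor: "far (loc_ftor C W) a b f = zclass C W a b [Fwd a b f]"
  by (simp add: loc_ftor_def zclass_def)

lemma zigzag_Fwd1: "a \<in> Ob C \<Longrightarrow> b \<in> Ob C \<Longrightarrow> f \<in> Hom C a b \<Longrightarrow> zigzag C W a b [Fwd a b f]"
  by (intro zigzag.intros)

lemma zigzag_Bwd1: "a \<in> Ob C \<Longrightarrow> b \<in> Ob C \<Longrightarrow> w \<in> W b a \<Longrightarrow> zigzag C W a b [Bwd a b w]"
  by (intro zigzag.intros)

locale relative_category =
  fixes C :: "('o, 'm) cat" and W :: "'o \<Rightarrow> 'o \<Rightarrow> 'm set"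
  assumes C: "is_category C" and W: "\<And>a b. W a b \<subseteq> Hom C a b"
begin

abbreviation "loc \<equiv> localization C W"
abbreviation "Q \<equiv> loc_ftor C W"

lemma loc: "is_category loc" by (rule is_category_localization[OF C])

lemma Q_functor: "is_functor C loc Q"
  unfolding is_functor_def
proof (intro conjI ballI)
  fix a b f assume "a \<in> Ob C" "b \<in> Ob C" "f \<in> Hom C a b"
  then show "far Q a b f \<in> Hom loc (fob Q a) (fob Q b)" by (auto simp: Hom_localization far_loc_ftor intro: zigzag_Fwd1)
next
  fix a assume "a \<in> Ob C" then show "far Q a a (Idn C a) = Idn loc (fob Q a)"
    by (simp add: far_loc_ftor Idn_localization zclass_eq[OF zz_Idn])
next
  fix a b c f g assume "a \<in> Ob C" "b \<in> Ob C" "c \<in> Ob C" "f \<in> Hom C a b" "g \<in> Hom C b c"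
  then show "far Q a c (Cmp C a b c g f) = Cmp loc (fob Q a) (fob Q b) (fob Q c) (far Q b c g) (far Q a b f)"
    by (auto simp: far_loc_ftor Cmp_localization zigzag_Fwd1 intro!: zclass_eq[symmetric] zz_Cmp)
qed simp

lemmas Q_in = functor_far[OF Q_functor, simplified]
lemmas Q_Cmp = functor_Cmp[OF Q_functor, simplified]
lemmas Q_Idn = functor_Idn[OF Q_functor, simplified]

lemma Q_inverse:
  assumes "a \<in> Ob C" "b \<in> Ob C" "w \<in> W a b"
  shows "zclass C W b a [Bwd b a w] \<in> Hom loc b a"
    "Cmp loc a b a (zclass C W b a [Bwd b a w]) (far Q a b w) = Idn loc a"
    "Cmp loc b a b (far Q a b w) (zclass C W b a [Bwd b a w]) = Idn loc b"
proof -
  have w: "w \<in> Hom C a b" using assms W by blast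
  show "zclass C W b a [Bwd b a w] \<in> Hom loc b a" using assms by (auto simp: Hom_localization intro: zigzag_Bwd1)
  show "Cmp loc a b a (zclass C W b a [Bwd b a w]) (far Q a b w) = Idn loc a"
    using assms w by (auto simp: far_loc_ftor Cmp_localization zigzag_Fwd1 zigzag_Bwd1 Idn_localization intro!: zclass_eq zz_inv1)
  show "Cmp loc b a b (far Q a b w) (zclass C W b a [Bwd b a w]) = Idn loc b"
    using assms w by (auto simp: far_loc_ftor Cmp_localization zigzag_Fwd1 zigzag_Bwd1 Idn_localization intro!: zclass_eq zz_inv2)
qed

lemma Q_is_iso: "a \<in> Ob C \<Longrightarrow> b \<in> Ob C \<Longrightarrow> w \<in> W a b \<Longrightarrow> is_iso loc a b (far Q a b w)"
  unfolding is_iso_def using Q_inverse[of a b w] W[of a b] Q_in[of a b w] by blast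

text \<open>Peeling off the first step of a zigzag shows that arrows of \<open>loc\<close> are
  generated by the images of arrows of \<open>C\<close> and the inverses of arrows in
  \<open>W\<close>, so naturality can be proved on generators.\<close>

lemma loc_induct [consumes 3, case_names Idn Fwd Bwd]:
  assumes "a \<in> Ob C" "b \<in> Ob C" "\<alpha> \<in> Hom loc a b"
    and I: "\<And>a. a \<in> Ob C \<Longrightarrow> P a a (Idn loc a)"
    and F: "\<And>a b c f \<beta>. a \<in> Ob C \<Longrightarrow> b \<in> Ob C \<Longrightarrow> c \<in> Ob C \<Longrightarrow> f \<in> Hom C a b \<Longrightarrow> \<beta> \<in> Hom loc b c \<Longrightarrow> P b c \<beta> \<Longrightarrow>
      P a c (Cmp loc a b c \<beta> (far Q a b f))"
    and B: "\<And>a b c w \<beta>. a \<in> Ob C \<Longrightarrow> b \<in> Ob C \<Longrightarrow> c \<in> Ob C \<Longrightarrow> w \<in> W b a \<Longrightarrow> \<beta> \<in> Hom loc b c \<Longrightarrow> P b c \<beta> \<Longrightarrow>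
      P a c (Cmp loc a b c \<beta> (zclass C W a b [Bwd a b w]))"
  shows "P a b \<alpha>"
proof -
  have "P a b (zclass C W a b p)" if "zigzag C W a b p" for a b p
    using that
  proof (induction rule: zigzag.induct)
    case (zigzag_Nil a) then show ?case using I by (simp add: Idn_localization)
  next
    case (zigzag_Fwd a b f c p)
    have "zclass C W a c (Fwd a b f # p) = Cmp loc a b c (zclass C W b c p) (far Q a b f)"
      using zigzag_Fwd by (simp add: far_loc_ftor Cmp_localization zigzag_Fwd1)
    then show ?case using F[OF zigzag_Fwd(1,2) _ zigzag_Fwd(3) _ zigzag_Fwd(5)] zigzag_Fwd(4) zigzag_Ob[OF zigzag_Fwd(4)]
      by (auto simp: Hom_localization)
  next
    case (zigzag_Bwd a b w c p)
    have "zclass C W a c (Bwd a b w # p) = Cmp loc a b c (zclass C W b c p) (zclass C W a b [Bwd a b w])"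
      using zigzag_Bwd by (simp add: Cmp_localization zigzag_Bwd1)
    then show ?case using B[OF zigzag_Bwd(1,2) _ zigzag_Bwd(3) _ zigzag_Bwd(5)] zigzag_Bwd(4) zigzag_Ob[OF zigzag_Bwd(4)]
      by (auto simp: Hom_localization)
  qed
  then show ?thesis using assms(3) by (auto simp: Hom_localization)
qed

text \<open>\<open>Q\<close> is the identity on objects, so the components are already there and
  only naturality at formal inverses is new. Both functors send the formal inverse of
  \<open>w\<close> to an inverse, hence the square of \<open>w\<close> can be inverted; squares
  paste along a zigzag.\<close>

lemma natural_localization:
  assumes E: "is_category E" and A: "is_functor loc E A" and B: "is_functor loc E B"
    and nat: "natural C E (comp_ftor A Q) (comp_ftor B Q) \<tau>"
  shows "natural loc E A B \<tau>"
proof -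
  note r = functor_fob[OF A, simplified] functor_fob[OF B, simplified] functor_far[OF A, simplified] functor_far[OF B, simplified]
  have \<tau>: "\<tau> a \<in> Hom E (fob A a) (fob B a)" if "a \<in> Ob C" for a using natural_in[OF nat that] by simp
  have N: "Cmp E (fob A a) (fob A b) (fob B b) (\<tau> b) (far A a b (far Q a b f)) =
    Cmp E (fob A a) (fob B a) (fob B b) (far B a b (far Q a b f)) (\<tau> a)" if "a \<in> Ob C" "b \<in> Ob C" "f \<in> Hom C a b" for a b f
    using natural_eq[OF nat that] by simp
  have step: "Cmp E (fob A a) (fob A c) (fob B c) (\<tau> c) (far A a c (Cmp loc a b c \<beta> \<phi>)) =
    Cmp E (fob A a) (fob B a) (fob B c) (far B a c (Cmp loc a b c \<beta> \<phi>)) (\<tau> a)"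
    if o: "a \<in> Ob C" "b \<in> Ob C" "c \<in> Ob C" and h: "\<phi> \<in> Hom loc a b" "\<beta> \<in> Hom loc b c"
      and 1: "Cmp E (fob A a) (fob A b) (fob B b) (\<tau> b) (far A a b \<phi>) = Cmp E (fob A a) (fob B a) (fob B b) (far B a b \<phi>) (\<tau> a)"
      and 2: "Cmp E (fob A b) (fob A c) (fob B c) (\<tau> c) (far A b c \<beta>) = Cmp E (fob A b) (fob B b) (fob B c) (far B b c \<beta>) (\<tau> b)"
    for a b c \<phi> \<beta>
  proof -
    note t = r[of a] r[of b] r[of c] o h \<tau>
    have "Cmp E (fob A a) (fob A c) (fob B c) (\<tau> c) (far A a c (Cmp loc a b c \<beta> \<phi>)) =
      Cmp E (fob A a) (fob A b) (fob B c) (Cmp E (fob A b) (fob A c) (fob B c) (\<tau> c) (far A b c \<beta>)) (far A a b \<phi>)"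
      using t functor_Cmp[OF A, simplified, OF o h] by (subst cat_assoc[OF E]) auto
    also have "\<dots> = Cmp E (fob A a) (fob B b) (fob B c) (far B b c \<beta>) (Cmp E (fob A a) (fob A b) (fob B b) (\<tau> b) (far A a b \<phi>))"
      unfolding 2 using t by (intro cat_assoc[OF E]) auto
    also have "\<dots> = Cmp E (fob A a) (fob B a) (fob B c) (Cmp E (fob B a) (fob B b) (fob B c) (far B b c \<beta>) (far B a b \<phi>)) (\<tau> a)"
      unfolding 1 using t by (intro cat_assoc[OF E, symmetric]) auto
    finally show ?thesis using functor_Cmp[OF B, simplified, OF o h] by simp
  qed
  have "Cmp E (fob A a) (fob A b) (fob B b) (\<tau> b) (far A a b \<alpha>) = Cmp E (fob A a) (fob B a) (fob B b) (far B a b \<alpha>) (\<tau> a)"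
    if "a \<in> Ob C" "b \<in> Ob C" "\<alpha> \<in> Hom loc a b" for a b \<alpha>
    using that
  proof (induction rule: loc_induct)
    case (Idn a) then show ?case
      by (simp add: functor_Idn[OF A] functor_Idn[OF B] cat_left[OF E] cat_right[OF E] r \<tau>)
  next
    case (Fwd a b c f \<beta>) then show ?case by (intro step N) (auto intro: Q_in)
  next
    case (Bwd a b c w \<beta>)
    have w: "w \<in> Hom C b a" using Bwd W by blast
    let ?i = "zclass C W a b [Bwd a b w]" and ?q = "far Q b a w"
    note i = Q_inverse[OF Bwd(2,1,4)]
    have q: "?q \<in> Hom loc b a" using w Bwd Q_in by simp
    note t = r[of a] r[of b] r[of c] Bwd(1,2,3) \<tau> i(1) q
    have Ai: "Cmp E (fob A a) (fob A b) (fob A a) (far A b a ?q) (far A a b ?i) = Idn E (fob A a)"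
      using functor_Cmp[OF A, simplified, OF Bwd(1,2,1) i(1) q] i Bwd by (simp add: functor_Idn[OF A])
    have Bi: "Cmp E (fob B b) (fob B a) (fob B b) (far B a b ?i) (far B b a ?q) = Idn E (fob B b)"
      using functor_Cmp[OF B, simplified, OF Bwd(2,1,2) q i(1)] i Bwd by (simp add: functor_Idn[OF B])
    \<comment> \<open>The identity \<open>Bi\<close> is inserted on the left, the square of
      \<open>w\<close> is applied in the middle, and \<open>Ai\<close> cancels what remains on the
      right.\<close>
    have "Cmp E (fob A a) (fob A b) (fob B b) (\<tau> b) (far A a b ?i) =
      Cmp E (fob A a) (fob A b) (fob B b) (Cmp E (fob A b) (fob B b) (fob B b) (Cmp E (fob B b) (fob B a) (fob B b) (far B a b ?i) (far B b a ?q)) (\<tau> b)) (far A a b ?i)"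
      unfolding Bi using t by (simp add: cat_left[OF E])
    also have "\<dots> = Cmp E (fob A a) (fob A b) (fob B b) (Cmp E (fob A b) (fob B a) (fob B b) (far B a b ?i) (Cmp E (fob A b) (fob B b) (fob B a) (far B b a ?q) (\<tau> b))) (far A a b ?i)"
      using t by (subst cat_assoc[OF E]) auto
    also have "\<dots> = Cmp E (fob A a) (fob A b) (fob B b) (Cmp E (fob A b) (fob B a) (fob B b) (far B a b ?i) (Cmp E (fob A b) (fob A a) (fob B a) (\<tau> a) (far A b a ?q))) (far A a b ?i)"
      using N[OF Bwd(2,1) w] by simp
    also have "\<dots> = Cmp E (fob A a) (fob B a) (fob B b) (far B a b ?i) (Cmp E (fob A a) (fob A b) (fob B a) (Cmp E (fob A b) (fob A a) (fob B a) (\<tau> a) (far A b a ?q)) (far A a b ?i))"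
      using t by (intro cat_assoc[OF E]) (auto intro!: cat_Cmp[OF E])
    also have "Cmp E (fob A a) (fob A b) (fob B a) (Cmp E (fob A b) (fob A a) (fob B a) (\<tau> a) (far A b a ?q)) (far A a b ?i) =
      Cmp E (fob A a) (fob A a) (fob B a) (\<tau> a) (Cmp E (fob A a) (fob A b) (fob A a) (far A b a ?q) (far A a b ?i))"
      using t by (intro cat_assoc[OF E]) auto
    also have "\<dots> = \<tau> a" unfolding Ai using t by (simp add: cat_right[OF E])
    finally show ?case using Bwd i by (intro step) auto
  qed
  then show ?thesis using \<tau> by (simp add: natural_def)
qed

end

section \<open>Functors and adjunctions between localizations\<close>

fun zstep_map :: "('o, 'm, 'p, 'n) ftor \<Rightarrow> ('o, 'm) zstep \<Rightarrow> ('p, 'n) zstep" where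
  "zstep_map S (Fwd a b f) = Fwd (fob S a) (fob S b) (far S a b f)"
| "zstep_map S (Bwd a b w) = Bwd (fob S a) (fob S b) (far S b a w)"

text \<open>The image of a class is the union of the classes of the images of its members, so no
  representative is chosen. If the functor \<open>S\<close> preserves the inverted arrows, these
  classes all coincide by \<open>zigzag_eq_map\<close>.\<close>

definition localized_ftor ::
  "('o, 'm) cat \<Rightarrow> ('o \<Rightarrow> 'o \<Rightarrow> 'm set) \<Rightarrow> ('p, 'n) cat \<Rightarrow> ('p \<Rightarrow> 'p \<Rightarrow> 'n set) \<Rightarrow>
    ('o, 'm, 'p, 'n) ftor \<Rightarrow> ('o, ('o, 'm) zstep list set, 'p, ('p, 'n) zstep list set) ftor" where
  "localized_ftor C V D W S = \<lparr>fob = fob S,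
     far = \<lambda>a b \<alpha>. {q. \<exists>p\<in>\<alpha>. zigzag_eq D W (fob S a) (fob S b) (map (zstep_map S) p) q}\<rparr>"

definition homotopical ::
  "('o, 'm) cat \<Rightarrow> ('o \<Rightarrow> 'o \<Rightarrow> 'm set) \<Rightarrow> ('p \<Rightarrow> 'p \<Rightarrow> 'n set) \<Rightarrow> ('o, 'm, 'p, 'n) ftor \<Rightarrow> bool" where
  "homotopical C V W S \<longleftrightarrow> (\<forall>a\<in>Ob C. \<forall>b\<in>Ob C. \<forall>w\<in>V a b. far S a b w \<in> W (fob S a) (fob S b))"

locale relative_functor = C: relative_category C V + D: relative_category D W
  for C :: "('o, 'm) cat" and V and D :: "('p, 'n) cat" and W +
  fixes S :: "('o, 'm, 'p, 'n) ftor"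
  assumes S: "is_functor C D S" and homotopical: "homotopical C V W S"
begin

abbreviation "locS \<equiv> localized_ftor C V D W S"

lemma zigzag_map: "zigzag C V a b p \<Longrightarrow> zigzag D W (fob S a) (fob S b) (map (zstep_map S) p)"
  by (induction rule: zigzag.induct)
    (use homotopical in \<open>auto intro!: zigzag.intros simp: functor_fob[OF S] functor_far[OF S] homotopical_def\<close>)

lemma zigzag_eq_map:
  "zigzag_eq C V a b p q \<Longrightarrow> zigzag_eq D W (fob S a) (fob S b) (map (zstep_map S) p) (map (zstep_map S) q)"
proof (induction rule: zigzag_eq.induct)
  case (zz_Idn a) then show ?case using zigzag_eq.zz_Idn[of "fob S a" D W]
    by (simp add: functor_fob[OF S] functor_Idn[OF S])
next
  case (zz_Cmp a b c f g) then show ?case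
    using zigzag_eq.zz_Cmp[of "fob S a" D "fob S b" "fob S c" "far S a b f" "far S b c g" W]
    by (simp add: functor_fob[OF S] functor_far[OF S] functor_Cmp[OF S])
next
  case (zz_inv1 a b w) then show ?case using homotopical
    by (auto intro!: zigzag_eq.zz_inv1 simp: functor_fob[OF S] functor_far[OF S] homotopical_def)
next
  case (zz_inv2 a b w) then show ?case using homotopical
    by (auto intro!: zigzag_eq.zz_inv2 simp: functor_fob[OF S] functor_far[OF S] homotopical_def)
qed (auto intro: zigzag_eq.intros zigzag_map)

lemma fob_locS [simp]: "fob locS = fob S" by (simp add: localized_ftor_def)

lemma far_locS:
  assumes "zigzag C V a b p"
  shows "far locS a b (zclass C V a b p) = zclass D W (fob S a) (fob S b) (map (zstep_map S) p)"
proof -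
  have "zigzag_eq C V a b p p" using assms by (rule zz_refl)
  then show ?thesis unfolding localized_ftor_def zclass_def
    by simp (meson zigzag_eq_map zz_trans)
qed

lemma far_locS_Q: "a \<in> Ob C \<Longrightarrow> b \<in> Ob C \<Longrightarrow> f \<in> Hom C a b \<Longrightarrow>
    far locS a b (far C.Q a b f) = far D.Q (fob S a) (fob S b) (far S a b f)"
  by (simp add: far_loc_ftor far_locS zigzag_Fwd1)

lemma locS: "is_functor C.loc D.loc locS"
  unfolding is_functor_def
proof (intro conjI ballI)
  fix a b \<alpha> assume "\<alpha> \<in> Hom C.loc a b"
  then show "far locS a b \<alpha> \<in> Hom D.loc (fob locS a) (fob locS b)" by (auto simp: Hom_localization far_locS intro: zigzag_map)
next
  fix a assume "a \<in> Ob C.loc"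
  then show "far locS a a (Idn C.loc a) = Idn D.loc (fob locS a)" by (simp add: Idn_localization far_locS zigzag_Nil)
next
  fix a b c \<alpha> \<beta> assume "\<alpha> \<in> Hom C.loc a b" "\<beta> \<in> Hom C.loc b c"
  then show "far locS a c (Cmp C.loc a b c \<beta> \<alpha>) =
    Cmp D.loc (fob locS a) (fob locS b) (fob locS c) (far locS b c \<beta>) (far locS a b \<alpha>)"
    by (auto simp: Hom_localization far_locS Cmp_localization zigzag_map zigzag_append)
qed (simp add: functor_fob[OF S])

end

lemma natural_localized:
  assumes A: "relative_functor C V D W A" and B: "relative_functor C V D W B" and n: "natural C D A B \<tau>"
  shows "natural (localization C V) (localization D W) (localized_ftor C V D W A) (localized_ftor C V D W B)
    (\<lambda>a. far (loc_ftor D W) (fob A a) (fob B a) (\<tau> a))"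
proof -
  interpret A: relative_functor C V D W A by fact
  interpret B: relative_functor C V D W B by fact
  note r = functor_fob[OF A.S] functor_fob[OF B.S] functor_far[OF A.S] functor_far[OF B.S] natural_in[OF n]
  show ?thesis
  proof (rule A.C.natural_localization[OF A.D.loc A.locS B.locS], unfold natural_def, intro conjI ballI)
    fix a b f assume "a \<in> Ob C" "b \<in> Ob C" "f \<in> Hom C a b"
    then show "Cmp A.D.loc (fob (comp_ftor A.locS A.C.Q) a) (fob (comp_ftor A.locS A.C.Q) b) (fob (comp_ftor B.locS A.C.Q) b)
       (far A.D.Q (fob A b) (fob B b) (\<tau> b)) (far (comp_ftor A.locS A.C.Q) a b f) =
       Cmp A.D.loc (fob (comp_ftor A.locS A.C.Q) a) (fob (comp_ftor B.locS A.C.Q) a) (fob (comp_ftor B.locS A.C.Q) b)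
        (far (comp_ftor B.locS A.C.Q) a b f) (far A.D.Q (fob A a) (fob B a) (\<tau> a))"
      using natural_eq[OF n, of a b f] by (simp add: A.far_locS_Q B.far_locS_Q r flip: A.D.Q_Cmp)
  qed (auto intro!: A.D.Q_in r)
qed

text \<open>Both functors preserve the inverted arrows, so nothing has to be derived. Unit and
  counit are the images of the old ones, the triangle identities are inherited through
  \<open>Q\<close>, and naturality extends to formal inverses by
  \<open>natural_localization\<close>.\<close>

lemma adjunction_localized:
  assumes L: "relative_functor C V D W L" and R: "relative_functor D W C V R" and adj: "adjunction C D L R \<eta> \<epsilon>"
  shows "adjunction (localization C V) (localization D W) (localized_ftor C V D W L) (localized_ftor D W C V R)
    (\<lambda>c. far (loc_ftor C V) c (fob R (fob L c)) (\<eta> c)) (\<lambda>d. far (loc_ftor D W) (fob L (fob R d)) d (\<epsilon> d))"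
proof -
  interpret L: relative_functor C V D W L by fact
  interpret R: relative_functor D W C V R by fact
  have \<eta>: "natural C C id_ftor (comp_ftor R L) \<eta>" and \<epsilon>: "natural D D (comp_ftor L R) id_ftor \<epsilon>"
    using adj by (auto simp: adjunction_def)
  note r = functor_fob[OF L.S] functor_fob[OF R.S] functor_far[OF L.S] functor_far[OF R.S]
    natural_in[OF \<eta>, simplified] natural_in[OF \<epsilon>, simplified]
  have idf: "is_functor L.C.loc L.C.loc id_ftor" "is_functor L.D.loc L.D.loc id_ftor" by (simp_all add: is_functor_def)
  have c: "is_functor L.C.loc L.C.loc (comp_ftor R.locS L.locS)" "is_functor L.D.loc L.D.loc (comp_ftor L.locS R.locS)"
    by (simp_all add: is_functor_def functor_fob[OF L.locS, simplified] functor_fob[OF R.locS, simplified]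
      functor_far[OF L.locS, simplified] functor_far[OF R.locS, simplified]
      functor_Cmp[OF L.locS, simplified] functor_Cmp[OF R.locS, simplified] functor_Idn[OF L.locS, simplified] functor_Idn[OF R.locS, simplified] r)
  show ?thesis unfolding adjunction_def
  proof (intro conjI L.locS R.locS ballI)
    show "natural L.C.loc L.C.loc id_ftor (comp_ftor R.locS L.locS) (\<lambda>c. far L.C.Q c (fob R (fob L c)) (\<eta> c))"
    proof (rule L.C.natural_localization[OF L.C.loc idf(1) c(1)], unfold natural_def, intro conjI ballI, goal_cases)
      case (2 a b f) then show ?case
        using natural_eq[OF \<eta>, of a b f] by (simp add: L.far_locS_Q R.far_locS_Q r flip: L.C.Q_Cmp)
    qed (auto intro!: L.C.Q_in r)
    show "natural L.D.loc L.D.loc (comp_ftor L.locS R.locS) id_ftor (\<lambda>d. far (loc_ftor D W) (fob L (fob R d)) d (\<epsilon> d))"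
    proof (rule L.D.natural_localization[OF L.D.loc c(2) idf(2)], unfold natural_def, intro conjI ballI, goal_cases)
      case (2 a b f) then show ?case
        using natural_eq[OF \<epsilon>, of a b f] by (simp add: L.far_locS_Q R.far_locS_Q r flip: L.D.Q_Cmp)
    qed (auto intro!: L.D.Q_in r)
  next
    fix a assume "a \<in> Ob L.C.loc" then show "Cmp L.D.loc (fob L.locS a) (fob L.locS (fob R.locS (fob L.locS a))) (fob L.locS a)
      (far L.D.Q (fob L (fob R (fob L.locS a))) (fob L.locS a) (\<epsilon> (fob L.locS a))) (far L.locS a (fob R.locS (fob L.locS a)) (far L.C.Q a (fob R (fob L a)) (\<eta> a))) =
        Idn L.D.loc (fob L.locS a)"
      using adj by (simp add: L.far_locS_Q R.far_locS_Q r adjunction_def L.D.Q_Idn flip: L.D.Q_Cmp)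
  next
    fix a assume "a \<in> Ob L.D.loc" then show "Cmp L.C.loc (fob R.locS a) (fob R.locS (fob L.locS (fob R.locS a))) (fob R.locS a)
      (far R.locS (fob L.locS (fob R.locS a)) a (far L.D.Q (fob L (fob R a)) a (\<epsilon> a))) (far L.C.Q (fob R.locS a) (fob R (fob L (fob R.locS a))) (\<eta> (fob R.locS a))) =
        Idn L.C.loc (fob R.locS a)"
      using adj by (simp add: L.far_locS_Q R.far_locS_Q r adjunction_def L.C.Q_Idn flip: L.C.Q_Cmp)
  qed
qed

section \<open>Transport along isomorphic functors, and uniqueness of derived functors\<close>

lemma natural_comp:
  assumes D: "is_category D" and F: "is_functor C D F" and G: "is_functor C D G" and H: "is_functor C D H"
    and \<sigma>: "natural C D F G \<sigma>" and \<tau>: "natural C D G H \<tau>"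
  shows "natural C D F H (\<lambda>a. Cmp D (fob F a) (fob G a) (fob H a) (\<tau> a) (\<sigma> a))"
  unfolding natural_def
proof (intro conjI ballI)
  note r = functor_fob[OF F] functor_fob[OF G] functor_fob[OF H] functor_far[OF F] functor_far[OF G] functor_far[OF H]
    natural_in[OF \<sigma>] natural_in[OF \<tau>]
  fix a assume "a \<in> Ob C"
  then show "Cmp D (fob F a) (fob G a) (fob H a) (\<tau> a) (\<sigma> a) \<in> Hom D (fob F a) (fob H a)" by (intro cat_Cmp[OF D] r)
  fix b f assume ab: "a \<in> Ob C" "b \<in> Ob C" "f \<in> Hom C a b"
  have "Cmp D (fob F a) (fob F b) (fob H b) (Cmp D (fob F b) (fob G b) (fob H b) (\<tau> b) (\<sigma> b)) (far F a b f)
    = Cmp D (fob F a) (fob G b) (fob H b) (\<tau> b) (Cmp D (fob F a) (fob F b) (fob G b) (\<sigma> b) (far F a b f))"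
    using ab by (intro cat_assoc[OF D] r) auto
  also have "\<dots> = Cmp D (fob F a) (fob G a) (fob H b) (Cmp D (fob G a) (fob G b) (fob H b) (\<tau> b) (far G a b f)) (\<sigma> a)"
    unfolding natural_eq[OF \<sigma> ab] using ab by (intro cat_assoc[OF D, symmetric] r) auto
  also have "\<dots> = Cmp D (fob F a) (fob H a) (fob H b) (far H a b f) (Cmp D (fob F a) (fob G a) (fob H a) (\<tau> a) (\<sigma> a))"
    unfolding natural_eq[OF \<tau> ab] using ab by (intro cat_assoc[OF D] r) auto
  finally show "Cmp D (fob F a) (fob F b) (fob H b) (Cmp D (fob F b) (fob G b) (fob H b) (\<tau> b) (\<sigma> b)) (far F a b f)
    = Cmp D (fob F a) (fob H a) (fob H b) (far H a b f) (Cmp D (fob F a) (fob G a) (fob H a) (\<tau> a) (\<sigma> a))" .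
qed

lemma natural_inverse:
  assumes D: "is_category D" and F: "is_functor C D F" and G: "is_functor C D G"
    and \<tau>: "natural C D F G \<tau>" and iso: "\<And>a. a \<in> Ob C \<Longrightarrow> is_iso D (fob F a) (fob G a) (\<tau> a)"
  obtains \<sigma> where "natural C D G F \<sigma>" "\<And>a. a \<in> Ob C \<Longrightarrow> is_iso D (fob G a) (fob F a) (\<sigma> a)"
proof -
  have "\<forall>a\<in>Ob C. \<exists>g. g \<in> Hom D (fob G a) (fob F a) \<and> Cmp D (fob F a) (fob G a) (fob F a) g (\<tau> a) = Idn D (fob F a) \<and>
    Cmp D (fob G a) (fob F a) (fob G a) (\<tau> a) g = Idn D (fob G a)"
    using iso by (auto simp: is_iso_def)
  then obtain \<sigma> where \<sigma>: "\<And>a. a \<in> Ob C \<Longrightarrow> \<sigma> a \<in> Hom D (fob G a) (fob F a)"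
    "\<And>a. a \<in> Ob C \<Longrightarrow> Cmp D (fob F a) (fob G a) (fob F a) (\<sigma> a) (\<tau> a) = Idn D (fob F a)"
    "\<And>a. a \<in> Ob C \<Longrightarrow> Cmp D (fob G a) (fob F a) (fob G a) (\<tau> a) (\<sigma> a) = Idn D (fob G a)" by metis
  note r = functor_fob[OF F] functor_fob[OF G] functor_far[OF F] functor_far[OF G] natural_in[OF \<tau>] \<sigma>(1)
  show ?thesis
  proof (rule that)
    show "natural C D G F \<sigma>" unfolding natural_def
    proof (intro conjI ballI \<sigma>(1))
      fix a b f assume ab: "a \<in> Ob C" "b \<in> Ob C" "f \<in> Hom C a b"
      let ?Fa = "fob F a" and ?Fb = "fob F b" and ?Ga = "fob G a" and ?Gb = "fob G b"
      have "Cmp D ?Ga ?Gb ?Fb (\<sigma> b) (far G a b f) = Cmp D ?Ga ?Gb ?Fb (\<sigma> b) (Cmp D ?Ga ?Ga ?Gb (far G a b f) (Cmp D ?Ga ?Fa ?Ga (\<tau> a) (\<sigma> a)))"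
        using ab by (simp add: \<sigma> cat_right[OF D] r)
      also have "Cmp D ?Ga ?Ga ?Gb (far G a b f) (Cmp D ?Ga ?Fa ?Ga (\<tau> a) (\<sigma> a)) = Cmp D ?Ga ?Fa ?Gb (Cmp D ?Fa ?Fb ?Gb (\<tau> b) (far F a b f)) (\<sigma> a)"
        unfolding natural_eq[OF \<tau> ab] using ab by (intro cat_assoc[OF D, symmetric] r) auto
      also have "\<dots> = Cmp D ?Ga ?Fb ?Gb (\<tau> b) (Cmp D ?Ga ?Fa ?Fb (far F a b f) (\<sigma> a))" using ab by (intro cat_assoc[OF D] r) auto
      also have "Cmp D ?Ga ?Gb ?Fb (\<sigma> b) \<dots> = Cmp D ?Ga ?Fb ?Fb (Cmp D ?Fb ?Gb ?Fb (\<sigma> b) (\<tau> b)) (Cmp D ?Ga ?Fa ?Fb (far F a b f) (\<sigma> a))"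
        using ab by (intro cat_assoc[OF D, symmetric] r cat_Cmp[OF D]) auto
      also have "\<dots> = Cmp D ?Ga ?Fa ?Fb (far F a b f) (\<sigma> a)"
        using ab cat_Cmp[OF D, of ?Ga ?Fa ?Fb] by (simp add: \<sigma> cat_left[OF D] r)
      finally show "Cmp D ?Ga ?Gb ?Fb (\<sigma> b) (far G a b f) = Cmp D ?Ga ?Fa ?Fb (far F a b f) (\<sigma> a)" .
    qed
    show "is_iso D (fob G a) (fob F a) (\<sigma> a)" if "a \<in> Ob C" for a
      unfolding is_iso_def using \<sigma>[OF that] r(5)[OF that] by blast
  qed
qed

text \<open>The new bijection is the old one followed by \<open>\<tau> d\<close>. This serves to
  pass from the cobar resolution back to the given functor, and from an explicit derived functor to
  the chosen one.\<close>

lemma left_adjoint_iso: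
  assumes C: "is_category C" and D: "is_category D" and adj: "left_adjoint C D L R"
    and R': "is_functor D C R'" and \<tau>: "natural D C R R' \<tau>"
    and iso: "\<And>d. d \<in> Ob D \<Longrightarrow> is_iso C (fob R d) (fob R' d) (\<tau> d)"
  shows "left_adjoint C D L R'"
proof -
  have L: "is_functor C D L" and R: "is_functor D C R" using adj by (auto simp: left_adjoint_def)
  note r = functor_fob[OF R] functor_fob[OF R'] functor_fob[OF L] functor_far[OF R] functor_far[OF R'] functor_far[OF L] natural_in[OF \<tau>]
  obtain \<Phi> where b: "\<And>c d. c \<in> Ob C \<Longrightarrow> d \<in> Ob D \<Longrightarrow> bij_betw (\<Phi> c d) (Hom D (fob L c) d) (Hom C c (fob R d))"
    and n: "\<And>c c' d d' u v h. c \<in> Ob C \<Longrightarrow> c' \<in> Ob C \<Longrightarrow> d \<in> Ob D \<Longrightarrow> d' \<in> Ob D \<Longrightarrow>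
          u\<in>Hom C c' c \<Longrightarrow> v\<in>Hom D d d' \<Longrightarrow> h\<in>Hom D (fob L c) d \<Longrightarrow>
            \<Phi> c' d' (Cmp D (fob L c') d d' v (Cmp D (fob L c') (fob L c) d h (far L c' c u))) =
            Cmp C c' (fob R d) (fob R d') (far R d d' v) (Cmp C c' c (fob R d) (\<Phi> c d h) u)"
    using adj unfolding left_adjoint_def by blast
  have \<Phi>i: "\<Phi> c d h \<in> Hom C c (fob R d)" if "c \<in> Ob C" "d \<in> Ob D" "h \<in> Hom D (fob L c) d" for c d h
    using b[OF that(1,2)] that(3) by (auto simp: bij_betw_def)
  define \<Psi> where "\<Psi> c d h = Cmp C c (fob R d) (fob R' d) (\<tau> d) (\<Phi> c d h)" for c d h
  have bij: "bij_betw (\<Psi> c d) (Hom D (fob L c) d) (Hom C c (fob R' d))" if cd: "c \<in> Ob C" "d \<in> Ob D" for c d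
  proof -
    obtain \<sigma> where \<sigma>: "\<sigma> \<in> Hom C (fob R' d) (fob R d)" "Cmp C (fob R d) (fob R' d) (fob R d) \<sigma> (\<tau> d) = Idn C (fob R d)"
      "Cmp C (fob R' d) (fob R d) (fob R' d) (\<tau> d) \<sigma> = Idn C (fob R' d)" using iso[OF cd(2)] by (auto simp: is_iso_def)
    have 1: "Cmp C c (fob R' d) (fob R d) \<sigma> (Cmp C c (fob R d) (fob R' d) (\<tau> d) k) = k" if "k \<in> Hom C c (fob R d)" for k
      using that cd by (subst cat_assoc[OF C, symmetric]) (auto simp: \<sigma> r cat_left[OF C])
    have 2: "Cmp C c (fob R d) (fob R' d) (\<tau> d) (Cmp C c (fob R' d) (fob R d) \<sigma> k) = k" if "k \<in> Hom C c (fob R' d)" for k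
      using that cd by (subst cat_assoc[OF C, symmetric]) (auto simp: \<sigma> r cat_left[OF C])
    have "bij_betw (Cmp C c (fob R d) (fob R' d) (\<tau> d)) (Hom C c (fob R d)) (Hom C c (fob R' d))"
      by (rule bij_betw_byWitness[of _ "Cmp C c (fob R' d) (fob R d) \<sigma>"])
        (use 1 2 cd in \<open>auto intro!: cat_Cmp[OF C] r \<sigma>\<close>)
    from bij_betw_trans[OF b[OF cd] this] show ?thesis by (simp add: \<Psi>_def[abs_def] o_def)
  qed
  have nat: "\<Psi> c' d' (Cmp D (fob L c') d d' v (Cmp D (fob L c') (fob L c) d h (far L c' c u))) =
            Cmp C c' (fob R' d) (fob R' d') (far R' d d' v) (Cmp C c' c (fob R' d) (\<Psi> c d h) u)"
    if t: "c \<in> Ob C" "c' \<in> Ob C" "d \<in> Ob D" "d' \<in> Ob D" "u\<in>Hom C c' c" "v\<in>Hom D d d'" "h\<in>Hom D (fob L c) d" for c c' d d' u v h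
  proof -
    let ?k = "Cmp C c' c (fob R d) (\<Phi> c d h) u"
    have k: "?k \<in> Hom C c' (fob R d)" using t by (intro cat_Cmp[OF C]) (auto simp: r \<Phi>i)
    have "\<Psi> c' d' (Cmp D (fob L c') d d' v (Cmp D (fob L c') (fob L c) d h (far L c' c u))) =
      Cmp C c' (fob R d') (fob R' d') (\<tau> d') (Cmp C c' (fob R d) (fob R d') (far R d d' v) ?k)"
      unfolding \<Psi>_def using n[OF t] by simp
    also have "\<dots> = Cmp C c' (fob R d) (fob R' d') (Cmp C (fob R d) (fob R d') (fob R' d') (\<tau> d') (far R d d' v)) ?k"
      using t k by (intro cat_assoc[OF C, symmetric]) (auto simp: r)
    also have "\<dots> = Cmp C c' (fob R' d) (fob R' d') (far R' d d' v) (Cmp C c' (fob R d) (fob R' d) (\<tau> d) ?k)"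
      unfolding natural_eq[OF \<tau> t(3,4,6)] using t k by (intro cat_assoc[OF C]) (auto simp: r)
    also have "Cmp C c' (fob R d) (fob R' d) (\<tau> d) ?k = Cmp C c' c (fob R' d) (\<Psi> c d h) u"
      unfolding \<Psi>_def using t by (intro cat_assoc[OF C, symmetric]) (auto simp: r \<Phi>i)
    finally show ?thesis .
  qed
  show ?thesis unfolding left_adjoint_def using L R' bij nat by blast
qed

text \<open>Terminal objects are isomorphic: comparison transformations exist in both directions,
  and their composites are identities by the uniqueness clause.\<close>

lemma left_derived_unique:
  assumes C: "relative_category C V" and D: "relative_category D W"
    and S: "is_functor C D S"
    and 1: "is_left_derived C V D W S L1 \<epsilon>1" and 2: "is_left_derived C V D W S L2 \<epsilon>2"
  obtains \<tau> where "natural (localization C V) (localization D W) L1 L2 \<tau>"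
    "\<And>a. a \<in> Ob C \<Longrightarrow> is_iso (localization D W) (fob L1 a) (fob L2 a) (\<tau> a)"
proof -
  interpret C: relative_category C V by fact
  interpret D: relative_category D W by fact
  have F: "is_functor C.loc D.loc L" and \<epsilon>: "nat_trans C D.loc (comp_ftor L C.Q) (comp_ftor D.Q S) \<epsilon>"
    and u: "\<And>G \<gamma>. is_functor C.loc D.loc G \<Longrightarrow> nat_trans C D.loc (comp_ftor G C.Q) (comp_ftor D.Q S) \<gamma> \<Longrightarrow>
      \<exists>!\<delta>. nat_trans C.loc D.loc G L \<delta> \<and> (\<forall>a\<in>Ob C. Cmp D.loc (fob G a) (fob L a) (fob S a) (\<epsilon> a) (\<delta> a) = \<gamma> a)"
    if "is_left_derived C V D W S L \<epsilon>" for L \<epsilon> using that unfolding is_left_derived_def by blast+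
  have o: "fob L a \<in> Ob D" if "is_left_derived C V D W S L \<epsilon>" "a \<in> Ob C" for L \<epsilon> a
    using functor_fob[OF F[OF that(1)]] that(2) by simp
  have e: "\<epsilon> a \<in> Hom D.loc (fob L a) (fob S a)" if "is_left_derived C V D W S L \<epsilon>" "a \<in> Ob C" for L \<epsilon> a
    using natural_in[OF conjunct2[OF \<epsilon>[OF that(1), unfolded nat_trans_iff_natural]] that(2)] by simp
  have ex: "\<exists>\<delta>. natural C.loc D.loc L L' \<delta> \<and> (\<forall>a\<in>Ob C. Cmp D.loc (fob L a) (fob L' a) (fob S a) (\<epsilon>' a) (\<delta> a) = \<epsilon> a)"
    if "is_left_derived C V D W S L \<epsilon>" "is_left_derived C V D W S L' \<epsilon>'" for L L' \<epsilon> \<epsilon>'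
    using u[OF that(2) F[OF that(1)] \<epsilon>[OF that(1)]] by (auto simp: nat_trans_iff_natural)
  have inv: "Cmp D.loc (fob L a) (fob L' a) (fob L a) (\<delta>' a) (\<delta> a) = Idn D.loc (fob L a)"
    if l: "is_left_derived C V D W S L \<epsilon>" "is_left_derived C V D W S L' \<epsilon>'" and a: "a \<in> Ob C"
     and d: "natural C.loc D.loc L L' \<delta>" "\<forall>a\<in>Ob C. Cmp D.loc (fob L a) (fob L' a) (fob S a) (\<epsilon>' a) (\<delta> a) = \<epsilon> a"
      "natural C.loc D.loc L' L \<delta>'" "\<forall>a\<in>Ob C. Cmp D.loc (fob L' a) (fob L a) (fob S a) (\<epsilon> a) (\<delta>' a) = \<epsilon>' a"
    for L L' \<epsilon> \<epsilon>' \<delta> \<delta>' a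
  proof -
    let ?c = "\<lambda>a. Cmp D.loc (fob L a) (fob L' a) (fob L a) (\<delta>' a) (\<delta> a)"
    let ?i = "\<lambda>a. Idn D.loc (fob L a)"
    have "natural C.loc D.loc L L ?c" by (rule natural_comp[OF D.loc F[OF l(1)] F[OF l(2)] F[OF l(1)] d(1,3)])
    then have n1: "nat_trans C.loc D.loc L L (restrict ?c (Ob C))" using natural_restrict by fastforce
    have "natural C.loc D.loc L L ?i" unfolding natural_def
      using functor_fob[OF F[OF l(1)]] functor_far[OF F[OF l(1)]]
      by (auto simp: cat_left[OF D.loc] cat_right[OF D.loc] intro!: cat_Idn[OF D.loc])
    then have n2: "nat_trans C.loc D.loc L L (restrict ?i (Ob C))" using natural_restrict by fastforce
    have c1: "Cmp D.loc (fob L b) (fob L b) (fob S b) (\<epsilon> b) (?c b) = \<epsilon> b" if b: "b \<in> Ob C" for b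
    proof -
      have "Cmp D.loc (fob L b) (fob L b) (fob S b) (\<epsilon> b) (?c b) = Cmp D.loc (fob L b) (fob L' b) (fob S b) (Cmp D.loc (fob L' b) (fob L b) (fob S b) (\<epsilon> b) (\<delta>' b)) (\<delta> b)"
        using b natural_in[OF d(1)] natural_in[OF d(3)] e[OF l(1) b] o[OF l(1) b] o[OF l(2) b] functor_fob[OF S b]
        by (intro cat_assoc[OF D.loc, symmetric]) auto
      then show ?thesis using d b by simp
    qed
    have c2: "Cmp D.loc (fob L b) (fob L b) (fob S b) (\<epsilon> b) (?i b) = \<epsilon> b" if b: "b \<in> Ob C" for b
      using b e[OF l(1) b] o[OF l(1) b] functor_fob[OF S b] by (intro cat_right[OF D.loc]) auto
    \<comment> \<open>Both families factor \<open>\<epsilon>\<close> through itself. They are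
      restricted because uniqueness is stated for extensional families.\<close>
    have "restrict ?c (Ob C) = restrict ?i (Ob C)"
      using u[OF l(1) F[OF l(1)] \<epsilon>[OF l(1)]] n1 n2 c1 c2 by (metis (no_types, lifting) restrict_apply')
    then show ?thesis using a by (metis (no_types, lifting) restrict_apply')
  qed
  obtain \<delta> where \<delta>: "natural C.loc D.loc L1 L2 \<delta>" "\<forall>a\<in>Ob C. Cmp D.loc (fob L1 a) (fob L2 a) (fob S a) (\<epsilon>2 a) (\<delta> a) = \<epsilon>1 a"
    using ex[OF 1 2] by blast
  obtain \<delta>' where \<delta>': "natural C.loc D.loc L2 L1 \<delta>'" "\<forall>a\<in>Ob C. Cmp D.loc (fob L2 a) (fob L1 a) (fob S a) (\<epsilon>1 a) (\<delta>' a) = \<epsilon>2 a"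
    using ex[OF 2 1] by blast
  show ?thesis
  proof (rule that[OF \<delta>(1)])
    fix a assume a: "a \<in> Ob C"
    show "is_iso D.loc (fob L1 a) (fob L2 a) (\<delta> a)" unfolding is_iso_def
      using inv[OF 1 2 a \<delta> \<delta>'] inv[OF 2 1 a \<delta>' \<delta>] natural_in[OF \<delta>(1)] natural_in[OF \<delta>'(1)] a by auto
  qed
qed

text \<open>
  For an adjunction \<open>L \<stileturn> R\<close>, the natural transformations \<open>G \<rightarrow> H \<circ> L\<close> correspond to the natural
  transformations \<open>G \<circ> R \<rightarrow> H\<close>.
\<close>

locale mates =
  fixes C :: "('o, 'm) cat" and D :: "('p, 'n) cat" and A :: "('q, 'l) cat" and L R \<eta> \<epsilon> G H
  assumes C: "is_category C" and D: "is_category D" and A: "is_category A" and adj: "adjunction C D L R \<eta> \<epsilon>"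
    and G: "is_functor C A G" and H: "is_functor D A H"
begin

definition mate :: "('o \<Rightarrow> 'l) \<Rightarrow> 'p \<Rightarrow> 'l" where
  "mate \<delta> d = Cmp A (fob G (fob R d)) (fob H (fob L (fob R d))) (fob H d) (far H (fob L (fob R d)) d (\<epsilon> d)) (\<delta> (fob R d))"

definition comate :: "('p \<Rightarrow> 'l) \<Rightarrow> 'o \<Rightarrow> 'l" where
  "comate \<mu> c = Cmp A (fob G c) (fob G (fob R (fob L c))) (fob H (fob L c)) (\<mu> (fob L c)) (far G c (fob R (fob L c)) (\<eta> c))"

lemma L: "is_functor C D L" and R: "is_functor D C R"
  and \<eta>: "natural C C id_ftor (comp_ftor R L) \<eta>" and \<epsilon>: "natural D D (comp_ftor L R) id_ftor \<epsilon>"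
  using adj by (auto simp: adjunction_def)

lemmas mate_rules = functor_fob[OF L] functor_fob[OF R] functor_fob[OF G] functor_fob[OF H]
  functor_far[OF L] functor_far[OF R] functor_far[OF G] functor_far[OF H]
  natural_in[OF \<eta>, simplified] natural_in[OF \<epsilon>, simplified]

lemmas as = cat_assoc[OF A]

context
  fixes \<delta> assumes \<delta>: "natural C A G (comp_ftor H L) \<delta>"
begin

lemma natural_mate: "natural D A (comp_ftor G R) H (mate \<delta>)"
  unfolding natural_def comp_ftor_simps
proof (intro conjI ballI)
  note r = mate_rules natural_in[OF \<delta>, simplified]
  show "mate \<delta> d \<in> Hom A (fob G (fob R d)) (fob H d)" if "d \<in> Ob D" for d
    unfolding mate_def using that by (intro cat_Cmp[OF A]) (auto simp: r)
  fix a b f assume ab: "a \<in> Ob D" "b \<in> Ob D" "f \<in> Hom D a b"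
  let ?G = "\<lambda>d. fob G (fob R d)" and ?H = "\<lambda>d. fob H (fob L (fob R d))" and ?L = "\<lambda>d. fob L (fob R d)" and ?f = "far R a b f"
  have "Cmp A (?G a) (?G b) (fob H b) (mate \<delta> b) (far G (fob R a) (fob R b) ?f) =
    Cmp A (?G a) (?H b) (fob H b) (far H (?L b) b (\<epsilon> b)) (Cmp A (?G a) (?G b) (?H b) (\<delta> (fob R b)) (far G (fob R a) (fob R b) ?f))"
    unfolding mate_def using ab by (intro as) (auto simp: r)
  also have "\<dots> = Cmp A (?G a) (?H b) (fob H b) (far H (?L b) b (\<epsilon> b)) (Cmp A (?G a) (?H a) (?H b) (far H (?L a) (?L b) (far L (fob R a) (fob R b) ?f)) (\<delta> (fob R a)))"
    using natural_eq[OF \<delta>, of "fob R a" "fob R b" ?f] ab by (simp add: r)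
  also have "\<dots> = Cmp A (?G a) (?H a) (fob H b) (far H (?L a) b (Cmp D (?L a) (?L b) b (\<epsilon> b) (far L (fob R a) (fob R b) ?f))) (\<delta> (fob R a))"
    using ab by (simp add: as[symmetric] functor_Cmp[OF H] r)
  also have "\<dots> = Cmp A (?G a) (?H a) (fob H b) (Cmp A (?H a) (fob H a) (fob H b) (far H a b f) (far H (?L a) a (\<epsilon> a))) (\<delta> (fob R a))"
    using natural_eq[OF \<epsilon> ab] ab by (simp add: functor_Cmp[OF H] r)
  also have "\<dots> = Cmp A (?G a) (fob H a) (fob H b) (far H a b f) (mate \<delta> a)" unfolding mate_def using ab by (intro as) (auto simp: r)
  finally show "Cmp A (?G a) (?G b) (fob H b) (mate \<delta> b) (far G (fob R a) (fob R b) ?f) = Cmp A (?G a) (fob H a) (fob H b) (far H a b f) (mate \<delta> a)" .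
qed

text \<open>Naturality of \<open>\<delta>\<close> at the unit moves both structure maps under
  \<open>H\<close>, where the triangle identity for \<open>L\<close> cancels them. The other round
  trip uses naturality at the counit and the triangle identity for \<open>R\<close>.\<close>

lemma comate_mate: "c \<in> Ob C \<Longrightarrow> comate (mate \<delta>) c = \<delta> c"
proof -
  assume c: "c \<in> Ob C"
  note r = mate_rules natural_in[OF \<delta>, simplified]
  let ?RL = "fob R (fob L c)" and ?G = "fob G c" and ?H = "fob H (fob L c)" and ?HRL = "fob H (fob L (fob R (fob L c)))"
  have "comate (mate \<delta>) c = Cmp A ?G ?HRL ?H (far H (fob L ?RL) (fob L c) (\<epsilon> (fob L c))) (Cmp A ?G (fob G ?RL) ?HRL (\<delta> ?RL) (far G c ?RL (\<eta> c)))"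
    unfolding comate_def mate_def using c by (intro as) (auto simp: r)
  also have "\<dots> = Cmp A ?G ?HRL ?H (far H (fob L ?RL) (fob L c) (\<epsilon> (fob L c))) (Cmp A ?G ?H ?HRL (far H (fob L c) (fob L ?RL) (far L c ?RL (\<eta> c))) (\<delta> c))"
    using natural_eq[OF \<delta>, of c ?RL "\<eta> c"] c by (simp add: r)
  also have "\<dots> = Cmp A ?G ?H ?H (far H (fob L c) (fob L c) (Cmp D (fob L c) (fob L ?RL) (fob L c) (\<epsilon> (fob L c)) (far L c ?RL (\<eta> c)))) (\<delta> c)"
    using c by (simp add: as[symmetric] functor_Cmp[OF H] r)
  also have "\<dots> = \<delta> c" using adj c by (simp add: adjunction_def functor_Idn[OF H] cat_left[OF A] r)
  finally show ?thesis .
qed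

end

context
  fixes \<mu> assumes \<mu>: "natural D A (comp_ftor G R) H \<mu>"
begin

lemma natural_comate: "natural C A G (comp_ftor H L) (comate \<mu>)"
  unfolding natural_def comp_ftor_simps
proof (intro conjI ballI)
  note r = mate_rules natural_in[OF \<mu>, simplified]
  show "comate \<mu> c \<in> Hom A (fob G c) (fob H (fob L c))" if "c \<in> Ob C" for c
    unfolding comate_def using that by (intro cat_Cmp[OF A]) (auto simp: r)
  fix a b f assume ab: "a \<in> Ob C" "b \<in> Ob C" "f \<in> Hom C a b"
  let ?RL = "\<lambda>c. fob R (fob L c)" and ?G = "\<lambda>c. fob G (fob R (fob L c))" and ?H = "\<lambda>c. fob H (fob L c)" and ?f = "far L a b f"
  have "Cmp A (fob G a) (fob G b) (?H b) (comate \<mu> b) (far G a b f) = Cmp A (fob G a) (?G b) (?H b) (\<mu> (fob L b)) (far G a (?RL b) (Cmp C a b (?RL b) (\<eta> b) f))"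
    unfolding comate_def using ab by (simp add: as functor_Cmp[OF G] r)
  also have "\<dots> = Cmp A (fob G a) (?G b) (?H b) (\<mu> (fob L b)) (Cmp A (fob G a) (?G a) (?G b) (far G (?RL a) (?RL b) (far R (fob L a) (fob L b) ?f)) (far G a (?RL a) (\<eta> a)))"
    using natural_eq[OF \<eta> ab] ab by (simp add: functor_Cmp[OF G] r)
  also have "\<dots> = Cmp A (fob G a) (?G a) (?H b) (Cmp A (?G a) (?G b) (?H b) (\<mu> (fob L b)) (far G (?RL a) (?RL b) (far R (fob L a) (fob L b) ?f))) (far G a (?RL a) (\<eta> a))"
    using ab by (intro as[symmetric]) (auto simp: r)
  also have "\<dots> = Cmp A (fob G a) (?G a) (?H b) (Cmp A (?G a) (?H a) (?H b) (far H (fob L a) (fob L b) ?f) (\<mu> (fob L a))) (far G a (?RL a) (\<eta> a))"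
    using natural_eq[OF \<mu>, of "fob L a" "fob L b" ?f] ab by (simp add: r)
  also have "\<dots> = Cmp A (fob G a) (?H a) (?H b) (far H (fob L a) (fob L b) ?f) (comate \<mu> a)"
    unfolding comate_def using ab by (intro as) (auto simp: r)
  finally show "Cmp A (fob G a) (fob G b) (?H b) (comate \<mu> b) (far G a b f) = Cmp A (fob G a) (?H a) (?H b) (far H (fob L a) (fob L b) ?f) (comate \<mu> a)" .
qed

lemma mate_comate: "d \<in> Ob D \<Longrightarrow> mate (comate \<mu>) d = \<mu> d"
proof -
  assume d: "d \<in> Ob D"
  note r = mate_rules natural_in[OF \<mu>, simplified]
  let ?R = "fob R d" and ?LR = "fob L (fob R d)" and ?G = "fob G (fob R d)" and ?RLR = "fob R (fob L (fob R d))"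
  have "mate (comate \<mu>) d = Cmp A ?G (fob G ?RLR) (fob H d) (Cmp A (fob G ?RLR) (fob H ?LR) (fob H d) (far H ?LR d (\<epsilon> d)) (\<mu> ?LR)) (far G ?R ?RLR (\<eta> ?R))"
    unfolding comate_def mate_def using d by (intro as[symmetric]) (auto simp: r)
  also have "\<dots> = Cmp A ?G (fob G ?RLR) (fob H d) (Cmp A (fob G ?RLR) ?G (fob H d) (\<mu> d) (far G ?RLR ?R (far R ?LR d (\<epsilon> d)))) (far G ?R ?RLR (\<eta> ?R))"
    using natural_eq[OF \<mu>, of ?LR d "\<epsilon> d"] d by (simp add: r)
  also have "\<dots> = Cmp A ?G ?G (fob H d) (\<mu> d) (far G ?R ?R (Cmp C ?R ?RLR ?R (far R ?LR d (\<epsilon> d)) (\<eta> ?R)))"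
    using d by (simp add: as functor_Cmp[OF G] r)
  also have "\<dots> = \<mu> d" using adj d by (simp add: adjunction_def functor_Idn[OF G] cat_right[OF A] r)
  finally show ?thesis .
qed

end

end

text \<open>
  If \<open>S\<close> has a right adjoint \<open>E\<close> that preserves the inverted arrows, then every left adjoint \<open>L\<close> of
  the localization of \<open>E\<close> is a left derived functor of \<open>S\<close>: for \<open>G : C[V\<inverse>] \<rightarrow> D[W\<inverse>]\<close> both the
  transformations \<open>G \<rightarrow> L\<close> and the transformations \<open>G \<circ> Q \<rightarrow> Q \<circ> S\<close> correspond to the
  transformations \<open>G \<circ> E \<rightarrow> 1\<close>.
\<close>

lemma left_derived_of_adjoint:
  assumes S: "is_functor C D S" and E: "relative_functor D W C V E"
    and adj: "adjunction C D S E \<eta> e"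
    and adj': "adjunction (localization C V) (localization D W) L (localized_ftor D W C V E) \<eta>' e'"
  shows "\<exists>\<epsilon>. is_left_derived C V D W S L \<epsilon>"
proof -
  interpret E: relative_functor D W C V E by fact
  let ?C = E.D.loc and ?D = E.C.loc and ?Q = E.D.Q and ?Q' = E.C.Q
  have L: "is_functor ?C ?D L" using adj' by (simp add: adjunction_def)
  have GQ: "is_functor C ?D (comp_ftor G ?Q)" if "is_functor ?C ?D G" for G
    using that functor_far[OF that] by (simp add: is_functor_def E.D.Q_in E.D.Q_Cmp E.D.Q_Idn)
  have idf: "is_functor ?D ?D id_ftor" by (simp add: is_functor_def)
  have m1: "mates C D ?D S E \<eta> e (comp_ftor G ?Q) ?Q'" if "is_functor ?C ?D G" for G
    using E.D.C E.C.C E.C.loc adj GQ[OF that] E.C.Q_functor by (simp add: mates_def)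
  have m2: "mates ?C ?D ?D L E.locS \<eta>' e' G id_ftor" if "is_functor ?C ?D G" for G
    using E.D.loc E.C.loc adj' that idf by (simp add: mates_def)
  \<comment> \<open>A transformation defined over \<open>D\<close> is already one over its
    localization. This makes the mates for the strict adjunction comparable with those for the
    localized one.\<close>
  have loc: "natural ?D ?D (comp_ftor G E.locS) id_ftor \<mu>" if G: "is_functor ?C ?D G" and \<mu>: "natural D ?D (comp_ftor (comp_ftor G ?Q) E) ?Q' \<mu>" for G \<mu>
  proof (rule E.C.natural_localization[OF E.C.loc _ idf])
    show "is_functor ?D ?D (comp_ftor G E.locS)"
      using functor_fob[OF G] functor_far[OF G] functor_fob[OF E.S]
      by (simp add: is_functor_def functor_far[OF E.locS, simplified] functor_Cmp[OF G] functor_Cmp[OF E.locS, simplified] functor_Idn[OF G] functor_Idn[OF E.locS, simplified])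
    show "natural D ?D (comp_ftor (comp_ftor G E.locS) ?Q') (comp_ftor id_ftor ?Q') \<mu>" using \<mu> by (simp add: natural_def E.far_locS_Q)
  qed
  interpret U: mates C D ?D S E \<eta> e "comp_ftor L ?Q" ?Q' by (rule m1[OF L])
  \<comment> \<open>The universal transformation is the one whose mate under the strict adjunction
    of \<open>S\<close> and \<open>E\<close> is the counit \<open>e'\<close> of the localized
    adjunction.\<close>
  define \<epsilon> where "\<epsilon> = U.comate e'"
  have e': "natural D ?D (comp_ftor (comp_ftor L ?Q) E) ?Q' e'" using adj' by (simp add: adjunction_def natural_def E.C.Q_in flip: E.far_locS_Q)
  note \<epsilon> = U.natural_comate[OF e', folded \<epsilon>_def] and tri = U.mate_comate[OF e', folded \<epsilon>_def]
  have main: "\<exists>!\<delta>. nat_trans ?C ?D G L \<delta> \<and> (\<forall>a\<in>Ob C. Cmp ?D (fob G a) (fob L a) (fob S a) (restrict \<epsilon> (Ob C) a) (\<delta> a) = \<gamma> a)"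
    if G: "is_functor ?C ?D G" and \<gamma>': "nat_trans C ?D (comp_ftor G ?Q) (comp_ftor ?Q' S) \<gamma>" for G \<gamma>
  proof -
    have \<gamma>: "natural C ?D (comp_ftor G ?Q) (comp_ftor ?Q' S) \<gamma>" using \<gamma>' by (simp add: nat_trans_iff_natural)
    interpret M: mates C D ?D S E \<eta> e "comp_ftor G ?Q" ?Q' by (rule m1[OF G])
    interpret N: mates ?C ?D ?D L E.locS \<eta>' e' G id_ftor by (rule m2[OF G])
    let ?\<mu> = "M.mate \<gamma>" and ?\<theta> = "\<lambda>\<delta> a. Cmp ?D (fob G a) (fob L a) (fob S a) (\<epsilon> a) (\<delta> a)"
    note \<mu> = loc[OF G M.natural_mate[OF \<gamma>]]
    \<comment> \<open>As \<open>\<epsilon>\<close> has mate \<open>e'\<close>, the strict mate of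
      the composite of \<open>\<delta>\<close> with \<open>\<epsilon>\<close> is the localized mate
      of \<open>\<delta>\<close>. Factoring \<open>\<gamma>\<close> thus becomes an equation between
      mates, with the single solution \<open>N.comate ?\<mu>\<close>.\<close>
    have mate: "M.mate (?\<theta> \<delta>) d = N.mate \<delta> d" if \<delta>: "natural ?C ?D G L \<delta>" and d: "d \<in> Ob D" for \<delta> d
    proof -
      note r = functor_fob[OF G, simplified] functor_fob[OF L, simplified] functor_fob[OF S] functor_fob[OF E.S] natural_in[OF \<delta>, simplified] natural_in[OF \<epsilon>, simplified]
        E.C.Q_in U.mate_rules
      have "M.mate (?\<theta> \<delta>) d = Cmp ?D (fob G (fob E d)) (fob L (fob E d)) d (U.mate \<epsilon> d) (\<delta> (fob E d))"
        unfolding M.mate_def U.mate_def using d by (simp, intro cat_assoc[OF E.C.loc, symmetric]) (auto simp: r)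
      then show ?thesis using tri[OF d] by (simp add: N.mate_def id_ftor_simps)
    qed
    have eq: "N.comate ?\<mu> c = \<delta> c" if \<delta>: "natural ?C ?D G L \<delta>" "\<And>a. a \<in> Ob C \<Longrightarrow> ?\<theta> \<delta> a = \<gamma> a" and c: "c \<in> Ob C" for \<delta> c
    proof -
      have "N.mate \<delta> (fob L c) = ?\<mu> (fob L c)"
        using mate[OF \<delta>(1), of "fob L c", symmetric] \<delta>(2) functor_fob[OF L] functor_fob[OF E.S] c by (simp add: M.mate_def)
      then show ?thesis using N.comate_mate[of \<delta> c] \<delta>(1) c by (simp add: N.comate_def natural_def)
    qed
    have \<delta>: "natural ?C ?D G L (N.comate ?\<mu>)" using N.natural_comate[OF \<mu>] by (simp add: natural_def)
    have \<epsilon>\<delta>: "?\<theta> (N.comate ?\<mu>) c = \<gamma> c" if c: "c \<in> Ob C" for c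
    proof -
      have \<delta>Q: "natural C ?D (comp_ftor G ?Q) (comp_ftor L ?Q) (N.comate ?\<mu>)" using \<delta> by (simp add: natural_def E.D.Q_in)
      have "natural C ?D (comp_ftor G ?Q) (comp_ftor ?Q' S) (?\<theta> (N.comate ?\<mu>))"
        using natural_comp[OF E.C.loc GQ[OF G] GQ[OF L] _ \<delta>Q \<epsilon>] functor_fob[OF S] functor_far[OF S]
        by (simp add: is_functor_def E.C.Q_in E.C.Q_Cmp E.C.Q_Idn functor_Cmp[OF S] functor_Idn[OF S])
      from M.comate_mate[OF this c] M.comate_mate[OF \<gamma> c] show ?thesis
        using mate[OF \<delta>, of "fob S c"] N.mate_comate[OF \<mu>, of "fob S c"] functor_fob[OF S] c by (simp add: M.comate_def)
    qed
    show ?thesis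
    proof (rule ex1I[of _ "restrict (N.comate ?\<mu>) (Ob C)"], intro conjI ballI)
      show "nat_trans ?C ?D G L (restrict (N.comate ?\<mu>) (Ob C))" using natural_restrict[OF \<delta>] by simp
    next
      fix a assume "a \<in> Ob C" then show "Cmp ?D (fob G a) (fob L a) (fob S a) (restrict \<epsilon> (Ob C) a) (restrict (N.comate ?\<mu>) (Ob C) a) = \<gamma> a"
        using \<epsilon>\<delta> by simp
    next
      fix \<delta>' assume *: "nat_trans ?C ?D G L \<delta>' \<and> (\<forall>a\<in>Ob C. Cmp ?D (fob G a) (fob L a) (fob S a) (restrict \<epsilon> (Ob C) a) (\<delta>' a) = \<gamma> a)"
      then have "N.comate ?\<mu> c = \<delta>' c" if "c \<in> Ob C" for c using eq[of \<delta>' c] that by (simp add: nat_trans_iff_natural)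
      moreover have "\<delta>' \<in> extensional (Ob C)" using * by (simp add: nat_trans_iff_natural)
      ultimately show "\<delta>' = restrict (N.comate ?\<mu>) (Ob C)" by (intro extensionalityI[of _ "Ob C"]) auto
    qed
  qed
  show ?thesis unfolding is_left_derived_def
    by (intro exI[of _ "restrict \<epsilon> (Ob C)"] conjI L natural_restrict[OF \<epsilon>] allI impI) (rule main)
qed

section \<open>Integer linear combinations and encoded products\<close>

text \<open>Arguments with coefficient \<open>0\<close> are allowed to lie outside of the carrier.\<close>

definition lincomb :: "('v, 'x) monoid_scheme \<Rightarrow> 'i set \<Rightarrow> ('i \<Rightarrow> int) \<Rightarrow> ('i \<Rightarrow> 'v) \<Rightarrow> 'v" where
  "lincomb A S k u = finprod A (\<lambda>i. u i [^]\<^bsub>A\<^esub> k i) S"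

context comm_group
begin

lemma lincomb_term: "(k \<noteq> 0 \<Longrightarrow> x \<in> carrier G) \<Longrightarrow> x [^] (k::int) \<in> carrier G"
  by (cases "k = 0") auto

lemma lincomb_closed: "(\<And>i. i \<in> S \<Longrightarrow> k i \<noteq> 0 \<Longrightarrow> u i \<in> carrier G) \<Longrightarrow> lincomb G S k u \<in> carrier G"
  unfolding lincomb_def by (intro finprod_closed) (auto intro: lincomb_term)

lemma lincomb_cong:
  assumes "\<And>i. i \<in> S \<Longrightarrow> k i = l i" "\<And>i. i \<in> S \<Longrightarrow> l i \<noteq> 0 \<Longrightarrow> u i = v i"
    "\<And>i. i \<in> S \<Longrightarrow> l i \<noteq> 0 \<Longrightarrow> v i \<in> carrier G"
  shows "lincomb G S k u = lincomb G S l v"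
  unfolding lincomb_def
proof (rule finprod_cong')
  show "(\<lambda>i. v i [^] l i) \<in> S \<rightarrow> carrier G" using assms by (auto intro!: lincomb_term)
  fix i assume "i \<in> S" then show "u i [^] k i = v i [^] l i" by (cases "l i = 0") (auto simp: assms)
qed simp

lemma lincomb_zero: "(\<And>i. i \<in> S \<Longrightarrow> k i = 0) \<Longrightarrow> lincomb G S k u = \<one>"
  unfolding lincomb_def by (intro finprod_one_eqI) simp

lemma int_pow_one': "\<one> [^] (k::int) = \<one>"
  using int_pow_one by simp

lemma lincomb_one: "(\<And>i. i \<in> S \<Longrightarrow> k i \<noteq> 0 \<Longrightarrow> u i = \<one>) \<Longrightarrow> lincomb G S k u = \<one>"
  unfolding lincomb_def
proof (intro finprod_one_eqI)
  fix i assume "\<And>i. i \<in> S \<Longrightarrow> k i \<noteq> 0 \<Longrightarrow> u i = \<one>" "i \<in> S"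
  then show "u i [^] k i = \<one>" by (cases "k i = 0") (auto simp: int_pow_one')
qed

lemma lincomb_mult:
  assumes "\<And>i. i \<in> S \<Longrightarrow> k i \<noteq> 0 \<Longrightarrow> u i \<in> carrier G" "\<And>i. i \<in> S \<Longrightarrow> k i \<noteq> 0 \<Longrightarrow> v i \<in> carrier G"
  shows "lincomb G S k (\<lambda>i. u i \<otimes> v i) = lincomb G S k u \<otimes> lincomb G S k v"
proof -
  have "lincomb G S k u \<otimes> lincomb G S k v = finprod G (\<lambda>i. u i [^] k i \<otimes> v i [^] k i) S"
    unfolding lincomb_def using assms by (intro finprod_multf[symmetric]) (auto intro!: lincomb_term)
  also have "\<dots> = lincomb G S k (\<lambda>i. u i \<otimes> v i)" unfolding lincomb_def
  proof (rule finprod_cong')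
    show "(\<lambda>i. (u i \<otimes> v i) [^] k i) \<in> S \<rightarrow> carrier G" using assms by (auto intro!: lincomb_term)
    fix i assume "i \<in> S" then show "u i [^] k i \<otimes> v i [^] k i = (u i \<otimes> v i) [^] k i"
      by (cases "k i = 0") (auto simp: assms int_pow_distrib)
  qed simp
  finally show ?thesis by simp
qed

lemma lincomb_add:
  assumes "\<And>i. i \<in> S \<Longrightarrow> k i \<noteq> 0 \<or> l i \<noteq> 0 \<Longrightarrow> u i \<in> carrier G"
  shows "lincomb G S k u \<otimes> lincomb G S l u = lincomb G S (\<lambda>i. k i + l i) u"
proof -
  have "lincomb G S k u \<otimes> lincomb G S l u = finprod G (\<lambda>i. u i [^] k i \<otimes> u i [^] l i) S"
    unfolding lincomb_def using assms by (intro finprod_multf[symmetric]) (auto intro!: lincomb_term)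
  also have "\<dots> = lincomb G S (\<lambda>i. k i + l i) u" unfolding lincomb_def
  proof (rule finprod_cong')
    show "(\<lambda>i. u i [^] (k i + l i)) \<in> S \<rightarrow> carrier G" using assms by (auto intro!: lincomb_term)
    fix i assume "i \<in> S" then show "u i [^] k i \<otimes> u i [^] l i = u i [^] (k i + l i)"
      by (cases "k i = 0 \<and> l i = 0") (auto simp: assms int_pow_mult)
  qed simp
  finally show ?thesis .
qed

lemma lincomb_insert:
  assumes "finite S" "i \<notin> S" "\<And>j. j \<in> insert i S \<Longrightarrow> k j \<noteq> 0 \<Longrightarrow> u j \<in> carrier G"
  shows "lincomb G (insert i S) k u = u i [^] k i \<otimes> lincomb G S k u"
  unfolding lincomb_def using assms by (intro finprod_insert) (auto intro!: lincomb_term)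

lemma lincomb_pow:
  assumes "finite S" "\<And>i. i \<in> S \<Longrightarrow> k i \<noteq> 0 \<Longrightarrow> u i \<in> carrier G"
  shows "lincomb G S k u [^] (c::int) = lincomb G S (\<lambda>i. c * k i) u"
  using assms
proof (induction S rule: finite_induct)
  case empty then show ?case by (simp add: lincomb_def int_pow_one')
next
  case (insert i S)
  have t: "u i [^] k i \<in> carrier G" "lincomb G S k u \<in> carrier G" using insert.prems by (auto intro!: lincomb_term lincomb_closed)
  have "(u i [^] k i) [^] c = u i [^] (c * k i)" using insert.prems[of i] by (cases "k i = 0") (auto simp: int_pow_pow int_pow_one' mult.commute)
  moreover have "lincomb G (insert i S) (\<lambda>i. c * k i) u = u i [^] (c * k i) \<otimes> lincomb G S (\<lambda>i. c * k i) u"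
    using insert by (intro lincomb_insert) auto
  moreover have "lincomb G (insert i S) k u = u i [^] k i \<otimes> lincomb G S k u" using insert by (intro lincomb_insert) auto
  ultimately show ?case using insert t by (simp add: int_pow_distrib)
qed

text \<open>Exchange of summations: composing two families of combinations multiplies their
  coefficient matrices. In this way a matrix that squares to zero acts with square zero on
  elements.\<close>

lemma lincomb_sum:
  assumes "finite S" "finite T" "\<And>i j. i \<in> S \<Longrightarrow> j \<in> T \<Longrightarrow> k i \<noteq> 0 \<Longrightarrow> l i j \<noteq> 0 \<Longrightarrow> v j \<in> carrier G"
  shows "lincomb G S k (\<lambda>i. lincomb G T (l i) v) = lincomb G T (\<lambda>j. \<Sum>i\<in>S. k i * l i j) v"
  using assms(1,3)
proof (induction S rule: finite_induct)
  case empty then show ?case by (simp add: lincomb_zero) (simp add: lincomb_def)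
next
  case (insert i S)
  have 1: "lincomb G T (l i) v [^] k i = lincomb G T (\<lambda>j. k i * l i j) v"
    using insert.prems assms(2) by (cases "k i = 0") (auto simp: lincomb_zero intro!: lincomb_pow)
  have c: "v j \<in> carrier G" if j: "j \<in> T" and n: "k i * l i j \<noteq> 0 \<or> (\<Sum>i\<in>S. k i * l i j) \<noteq> 0" for j
  proof -
    have "\<exists>i'\<in>insert i S. k i' * l i' j \<noteq> 0" using n by (metis (mono_tags, lifting) insertCI sum.neutral)
    then show ?thesis using insert.prems j by auto
  qed
  have "lincomb G (insert i S) k (\<lambda>i. lincomb G T (l i) v) = lincomb G T (l i) v [^] k i \<otimes> lincomb G S k (\<lambda>i. lincomb G T (l i) v)"
    using insert by (intro lincomb_insert) (auto intro!: lincomb_closed)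
  also have "\<dots> = lincomb G T (\<lambda>j. k i * l i j) v \<otimes> lincomb G T (\<lambda>j. \<Sum>i\<in>S. k i * l i j) v"
  proof -
    have "lincomb G S k (\<lambda>i. lincomb G T (l i) v) = lincomb G T (\<lambda>j. \<Sum>i\<in>S. k i * l i j) v"
      by (rule insert.IH) (use insert.prems in auto)
    then show ?thesis using 1 by simp
  qed
  also have "\<dots> = lincomb G T (\<lambda>j. k i * l i j + (\<Sum>i\<in>S. k i * l i j)) v" by (rule lincomb_add) (rule c)
  finally show ?case using insert by simp
qed

lemma lincomb_single:
  assumes "finite S" "i \<in> S" "\<And>j. j \<in> S \<Longrightarrow> j \<noteq> i \<Longrightarrow> k j = 0" "k i \<noteq> 0 \<Longrightarrow> u i \<in> carrier G"
  shows "lincomb G S k u = u i [^] k i"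
proof -
  have "lincomb G (insert i (S - {i})) k u = u i [^] k i \<otimes> lincomb G (S - {i}) k u" using assms by (intro lincomb_insert) auto
  moreover have "lincomb G (S - {i}) k u = \<one>" using assms by (intro lincomb_zero) auto
  ultimately show ?thesis using assms by (simp add: insert_absorb lincomb_term)
qed

lemma lincomb_neutral:
  assumes "finite S" "T \<subseteq> S" "\<And>i. i \<in> S - T \<Longrightarrow> k i \<noteq> 0 \<Longrightarrow> u i = \<one>"
    "\<And>i. i \<in> T \<Longrightarrow> k i \<noteq> 0 \<Longrightarrow> u i \<in> carrier G"
  shows "lincomb G S k u = lincomb G T k u"
  unfolding lincomb_def
proof (rule finprod_mono_neutral_cong_right)
  show "u i [^] k i = \<one>" if "i \<in> S - T" for i using assms(3)[OF that] by (cases "k i = 0") (auto simp: int_pow_one')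
  show "(\<lambda>i. u i [^] k i) \<in> S \<rightarrow> carrier G"
  proof
    fix i assume "i \<in> S" then show "u i [^] k i \<in> carrier G" using assms(3,4)[of i] by (cases "i \<in> T") (auto intro!: lincomb_term)
  qed
qed (use assms in auto)

lemma lincomb_hom:
  assumes H: "comm_group H" and h: "h \<in> hom G H" and "finite S"
    "\<And>i. i \<in> S \<Longrightarrow> k i \<noteq> 0 \<Longrightarrow> u i \<in> carrier G"
  shows "h (lincomb G S k u) = lincomb H S k (\<lambda>i. h (u i))"
proof -
  interpret H: comm_group H by fact
  interpret h: group_hom G H h by unfold_locales (rule h)
  show ?thesis using assms(3,4)
proof (induction S rule: finite_induct)
  case empty then show ?case by (simp add: lincomb_def)
next
  case (insert i S)
  have "h (u i [^] k i) = h (u i) [^]\<^bsub>H\<^esub> k i" using insert.prems[of i] h.hom_int_pow by (cases "k i = 0") auto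
  moreover have "lincomb G (insert i S) k u = u i [^] k i \<otimes> lincomb G S k u" using insert by (intro lincomb_insert) auto
  moreover have "lincomb H (insert i S) k (\<lambda>i. h (u i)) = h (u i) [^]\<^bsub>H\<^esub> k i \<otimes>\<^bsub>H\<^esub> lincomb H S k (\<lambda>i. h (u i))"
    using insert by (intro H.lincomb_insert) (auto intro!: h.hom_closed)
  moreover have "u i [^] k i \<in> carrier G" "lincomb G S k u \<in> carrier G" using insert.prems by (auto intro!: lincomb_term lincomb_closed)
  ultimately show ?case using insert by (simp add: h.hom_mult)
qed
qed

end

section \<open>Finite products of groups inside the universe\<close>

lemma ex_inj_extensional: "finite I \<Longrightarrow> \<exists>e :: ('i \<Rightarrow> 'u::infinite) \<Rightarrow> 'u. inj_on e (extensional I)"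
proof (induction I rule: finite_induct)
  case empty then show ?case
    by (intro exI[of _ "\<lambda>_. undefined"]) (auto simp: inj_on_def extensional_def fun_eq_iff)
next
  case (insert i I)
  then obtain e :: "('i \<Rightarrow> 'u) \<Rightarrow> 'u" where e: "inj_on e (extensional I)" by blast
  \<comment> \<open>An infinite set is equipotent to its square, so one more coordinate can be
    absorbed into a single element of \<open>'u\<close>.\<close>
  have "(card_of (UNIV \<times> UNIV :: ('u \<times> 'u) set), card_of (UNIV :: 'u set)) \<in> ordIso"
    using card_of_Times_infinite[of "UNIV :: 'u set" "UNIV :: 'u set"] infinite_UNIV card_of_mono1[OF subset_refl] by auto
  then obtain j :: "'u \<times> 'u \<Rightarrow> 'u" where "bij_betw j (UNIV \<times> UNIV) UNIV" using card_of_ordIso by blast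
  then have j: "inj j" by (simp add: bij_betw_def)
  have "inj_on (\<lambda>u. j (u i, e (u(i := undefined)))) (extensional (insert i I))"
  proof (rule inj_onI)
    fix u v :: "'i \<Rightarrow> 'u" assume uv: "u \<in> extensional (insert i I)" "v \<in> extensional (insert i I)"
      and "j (u i, e (u(i := undefined))) = j (v i, e (v(i := undefined)))"
    then have *: "u i = v i" "e (u(i := undefined)) = e (v(i := undefined))" using j by (auto dest: injD)
    have "u(i := undefined) = v(i := undefined)"
    proof -
      have "u(i := undefined) \<in> extensional I" "v(i := undefined) \<in> extensional I" using uv by (auto simp: extensional_def)
      then show ?thesis using e *(2) unfolding inj_on_def by blast
    qed
    then show "u = v" using * by (metis fun_upd_triv fun_upd_upd)
  qed
  then show ?case by blast
qed

text \<open>Carriers consist of elements of \<open>'u\<close>, so a finite family of elements has to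
  be coded as one element. Any injection on extensional families will do; \<open>entry\<close>
  decodes it.\<close>

definition tuple_code :: "'i set \<Rightarrow> ('i \<Rightarrow> 'u::infinite) \<Rightarrow> 'u" where
  "tuple_code J = (SOME e. inj_on e (extensional J))"

definition tuple :: "'i set \<Rightarrow> ('i \<Rightarrow> 'u::infinite) \<Rightarrow> 'u" where
  "tuple J u = tuple_code J (restrict u J)"

definition entry :: "'i set \<Rightarrow> 'i \<Rightarrow> 'u::infinite \<Rightarrow> 'u" where
  "entry J i x = inv_into (extensional J) (tuple_code J) x i"

text \<open>The product of the groups \<open>A i\<close>, \<open>i \<in> J\<close>, with carrier inside the universe.\<close>

definition prodgroup :: "'i set \<Rightarrow> ('i \<Rightarrow> ('u::infinite) monoid) \<Rightarrow> 'u monoid" where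
  "prodgroup J A = \<lparr>carrier = tuple J ` (\<Pi> i\<in>J. carrier (A i)),
     monoid.mult = \<lambda>x y. tuple J (\<lambda>i. entry J i x \<otimes>\<^bsub>A i\<^esub> entry J i y), one = tuple J (\<lambda>i. \<one>\<^bsub>A i\<^esub>)\<rparr>"

lemma entry_tuple [simp]:
  assumes "finite J" "i \<in> J" shows "entry J i (tuple J u) = u i"
proof -
  have "inj_on (tuple_code J :: ('a \<Rightarrow> 'b) \<Rightarrow> 'b) (extensional J)" unfolding tuple_code_def
    using ex_inj_extensional[OF assms(1)] by (rule someI_ex)
  then show ?thesis using assms by (simp add: entry_def tuple_def inv_into_f_f)
qed

lemma tuple_cong: "(\<And>i. i \<in> J \<Longrightarrow> u i = v i) \<Longrightarrow> tuple J u = tuple J v"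
  unfolding tuple_def by (rule arg_cong[OF restrict_ext])

lemma tuple_closed: "(\<And>i. i \<in> J \<Longrightarrow> u i \<in> carrier (A i)) \<Longrightarrow> tuple J u \<in> carrier (prodgroup J A)"
  by (simp add: prodgroup_def)

lemma entry_closed: "finite J \<Longrightarrow> x \<in> carrier (prodgroup J A) \<Longrightarrow> i \<in> J \<Longrightarrow> entry J i x \<in> carrier (A i)"
  by (auto simp: prodgroup_def)

lemma tuple_entry: "finite J \<Longrightarrow> x \<in> carrier (prodgroup J A) \<Longrightarrow> tuple J (\<lambda>i. entry J i x) = x"
  by (auto simp: prodgroup_def intro: tuple_cong)

lemma prodgroup_eqI:
  assumes "finite J" "x \<in> carrier (prodgroup J A)" "y \<in> carrier (prodgroup J A)" "\<And>i. i \<in> J \<Longrightarrow> entry J i x = entry J i y"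
  shows "x = y"
proof -
  have "x = tuple J (\<lambda>i. entry J i x)" by (rule tuple_entry[OF assms(1,2), symmetric])
  also have "\<dots> = tuple J (\<lambda>i. entry J i y)" by (rule tuple_cong) (rule assms(4))
  also have "\<dots> = y" by (rule tuple_entry[OF assms(1,3)])
  finally show ?thesis .
qed

lemma entry_mult [simp]: "finite J \<Longrightarrow> i \<in> J \<Longrightarrow> entry J i (x \<otimes>\<^bsub>prodgroup J A\<^esub> y) = entry J i x \<otimes>\<^bsub>A i\<^esub> entry J i y"
  by (simp add: prodgroup_def)

lemma entry_one [simp]: "finite J \<Longrightarrow> i \<in> J \<Longrightarrow> entry J i \<one>\<^bsub>prodgroup J A\<^esub> = \<one>\<^bsub>A i\<^esub>"
  by (simp add: prodgroup_def)

lemma comm_group_prodgroup: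
  assumes J: "finite J" and A: "\<And>i. i \<in> J \<Longrightarrow> comm_group (A i)"
  shows "comm_group (prodgroup J A)"
proof -
  have g: "group (A i)" "monoid (A i)" "comm_monoid (A i)" if "i \<in> J" for i
    using A[OF that] by (auto simp: comm_group_def group_def)
  let ?P = "prodgroup J A"
  note e = entry_closed[OF J]
  have cl: "x \<otimes>\<^bsub>?P\<^esub> y \<in> carrier ?P" if "x \<in> carrier ?P" "y \<in> carrier ?P" for x y
  proof -
    have "tuple J (\<lambda>i. entry J i x \<otimes>\<^bsub>A i\<^esub> entry J i y) \<in> carrier ?P"
      using that e by (intro tuple_closed monoid.m_closed[OF g(2)])
    then show ?thesis by (simp add: prodgroup_def)
  qed
  have "tuple J (\<lambda>i. \<one>\<^bsub>A i\<^esub>) \<in> carrier ?P" by (intro tuple_closed monoid.one_closed[OF g(2)])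
  then have o: "\<one>\<^bsub>?P\<^esub> \<in> carrier ?P" by (simp add: prodgroup_def)
  show ?thesis
  proof (rule comm_groupI[OF cl o])
    fix x y z assume xyz: "x \<in> carrier ?P" "y \<in> carrier ?P" "z \<in> carrier ?P"
    show "x \<otimes>\<^bsub>?P\<^esub> y \<otimes>\<^bsub>?P\<^esub> z = x \<otimes>\<^bsub>?P\<^esub> (y \<otimes>\<^bsub>?P\<^esub> z)"
      by (rule prodgroup_eqI[OF J, of _ A]) (use xyz in \<open>auto simp: J cl e monoid.m_assoc[OF g(2)]\<close>)
    show "x \<otimes>\<^bsub>?P\<^esub> y = y \<otimes>\<^bsub>?P\<^esub> x"
      by (rule prodgroup_eqI[OF J, of _ A]) (use xyz in \<open>auto simp: J cl e comm_monoid.m_comm[OF g(3)]\<close>)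
    show "\<one>\<^bsub>?P\<^esub> \<otimes>\<^bsub>?P\<^esub> x = x"
      by (rule prodgroup_eqI[OF J, of _ A]) (use xyz in \<open>auto simp: J cl o e monoid.l_one[OF g(2)]\<close>)
    have t: "tuple J (\<lambda>i. inv\<^bsub>A i\<^esub> entry J i x) \<in> carrier ?P" using xyz e by (intro tuple_closed) (auto intro!: group.inv_closed[OF g(1)])
    have "tuple J (\<lambda>i. inv\<^bsub>A i\<^esub> entry J i x) \<otimes>\<^bsub>?P\<^esub> x = \<one>\<^bsub>?P\<^esub>"
      by (rule prodgroup_eqI[OF J, of _ A]) (use xyz t in \<open>auto simp: J cl o e group.l_inv[OF g(1)]\<close>)
    then show "\<exists>y\<in>carrier ?P. y \<otimes>\<^bsub>?P\<^esub> x = \<one>\<^bsub>?P\<^esub>" using t by blast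
  qed
qed

lemma entry_hom: "finite J \<Longrightarrow> i \<in> J \<Longrightarrow> entry J i \<in> hom (prodgroup J A) (A i)"
  by (auto simp: hom_def entry_closed)

lemma tuple_hom:
  assumes J: "finite J" and h: "\<And>i. i \<in> J \<Longrightarrow> h i \<in> hom B (A i)"
  shows "(\<lambda>x. tuple J (\<lambda>i. h i x)) \<in> hom B (prodgroup J A)"
proof (rule homI)
  fix x assume "x \<in> carrier B" then show "tuple J (\<lambda>i. h i x) \<in> carrier (prodgroup J A)"
    using h by (intro tuple_closed) (auto simp: hom_def)
next
  fix x y assume "x \<in> carrier B" "y \<in> carrier B"
  then show "tuple J (\<lambda>i. h i (x \<otimes>\<^bsub>B\<^esub> y)) = tuple J (\<lambda>i. h i x) \<otimes>\<^bsub>prodgroup J A\<^esub> tuple J (\<lambda>i. h i y)"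
    using h J by (auto simp: prodgroup_def hom_def intro!: tuple_cong)
qed

definition inclusion :: "'i set \<Rightarrow> ('i \<Rightarrow> ('u::infinite) monoid) \<Rightarrow> 'i \<Rightarrow> 'u \<Rightarrow> 'u" where
  "inclusion J A i x = tuple J (\<lambda>j. if j = i then x else \<one>\<^bsub>A j\<^esub>)"

lemma inclusion_hom:
  assumes J: "finite J" and A: "\<And>i. i \<in> J \<Longrightarrow> comm_group (A i)"
  shows "inclusion J A i \<in> hom (A i) (prodgroup J A)"
  unfolding inclusion_def
proof (rule tuple_hom[OF J])
  fix j assume "j \<in> J"
  then have "comm_group (A j)" using A by simp
  then have "monoid (A j)" by (simp add: comm_group_def group_def)
  then show "(\<lambda>x. if j = i then x else \<one>\<^bsub>A j\<^esub>) \<in> hom (A i) (A j)"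
    by (auto intro!: homI simp: monoid.one_closed monoid.l_one)
qed

text \<open>Compared entry by entry, only the summand with the right index survives. It makes the
  product serve as a direct sum as well: homomorphisms out of it are determined on the images of the
  inclusions (\<open>prodgroup_hom_eqI\<close>).\<close>

lemma lincomb_inclusion:
  fixes A :: "'i \<Rightarrow> ('u::infinite) monoid"
  assumes J: "finite J" and A: "\<And>i. i \<in> J \<Longrightarrow> comm_group (A i)" and x: "x \<in> carrier (prodgroup J A)"
  shows "lincomb (prodgroup J A) J (\<lambda>_. 1) (\<lambda>i. inclusion J A i (entry J i x)) = x"
proof -
  interpret P: comm_group "prodgroup J A" by (rule comm_group_prodgroup[OF J A])
  have c: "inclusion J A i (entry J i x) \<in> carrier (prodgroup J A)" if "i \<in> J" for i
    using inclusion_hom[of J A i, OF J A] entry_closed[OF J x that] by (auto simp: hom_def)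
  show ?thesis
  proof (rule prodgroup_eqI[OF J _ x])
    show "lincomb (prodgroup J A) J (\<lambda>_. 1) (\<lambda>i. inclusion J A i (entry J i x)) \<in> carrier (prodgroup J A)"
      by (rule P.lincomb_closed) (rule c)
    fix j assume j: "j \<in> J"
    then interpret Aj: comm_group "A j" using A by simp
    have "entry J j (lincomb (prodgroup J A) J (\<lambda>_. 1) (\<lambda>i. inclusion J A i (entry J i x)))
      = lincomb (A j) J (\<lambda>_. 1) (\<lambda>i. entry J j (inclusion J A i (entry J i x)))"
      by (rule P.lincomb_hom[OF Aj.comm_group_axioms entry_hom[OF J j] J c])
    also have "\<dots> = lincomb (A j) J (\<lambda>i. if i = j then 1 else 0) (\<lambda>_. entry J j x)"
      unfolding lincomb_def
      by (rule Aj.finprod_cong') (use j J x in \<open>auto simp: inclusion_def Aj.int_pow_one' entry_closed\<close>)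
    also have "\<dots> = entry J j x" using Aj.lincomb_single[OF J j, of "\<lambda>i. if i = j then 1 else 0"] entry_closed[OF J x j] by simp
    finally show "entry J j (lincomb (prodgroup J A) J (\<lambda>_. 1) (\<lambda>i. inclusion J A i (entry J i x))) = entry J j x" .
  qed
qed

text \<open>The universal map out of the finite product, read as a direct sum.\<close>

definition copair :: "'i set \<Rightarrow> ('v, 'x) monoid_scheme \<Rightarrow> ('i \<Rightarrow> 'u::infinite \<Rightarrow> 'v) \<Rightarrow> 'u \<Rightarrow> 'v" where
  "copair J B \<kappa> x = lincomb B J (\<lambda>_. 1) (\<lambda>i. \<kappa> i (entry J i x))"

context
  fixes J :: "'i set" and A :: "'i \<Rightarrow> ('u::infinite) monoid" and B :: "('v, 'x) monoid_scheme"
  assumes J: "finite J" and A: "\<And>i. i \<in> J \<Longrightarrow> comm_group (A i)" and B: "comm_group B"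
begin

interpretation B: comm_group B by (rule B)

lemma copair_hom:
  assumes \<kappa>: "\<And>i. i \<in> J \<Longrightarrow> \<kappa> i \<in> hom (A i) B"
  shows "copair J B \<kappa> \<in> hom (prodgroup J A) B"
proof -
  have c: "\<kappa> i (entry J i x) \<in> carrier B" if "i \<in> J" "x \<in> carrier (prodgroup J A)" for i x
    using hom_in_carrier[OF \<kappa>[OF that(1)] entry_closed[OF J that(2,1)]] .
  show ?thesis
  proof (rule homI)
    show "copair J B \<kappa> x \<in> carrier B" if "x \<in> carrier (prodgroup J A)" for x
      unfolding copair_def by (rule B.lincomb_closed) (use c that in auto)
    fix x y assume xy: "x \<in> carrier (prodgroup J A)" "y \<in> carrier (prodgroup J A)"
    have "copair J B \<kappa> (x \<otimes>\<^bsub>prodgroup J A\<^esub> y) = lincomb B J (\<lambda>_. 1) (\<lambda>i. \<kappa> i (entry J i x) \<otimes>\<^bsub>B\<^esub> \<kappa> i (entry J i y))"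
      unfolding copair_def
    proof (rule B.lincomb_cong)
      fix i assume i: "i \<in> J"
      show "\<kappa> i (entry J i (x \<otimes>\<^bsub>prodgroup J A\<^esub> y)) = \<kappa> i (entry J i x) \<otimes>\<^bsub>B\<^esub> \<kappa> i (entry J i y)"
        using hom_mult[OF \<kappa>[OF i] entry_closed[OF J xy(1) i] entry_closed[OF J xy(2) i]] J i by simp
      show "\<kappa> i (entry J i x) \<otimes>\<^bsub>B\<^esub> \<kappa> i (entry J i y) \<in> carrier B" using c[OF i] xy by simp
    qed simp
    also have "\<dots> = copair J B \<kappa> x \<otimes>\<^bsub>B\<^esub> copair J B \<kappa> y"
      unfolding copair_def by (rule B.lincomb_mult) (use c xy in auto)
    finally show "copair J B \<kappa> (x \<otimes>\<^bsub>prodgroup J A\<^esub> y) = copair J B \<kappa> x \<otimes>\<^bsub>B\<^esub> copair J B \<kappa> y" .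
  qed
qed

lemma copair_inclusion:
  assumes \<kappa>: "\<And>i. i \<in> J \<Longrightarrow> \<kappa> i \<in> hom (A i) B" and i: "i \<in> J" "x \<in> carrier (A i)"
  shows "copair J B \<kappa> (inclusion J A i x) = \<kappa> i x"
proof -
  have e: "\<kappa> j (entry J j (inclusion J A i x)) = (if j = i then \<kappa> i x else \<one>\<^bsub>B\<^esub>)" if j: "j \<in> J" for j
    using hom_one[OF \<kappa>[OF j]] A[OF j] B.is_group J j by (auto simp: inclusion_def comm_group_def)
  have k: "\<kappa> i x \<in> carrier B" by (rule hom_in_carrier[OF \<kappa>[OF i(1)] i(2)])
  have "copair J B \<kappa> (inclusion J A i x) = lincomb B J (\<lambda>_. 1) (\<lambda>j. if j = i then \<kappa> i x else \<one>\<^bsub>B\<^esub>)"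
    unfolding copair_def by (rule B.lincomb_cong) (use e k in auto)
  also have "\<dots> = lincomb B {i} (\<lambda>_. 1) (\<lambda>j. if j = i then \<kappa> i x else \<one>\<^bsub>B\<^esub>)"
    by (rule B.lincomb_neutral[OF J]) (use i k in auto)
  also have "\<dots> = \<kappa> i x" using B.lincomb_single[of "{i}" i "\<lambda>_. 1" "\<lambda>_. \<kappa> i x"] k by (simp add: lincomb_def)
  finally show ?thesis .
qed

lemma prodgroup_hom_eqI:
  assumes h: "h \<in> hom (prodgroup J A) B" "h' \<in> hom (prodgroup J A) B"
    and eq: "\<And>i x. i \<in> J \<Longrightarrow> x \<in> carrier (A i) \<Longrightarrow> h (inclusion J A i x) = h' (inclusion J A i x)"
    and x: "x \<in> carrier (prodgroup J A)"
  shows "h x = h' x"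
proof -
  interpret P: comm_group "prodgroup J A" by (rule comm_group_prodgroup[OF J A])
  have c: "inclusion J A i (entry J i x) \<in> carrier (prodgroup J A)" if "i \<in> J" for i
    using hom_in_carrier[OF inclusion_hom[of J A, OF J A] entry_closed[OF J x that]] that by blast
  have l: "g x = lincomb B J (\<lambda>_. 1) (\<lambda>i. g (inclusion J A i (entry J i x)))" if g: "g \<in> hom (prodgroup J A) B" for g
    using P.lincomb_hom[OF B g J, of "\<lambda>_. 1" "\<lambda>i. inclusion J A i (entry J i x)"] c lincomb_inclusion[of J A, OF J A x] by simp
  show ?thesis unfolding l[OF h(1)] l[OF h(2)]
    by (rule B.lincomb_cong) (use eq entry_closed[OF J x] hom_in_carrier[OF h(2) c] in auto)
qed

end

section \<open>Complexes of abelian data, elementwise\<close>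

text \<open>Pointwise inverses are homomorphisms and commute with restrictions, both by injectivity
  of \<open>\<phi>\<close>. Hence quasi-isomorphisms can be tested on stalks.\<close>

lemma is_iso_abdata_iff:
  assumes F: "abelian_data X F" and G: "abelian_data X G" and \<phi>: "\<phi> \<in> Hom (abdata_cat X) F G"
  shows "is_iso (abdata_cat X) F G \<phi> \<longleftrightarrow> (\<forall>p\<in>topspace X. bij_betw (\<phi> p) (carrier (stalk F p)) (carrier (stalk G p)))"
proof
  assume "is_iso (abdata_cat X) F G \<phi>"
  then obtain \<psi> where \<psi>: "\<psi> \<in> Hom (abdata_cat X) G F" "Cmp (abdata_cat X) F G F \<psi> \<phi> = Idn (abdata_cat X) F"
    "Cmp (abdata_cat X) G F G \<phi> \<psi> = Idn (abdata_cat X) G" by (auto simp: is_iso_def)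
  show "\<forall>p\<in>topspace X. bij_betw (\<phi> p) (carrier (stalk F p)) (carrier (stalk G p))"
  proof
    fix p assume p: "p \<in> topspace X"
    have "\<psi> p (\<phi> p x) = x" if "x \<in> carrier (stalk F p)" for x
      using fun_cong[OF fun_cong[OF \<psi>(2), of p], of x] p that by (simp add: abdata_cat_def compose_def)
    moreover have "\<phi> p (\<psi> p x) = x" if "x \<in> carrier (stalk G p)" for x
      using fun_cong[OF fun_cong[OF \<psi>(3), of p], of x] p that by (simp add: abdata_cat_def compose_def)
    ultimately show "bij_betw (\<phi> p) (carrier (stalk F p)) (carrier (stalk G p))"
      using \<phi> \<psi>(1) p by (intro bij_betw_byWitness[of _ "\<psi> p"]) (auto simp: Hom_abdata_cat_iff ghom_iff)
  qed
next
  assume b: "\<forall>p\<in>topspace X. bij_betw (\<phi> p) (carrier (stalk F p)) (carrier (stalk G p))"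
  define \<psi> where "\<psi> = (\<lambda>p\<in>topspace X. \<lambda>y\<in>carrier (stalk G p). inv_into (carrier (stalk F p)) (\<phi> p) y)"
  have gF: "comm_group (stalk F p)" and gG: "comm_group (stalk G p)" if "p \<in> topspace X" for p
    using F G that by (auto simp: abelian_data_def)
  have 1: "\<psi> p y \<in> carrier (stalk F p)" "\<phi> p (\<psi> p y) = y" if "p \<in> topspace X" "y \<in> carrier (stalk G p)" for p y
    using b that by (auto simp: \<psi>_def bij_betw_def inv_into_into f_inv_into_f)
  have 2: "\<psi> p (\<phi> p x) = x" if "p \<in> topspace X" "x \<in> carrier (stalk F p)" for p x
    using b that by (auto simp: \<psi>_def bij_betw_def inv_into_f_f)
  have inj: "x = y" if "p \<in> topspace X" "x \<in> carrier (stalk F p)" "y \<in> carrier (stalk F p)" "\<phi> p x = \<phi> p y" for p x y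
    using b that by (auto simp: bij_betw_def inj_on_def)
  have \<phi>h: "\<phi> p (x \<otimes>\<^bsub>stalk F p\<^esub> y) = \<phi> p x \<otimes>\<^bsub>stalk G p\<^esub> \<phi> p y" if "p \<in> topspace X" "x \<in> carrier (stalk F p)" "y \<in> carrier (stalk F p)" for p x y
    using \<phi> that by (auto simp: Hom_abdata_cat_iff ghom_iff)
  have \<phi>r: "res G p q (\<phi> p x) = \<phi> q (res F p q x)" if "spec_le X p q" "x \<in> carrier (stalk F p)" for p q x
    using \<phi> that by (auto simp: Hom_abdata_cat_iff)
  have rc: "res F p q x \<in> carrier (stalk F q)" if "spec_le X p q" "x \<in> carrier (stalk F p)" for p q x
    using F that by (auto simp: abelian_data_def ghom_iff)
  have rc': "res G p q x \<in> carrier (stalk G q)" if "spec_le X p q" "x \<in> carrier (stalk G p)" for p q x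
    using G that by (auto simp: abelian_data_def ghom_iff)
  have mF: "x \<otimes>\<^bsub>stalk F p\<^esub> y \<in> carrier (stalk F p)" if "p \<in> topspace X" "x \<in> carrier (stalk F p)" "y \<in> carrier (stalk F p)" for p x y
    using gF[OF that(1)] that by (simp add: comm_group_def comm_monoid_def monoid.m_closed)
  have mG: "x \<otimes>\<^bsub>stalk G p\<^esub> y \<in> carrier (stalk G p)" if "p \<in> topspace X" "x \<in> carrier (stalk G p)" "y \<in> carrier (stalk G p)" for p x y
    using gG[OF that(1)] that by (simp add: comm_group_def comm_monoid_def monoid.m_closed)
  have ext: "\<psi> \<in> extensional (topspace X)" "\<psi> p \<in> extensional (carrier (stalk G p))" if "p \<in> topspace X" for p
    using that by (simp_all add: \<psi>_def)
  have "\<psi> \<in> Hom (abdata_cat X) G F" unfolding Hom_abdata_cat_iff ghom_iff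
  proof (intro conjI ballI allI impI)
    show "\<psi> \<in> extensional (topspace X)" by (simp add: \<psi>_def)
  next
    fix p assume "p \<in> topspace X" then show "\<psi> p \<in> extensional (carrier (stalk G p))" by (rule ext)
  next
    fix p x assume "p \<in> topspace X" "x \<in> carrier (stalk G p)" then show "\<psi> p x \<in> carrier (stalk F p)" by (rule 1)
  next
    fix p x y assume *: "p \<in> topspace X" "x \<in> carrier (stalk G p)" "y \<in> carrier (stalk G p)"
    show "\<psi> p (x \<otimes>\<^bsub>stalk G p\<^esub> y) = \<psi> p x \<otimes>\<^bsub>stalk F p\<^esub> \<psi> p y"
    proof (rule inj[OF *(1)])
      show "\<phi> p (\<psi> p (x \<otimes>\<^bsub>stalk G p\<^esub> y)) = \<phi> p (\<psi> p x \<otimes>\<^bsub>stalk F p\<^esub> \<psi> p y)"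
        using \<phi>h[OF *(1) 1(1)[OF *(1,2)] 1(1)[OF *(1,3)]] 1(2)[OF *(1,2)] 1(2)[OF *(1,3)] 1(2)[OF *(1) mG[OF *]] by simp
    qed (intro * 1(1) mF mG)+
  next
    fix p q x assume *: "spec_le X p q" "x \<in> carrier (stalk G p)"
    then have pq: "p \<in> topspace X" "q \<in> topspace X" by (auto dest: spec_leD)
    show "res F p q (\<psi> p x) = \<psi> q (res G p q x)"
    proof (rule inj[OF pq(2)])
      show "\<phi> q (res F p q (\<psi> p x)) = \<phi> q (\<psi> q (res G p q x))"
        using \<phi>r[OF *(1) 1(1)[OF pq(1) *(2)]] 1(2)[OF pq(1) *(2)] 1(2)[OF pq(2) rc'[OF *]] by simp
    qed (intro * pq 1(1) rc rc')+
  qed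
  moreover have "Cmp (abdata_cat X) F G F \<psi> \<phi> = Idn (abdata_cat X) F" "Cmp (abdata_cat X) G F G \<phi> \<psi> = Idn (abdata_cat X) G"
    using 1 2 by (auto simp: abdata_cat_def compose_def fun_eq_iff restrict_def)
  ultimately show "is_iso (abdata_cat X) F G \<phi>" using \<phi> by (auto simp: is_iso_def)
qed

section \<open>Complexes and chain maps in terms of elements\<close>

abbreviation grp :: "('a, 'u) cochain \<Rightarrow> int \<Rightarrow> 'a \<Rightarrow> 'u monoid" where
  "grp K n p \<equiv> stalk (cterm K n) p"

abbreviation rst :: "('a, 'u) cochain \<Rightarrow> int \<Rightarrow> 'a \<Rightarrow> 'a \<Rightarrow> 'u \<Rightarrow> 'u" where
  "rst K n p q \<equiv> res (cterm K n) p q"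

lemma complexI:
  assumes "\<And>n p. p \<in> topspace X \<Longrightarrow> comm_group (grp K n p)"
    and "\<And>n p q. spec_le X p q \<Longrightarrow> rst K n p q \<in> ghom (grp K n p) (grp K n q)"
    and "\<And>n p x. p \<in> topspace X \<Longrightarrow> x \<in> carrier (grp K n p) \<Longrightarrow> rst K n p p x = x"
    and "\<And>n p q r x. spec_le X p q \<Longrightarrow> spec_le X q r \<Longrightarrow> x \<in> carrier (grp K n p) \<Longrightarrow> rst K n p r x = rst K n q r (rst K n p q x)"
    and "\<And>n. cdiff K n \<in> extensional (topspace X)"
    and "\<And>n p. p \<in> topspace X \<Longrightarrow> cdiff K n p \<in> ghom (grp K n p) (grp K (n + 1) p)"
    and "\<And>n p q x. spec_le X p q \<Longrightarrow> x \<in> carrier (grp K n p) \<Longrightarrow> rst K (n + 1) p q (cdiff K n p x) = cdiff K n q (rst K n p q x)"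
    and "\<And>n p x. p \<in> topspace X \<Longrightarrow> x \<in> carrier (grp K n p) \<Longrightarrow> cdiff K (n + 1) p (cdiff K n p x) = \<one>\<^bsub>grp K (n + 1 + 1) p\<^esub>"
  shows "K \<in> Ob (complex_cat X)"
proof -
  have "abelian_data X (cterm K n)" for n unfolding abelian_data_def
  proof (intro conjI ballI allI impI assms(1,2))
    fix p assume p: "p \<in> topspace X"
    show "rst K n p p = (\<lambda>x\<in>carrier (grp K n p). x)"
      using assms(2)[OF spec_le_refl[OF p], of n] assms(3)[OF p]
      by (intro extensionalityI[of _ "carrier (grp K n p)"]) (auto simp: ghom_iff)
  next
    fix p q r assume pq: "spec_le X p q" "spec_le X q r"
    then have "spec_le X p r" by (auto simp: spec_le_def)
    then show "rst K n p r = compose (carrier (grp K n p)) (rst K n q r) (rst K n p q)"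
      using assms(2)[of p r n] assms(4)[OF pq]
      by (intro extensionalityI[of _ "carrier (grp K n p)"]) (auto simp: ghom_iff compose_def)
  qed
  moreover have "cdiff K n \<in> Hom (abdata_cat X) (cterm K n) (cterm K (n + 1))" for n
    unfolding Hom_abdata_cat_iff using assms by blast
  moreover have "Cmp (abdata_cat X) (cterm K n) (cterm K (n + 1)) (cterm K (n + 1 + 1))
           (cdiff K (n + 1)) (cdiff K n) = zero_mor X (cterm K n) (cterm K (n + 1 + 1))" for n
    using assms(8) by (auto simp: abdata_cat_def zero_mor_def compose_def restrict_def fun_eq_iff)
  ultimately show ?thesis by (simp add: complex_cat_def abdata_cat_def)
qed

context
  fixes X :: "'a topology" and K :: "('a, 'u) cochain"
  assumes K: "K \<in> Ob (complex_cat X)"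
begin

lemma complex_cterm: "abelian_data X (cterm K n)"
  using K by (simp add: complex_cat_def abdata_cat_def)

lemma complex_cdiff: "cdiff K n \<in> Hom (abdata_cat X) (cterm K n) (cterm K (n + 1))"
  using K by (simp add: complex_cat_def)

lemma complex_grp: "p \<in> topspace X \<Longrightarrow> comm_group (grp K n p)"
  using complex_cterm[of n] by (simp add: abelian_data_def)

lemma complex_rst: "spec_le X p q \<Longrightarrow> rst K n p q \<in> ghom (grp K n p) (grp K n q)"
  using complex_cterm[of n] by (simp add: abelian_data_def)

lemma complex_rst_hom: "spec_le X p q \<Longrightarrow> rst K n p q \<in> hom (grp K n p) (grp K n q)"
  using complex_rst by (simp add: ghom_def)

lemma complex_rst_closed: "spec_le X p q \<Longrightarrow> x \<in> carrier (grp K n p) \<Longrightarrow> rst K n p q x \<in> carrier (grp K n q)"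
  using complex_rst by (simp add: ghom_iff)

lemma complex_rst_refl: "p \<in> topspace X \<Longrightarrow> x \<in> carrier (grp K n p) \<Longrightarrow> rst K n p p x = x"
  using complex_cterm[of n] by (simp add: abelian_data_def)

lemma complex_rst_rst: "spec_le X p q \<Longrightarrow> spec_le X q r \<Longrightarrow> x \<in> carrier (grp K n p) \<Longrightarrow>
    rst K n q r (rst K n p q x) = rst K n p r x"
  using complex_cterm[of n] by (simp add: abelian_data_def compose_def)

lemma complex_cdiff_ghom: "p \<in> topspace X \<Longrightarrow> cdiff K n p \<in> ghom (grp K n p) (grp K (n + 1) p)"
  using complex_cdiff[of n] by (simp add: Hom_abdata_cat_iff)

lemma complex_cdiff_hom: "p \<in> topspace X \<Longrightarrow> cdiff K n p \<in> hom (grp K n p) (grp K (n + 1) p)"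
  using complex_cdiff_ghom by (simp add: ghom_def)

lemma complex_cdiff_closed: "p \<in> topspace X \<Longrightarrow> x \<in> carrier (grp K n p) \<Longrightarrow> cdiff K n p x \<in> carrier (grp K (n + 1) p)"
  using complex_cdiff_ghom by (simp add: ghom_iff)

lemma complex_one_closed: "p \<in> topspace X \<Longrightarrow> \<one>\<^bsub>grp K n p\<^esub> \<in> carrier (grp K n p)"
  using complex_grp by (simp add: comm_group_def group.is_monoid monoid.one_closed)

lemma complex_rst_one: "spec_le X p q \<Longrightarrow> rst K n p q \<one>\<^bsub>grp K n p\<^esub> = \<one>\<^bsub>grp K n q\<^esub>"
  using complex_rst_hom complex_grp by (intro hom_one) (auto simp: comm_group_def dest: spec_leD)

lemma complex_cdiff_one: "p \<in> topspace X \<Longrightarrow> cdiff K n p \<one>\<^bsub>grp K n p\<^esub> = \<one>\<^bsub>grp K (n + 1) p\<^esub>"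
  using complex_cdiff_hom complex_grp by (intro hom_one) (auto simp: comm_group_def)

lemma complex_rst_cdiff: "spec_le X p q \<Longrightarrow> x \<in> carrier (grp K n p) \<Longrightarrow>
    rst K (n + 1) p q (cdiff K n p x) = cdiff K n q (rst K n p q x)"
  using complex_cdiff[of n] by (simp add: Hom_abdata_cat_iff)

lemma complex_cdiff_cdiff:
  assumes "p \<in> topspace X" "x \<in> carrier (grp K n p)"
  shows "cdiff K (n + 1) p (cdiff K n p x) = \<one>\<^bsub>grp K (n + 1 + 1) p\<^esub>"
proof -
  have "Cmp (abdata_cat X) (cterm K n) (cterm K (n + 1)) (cterm K (n + 1 + 1))
           (cdiff K (n + 1)) (cdiff K n) = zero_mor X (cterm K n) (cterm K (n + 1 + 1))"
    using K by (simp add: complex_cat_def)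
  from fun_cong[OF fun_cong[OF this, of p], of x] show ?thesis
    using assms by (simp add: abdata_cat_def zero_mor_def compose_def)
qed

end

lemma complex_Hom_iff:
  "\<phi> \<in> Hom (complex_cat X) K L \<longleftrightarrow> (\<forall>n. \<phi> n \<in> Hom (abdata_cat X) (cterm K n) (cterm L n) \<and>
     (\<forall>p\<in>topspace X. \<forall>x\<in>carrier (grp K n p). cdiff L n p (\<phi> n p x) = \<phi> (n + 1) p (cdiff K n p x)))"
  by (auto simp: complex_cat_def abdata_cat_def compose_def restrict_def fun_eq_iff)

lemma complex_HomI:
  assumes "\<And>n. \<phi> n \<in> extensional (topspace X)"
    and "\<And>n p. p \<in> topspace X \<Longrightarrow> \<phi> n p \<in> ghom (grp K n p) (grp L n p)"
    and "\<And>n p q x. spec_le X p q \<Longrightarrow> x \<in> carrier (grp K n p) \<Longrightarrow> rst L n p q (\<phi> n p x) = \<phi> n q (rst K n p q x)"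
    and "\<And>n p x. p \<in> topspace X \<Longrightarrow> x \<in> carrier (grp K n p) \<Longrightarrow> cdiff L n p (\<phi> n p x) = \<phi> (n + 1) p (cdiff K n p x)"
  shows "\<phi> \<in> Hom (complex_cat X) K L"
  using assms unfolding complex_Hom_iff Hom_abdata_cat_iff by blast

context
  fixes X :: "'a topology" and K L :: "('a, 'u) cochain" and \<phi>
  assumes \<phi>: "\<phi> \<in> Hom (complex_cat X) K L"
begin

lemma mor_abdata: "\<phi> n \<in> Hom (abdata_cat X) (cterm K n) (cterm L n)"
  using \<phi> by (simp add: complex_Hom_iff)

lemma mor_ext: "\<phi> n \<in> extensional (topspace X)"
  using mor_abdata[of n] by (simp add: Hom_abdata_cat_iff)

lemma mor_ghom: "p \<in> topspace X \<Longrightarrow> \<phi> n p \<in> ghom (grp K n p) (grp L n p)"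
  using mor_abdata[of n] by (simp add: Hom_abdata_cat_iff)

lemma mor_hom: "p \<in> topspace X \<Longrightarrow> \<phi> n p \<in> hom (grp K n p) (grp L n p)"
  using mor_ghom by (simp add: ghom_def)

lemma mor_closed: "p \<in> topspace X \<Longrightarrow> x \<in> carrier (grp K n p) \<Longrightarrow> \<phi> n p x \<in> carrier (grp L n p)"
  using mor_ghom by (simp add: ghom_iff)

lemma mor_rst: "spec_le X p q \<Longrightarrow> x \<in> carrier (grp K n p) \<Longrightarrow> rst L n p q (\<phi> n p x) = \<phi> n q (rst K n p q x)"
  using mor_abdata[of n] by (simp add: Hom_abdata_cat_iff)

lemma mor_cdiff: "p \<in> topspace X \<Longrightarrow> x \<in> carrier (grp K n p) \<Longrightarrow> cdiff L n p (\<phi> n p x) = \<phi> (n + 1) p (cdiff K n p x)"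
  using \<phi> by (simp add: complex_Hom_iff)

end

lemma mor_one: "K \<in> Ob (complex_cat X) \<Longrightarrow> L \<in> Ob (complex_cat X) \<Longrightarrow> \<phi> \<in> Hom (complex_cat X) K L \<Longrightarrow> p \<in> topspace X \<Longrightarrow>
    \<phi> n p \<one>\<^bsub>grp K n p\<^esub> = \<one>\<^bsub>grp L n p\<^esub>"
  using mor_hom[of \<phi> X K L p n] complex_grp[of K X p n] complex_grp[of L X p n] by (intro hom_one) (auto simp: comm_group_def)

lemma complex_mor_eqI:
  assumes "\<phi> \<in> Hom (complex_cat X) K L" "\<psi> \<in> Hom (complex_cat X) K L"
    "\<And>n p x. p \<in> topspace X \<Longrightarrow> x \<in> carrier (grp K n p) \<Longrightarrow> \<phi> n p x = \<psi> n p x"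
  shows "\<phi> = \<psi>"
proof (intro ext)
  fix n p x
  show "\<phi> n p x = \<psi> n p x"
    using assms(3)[of p x n] mor_ext[OF assms(1), of n] mor_ext[OF assms(2), of n]
      mor_ghom[OF assms(1), of p n] mor_ghom[OF assms(2), of p n]
    by (cases "p \<in> topspace X"; cases "x \<in> carrier (grp K n p)") (auto simp: extensional_def ghom_def)
qed

lemma complex_Cmp_app [simp]: "p \<in> topspace X \<Longrightarrow> x \<in> carrier (grp K n p) \<Longrightarrow>
    Cmp (complex_cat X) K L M \<psi> \<phi> n p x = \<psi> n p (\<phi> n p x)"
  by (simp add: complex_cat_def abdata_cat_def compose_def)

lemma complex_Idn_app [simp]: "p \<in> topspace X \<Longrightarrow> x \<in> carrier (grp K n p) \<Longrightarrow> Idn (complex_cat X) K n p x = x"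
  by (simp add: complex_cat_def abdata_cat_def)

text \<open>
  Acyclicity of the mapping cone of \<open>\<phi> : K \<rightarrow> L\<close>, stated with \<open>n + 1\<close> and \<open>n + 1 + 1\<close> in order to
  avoid differences of degrees.
\<close>

definition cone_acyclic ::
  "(int \<Rightarrow> 'u monoid) \<Rightarrow> (int \<Rightarrow> 'u \<Rightarrow> 'u) \<Rightarrow> (int \<Rightarrow> 'v monoid) \<Rightarrow> (int \<Rightarrow> 'v \<Rightarrow> 'v) \<Rightarrow> (int \<Rightarrow> 'u \<Rightarrow> 'v) \<Rightarrow> bool" where
  "cone_acyclic K d L d' \<phi> \<longleftrightarrow> (\<forall>n. \<forall>k\<in>carrier (K (n + 1 + 1)). \<forall>l\<in>carrier (L (n + 1)).
     d (n + 1 + 1) k = \<one>\<^bsub>K (n + 1 + 1 + 1)\<^esub> \<longrightarrow> \<phi> (n + 1 + 1) k = d' (n + 1) l \<longrightarrow>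
     (\<exists>k'\<in>carrier (K (n + 1)). \<exists>l'\<in>carrier (L n). d (n + 1) k' = k \<and> l = \<phi> (n + 1) k' \<otimes>\<^bsub>L (n + 1)\<^esub> d' n l'))"

lemma coboundaries_Suc: "coboundaries K (n + 1) p = cdiff K n p ` carrier (grp K n p)"
  by (simp add: coboundaries_def)

lemma cohomology_mor_val:
  assumes K: "K \<in> Ob (complex_cat X)" and L: "L \<in> Ob (complex_cat X)" and \<phi>: "\<phi> \<in> Hom (complex_cat X) K L"
    and p: "p \<in> topspace X"
  shows "\<phi> n p ` cocycles K n p \<subseteq> cocycles L n p" "\<phi> n p ` coboundaries K n p \<subseteq> coboundaries L n p"
    "x \<in> cocycles K n p \<Longrightarrow> cohomology_mor X K L n \<phi> p (coboundaries K n p #>\<^bsub>grp K n p\<^esub> x) = coboundaries L n p #>\<^bsub>grp L n p\<^esub> \<phi> n p x"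
proof -
  have one: "\<phi> m p \<one>\<^bsub>grp K m p\<^esub> = \<one>\<^bsub>grp L m p\<^esub>" for m
    using hom_one[OF mor_hom[OF \<phi> p, of m]] complex_grp[OF K p, of m] complex_grp[OF L p, of m] by (simp add: comm_group_def)
  show Z: "\<phi> n p ` cocycles K n p \<subseteq> cocycles L n p"
    using mor_closed[OF \<phi> p] mor_cdiff[OF \<phi> p] by (auto simp: cocycles_def kernel_def one)
  have "\<phi> n p (cdiff K (n - 1) p x) = cdiff L (n - 1) p (\<phi> (n - 1) p x)" if "x \<in> carrier (grp K (n - 1) p)" for x
    using mor_cdiff[OF \<phi> p that] by simp
  then show B: "\<phi> n p ` coboundaries K n p \<subseteq> coboundaries L n p" using mor_closed[OF \<phi> p] by (auto simp: coboundaries_def)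
  note f = cohomology_subgroups[OF K p, of n] and f' = cohomology_subgroups[OF L p, of n]
  assume x: "x \<in> cocycles K n p"
  show "cohomology_mor X K L n \<phi> p (coboundaries K n p #>\<^bsub>grp K n p\<^esub> x) = coboundaries L n p #>\<^bsub>grp L n p\<^esub> \<phi> n p x"
    unfolding cohomology_mor_def cohomology_group_def using p
      coset_map_val[OF f(1) f'(1) f(2,3,4) f'(2,3,4) mor_hom[OF \<phi> p] Z B x] by simp
qed

lemma cohomology_mor_in:
  assumes K: "K \<in> Ob (complex_cat X)" and L: "L \<in> Ob (complex_cat X)" and \<phi>: "\<phi> \<in> Hom (complex_cat X) K L"
  shows "cohomology_mor X K L n \<phi> \<in> Hom (abdata_cat X) (cohomology K n) (cohomology L n)"
  unfolding Hom_abdata_cat_iff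
proof (intro conjI ballI allI impI)
  show "cohomology_mor X K L n \<phi> \<in> extensional (topspace X)" by (simp add: cohomology_mor_def)
next
  fix p assume p: "p \<in> topspace X"
  note f = cohomology_subgroups[OF K p, of n] and f' = cohomology_subgroups[OF L p, of n]
  show "cohomology_mor X K L n \<phi> p \<in> ghom (stalk (cohomology K n) p) (stalk (cohomology L n) p)"
    using p coset_map_ghom[OF f(1) f'(1) f(2,3,4) f'(2,3,4) mor_hom[OF \<phi> p] cohomology_mor_val(1,2)[OF K L \<phi> p]]
    by (simp add: cohomology_mor_def cohomology_def cohomology_group_def)
next
  fix p q S assume pq: "spec_le X p q" and "S \<in> carrier (stalk (cohomology K n) p)"
  then obtain x where x: "x \<in> cocycles K n p" "S = coboundaries K n p #>\<^bsub>grp K n p\<^esub> x" by (auto simp: cohomology_def carH)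
  have p: "p \<in> topspace X" "q \<in> topspace X" using pq by (auto dest: spec_leD)
  have val: "rst K n p q x \<in> cocycles K n q" "res (cohomology K n) p q (coboundaries K n p #>\<^bsub>grp K n p\<^esub> x) =
    coboundaries K n q #>\<^bsub>grp K n q\<^esub> rst K n p q x"
    if K: "K \<in> Ob (complex_cat X)" and x: "x \<in> cocycles K n p" for K :: "('a, 'b) cochain" and x
  proof -
    have one: "rst K m p q \<one>\<^bsub>grp K m p\<^esub> = \<one>\<^bsub>grp K m q\<^esub>" for m
      using hom_one[OF complex_rst_hom[OF K pq, of m]] complex_grp[OF K p(1), of m] complex_grp[OF K p(2), of m] by (simp add: comm_group_def)
    have Z: "rst K n p q ` cocycles K n p \<subseteq> cocycles K n q"
      using complex_rst_cdiff[OF K pq, of _ n] complex_rst_closed[OF K pq, of _ n] one by (auto simp: cocycles_def kernel_def simp flip: complex_rst_cdiff[OF K pq])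
    have "rst K n p q (cdiff K (n - 1) p x) = cdiff K (n - 1) q (rst K (n - 1) p q x)" if "x \<in> carrier (grp K (n - 1) p)" for x
      using complex_rst_cdiff[OF K pq that] by simp
    then have B: "rst K n p q ` coboundaries K n p \<subseteq> coboundaries K n q" using complex_rst_closed[OF K pq] by (auto simp: coboundaries_def)
    show "rst K n p q x \<in> cocycles K n q" using Z x by blast
    note f = cohomology_subgroups[OF K p(1), of n] and f' = cohomology_subgroups[OF K p(2), of n]
    show "res (cohomology K n) p q (coboundaries K n p #>\<^bsub>grp K n p\<^esub> x) = coboundaries K n q #>\<^bsub>grp K n q\<^esub> rst K n p q x"
      unfolding cohomology_def cohomology_group_def using
        coset_map_val[OF f(1) f'(1) f(2,3,4) f'(2,3,4) complex_rst_hom[OF K pq] Z B x] by simp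
  qed
  have x': "x \<in> carrier (grp K n p)" using x by (simp add: cocycles_def kernel_def)
  have \<phi>x: "\<phi> n p x \<in> cocycles L n p" using cohomology_mor_val(1)[OF K L \<phi> p(1)] x by blast
  show "res (cohomology L n) p q (cohomology_mor X K L n \<phi> p S) = cohomology_mor X K L n \<phi> q (res (cohomology K n) p q S)"
    unfolding x(2) by (simp add: cohomology_mor_val(3)[OF K L \<phi>] p x(1) val(2)[OF K x(1)] val(1)[OF K x(1)] val(2)[OF L \<phi>x] mor_rst[OF \<phi> pq x'])
qed

lemma (in group) rcoset_eq_iff:
  assumes "subgroup B G" "x \<in> carrier G" "y \<in> carrier G"
  shows "B #> x = B #> y \<longleftrightarrow> x \<otimes> inv y \<in> B"
proof -
  have "x \<in> B #> y \<longleftrightarrow> x \<otimes> inv y \<in> B" by (rule subgroup.rcos_module[OF assms(1) is_group assms(3,2)])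
  moreover have "x \<in> B #> y \<longleftrightarrow> B #> x = B #> y" using repr_independence[OF _ assms(3,1), of x] rcos_self[OF assms(2,1)] by auto
  ultimately show ?thesis by simp
qed

text \<open>Cosets are traded for representatives once and for all, through
  \<open>rcoset_eq_iff\<close>. The first conjunct is injectivity, the second surjectivity.\<close>

lemma cohomology_bij_iff:
  assumes K: "K \<in> Ob (complex_cat X)" and L: "L \<in> Ob (complex_cat X)" and \<phi>: "\<phi> \<in> Hom (complex_cat X) K L"
    and p: "p \<in> topspace X"
  shows "bij_betw (cohomology_mor X K L n \<phi> p) (carrier (cohomology_group K n p)) (carrier (cohomology_group L n p)) \<longleftrightarrow>
    (\<forall>x\<in>cocycles K n p. \<phi> n p x \<in> coboundaries L n p \<longrightarrow> x \<in> coboundaries K n p) \<and>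
    (\<forall>y\<in>cocycles L n p. \<exists>x\<in>cocycles K n p. \<exists>b\<in>coboundaries L n p. y = \<phi> n p x \<otimes>\<^bsub>grp L n p\<^esub> b)"
    (is "?l \<longleftrightarrow> ?i \<and> ?s")
proof -
  note f = cohomology_subgroups[OF K p, of n] and f' = cohomology_subgroups[OF L p, of n]
  interpret A: comm_group "grp K n p" by (rule f)
  interpret B: comm_group "grp L n p" by (rule f')
  interpret h: group_hom "grp K n p" "grp L n p" "\<phi> n p" by unfold_locales (rule mor_hom[OF \<phi> p])
  note val = cohomology_mor_val[OF K L \<phi> p]
  have Zc: "x \<in> carrier (grp K n p)" if "x \<in> cocycles K n p" for x using that f subgroup.subset by blast
  have Zc': "x \<in> carrier (grp L n p)" if "x \<in> cocycles L n p" for x using that f' subgroup.subset by blast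
  have Bc': "x \<in> carrier (grp L n p)" if "x \<in> coboundaries L n p" for x using that f' subgroup.subset by blast
  have inj: "inj_on (cohomology_mor X K L n \<phi> p) (carrier (cohomology_group K n p)) \<longleftrightarrow> ?i"
  proof
    assume I: "inj_on (cohomology_mor X K L n \<phi> p) (carrier (cohomology_group K n p))"
    show ?i
    proof (intro ballI impI)
      fix x assume x: "x \<in> cocycles K n p" "\<phi> n p x \<in> coboundaries L n p"
      have o: "\<one>\<^bsub>grp K n p\<^esub> \<in> cocycles K n p" using f(2) subgroup.one_closed by blast
      have "coboundaries L n p #>\<^bsub>grp L n p\<^esub> \<phi> n p x = coboundaries L n p #>\<^bsub>grp L n p\<^esub> \<phi> n p \<one>\<^bsub>grp K n p\<^esub>"
        using x f' by (subst B.rcoset_eq_iff) (auto simp: Zc)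
      then have "coboundaries K n p #>\<^bsub>grp K n p\<^esub> x = coboundaries K n p #>\<^bsub>grp K n p\<^esub> \<one>\<^bsub>grp K n p\<^esub>"
        using inj_onD[OF I] x(1) o val(3) by (auto simp: carH)
      then show "x \<in> coboundaries K n p" using A.rcoset_eq_iff[OF f(3) Zc[OF x(1)] A.one_closed] Zc[OF x(1)] by simp
    qed
  next
    assume i: ?i
    show "inj_on (cohomology_mor X K L n \<phi> p) (carrier (cohomology_group K n p))"
    proof (rule inj_onI)
      fix S T assume "S \<in> carrier (cohomology_group K n p)" "T \<in> carrier (cohomology_group K n p)"
        and e: "cohomology_mor X K L n \<phi> p S = cohomology_mor X K L n \<phi> p T"
      then obtain x y where xy: "x \<in> cocycles K n p" "y \<in> cocycles K n p"
        "S = coboundaries K n p #>\<^bsub>grp K n p\<^esub> x" "T = coboundaries K n p #>\<^bsub>grp K n p\<^esub> y" by (auto simp: carH)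
      have "\<phi> n p x \<otimes>\<^bsub>grp L n p\<^esub> inv\<^bsub>grp L n p\<^esub> \<phi> n p y \<in> coboundaries L n p"
        using e B.rcoset_eq_iff[OF f'(3), of "\<phi> n p x" "\<phi> n p y"] by (simp add: xy val Zc)
      then have "\<phi> n p (x \<otimes>\<^bsub>grp K n p\<^esub> inv\<^bsub>grp K n p\<^esub> y) \<in> coboundaries L n p" using xy Zc by simp
      moreover have "x \<otimes>\<^bsub>grp K n p\<^esub> inv\<^bsub>grp K n p\<^esub> y \<in> cocycles K n p"
        using xy f(2) by (simp add: subgroup.m_closed subgroup.m_inv_closed)
      ultimately show "S = T" using i A.rcoset_eq_iff[OF f(3)] xy Zc by simp
    qed
  qed
  have surj: "carrier (cohomology_group L n p) \<subseteq> cohomology_mor X K L n \<phi> p ` carrier (cohomology_group K n p) \<longleftrightarrow> ?s"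
  proof
    assume S: "carrier (cohomology_group L n p) \<subseteq> cohomology_mor X K L n \<phi> p ` carrier (cohomology_group K n p)"
    show ?s
    proof
      fix y assume y: "y \<in> cocycles L n p"
      then obtain x where x: "x \<in> cocycles K n p" "coboundaries L n p #>\<^bsub>grp L n p\<^esub> y = coboundaries L n p #>\<^bsub>grp L n p\<^esub> \<phi> n p x"
      proof -
        have "coboundaries L n p #>\<^bsub>grp L n p\<^esub> y \<in> cohomology_mor X K L n \<phi> p ` carrier (cohomology_group K n p)"
          using S y by (auto simp: carH)
        then show ?thesis using val(3) that by (auto simp: carH)
      qed
      have "y \<otimes>\<^bsub>grp L n p\<^esub> inv\<^bsub>grp L n p\<^esub> \<phi> n p x \<in> coboundaries L n p"
        using x(2) B.rcoset_eq_iff[OF f'(3) Zc'[OF y], of "\<phi> n p x"] Zc[OF x(1)] by simp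
      moreover have "y = \<phi> n p x \<otimes>\<^bsub>grp L n p\<^esub> (y \<otimes>\<^bsub>grp L n p\<^esub> inv\<^bsub>grp L n p\<^esub> \<phi> n p x)"
        using Zc'[OF y] Zc[OF x(1)] by (simp add: B.m_lcomm)
      ultimately show "\<exists>x\<in>cocycles K n p. \<exists>b\<in>coboundaries L n p. y = \<phi> n p x \<otimes>\<^bsub>grp L n p\<^esub> b" using x(1) by blast
    qed
  next
    assume s: ?s
    show "carrier (cohomology_group L n p) \<subseteq> cohomology_mor X K L n \<phi> p ` carrier (cohomology_group K n p)"
    proof
      fix T assume "T \<in> carrier (cohomology_group L n p)"
      then obtain y where y: "y \<in> cocycles L n p" "T = coboundaries L n p #>\<^bsub>grp L n p\<^esub> y" by (auto simp: carH)
      then obtain x b where x: "x \<in> cocycles K n p" "b \<in> coboundaries L n p" "y = \<phi> n p x \<otimes>\<^bsub>grp L n p\<^esub> b" using s by blast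
      have "T = coboundaries L n p #>\<^bsub>grp L n p\<^esub> \<phi> n p x"
      proof -
        have "y \<otimes>\<^bsub>grp L n p\<^esub> inv\<^bsub>grp L n p\<^esub> \<phi> n p x = b"
          unfolding x(3) using Zc[OF x(1)] Bc'[OF x(2)] by (simp add: B.m_comm[of _ b] B.m_assoc)
        then show ?thesis using B.rcoset_eq_iff[OF f'(3) Zc'[OF y(1)], of "\<phi> n p x"] x(2) Zc[OF x(1)] y(2) by simp
      qed
      then show "T \<in> cohomology_mor X K L n \<phi> p ` carrier (cohomology_group K n p)" using x(1) val(3) by (auto simp: carH)
    qed
  qed
  have "cohomology_mor X K L n \<phi> p ` carrier (cohomology_group K n p) \<subseteq> carrier (cohomology_group L n p)"
  proof -
    have "\<phi> n p x \<in> cocycles L n p" if "x \<in> cocycles K n p" for x using val(1)[of n] that by blast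
    then show ?thesis using val(3) by (auto simp: carH)
  qed
  then show ?thesis using inj surj by (auto simp: bij_betw_def)
qed

text \<open>The mapping cone criterion on elements: injectivity in one degree and surjectivity in
  the degree below together are exactness of the cone. The resulting condition is free of cosets and
  behaves well under shifts and extensions.\<close>

lemma quasi_isos_iff:
  assumes K: "K \<in> Ob (complex_cat X)" and L: "L \<in> Ob (complex_cat X)"
  shows "\<phi> \<in> quasi_isos X K L \<longleftrightarrow> \<phi> \<in> Hom (complex_cat X) K L \<and>
    (\<forall>p\<in>topspace X. cone_acyclic (\<lambda>n. grp K n p) (\<lambda>n. cdiff K n p) (\<lambda>n. grp L n p) (\<lambda>n. cdiff L n p) (\<lambda>n. \<phi> n p))"
proof (cases "\<phi> \<in> Hom (complex_cat X) K L")
  case \<phi>: True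
  have "(\<forall>n. bij_betw (cohomology_mor X K L n \<phi> p) (carrier (cohomology_group K n p)) (carrier (cohomology_group L n p))) \<longleftrightarrow>
    cone_acyclic (\<lambda>n. grp K n p) (\<lambda>n. cdiff K n p) (\<lambda>n. grp L n p) (\<lambda>n. cdiff L n p) (\<lambda>n. \<phi> n p)" (is "?b \<longleftrightarrow> ?c")
    if p: "p \<in> topspace X" for p
  proof
    assume ?b
    then have i: "x \<in> coboundaries K n p" if "x \<in> cocycles K n p" "\<phi> n p x \<in> coboundaries L n p" for n x
      using cohomology_bij_iff[OF K L \<phi> p] that by blast
    have s: "\<exists>x\<in>cocycles K n p. \<exists>b\<in>coboundaries L n p. y = \<phi> n p x \<otimes>\<^bsub>grp L n p\<^esub> b" if "y \<in> cocycles L n p" for n y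
      using \<open>?b\<close> cohomology_bij_iff[OF K L \<phi> p] that by blast
    show ?c unfolding cone_acyclic_def
    proof (intro allI ballI impI)
      fix n k l assume k: "k \<in> carrier (grp K (n + 1 + 1) p)" "l \<in> carrier (grp L (n + 1) p)"
       "cdiff K (n + 1 + 1) p k = \<one>\<^bsub>grp K (n + 1 + 1 + 1) p\<^esub>" "\<phi> (n + 1 + 1) p k = cdiff L (n + 1) p l"
      have "k \<in> coboundaries K (n + 1 + 1) p"
      proof (rule i)
        show "k \<in> cocycles K (n + 1 + 1) p" unfolding cocycles_def kernel_def using k by blast
        show "\<phi> (n + 1 + 1) p k \<in> coboundaries L (n + 1 + 1) p" unfolding coboundaries_Suc k(4) using k(2) by blast
      qed
      then obtain k0 where k0: "k0 \<in> carrier (grp K (n + 1) p)" "cdiff K (n + 1) p k0 = k" unfolding coboundaries_Suc by blast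
      interpret A: comm_group "grp K (n + 1) p" by (rule complex_grp[OF K p])
      interpret B: comm_group "grp L (n + 1) p" by (rule complex_grp[OF L p])
      interpret A2: comm_group "grp K (n + 1 + 1) p" by (rule complex_grp[OF K p])
      interpret B2: comm_group "grp L (n + 1 + 1) p" by (rule complex_grp[OF L p])
      interpret d: group_hom "grp L (n + 1) p" "grp L (n + 1 + 1) p" "cdiff L (n + 1) p" by unfold_locales (rule complex_cdiff_hom[OF L p])
      interpret dK: group_hom "grp K (n + 1) p" "grp K (n + 1 + 1) p" "cdiff K (n + 1) p" by unfold_locales (rule complex_cdiff_hom[OF K p])
      interpret h: group_hom "grp K (n + 1) p" "grp L (n + 1) p" "\<phi> (n + 1) p" by unfold_locales (rule mor_hom[OF \<phi> p])
      \<comment> \<open>Injectivity has produced \<open>k0\<close> with differential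
        \<open>k\<close>. Subtracting its image from \<open>l\<close> leaves a cocycle, to which
        surjectivity applies; the \<open>x\<close> so obtained is then added to
        \<open>k0\<close>.\<close>
      let ?y = "l \<otimes>\<^bsub>grp L (n + 1) p\<^esub> inv\<^bsub>grp L (n + 1) p\<^esub> \<phi> (n + 1) p k0"
      have "?y \<in> cocycles L (n + 1) p" using k k0 mor_cdiff[OF \<phi> p k0(1)]
          [[simproc del: int_combine_numerals]]
        by (simp add: cocycles_def kernel_def)
      then obtain x b where x: "x \<in> cocycles K (n + 1) p" "b \<in> coboundaries L (n + 1) p" "?y = \<phi> (n + 1) p x \<otimes>\<^bsub>grp L (n + 1) p\<^esub> b"
        using s by blast
      then obtain l' where l': "l' \<in> carrier (grp L n p)" "b = cdiff L n p l'" by (auto simp: coboundaries_def)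
      have xc: "x \<in> carrier (grp K (n + 1) p)" "cdiff K (n + 1) p x = \<one>\<^bsub>grp K (n + 1 + 1) p\<^esub>" using x by (auto simp: cocycles_def kernel_def)
      have b: "b \<in> carrier (grp L (n + 1) p)" using l' complex_cdiff_closed[OF L p] by simp
      have "l = ?y \<otimes>\<^bsub>grp L (n + 1) p\<^esub> \<phi> (n + 1) p k0" using k k0 by (simp add: B.m_assoc)
      also have "\<dots> = \<phi> (n + 1) p (k0 \<otimes>\<^bsub>grp K (n + 1) p\<^esub> x) \<otimes>\<^bsub>grp L (n + 1) p\<^esub> cdiff L n p l'"
        unfolding x(3) l'(2)[symmetric] using xc k0 b by (simp add: B.m_ac)
      finally show "\<exists>k'\<in>carrier (grp K (n + 1) p). \<exists>l'\<in>carrier (grp L n p). cdiff K (n + 1) p k' = k \<and> l = \<phi> (n + 1) p k' \<otimes>\<^bsub>grp L (n + 1) p\<^esub> cdiff L n p l'"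
        using k0 xc l' dK.hom_closed[OF k0(1)] [[simproc del: int_combine_numerals]]
        by (intro bexI[of _ "k0 \<otimes>\<^bsub>grp K (n + 1) p\<^esub> x" "carrier (grp K (n + 1) p)"] bexI[of _ l' "carrier (grp L n p)"]) simp_all
    qed
  next
    assume c: ?c
    show ?b
    proof
      fix n
      interpret A: comm_group "grp K (n - 1 + 1 + 1) p" by (rule complex_grp[OF K p])
      show "bij_betw (cohomology_mor X K L n \<phi> p) (carrier (cohomology_group K n p)) (carrier (cohomology_group L n p))"
        unfolding cohomology_bij_iff[OF K L \<phi> p]
      proof (intro conjI ballI impI)
        fix x assume x: "x \<in> cocycles K n p" "\<phi> n p x \<in> coboundaries L n p"
        then obtain l where l: "l \<in> carrier (grp L (n - 1) p)" "\<phi> n p x = cdiff L (n - 1) p l" by (auto simp: coboundaries_def)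
        \<comment> \<open>Injectivity in degree \<open>n\<close> is the cone condition based at
          \<open>n - 2\<close>. Below, surjectivity is the one based at \<open>n - 1\<close>, with
          the neutral element for \<open>k\<close>.\<close>
        have "\<exists>k'\<in>carrier (grp K (n - 2 + 1) p). \<exists>l'\<in>carrier (grp L (n - 2) p). cdiff K (n - 2 + 1) p k' = x \<and> l = \<phi> (n - 2 + 1) p k' \<otimes>\<^bsub>grp L (n - 2 + 1) p\<^esub> cdiff L (n - 2) p l'"
          by (rule c[unfolded cone_acyclic_def, rule_format]) (use x l in \<open>simp_all add: cocycles_def kernel_def\<close>)
        then show "x \<in> coboundaries K n p" by (auto simp: coboundaries_def)
      next
        fix y assume y: "y \<in> cocycles L n p"
        have 1: "cdiff K (n - 1 + 1 + 1) p \<one>\<^bsub>grp K (n - 1 + 1 + 1) p\<^esub> = \<one>\<^bsub>grp K (n - 1 + 1 + 1 + 1) p\<^esub>" by (rule complex_cdiff_one[OF K p])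
        have 2: "\<phi> (n + 1) p \<one>\<^bsub>grp K (n + 1) p\<^esub> = \<one>\<^bsub>grp L (n + 1) p\<^esub>" by (rule mor_one[OF K L \<phi> p])
        have "\<exists>k'\<in>carrier (grp K (n - 1 + 1) p). \<exists>l'\<in>carrier (grp L (n - 1) p). cdiff K (n - 1 + 1) p k' = \<one>\<^bsub>grp K (n - 1 + 1 + 1) p\<^esub> \<and> y = \<phi> (n - 1 + 1) p k' \<otimes>\<^bsub>grp L (n - 1 + 1) p\<^esub> cdiff L (n - 1) p l'"
          by (rule c[unfolded cone_acyclic_def, rule_format]) (use y 1 2 A.one_closed in \<open>simp_all add: cocycles_def kernel_def\<close>)
        then show "\<exists>x\<in>cocycles K n p. \<exists>b\<in>coboundaries L n p. y = \<phi> n p x \<otimes>\<^bsub>grp L n p\<^esub> b"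
          by (fastforce simp: coboundaries_def cocycles_def kernel_def)
      qed
    qed
  qed
  then show ?thesis
    using \<phi> is_iso_abdata_iff[OF abelian_data_cohomology[OF K] abelian_data_cohomology[OF L] cohomology_mor_in[OF K L \<phi>]]
    by (simp add: quasi_isos_def cohomology_def) blast
qed (simp add: quasi_isos_def)

lemma relative_category_complex: "relative_category (complex_cat X) (quasi_isos X)"
  by unfold_locales (auto simp: is_category_complex_cat quasi_isos_def)

section \<open>Twisted finite sums of shifted stalks\<close>

text \<open>The simproc would rewrite \<open>n + 1 + 1\<close> to \<open>2 + n\<close> and so break the matching of degrees.\<close>

declare [[simproc del: int_combine_numerals]]

context comm_group
begin

lemma lincomb_pow_arg:
  assumes "\<And>i. i \<in> S \<Longrightarrow> k i \<noteq> 0 \<Longrightarrow> u i \<in> carrier G"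
  shows "lincomb G S k (\<lambda>i. u i [^] (c i :: int)) = lincomb G S (\<lambda>i. k i * c i) u"
  unfolding lincomb_def
proof (rule finprod_cong')
  fix i assume i: "i \<in> S"
  show "(u i [^] c i) [^] k i = u i [^] (k i * c i)" using assms[OF i] by (cases "k i = 0") (auto simp: int_pow_pow mult.commute)
next
  show "(\<lambda>i. u i [^] (k i * c i)) \<in> S \<rightarrow> carrier G" using assms by (auto intro!: lincomb_term)
qed simp

end

text \<open>The long exact sequence argument, for the mapping cones of a morphism of short exact sequences.\<close>

lemma cone_acyclic_extension:
  fixes A B C :: "int \<Rightarrow> 'u monoid" and A' B' C' :: "int \<Rightarrow> 'u monoid"
  assumes gA: "\<And>n. comm_group (A n)" and gB: "\<And>n. comm_group (B n)" and gC: "\<And>n. comm_group (C n)"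
    and gA': "\<And>n. comm_group (A' n)" and gB': "\<And>n. comm_group (B' n)" and gC': "\<And>n. comm_group (C' n)"
    and dA: "\<And>n. dA n \<in> hom (A n) (A (n + 1))" and dB: "\<And>n. dB n \<in> hom (B n) (B (n + 1))"
    and dA': "\<And>n. dA' n \<in> hom (A' n) (A' (n + 1))" and dB': "\<And>n. dB' n \<in> hom (B' n) (B' (n + 1))"
    and ddB: "\<And>n x. x \<in> carrier (B n) \<Longrightarrow> dB (n + 1) (dB n x) = \<one>\<^bsub>B (n + 1 + 1)\<^esub>"
    and ddB': "\<And>n x. x \<in> carrier (B' n) \<Longrightarrow> dB' (n + 1) (dB' n x) = \<one>\<^bsub>B' (n + 1 + 1)\<^esub>"
    and \<iota>: "\<And>n. \<iota> n \<in> hom (A n) (B n)" "\<And>n x. x \<in> carrier (A n) \<Longrightarrow> \<iota> (n + 1) (dA n x) = dB n (\<iota> n x)"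
    and \<iota>_inj: "\<And>n x y. x \<in> carrier (A n) \<Longrightarrow> y \<in> carrier (A n) \<Longrightarrow> \<iota> n x = \<iota> n y \<Longrightarrow> x = y"
    and \<iota>': "\<And>n. \<iota>' n \<in> hom (A' n) (B' n)" "\<And>n x. x \<in> carrier (A' n) \<Longrightarrow> \<iota>' (n + 1) (dA' n x) = dB' n (\<iota>' n x)"
    and \<iota>'_inj: "\<And>n x y. x \<in> carrier (A' n) \<Longrightarrow> y \<in> carrier (A' n) \<Longrightarrow> \<iota>' n x = \<iota>' n y \<Longrightarrow> x = y"
    and \<pi>: "\<And>n. \<pi> n \<in> hom (B n) (C n)" "\<And>n x. x \<in> carrier (B n) \<Longrightarrow> \<pi> (n + 1) (dB n x) = dC n (\<pi> n x)"
    and \<pi>': "\<And>n. \<pi>' n \<in> hom (B' n) (C' n)" "\<And>n x. x \<in> carrier (B' n) \<Longrightarrow> \<pi>' (n + 1) (dB' n x) = dC' n (\<pi>' n x)"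
    and \<pi>_surj: "\<And>n c. c \<in> carrier (C n) \<Longrightarrow> \<exists>b\<in>carrier (B n). \<pi> n b = c"
    and \<pi>'_surj: "\<And>n c. c \<in> carrier (C' n) \<Longrightarrow> \<exists>b\<in>carrier (B' n). \<pi>' n b = c"
    and ker: "\<And>n b. b \<in> carrier (B n) \<Longrightarrow> \<pi> n b = \<one>\<^bsub>C n\<^esub> \<Longrightarrow> \<exists>a\<in>carrier (A n). \<iota> n a = b"
    and ker': "\<And>n b. b \<in> carrier (B' n) \<Longrightarrow> \<pi>' n b = \<one>\<^bsub>C' n\<^esub> \<Longrightarrow> \<exists>a\<in>carrier (A' n). \<iota>' n a = b"
    and \<alpha>: "\<And>n. \<alpha> n \<in> hom (A n) (A' n)"
    and \<beta>: "\<And>n. \<beta> n \<in> hom (B n) (B' n)" "\<And>n x. x \<in> carrier (B n) \<Longrightarrow> \<beta> (n + 1) (dB n x) = dB' n (\<beta> n x)"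
    and \<alpha>\<beta>: "\<And>n x. x \<in> carrier (A n) \<Longrightarrow> \<beta> n (\<iota> n x) = \<iota>' n (\<alpha> n x)"
    and \<beta>\<gamma>: "\<And>n x. x \<in> carrier (B n) \<Longrightarrow> \<gamma> n (\<pi> n x) = \<pi>' n (\<beta> n x)"
    and acA: "cone_acyclic A dA A' dA' \<alpha>" and acC: "cone_acyclic C dC C' dC' \<gamma>"
  shows "cone_acyclic B dB B' dB' \<beta>"
  unfolding cone_acyclic_def
proof (intro allI ballI impI)
  fix n b w assume b: "b \<in> carrier (B (n + 1 + 1))" and w: "w \<in> carrier (B' (n + 1))"
    and db: "dB (n + 1 + 1) b = \<one>\<^bsub>B (n + 1 + 1 + 1)\<^esub>" and bw: "\<beta> (n + 1 + 1) b = dB' (n + 1) w"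
  have gh: "group_hom (A m) (B m) (\<iota> m)" "group_hom (A' m) (B' m) (\<iota>' m)" "group_hom (B m) (C m) (\<pi> m)"
    "group_hom (B' m) (C' m) (\<pi>' m)" "group_hom (A m) (A' m) (\<alpha> m)" "group_hom (B m) (B' m) (\<beta> m)"
    "group_hom (B m) (B (m + 1)) (dB m)" "group_hom (B' m) (B' (m + 1)) (dB' m)" "group_hom (A m) (A (m + 1)) (dA m)"
    "group_hom (A' m) (A' (m + 1)) (dA' m)" for m
    using gA gB gC gA' gB' gC' \<iota> \<iota>' \<pi> \<pi>' \<alpha> \<beta> dA dB dA' dB' by (auto simp: group_hom_def group_hom_axioms_def comm_group_def)
  note cl = gh[THEN group_hom.hom_closed] and mu = gh[THEN group_hom.hom_mult] and iv = gh[THEN group_hom.hom_inv]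
    and on = gh[THEN group_hom.hom_one]
  interpret B1: comm_group "B (n + 1)" by (rule gB)
  interpret B2: comm_group "B (n + 1 + 1)" by (rule gB)
  interpret B3: comm_group "B (n + 1 + 1 + 1)" by (rule gB)
  interpret B'0: comm_group "B' n" by (rule gB')
  interpret B'1: comm_group "B' (n + 1)" by (rule gB')
  interpret B'2: comm_group "B' (n + 1 + 1)" by (rule gB')
  interpret C2: comm_group "C (n + 1 + 1)" by (rule gC)
  interpret C'1: comm_group "C' (n + 1)" by (rule gC')
  have dc: "dC (n + 1 + 1) (\<pi> (n + 1 + 1) b) = \<one>\<^bsub>C (n + 1 + 1 + 1)\<^esub>" using \<pi>(2)[OF b] db on by simp
  have \<gamma>c: "\<gamma> (n + 1 + 1) (\<pi> (n + 1 + 1) b) = dC' (n + 1) (\<pi>' (n + 1) w)" using \<beta>\<gamma>[OF b] bw \<pi>'(2)[OF w] by simp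
  obtain c' c'' where c: "c' \<in> carrier (C (n + 1))" "c'' \<in> carrier (C' n)" "dC (n + 1) c' = \<pi> (n + 1 + 1) b"
    "\<pi>' (n + 1) w = \<gamma> (n + 1) c' \<otimes>\<^bsub>C' (n + 1)\<^esub> dC' n c''"
    using acC[unfolded cone_acyclic_def, rule_format, OF cl(3)[OF b] cl(4)[OF w] dc \<gamma>c] by blast
  \<comment> \<open>The solution in the quotient is lifted to the middle complexes. After
    subtracting the lifts, \<open>?b\<close> and \<open>?w\<close> are killed by the projections and
    so come from a cone cocycle of the subcomplexes, where the other acyclicity applies.\<close>
  obtain b1 where b1: "b1 \<in> carrier (B (n + 1))" "\<pi> (n + 1) b1 = c'" using \<pi>_surj[OF c(1)] by blast
  obtain w1 where w1: "w1 \<in> carrier (B' n)" "\<pi>' n w1 = c''" using \<pi>'_surj[OF c(2)] by blast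
  let ?b = "b \<otimes>\<^bsub>B (n + 1 + 1)\<^esub> inv\<^bsub>B (n + 1 + 1)\<^esub> dB (n + 1) b1"
  let ?w = "w \<otimes>\<^bsub>B' (n + 1)\<^esub> inv\<^bsub>B' (n + 1)\<^esub> (\<beta> (n + 1) b1 \<otimes>\<^bsub>B' (n + 1)\<^esub> dB' n w1)"
  have b2: "?b \<in> carrier (B (n + 1 + 1))" using b b1 cl(7) by simp
  have w2: "?w \<in> carrier (B' (n + 1))" using w b1 w1 cl(6,8) by simp
  have "\<pi> (n + 1 + 1) ?b = \<one>\<^bsub>C (n + 1 + 1)\<^esub>"
    using b b1 c(3) cl(7)[OF b1(1)] cl(3)[OF b] \<pi>(2)[OF b1(1)] by (simp add: mu(3) iv(3))
  then obtain a where a: "a \<in> carrier (A (n + 1 + 1))" "\<iota> (n + 1 + 1) a = ?b" using ker[OF b2] by blast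
  have "\<pi>' (n + 1) ?w = \<one>\<^bsub>C' (n + 1)\<^esub>"
  proof -
    have t: "\<beta> (n + 1) b1 \<in> carrier (B' (n + 1))" "dB' n w1 \<in> carrier (B' (n + 1))" using cl b1 w1 by auto
    have "\<pi>' (n + 1) (\<beta> (n + 1) b1 \<otimes>\<^bsub>B' (n + 1)\<^esub> dB' n w1) = \<pi>' (n + 1) w"
      using t b1 w1 \<beta>\<gamma>[OF b1(1)] \<pi>'(2)[OF w1(1)] c(4) by (simp add: mu(4))
    then show ?thesis using t w cl(4)[OF w] by (simp add: mu(4)[OF w] iv(4)[OF B'1.m_closed])
  qed
  then obtain a' where a': "a' \<in> carrier (A' (n + 1))" "\<iota>' (n + 1) a' = ?w" using ker'[OF w2] by blast
  have dae: "dB (n + 1 + 1) ?b = \<one>\<^bsub>B (n + 1 + 1 + 1)\<^esub>" using b b1 cl(7)[OF b1(1)] ddB[OF b1(1)] db by (simp add: mu(7) iv(7))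
  have da: "dA (n + 1 + 1) a = \<one>\<^bsub>A (n + 1 + 1 + 1)\<^esub>"
  proof (rule \<iota>_inj[of _ "n + 1 + 1 + 1"])
    show "\<iota> (n + 1 + 1 + 1) (dA (n + 1 + 1) a) = \<iota> (n + 1 + 1 + 1) \<one>\<^bsub>A (n + 1 + 1 + 1)\<^esub>"
      using \<iota>(2)[OF a(1)] dae a(2) on(1) by simp
    show "\<one>\<^bsub>A (n + 1 + 1 + 1)\<^esub> \<in> carrier (A (n + 1 + 1 + 1))" using gA by (simp add: comm_group_def group.is_monoid monoid.one_closed)
  qed (rule cl(9)[OF a(1)])
  have \<alpha>a: "\<alpha> (n + 1 + 1) a = dA' (n + 1) a'"
  proof (rule \<iota>'_inj[OF cl(5)[OF a(1)] cl(10)[OF a'(1)]])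
    have t: "\<beta> (n + 1) b1 \<in> carrier (B' (n + 1))" "dB' n w1 \<in> carrier (B' (n + 1))"
      "dB' (n + 1) (\<beta> (n + 1) b1) \<in> carrier (B' (n + 1 + 1))" "\<beta> (n + 1 + 1) b \<in> carrier (B' (n + 1 + 1))" using cl b1 w1 b by auto
    have "\<iota>' (n + 1 + 1) (\<alpha> (n + 1 + 1) a) = \<beta> (n + 1 + 1) ?b" using \<alpha>\<beta>[OF a(1)] a(2) by simp
    also have "\<dots> = \<beta> (n + 1 + 1) b \<otimes>\<^bsub>B' (n + 1 + 1)\<^esub> inv\<^bsub>B' (n + 1 + 1)\<^esub> dB' (n + 1) (\<beta> (n + 1) b1)"
      using b b1 cl(7)[OF b1(1)] \<beta>(2)[OF b1(1)] by (simp add: mu(6) iv(6))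
    also have "\<dots> = dB' (n + 1) ?w" using w t ddB'[OF w1(1)] bw by (simp add: mu(8)[OF w] mu(8)[OF t(1,2)] iv(8)[OF B'1.m_closed])
    also have "\<dots> = \<iota>' (n + 1 + 1) (dA' (n + 1) a')" using \<iota>'(2)[OF a'(1)] a'(2) by simp
    finally show "\<iota>' (n + 1 + 1) (\<alpha> (n + 1 + 1) a) = \<iota>' (n + 1 + 1) (dA' (n + 1) a')" .
  qed
  obtain a1 a2 where a12: "a1 \<in> carrier (A (n + 1))" "a2 \<in> carrier (A' n)" "dA (n + 1) a1 = a"
    "a' = \<alpha> (n + 1) a1 \<otimes>\<^bsub>A' (n + 1)\<^esub> dA' n a2"
    using acA[unfolded cone_acyclic_def, rule_format, OF a(1) a'(1) da \<alpha>a] by blast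
  have t: "\<iota> (n + 1) a1 \<in> carrier (B (n + 1))" "\<iota>' n a2 \<in> carrier (B' n)" "dB (n + 1) b1 \<in> carrier (B (n + 1 + 1))"
    "\<beta> (n + 1) b1 \<in> carrier (B' (n + 1))" "dB' n w1 \<in> carrier (B' (n + 1))" "\<beta> (n + 1) (\<iota> (n + 1) a1) \<in> carrier (B' (n + 1))"
    "dB' n (\<iota>' n a2) \<in> carrier (B' (n + 1))"
    using cl a12 b1 w1 by auto
  show "\<exists>k'\<in>carrier (B (n + 1)). \<exists>l'\<in>carrier (B' n). dB (n + 1) k' = b \<and> w = \<beta> (n + 1) k' \<otimes>\<^bsub>B' (n + 1)\<^esub> dB' n l'"
  proof (intro bexI conjI)
    have "dB (n + 1) (\<iota> (n + 1) a1) = ?b" using \<iota>(2)[OF a12(1)] a12(3) a(2) by simp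
    then have "dB (n + 1) (b1 \<otimes>\<^bsub>B (n + 1)\<^esub> \<iota> (n + 1) a1) = dB (n + 1) b1 \<otimes>\<^bsub>B (n + 1 + 1)\<^esub> ?b" using b1 t by (simp add: mu(7))
    also have "\<dots> = b" using t b by (simp add: B2.m_ac)
    finally show "dB (n + 1) (b1 \<otimes>\<^bsub>B (n + 1)\<^esub> \<iota> (n + 1) a1) = b" .
    have "?w = \<beta> (n + 1) (\<iota> (n + 1) a1) \<otimes>\<^bsub>B' (n + 1)\<^esub> dB' n (\<iota>' n a2)"
      using a12 a'(2) \<alpha>\<beta>[OF a12(1)] \<iota>'(2)[OF a12(2)] cl(5)[OF a12(1)] cl(10)[OF a12(2)] by (simp add: mu(2))
    then have "?w \<otimes>\<^bsub>B' (n + 1)\<^esub> (\<beta> (n + 1) b1 \<otimes>\<^bsub>B' (n + 1)\<^esub> dB' n w1) =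
      \<beta> (n + 1) (\<iota> (n + 1) a1) \<otimes>\<^bsub>B' (n + 1)\<^esub> dB' n (\<iota>' n a2) \<otimes>\<^bsub>B' (n + 1)\<^esub> (\<beta> (n + 1) b1 \<otimes>\<^bsub>B' (n + 1)\<^esub> dB' n w1)" by simp
    then show "w = \<beta> (n + 1) (b1 \<otimes>\<^bsub>B (n + 1)\<^esub> \<iota> (n + 1) a1) \<otimes>\<^bsub>B' (n + 1)\<^esub> dB' n (w1 \<otimes>\<^bsub>B' n\<^esub> \<iota>' n a2)"
      using w t b1 w1 by (simp add: mu(6,8) B'1.inv_solve_right' B'1.m_assoc) (simp add: B'1.m_ac)
  qed (use b1 w1 t in auto)
qed

definition parity_sign :: "int \<Rightarrow> int" where
  "parity_sign k = (if even k then 1 else - 1)"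

text \<open>The sign squares to one, so it is absorbed by raising \<open>l\<close> and
  \<open>k'\<close> to the power \<open>parity_sign s\<close>.\<close>

lemma cone_acyclic_shift:
  assumes ac: "cone_acyclic K d L d' \<phi>" and K: "\<And>n. comm_group (K n)" and L: "\<And>n. comm_group (L n)"
    and d: "\<And>n. d n \<in> hom (K n) (K (n + 1))" and d': "\<And>n. d' n \<in> hom (L n) (L (n + 1))" and \<phi>: "\<And>n. \<phi> n \<in> hom (K n) (L n)"
  shows "cone_acyclic (\<lambda>n. K (s + n)) (\<lambda>n x. d (s + n) x [^]\<^bsub>K (s + n + 1)\<^esub> parity_sign s)
    (\<lambda>n. L (s + n)) (\<lambda>n x. d' (s + n) x [^]\<^bsub>L (s + n + 1)\<^esub> parity_sign s) (\<lambda>n. \<phi> (s + n))"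
  unfolding cone_acyclic_def add.assoc[symmetric]
proof (intro allI ballI impI)
  fix n k l
  interpret K1: comm_group "K (s + n + 1)" by (rule K)
  interpret K2: comm_group "K (s + n + 1 + 1)" by (rule K)
  interpret K3: comm_group "K (s + n + 1 + 1 + 1)" by (rule K)
  interpret L0: comm_group "L (s + n)" by (rule L)
  interpret L1: comm_group "L (s + n + 1)" by (rule L)
  interpret L2: comm_group "L (s + n + 1 + 1)" by (rule L)
  interpret dK: group_hom "K (s + n + 1)" "K (s + n + 1 + 1)" "d (s + n + 1)" by unfold_locales (rule d)
  interpret dK2: group_hom "K (s + n + 1 + 1)" "K (s + n + 1 + 1 + 1)" "d (s + n + 1 + 1)" by unfold_locales (rule d)
  interpret dL: group_hom "L (s + n + 1)" "L (s + n + 1 + 1)" "d' (s + n + 1)" by unfold_locales (rule d')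
  interpret dL0: group_hom "L (s + n)" "L (s + n + 1)" "d' (s + n)" by unfold_locales (rule d')
  interpret h: group_hom "K (s + n + 1)" "L (s + n + 1)" "\<phi> (s + n + 1)" by unfold_locales (rule \<phi>)
  assume k: "k \<in> carrier (K (s + n + 1 + 1))" and l: "l \<in> carrier (L (s + n + 1))"
    and 1: "d (s + n + 1 + 1) k [^]\<^bsub>K (s + n + 1 + 1 + 1)\<^esub> parity_sign s = \<one>\<^bsub>K (s + n + 1 + 1 + 1)\<^esub>"
    and 2: "\<phi> (s + n + 1 + 1) k = d' (s + n + 1) l [^]\<^bsub>L (s + n + 1 + 1)\<^esub> parity_sign s"
  let ?l = "l [^]\<^bsub>L (s + n + 1)\<^esub> parity_sign s"
  have sq: "parity_sign s = 1 \<or> parity_sign s = - 1" by (simp add: parity_sign_def)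
  have ll: "?l [^]\<^bsub>L (s + n + 1)\<^esub> parity_sign s = l" using l sq by (auto simp: L1.int_pow_neg)
  have d1: "d (s + n + 1 + 1) k = \<one>\<^bsub>K (s + n + 1 + 1 + 1)\<^esub>"
    using 1 sq k dK2.hom_closed[OF k] by (auto simp: K3.int_pow_neg K3.inv_eq_1_iff)
  have d2: "\<phi> (s + n + 1 + 1) k = d' (s + n + 1) ?l" using 2 l by (simp add: dL.hom_int_pow)
  obtain k' l' where kl: "k' \<in> carrier (K (s + n + 1))" "l' \<in> carrier (L (s + n))" "d (s + n + 1) k' = k" "?l = \<phi> (s + n + 1) k' \<otimes>\<^bsub>L (s + n + 1)\<^esub> d' (s + n) l'"
    using ac[unfolded cone_acyclic_def, rule_format, OF k _ d1 d2] l by auto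
  show "\<exists>k'\<in>carrier (K (s + n + 1)). \<exists>l'\<in>carrier (L (s + n)). d (s + n + 1) k' [^]\<^bsub>K (s + n + 1 + 1)\<^esub> parity_sign s = k \<and>
    l = \<phi> (s + n + 1) k' \<otimes>\<^bsub>L (s + n + 1)\<^esub> d' (s + n) l' [^]\<^bsub>L (s + n + 1)\<^esub> parity_sign s"
  proof (intro bexI conjI)
    show "d (s + n + 1) (k' [^]\<^bsub>K (s + n + 1)\<^esub> parity_sign s) [^]\<^bsub>K (s + n + 1 + 1)\<^esub> parity_sign s = k"
      using kl k sq by (auto simp: dK.hom_int_pow K2.int_pow_neg)
    show "l = \<phi> (s + n + 1) (k' [^]\<^bsub>K (s + n + 1)\<^esub> parity_sign s) \<otimes>\<^bsub>L (s + n + 1)\<^esub> d' (s + n) l' [^]\<^bsub>L (s + n + 1)\<^esub> parity_sign s"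
      using ll kl by (simp add: h.hom_int_pow L1.int_pow_distrib)
  qed (use kl in auto)
qed

section \<open>Twisted sums over one finite index set\<close>

definition tw_grp :: "('a, 'u::infinite) cochain \<Rightarrow> 'i set \<Rightarrow> ('i \<Rightarrow> 'a) \<Rightarrow> ('i \<Rightarrow> int) \<Rightarrow> int \<Rightarrow> 'u monoid" where
  "tw_grp F J a s n = prodgroup J (\<lambda>i. grp F (s i + n) (a i))"

text \<open>The first factor is the differential of the summand shifted by \<open>s j\<close>, with
  the usual sign of a shift. In the second, \<open>twisted\<close> will ensure
  \<open>s i = s j + 1\<close> for nonzero \<open>m i j\<close>, so that \<open>s i + n\<close> and
  \<open>s j + n + 1\<close> are the same degree.\<close>

definition tw_comp :: "('a, 'u::infinite) cochain \<Rightarrow> 'i set \<Rightarrow> ('i \<Rightarrow> 'a) \<Rightarrow> ('i \<Rightarrow> int) \<Rightarrow>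
    ('i \<Rightarrow> 'i \<Rightarrow> int) \<Rightarrow> int \<Rightarrow> 'i \<Rightarrow> 'u \<Rightarrow> 'u" where
  "tw_comp F J a s m n j x =
     cdiff F (s j + n) (a j) (entry J j x) [^]\<^bsub>grp F (s j + n + 1) (a j)\<^esub> parity_sign (s j) \<otimes>\<^bsub>grp F (s j + n + 1) (a j)\<^esub>
     lincomb (grp F (s j + n + 1) (a j)) J (\<lambda>i. m i j) (\<lambda>i. rst F (s i + n) (a i) (a j) (entry J i x))"

definition tw_dif :: "('a, 'u::infinite) cochain \<Rightarrow> 'i set \<Rightarrow> ('i \<Rightarrow> 'a) \<Rightarrow> ('i \<Rightarrow> int) \<Rightarrow>
    ('i \<Rightarrow> 'i \<Rightarrow> int) \<Rightarrow> int \<Rightarrow> 'u \<Rightarrow> 'u" where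
  "tw_dif F J a s m n x = tuple J (\<lambda>j. tw_comp F J a s m n j x)"

definition tw_mor :: "'i set \<Rightarrow> ('i \<Rightarrow> 'a) \<Rightarrow> ('i \<Rightarrow> int) \<Rightarrow> ('a, 'u::infinite) cmor \<Rightarrow> int \<Rightarrow> 'u \<Rightarrow> 'u" where
  "tw_mor J a s \<phi> n x = tuple J (\<lambda>i. \<phi> (s i + n) (a i) (entry J i x))"

text \<open>These conditions make \<open>tw_dif\<close> square to zero: terms quadratic in
  \<open>m\<close> cancel by the last clause, and terms with one differential and one entry of
  \<open>m\<close> cancel because the shift changes parity along a nonzero entry. The same drop of
  the shift makes the matrix triangular, which permits induction over the summands.\<close>

definition twisted :: "'a topology \<Rightarrow> 'i set \<Rightarrow> ('i \<Rightarrow> 'a) \<Rightarrow> ('i \<Rightarrow> int) \<Rightarrow> ('i \<Rightarrow> 'i \<Rightarrow> int) \<Rightarrow> bool" where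
  "twisted X J a s m \<longleftrightarrow> finite J \<and> (\<forall>i\<in>J. a i \<in> topspace X) \<and>
     (\<forall>i\<in>J. \<forall>j\<in>J. m i j \<noteq> 0 \<longrightarrow> s i = s j + 1 \<and> spec_le X (a i) (a j)) \<and>
     (\<forall>i\<in>J. \<forall>k\<in>J. (\<Sum>j\<in>J. m i j * m j k) = 0)"

lemma twistedD:
  assumes "twisted X J a s m"
  shows "finite J" "i \<in> J \<Longrightarrow> a i \<in> topspace X"
    "i \<in> J \<Longrightarrow> j \<in> J \<Longrightarrow> m i j \<noteq> 0 \<Longrightarrow> spec_le X (a i) (a j)"
    "i \<in> J \<Longrightarrow> j \<in> J \<Longrightarrow> m i j \<noteq> 0 \<Longrightarrow> s i = s j + 1"
    "i \<in> J \<Longrightarrow> j \<in> J \<Longrightarrow> m i j \<noteq> 0 \<Longrightarrow> s i + n = s j + n + 1"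
    "i \<in> J \<Longrightarrow> k \<in> J \<Longrightarrow> (\<Sum>j\<in>J. m i j * m j k) = 0"
  using assms by (auto simp: twisted_def)

lemma parity_sign_Suc: "parity_sign (k + 1) = - parity_sign k"
  by (auto simp: parity_sign_def)

context
  fixes X :: "'a topology" and F :: "('a, 'u::infinite) cochain" and J :: "'i set" and a s m
  assumes F: "F \<in> Ob (complex_cat X)" and tw: "twisted X J a s m"
begin

lemma tw_entry_closed: "x \<in> carrier (tw_grp F J a s n) \<Longrightarrow> i \<in> J \<Longrightarrow> entry J i x \<in> carrier (grp F (s i + n) (a i))"
  unfolding tw_grp_def by (rule entry_closed[OF twistedD(1)[OF tw]])

lemma comm_group_tw_grp: "comm_group (tw_grp F J a s n)"
  unfolding tw_grp_def using twistedD(1,2)[OF tw] complex_grp[OF F] by (intro comm_group_prodgroup) auto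

lemma tw_rst_closed:
  assumes "x \<in> carrier (tw_grp F J a s n)" "i \<in> J" "j \<in> J" "m i j \<noteq> 0"
  shows "rst F (s i + n) (a i) (a j) (entry J i x) \<in> carrier (grp F (s j + n + 1) (a j))"
  using complex_rst_closed[OF F twistedD(3)[OF tw assms(2-4)] tw_entry_closed[OF assms(1,2)]]
  unfolding twistedD(5)[OF tw assms(2-4), of n] .

lemma tw_comp_closed:
  assumes x: "x \<in> carrier (tw_grp F J a s n)" and j: "j \<in> J"
  shows "tw_comp F J a s m n j x \<in> carrier (grp F (s j + n + 1) (a j))"
proof -
  note t = twistedD[OF tw]
  interpret G: comm_group "grp F (s j + n + 1) (a j)" by (rule complex_grp[OF F t(2)[OF j]])
  show ?thesis unfolding tw_comp_def
    using complex_cdiff_closed[OF F t(2)[OF j] tw_entry_closed[OF x j]] tw_rst_closed[OF x _ j]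
    by (intro G.m_closed G.int_pow_closed G.lincomb_closed) auto
qed

lemma tw_comp_mult:
  assumes x: "x \<in> carrier (tw_grp F J a s n)" and y: "y \<in> carrier (tw_grp F J a s n)" and j: "j \<in> J"
  shows "tw_comp F J a s m n j (x \<otimes>\<^bsub>tw_grp F J a s n\<^esub> y) =
    tw_comp F J a s m n j x \<otimes>\<^bsub>grp F (s j + n + 1) (a j)\<^esub> tw_comp F J a s m n j y"
proof -
  note t = twistedD[OF tw]
  let ?G = "grp F (s j + n + 1) (a j)"
  interpret G: comm_group ?G by (rule complex_grp[OF F t(2)[OF j]])
  note cx = complex_cdiff_closed[OF F t(2)[OF j] tw_entry_closed[OF x j]] complex_cdiff_closed[OF F t(2)[OF j] tw_entry_closed[OF y j]]
  note cl = tw_rst_closed[OF x _ j] tw_rst_closed[OF y _ j]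
  have e: "entry J i (x \<otimes>\<^bsub>tw_grp F J a s n\<^esub> y) = entry J i x \<otimes>\<^bsub>grp F (s i + n) (a i)\<^esub> entry J i y" if "i \<in> J" for i
    unfolding tw_grp_def using t(1) that by simp
  have 1: "cdiff F (s j + n) (a j) (entry J j (x \<otimes>\<^bsub>tw_grp F J a s n\<^esub> y)) =
    cdiff F (s j + n) (a j) (entry J j x) \<otimes>\<^bsub>?G\<^esub> cdiff F (s j + n) (a j) (entry J j y)"
    unfolding e[OF j] using complex_cdiff_hom[OF F t(2)[OF j]] tw_entry_closed[OF x j] tw_entry_closed[OF y j] by (rule hom_mult)
  have "lincomb ?G J (\<lambda>i. m i j) (\<lambda>i. rst F (s i + n) (a i) (a j) (entry J i (x \<otimes>\<^bsub>tw_grp F J a s n\<^esub> y))) =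
    lincomb ?G J (\<lambda>i. m i j) (\<lambda>i. rst F (s i + n) (a i) (a j) (entry J i x) \<otimes>\<^bsub>?G\<^esub> rst F (s i + n) (a i) (a j) (entry J i y))"
  proof (rule G.lincomb_cong)
    fix i assume i: "i \<in> J" "m i j \<noteq> 0"
    show "rst F (s i + n) (a i) (a j) (entry J i (x \<otimes>\<^bsub>tw_grp F J a s n\<^esub> y)) =
      rst F (s i + n) (a i) (a j) (entry J i x) \<otimes>\<^bsub>?G\<^esub> rst F (s i + n) (a i) (a j) (entry J i y)"
      using hom_mult[OF complex_rst_hom[OF F t(3)[OF i(1) j i(2)], of "s i + n"] tw_entry_closed[OF x i(1)] tw_entry_closed[OF y i(1)]]
      unfolding e[OF i(1)] t(5)[OF i(1) j i(2), of n] .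
  qed (use cl in auto)
  also have "\<dots> = lincomb ?G J (\<lambda>i. m i j) (\<lambda>i. rst F (s i + n) (a i) (a j) (entry J i x)) \<otimes>\<^bsub>?G\<^esub> lincomb ?G J (\<lambda>i. m i j) (\<lambda>i. rst F (s i + n) (a i) (a j) (entry J i y))"
    by (rule G.lincomb_mult) (use cl in auto)
  finally show ?thesis unfolding tw_comp_def 1
    using cx cl G.lincomb_closed[of J "\<lambda>i. m i j"] by (simp add: G.int_pow_distrib G.m_ac)
qed

lemma tw_dif_hom: "tw_dif F J a s m n \<in> hom (tw_grp F J a s n) (tw_grp F J a s (n + 1))"
proof -
  have "(\<lambda>x. tuple J (\<lambda>j. tw_comp F J a s m n j x)) \<in> hom (tw_grp F J a s n) (prodgroup J (\<lambda>i. grp F (s i + (n + 1)) (a i)))"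
    using twistedD(1)[OF tw] tw_comp_closed tw_comp_mult by (intro tuple_hom homI) (auto simp: add.assoc[symmetric])
  then show ?thesis by (simp add: tw_dif_def[abs_def] tw_grp_def)
qed

lemma entry_tw_dif: "j \<in> J \<Longrightarrow> entry J j (tw_dif F J a s m n x) = tw_comp F J a s m n j x"
  unfolding tw_dif_def using twistedD(1)[OF tw] by simp

lemma tw_dif_dif:
  assumes x: "x \<in> carrier (tw_grp F J a s n)"
  shows "tw_dif F J a s m (n + 1) (tw_dif F J a s m n x) = \<one>\<^bsub>tw_grp F J a s (n + 1 + 1)\<^esub>"
proof -
  note t = twistedD[OF tw] and cl = hom_in_carrier[OF tw_dif_hom]
  have "tw_comp F J a s m (n + 1) k (tw_dif F J a s m n x) = \<one>\<^bsub>grp F (s k + n + 1 + 1) (a k)\<^esub>" if k: "k \<in> J" for k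
  proof -
    let ?G1 = "grp F (s k + n + 1) (a k)" and ?G = "grp F (s k + n + 1 + 1) (a k)"
    interpret G1: comm_group ?G1 by (rule complex_grp[OF F t(2)[OF k]])
    interpret G: comm_group ?G by (rule complex_grp[OF F t(2)[OF k]])
    interpret d: group_hom ?G1 ?G "cdiff F (s k + n + 1) (a k)" by unfold_locales (rule complex_cdiff_hom[OF F t(2)[OF k]])
    \<comment> \<open>After expansion at \<open>k\<close>, two kinds of terms are left:
      \<open>w i\<close> with one differential, which arises from both orders of differential and
      matrix, and \<open>v i\<close> with two matrix entries.\<close>
    define w where "w i = cdiff F (s k + n + 1) (a k) (rst F (s i + n) (a i) (a k) (entry J i x))" for i
    define v where "v i = rst F (s i + n) (a i) (a k) (entry J i x)" for i
    have wc: "w i \<in> carrier ?G" if "i \<in> J" "m i k \<noteq> 0" for i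
      unfolding w_def using tw_rst_closed[OF x that(1) k that(2)] by simp
    have vc: "v i \<in> carrier ?G" if "i \<in> J" "j \<in> J" "m i j \<noteq> 0" "m j k \<noteq> 0" for i j
    proof -
      have "spec_le X (a i) (a k)" using t(3)[OF that(1,2,3)] t(3)[OF that(2) k that(4)] by (auto simp: spec_le_def)
      from complex_rst_closed[OF F this tw_entry_closed[OF x that(1)]] show ?thesis
        unfolding v_def t(5)[OF that(1,2,3), of n] t(5)[OF that(2) k that(4), of n] .
    qed
    have e: "entry J k x \<in> carrier (grp F (s k + n) (a k))" by (rule tw_entry_closed[OF x k])
    note ec = complex_cdiff_closed[OF F t(2)[OF k] e]
    have lc: "lincomb ?G1 J (\<lambda>i. m i k) v \<in> carrier ?G1" unfolding v_def by (intro G1.lincomb_closed tw_rst_closed[OF x _ k])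
    have "cdiff F (s k + n + 1) (a k) (tw_comp F J a s m n k x) =
      cdiff F (s k + n + 1) (a k) (cdiff F (s k + n) (a k) (entry J k x)) [^]\<^bsub>?G\<^esub> parity_sign (s k) \<otimes>\<^bsub>?G\<^esub> cdiff F (s k + n + 1) (a k) (lincomb ?G1 J (\<lambda>i. m i k) v)"
      using ec lc unfolding tw_comp_def v_def by (simp add: d.hom_int_pow)
    also have "\<dots> = cdiff F (s k + n + 1) (a k) (lincomb ?G1 J (\<lambda>i. m i k) v)"
      using lc by (simp add: complex_cdiff_cdiff[OF F t(2)[OF k] e] G.int_pow_one')
    also have "\<dots> = lincomb ?G J (\<lambda>i. m i k) w"
      unfolding w_def v_def by (rule G1.lincomb_hom[OF G.comm_group_axioms d.homh t(1)]) (rule tw_rst_closed[OF x _ k])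
    finally have 1: "cdiff F (s k + n + 1) (a k) (tw_comp F J a s m n k x) [^]\<^bsub>?G\<^esub> parity_sign (s k) = lincomb ?G J (\<lambda>i. parity_sign (s k) * m i k) w"
      using G.lincomb_pow[OF t(1)] wc by simp
    have "lincomb ?G J (\<lambda>j. m j k) (\<lambda>j. rst F (s j + n + 1) (a j) (a k) (tw_comp F J a s m n j x)) =
      lincomb ?G J (\<lambda>j. m j k) (\<lambda>j. w j [^]\<^bsub>?G\<^esub> parity_sign (s j) \<otimes>\<^bsub>?G\<^esub> lincomb ?G J (\<lambda>i. m i j) v)"
    proof (rule G.lincomb_cong)
      fix j assume j: "j \<in> J" "m j k \<noteq> 0"
      let ?H = "grp F (s j + n + 1) (a j)"
      have le: "spec_le X (a j) (a k)" by (rule t(3)[OF j(1) k j(2)])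
      interpret H: comm_group ?H by (rule complex_grp[OF F t(2)[OF j(1)]])
      have G: "grp F (s j + n + 1) (a k) = ?G" unfolding t(5)[OF j(1) k j(2), of n] ..
      interpret r: group_hom ?H ?G "rst F (s j + n + 1) (a j) (a k)"
        by unfold_locales (use complex_rst_hom[OF F le, of "s j + n + 1"] G in simp)
      have ej: "entry J j x \<in> carrier (grp F (s j + n) (a j))" by (rule tw_entry_closed[OF x j(1)])
      note ejc = complex_cdiff_closed[OF F t(2)[OF j(1)] ej]
      have lc: "lincomb ?H J (\<lambda>i. m i j) (\<lambda>i. rst F (s i + n) (a i) (a j) (entry J i x)) \<in> carrier ?H"
        by (intro H.lincomb_closed tw_rst_closed[OF x _ j(1)])
      have "rst F (s j + n + 1) (a j) (a k) (tw_comp F J a s m n j x) =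
        rst F (s j + n + 1) (a j) (a k) (cdiff F (s j + n) (a j) (entry J j x)) [^]\<^bsub>?G\<^esub> parity_sign (s j) \<otimes>\<^bsub>?G\<^esub>
        rst F (s j + n + 1) (a j) (a k) (lincomb ?H J (\<lambda>i. m i j) (\<lambda>i. rst F (s i + n) (a i) (a j) (entry J i x)))"
        unfolding tw_comp_def using ejc lc by (simp add: r.hom_int_pow)
      also have "rst F (s j + n + 1) (a j) (a k) (cdiff F (s j + n) (a j) (entry J j x)) = w j"
        using complex_rst_cdiff[OF F le ej] unfolding w_def t(5)[OF j(1) k j(2), of n] .
      also have "rst F (s j + n + 1) (a j) (a k) (lincomb ?H J (\<lambda>i. m i j) (\<lambda>i. rst F (s i + n) (a i) (a j) (entry J i x))) =
        lincomb ?G J (\<lambda>i. m i j) (\<lambda>i. rst F (s j + n + 1) (a j) (a k) (rst F (s i + n) (a i) (a j) (entry J i x)))"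
        by (rule H.lincomb_hom[OF G.comm_group_axioms r.homh t(1)]) (rule tw_rst_closed[OF x _ j(1)])
      also have "\<dots> = lincomb ?G J (\<lambda>i. m i j) v"
      proof (rule G.lincomb_cong)
        fix i assume i: "i \<in> J" "m i j \<noteq> 0"
        show "rst F (s j + n + 1) (a j) (a k) (rst F (s i + n) (a i) (a j) (entry J i x)) = v i"
          using complex_rst_rst[OF F t(3)[OF i(1) j(1) i(2)] le tw_entry_closed[OF x i(1)]]
          unfolding v_def t(5)[OF i(1) j(1) i(2), of n] .
      qed (use vc j in auto)
      finally show "rst F (s j + n + 1) (a j) (a k) (tw_comp F J a s m n j x) = w j [^]\<^bsub>?G\<^esub> parity_sign (s j) \<otimes>\<^bsub>?G\<^esub> lincomb ?G J (\<lambda>i. m i j) v" .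
    next
      fix j assume j: "j \<in> J" "m j k \<noteq> 0"
      show "w j [^]\<^bsub>?G\<^esub> parity_sign (s j) \<otimes>\<^bsub>?G\<^esub> lincomb ?G J (\<lambda>i. m i j) v \<in> carrier ?G"
        using wc[OF j] vc[OF _ j(1) _ j(2)] by (intro G.m_closed G.int_pow_closed G.lincomb_closed)
    qed simp
    also have "\<dots> = lincomb ?G J (\<lambda>j. m j k) (\<lambda>j. w j [^]\<^bsub>?G\<^esub> parity_sign (s j)) \<otimes>\<^bsub>?G\<^esub> lincomb ?G J (\<lambda>j. m j k) (\<lambda>j. lincomb ?G J (\<lambda>i. m i j) v)"
      by (rule G.lincomb_mult) (use wc vc in \<open>auto intro!: G.lincomb_closed\<close>)
    also have "lincomb ?G J (\<lambda>j. m j k) (\<lambda>j. lincomb ?G J (\<lambda>i. m i j) v) = lincomb ?G J (\<lambda>i. \<Sum>j\<in>J. m j k * m i j) v"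
      by (rule G.lincomb_sum[OF t(1) t(1)]) (use vc in auto)
    also have "\<dots> = \<one>\<^bsub>?G\<^esub>" by (rule G.lincomb_zero) (use t(6)[OF _ k] in \<open>simp add: mult.commute\<close>)
    also have "lincomb ?G J (\<lambda>j. m j k) (\<lambda>j. w j [^]\<^bsub>?G\<^esub> parity_sign (s j)) = lincomb ?G J (\<lambda>j. m j k * parity_sign (s j)) w"
      by (rule G.lincomb_pow_arg) (use wc in auto)
    finally have 2: "lincomb ?G J (\<lambda>j. m j k) (\<lambda>j. rst F (s j + n + 1) (a j) (a k) (tw_comp F J a s m n j x)) = lincomb ?G J (\<lambda>j. m j k * parity_sign (s j)) w"
      using G.lincomb_closed[of J "\<lambda>j. m j k * parity_sign (s j)" w] wc by simp
    have "tw_comp F J a s m (n + 1) k (tw_dif F J a s m n x) = lincomb ?G J (\<lambda>i. parity_sign (s k) * m i k) w \<otimes>\<^bsub>?G\<^esub> lincomb ?G J (\<lambda>j. m j k * parity_sign (s j)) w"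
    proof -
      have "lincomb ?G J (\<lambda>j. m j k) (\<lambda>j. rst F (s j + n + 1) (a j) (a k) (entry J j (tw_dif F J a s m n x))) =
        lincomb ?G J (\<lambda>j. m j k) (\<lambda>j. rst F (s j + n + 1) (a j) (a k) (tw_comp F J a s m n j x))"
      proof (rule G.lincomb_cong)
        fix j assume j: "j \<in> J" "m j k \<noteq> 0"
        show "rst F (s j + n + 1) (a j) (a k) (tw_comp F J a s m n j x) \<in> carrier ?G"
          using complex_rst_closed[OF F t(3)[OF j(1) k j(2)] tw_comp_closed[OF x j(1)]] unfolding t(5)[OF j(1) k j(2), of n] .
      qed (auto simp: entry_tw_dif)
      then show ?thesis unfolding tw_comp_def[of _ _ _ _ _ "n + 1"] add.assoc[symmetric] using 1 2 k by (simp add: entry_tw_dif)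
    qed
    also have "\<dots> = lincomb ?G J (\<lambda>i. parity_sign (s k) * m i k + m i k * parity_sign (s i)) w" by (rule G.lincomb_add) (use wc in auto)
    also have "\<dots> = \<one>\<^bsub>?G\<^esub>"
    proof (rule G.lincomb_zero)
      \<comment> \<open>Differentiating before and after applying the matrix carries opposite signs,
        because \<open>s i\<close> and \<open>s k\<close> differ by one when \<open>m i k\<close> is
        nonzero.\<close>
      fix i assume i: "i \<in> J"
      show "parity_sign (s k) * m i k + m i k * parity_sign (s i) = 0" using t(4)[OF i k] by (cases "m i k = 0") (auto simp: parity_sign_Suc)
    qed
    finally show ?thesis .
  qed
  note comp = this
  have 1: "\<one>\<^bsub>tw_grp F J a s (n + 1 + 1)\<^esub> \<in> carrier (tw_grp F J a s (n + 1 + 1))"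
    using comm_group_tw_grp[of "n + 1 + 1"] by (simp add: comm_group_def group.is_monoid monoid.one_closed)
  show ?thesis
  proof (rule prodgroup_eqI[OF t(1)])
    show "tw_dif F J a s m (n + 1) (tw_dif F J a s m n x) \<in> carrier (prodgroup J (\<lambda>i. grp F (s i + (n + 1 + 1)) (a i)))"
      using cl[OF cl[OF x]] unfolding tw_grp_def .
    show "\<one>\<^bsub>tw_grp F J a s (n + 1 + 1)\<^esub> \<in> carrier (prodgroup J (\<lambda>i. grp F (s i + (n + 1 + 1)) (a i)))"
      using 1 unfolding tw_grp_def .
    fix i assume i: "i \<in> J"
    show "entry J i (tw_dif F J a s m (n + 1) (tw_dif F J a s m n x)) = entry J i \<one>\<^bsub>tw_grp F J a s (n + 1 + 1)\<^esub>"
      using comp[OF i] i t(1) by (simp add: entry_tw_dif tw_grp_def add.assoc[symmetric])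
  qed
qed

lemma tw_mor_hom:
  assumes \<phi>: "\<phi> \<in> Hom (complex_cat X) F F'"
  shows "tw_mor J a s \<phi> n \<in> hom (tw_grp F J a s n) (tw_grp F' J a s n)"
proof -
  note t = twistedD[OF tw]
  have "(\<lambda>x. tuple J (\<lambda>i. \<phi> (s i + n) (a i) (entry J i x))) \<in> hom (tw_grp F J a s n) (prodgroup J (\<lambda>i. grp F' (s i + n) (a i)))"
  proof (rule tuple_hom[OF t(1)])
    fix i assume i: "i \<in> J"
    show "(\<lambda>x. \<phi> (s i + n) (a i) (entry J i x)) \<in> hom (tw_grp F J a s n) (grp F' (s i + n) (a i))"
    proof (rule homI)
      fix x y assume x: "x \<in> carrier (tw_grp F J a s n)" and y: "y \<in> carrier (tw_grp F J a s n)"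
      show "\<phi> (s i + n) (a i) (entry J i (x \<otimes>\<^bsub>tw_grp F J a s n\<^esub> y)) =
        \<phi> (s i + n) (a i) (entry J i x) \<otimes>\<^bsub>grp F' (s i + n) (a i)\<^esub> \<phi> (s i + n) (a i) (entry J i y)"
        using hom_mult[OF mor_hom[OF \<phi> t(2)[OF i]] tw_entry_closed[OF x i] tw_entry_closed[OF y i]] t(1) i
        by (simp add: tw_grp_def)
    qed (use mor_closed[OF \<phi> t(2)[OF i]] tw_entry_closed i in blast)
  qed
  then show ?thesis by (simp add: tw_mor_def[abs_def] tw_grp_def)
qed

lemma entry_tw_mor: "i \<in> J \<Longrightarrow> entry J i (tw_mor J a s \<phi> n x) = \<phi> (s i + n) (a i) (entry J i x)"
  unfolding tw_mor_def using twistedD(1)[OF tw] by simp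

lemma tw_comp_mor:
  assumes F': "F' \<in> Ob (complex_cat X)" and \<phi>: "\<phi> \<in> Hom (complex_cat X) F F'"
    and x: "x \<in> carrier (tw_grp F J a s n)" and j: "j \<in> J"
  shows "\<phi> (s j + n + 1) (a j) (tw_comp F J a s m n j x) = tw_comp F' J a s m n j (tw_mor J a s \<phi> n x)"
proof -
  note t = twistedD[OF tw]
  let ?G = "grp F (s j + n + 1) (a j)" and ?G' = "grp F' (s j + n + 1) (a j)"
  interpret G: comm_group ?G by (rule complex_grp[OF F t(2)[OF j]])
  interpret G': comm_group ?G' by (rule complex_grp[OF F' t(2)[OF j]])
  interpret h: group_hom ?G ?G' "\<phi> (s j + n + 1) (a j)" by unfold_locales (rule mor_hom[OF \<phi> t(2)[OF j]])
  have e: "entry J j x \<in> carrier (grp F (s j + n) (a j))" by (rule tw_entry_closed[OF x j])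
  note ec = complex_cdiff_closed[OF F t(2)[OF j] e]
  have lc: "lincomb ?G J (\<lambda>i. m i j) (\<lambda>i. rst F (s i + n) (a i) (a j) (entry J i x)) \<in> carrier ?G"
    by (intro G.lincomb_closed tw_rst_closed[OF x _ j])
  have "\<phi> (s j + n + 1) (a j) (lincomb ?G J (\<lambda>i. m i j) (\<lambda>i. rst F (s i + n) (a i) (a j) (entry J i x))) =
    lincomb ?G' J (\<lambda>i. m i j) (\<lambda>i. \<phi> (s j + n + 1) (a j) (rst F (s i + n) (a i) (a j) (entry J i x)))"
    by (rule G.lincomb_hom[OF G'.comm_group_axioms h.homh t(1)]) (rule tw_rst_closed[OF x _ j])
  also have "\<dots> = lincomb ?G' J (\<lambda>i. m i j) (\<lambda>i. rst F' (s i + n) (a i) (a j) (entry J i (tw_mor J a s \<phi> n x)))"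
  proof (rule G'.lincomb_cong)
    fix i assume i: "i \<in> J" "m i j \<noteq> 0"
    show e: "\<phi> (s j + n + 1) (a j) (rst F (s i + n) (a i) (a j) (entry J i x)) = rst F' (s i + n) (a i) (a j) (entry J i (tw_mor J a s \<phi> n x))"
      unfolding entry_tw_mor[OF i(1)] mor_rst[OF \<phi> t(3)[OF i(1) j i(2)] tw_entry_closed[OF x i(1)]]
      unfolding t(5)[OF i(1) j i(2), of n] ..
    show "rst F' (s i + n) (a i) (a j) (entry J i (tw_mor J a s \<phi> n x)) \<in> carrier ?G'"
      using h.hom_closed[OF tw_rst_closed[OF x i(1) j i(2)]] unfolding e .
  qed simp
  finally show ?thesis unfolding tw_comp_def
    using ec lc mor_cdiff[OF \<phi> t(2)[OF j] e] j by (simp add: h.hom_int_pow entry_tw_mor)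
qed

lemma tw_dif_mor:
  assumes F': "F' \<in> Ob (complex_cat X)" and \<phi>: "\<phi> \<in> Hom (complex_cat X) F F'"
    and x: "x \<in> carrier (tw_grp F J a s n)"
  shows "tw_dif F' J a s m n (tw_mor J a s \<phi> n x) = tw_mor J a s \<phi> (n + 1) (tw_dif F J a s m n x)"
  unfolding tw_dif_def[of F'] tw_mor_def[of _ _ _ _ "n + 1"]
  by (rule tuple_cong) (simp add: entry_tw_dif tw_comp_mor[OF F' \<phi> x, symmetric] add.assoc[symmetric])

end

text \<open>A nonzero entry out of \<open>i0\<close> would lead to an index of smaller shift. So the
  summand \<open>i0\<close> is a subcomplex, and the other summands form the quotient
  complex.\<close>

lemma twisted_remove:
  assumes tw: "twisted X J a s m" and i0: "i0 \<in> J" "\<forall>i\<in>J. s i0 \<le> s i"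
  shows "twisted X (J - {i0}) a s m" "\<And>j. j \<in> J \<Longrightarrow> m i0 j = 0"
proof -
  note t = twistedD[OF tw]
  show z: "m i0 j = 0" if "j \<in> J" for j using t(4)[OF i0(1) that] i0(2) that by force
  have "(\<Sum>j\<in>J - {i0}. m i j * m j k) = 0" if "i \<in> J" "k \<in> J" for i k
    using t(6)[OF that] sum.remove[OF t(1) i0(1), of "\<lambda>j. m i j * m j k"] z[OF that(2)] by simp
  then show "twisted X (J - {i0}) a s m" using tw by (auto simp: twisted_def)
qed

text \<open>Induction on the number of summands, splitting off one of least shift. This gives a
  short exact sequence with a shifted stalk as subcomplex and a smaller twisted sum as quotient, and
  \<open>cone_acyclic_extension\<close> combines the two.\<close>

lemma cone_acyclic_twisted:
  assumes F: "F \<in> Ob (complex_cat X)" and F': "F' \<in> Ob (complex_cat X)" and \<phi>: "\<phi> \<in> quasi_isos X F F'"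
    and tw: "twisted X J a s m"
  shows "cone_acyclic (tw_grp F J a s) (tw_dif F J a s m) (tw_grp F' J a s) (tw_dif F' J a s m) (tw_mor J a s \<phi>)"
  using tw
proof (induction "card J" arbitrary: J)
  case (0 J)
  then have J: "J = {}" using twistedD(1) by fastforce
  have triv: "x = y" if "x \<in> carrier (tw_grp G J a s n)" "y \<in> carrier (tw_grp G J a s n)" for x y n and G :: "('a, 'b) cochain"
  proof (rule prodgroup_eqI)
    show "finite J" by (simp add: J)
    show "x \<in> carrier (prodgroup J (\<lambda>i. grp G (s i + n) (a i)))" "y \<in> carrier (prodgroup J (\<lambda>i. grp G (s i + n) (a i)))"
      using that unfolding tw_grp_def .
  qed (simp add: J)
  have \<phi>H: "\<phi> \<in> Hom (complex_cat X) F F'" using \<phi> by (simp add: quasi_isos_def)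
  show ?case unfolding cone_acyclic_def
  proof (intro allI ballI impI)
    fix n k l assume k: "k \<in> carrier (tw_grp F J a s (n + 1 + 1))" and l: "l \<in> carrier (tw_grp F' J a s (n + 1))"
    interpret G1: comm_group "tw_grp F J a s (n + 1)" by (rule comm_group_tw_grp[OF F 0(2)])
    interpret G0: comm_group "tw_grp F' J a s n" by (rule comm_group_tw_grp[OF F' 0(2)])
    interpret G2: comm_group "tw_grp F' J a s (n + 1)" by (rule comm_group_tw_grp[OF F' 0(2)])
    show "\<exists>k'\<in>carrier (tw_grp F J a s (n + 1)). \<exists>l'\<in>carrier (tw_grp F' J a s n). tw_dif F J a s m (n + 1) k' = k \<and>
      l = tw_mor J a s \<phi> (n + 1) k' \<otimes>\<^bsub>tw_grp F' J a s (n + 1)\<^esub> tw_dif F' J a s m n l'"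
      using hom_in_carrier[OF tw_dif_hom[OF F 0(2)] G1.one_closed] hom_in_carrier[OF tw_dif_hom[OF F' 0(2)] G0.one_closed]
        hom_in_carrier[OF tw_mor_hom[OF F 0(2) \<phi>H] G1.one_closed]
      by (intro bexI[OF _ G1.one_closed] bexI[OF _ G0.one_closed] conjI triv[OF _ k] triv[OF l]) auto
  qed
next
  case (Suc c J)
  note t = twistedD[OF Suc.prems]
  have "s ` J \<noteq> {}" using Suc(2) by auto
  then have "Min (s ` J) \<in> s ` J" using t(1) by simp
  then obtain i0 where "i0 \<in> J" "s i0 = Min (s ` J)" by auto
  then have i0: "i0 \<in> J" "\<forall>i\<in>J. s i0 \<le> s i" using t(1) by simp_all
  let ?J = "J - {i0}"
  note r = twisted_remove[OF Suc.prems i0]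
  have cC: "cone_acyclic (tw_grp F ?J a s) (tw_dif F ?J a s m) (tw_grp F' ?J a s) (tw_dif F' ?J a s m) (tw_mor ?J a s \<phi>)"
    using Suc(2) i0(1) t(1) by (intro Suc.hyps(1) r) simp
  have ai: "a i0 \<in> topspace X" by (rule t(2)[OF i0(1)])
  have \<phi>H: "\<phi> \<in> Hom (complex_cat X) F F'" using \<phi> by (simp add: quasi_isos_def)
  let ?A = "\<lambda>(F :: ('a, 'b) cochain) n. grp F (s i0 + n) (a i0)"
  let ?dA = "\<lambda>(F :: ('a, 'b) cochain) n x. cdiff F (s i0 + n) (a i0) x [^]\<^bsub>grp F (s i0 + n + 1) (a i0)\<^esub> parity_sign (s i0)"
  let ?\<iota> = "\<lambda>(F :: ('a, 'b) cochain) n. inclusion J (\<lambda>i. grp F (s i + n) (a i)) i0"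
  let ?\<pi> = "\<lambda>x. tuple ?J (\<lambda>i. entry J i x) :: 'b"
  have cA: "cone_acyclic (?A F) (?dA F) (?A F') (?dA F') (\<lambda>n. \<phi> (s i0 + n) (a i0))"
    using \<phi> quasi_isos_iff[OF F F'] ai
    by (intro cone_acyclic_shift[where K = "\<lambda>n. grp F n (a i0)" and L = "\<lambda>n. grp F' n (a i0)" and d = "\<lambda>n. cdiff F n (a i0)"
       and d' = "\<lambda>n. cdiff F' n (a i0)" and \<phi> = "\<lambda>n. \<phi> n (a i0)"])
      (auto intro: complex_grp[OF F] complex_grp[OF F'] complex_cdiff_hom[OF F] complex_cdiff_hom[OF F'] mor_hom[OF \<phi>H])
  have dA: "?dA G n \<in> hom (?A G n) (?A G (n + 1))" if G: "G \<in> Ob (complex_cat X)" for G n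
  proof -
    interpret B: comm_group "grp G (s i0 + n + 1) (a i0)" by (rule complex_grp[OF G ai])
    interpret h: group_hom "grp G (s i0 + n) (a i0)" "grp G (s i0 + n + 1) (a i0)" "cdiff G (s i0 + n) (a i0)"
      using complex_grp[OF G ai] complex_cdiff_hom[OF G ai] by (simp add: group_hom_def group_hom_axioms_def comm_group_def)
    show ?thesis unfolding add.assoc[symmetric] by (rule homI) (auto simp: B.int_pow_distrib)
  qed
  have \<iota>: "?\<iota> G n \<in> hom (?A G n) (tw_grp G J a s n)" if G: "G \<in> Ob (complex_cat X)" for G n
    unfolding tw_grp_def by (rule inclusion_hom[OF t(1)]) (rule complex_grp[OF G t(2)])
  have e\<iota>: "entry J i (?\<iota> G n x) = (if i = i0 then x else \<one>\<^bsub>grp G (s i + n) (a i)\<^esub>)" if "i \<in> J" for i n x G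
    using t(1) that by (simp add: inclusion_def)
  have d\<iota>: "?\<iota> G (n + 1) (?dA G n x) = tw_dif G J a s m n (?\<iota> G n x)"
    if G: "G \<in> Ob (complex_cat X)" and x: "x \<in> carrier (?A G n)" for G n x
  proof (rule prodgroup_eqI[OF t(1)])
    show "?\<iota> G (n + 1) (?dA G n x) \<in> carrier (prodgroup J (\<lambda>i. grp G (s i + (n + 1)) (a i)))"
      using hom_in_carrier[OF \<iota>[OF G] hom_in_carrier[OF dA[OF G] x]] by (simp add: tw_grp_def)
    show "tw_dif G J a s m n (?\<iota> G n x) \<in> carrier (prodgroup J (\<lambda>i. grp G (s i + (n + 1)) (a i)))"
      using hom_in_carrier[OF tw_dif_hom[OF G Suc.prems] hom_in_carrier[OF \<iota>[OF G] x]] by (simp add: tw_grp_def)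
    fix j assume j: "j \<in> J"
    interpret B: comm_group "grp G (s j + n + 1) (a j)" by (rule complex_grp[OF G t(2)[OF j]])
    interpret B0: comm_group "grp G (s i0 + n + 1) (a i0)" by (rule complex_grp[OF G ai])
    have lc: "lincomb (grp G (s j + n + 1) (a j)) J (\<lambda>i. m i j) (\<lambda>i. rst G (s i + n) (a i) (a j) (entry J i (?\<iota> G n x))) = \<one>\<^bsub>grp G (s j + n + 1) (a j)\<^esub>"
    proof (rule B.lincomb_one)
      fix i assume i: "i \<in> J" "m i j \<noteq> 0"
      then have "i \<noteq> i0" using r(2)[OF j] by auto
      moreover have "rst G (s i + n) (a i) (a j) \<one>\<^bsub>grp G (s i + n) (a i)\<^esub> = \<one>\<^bsub>grp G (s i + n) (a j)\<^esub>" by (rule complex_rst_one[OF G t(3)[OF i(1) j i(2)]])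
      ultimately show "rst G (s i + n) (a i) (a j) (entry J i (?\<iota> G n x)) = \<one>\<^bsub>grp G (s j + n + 1) (a j)\<^esub>"
        unfolding e\<iota>[OF i(1)] t(5)[OF i(1) j i(2), of n] by simp
    qed
    have d1: "cdiff G (s j + n) (a j) \<one>\<^bsub>grp G (s j + n) (a j)\<^esub> = \<one>\<^bsub>grp G (s j + n + 1) (a j)\<^esub>" by (rule complex_cdiff_one[OF G t(2)[OF j]])
    have c: "cdiff G (s i0 + n) (a i0) x \<in> carrier (grp G (s i0 + n + 1) (a i0))" using complex_cdiff_closed[OF G ai x] .
    show "entry J j (?\<iota> G (n + 1) (?dA G n x)) = entry J j (tw_dif G J a s m n (?\<iota> G n x))"
      unfolding entry_tw_dif[OF G Suc.prems j] tw_comp_def lc e\<iota>[OF j]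
      using c B0.int_pow_closed[OF c] by (cases "j = i0") (auto simp: d1 B.int_pow_one' add.assoc[symmetric])
  qed
  have \<iota>_inj: "x = y" if "x \<in> carrier (?A G n)" "y \<in> carrier (?A G n)" "?\<iota> G n x = ?\<iota> G n y" for G n x y
    using arg_cong[OF that(3), of "entry J i0"] unfolding e\<iota>[OF i0(1)] by simp
  have e\<pi>: "entry ?J i (?\<pi> x) = entry J i x" if "i \<in> ?J" for i x using that t(1) by simp
  have \<pi>: "?\<pi> \<in> hom (tw_grp G J a s n) (tw_grp G ?J a s n)" for G n
    unfolding tw_grp_def using t(1) by (intro tuple_hom) (auto intro: entry_hom)
  have d\<pi>: "?\<pi> (tw_dif G J a s m n x) = tw_dif G ?J a s m n (?\<pi> x)"
    if G: "G \<in> Ob (complex_cat X)" and x: "x \<in> carrier (tw_grp G J a s n)" for G n x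
    unfolding tw_dif_def[of G ?J]
  proof (rule tuple_cong)
    fix j assume j: "j \<in> ?J"
    then have j': "j \<in> J" by simp
    interpret B: comm_group "grp G (s j + n + 1) (a j)" by (rule complex_grp[OF G t(2)[OF j']])
    have "lincomb (grp G (s j + n + 1) (a j)) J (\<lambda>i. m i j) (\<lambda>i. rst G (s i + n) (a i) (a j) (entry J i x)) =
      lincomb (grp G (s j + n + 1) (a j)) ?J (\<lambda>i. m i j) (\<lambda>i. rst G (s i + n) (a i) (a j) (entry J i x))"
      using r(2)[OF j'] tw_rst_closed[OF G Suc.prems x _ j'] by (intro B.lincomb_neutral[OF t(1)]) auto
    also have "\<dots> = lincomb (grp G (s j + n + 1) (a j)) ?J (\<lambda>i. m i j) (\<lambda>i. rst G (s i + n) (a i) (a j) (entry ?J i (?\<pi> x)))"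
      using tw_rst_closed[OF G Suc.prems x _ j'] t(1) by (intro B.lincomb_cong) auto
    finally show "entry J j (tw_dif G J a s m n x) = tw_comp G ?J a s m n j (?\<pi> x)"
      unfolding entry_tw_dif[OF G Suc.prems j'] tw_comp_def using e\<pi>[OF j] by simp
  qed
  have \<pi>_surj: "\<exists>b\<in>carrier (tw_grp G J a s n). ?\<pi> b = c" if G: "G \<in> Ob (complex_cat X)" and c: "c \<in> carrier (tw_grp G ?J a s n)" for G n c
  proof (intro bexI)
    let ?b = "tuple J (\<lambda>i. if i = i0 then \<one>\<^bsub>?A G n\<^esub> else entry ?J i c)"
    have "?\<pi> ?b = tuple ?J (\<lambda>i. entry ?J i c)" by (rule tuple_cong) (use t(1) in simp)
    also have "\<dots> = c" using c t(1) unfolding tw_grp_def by (intro tuple_entry) auto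
    finally show "?\<pi> ?b = c" .
    have "\<one>\<^bsub>?A G n\<^esub> \<in> carrier (?A G n)" by (rule complex_one_closed[OF G ai])
    then show "?b \<in> carrier (tw_grp G J a s n)" unfolding tw_grp_def
      using tw_entry_closed[OF G r(1) c] by (intro tuple_closed) auto
  qed
  have ker: "\<exists>x\<in>carrier (?A G n). ?\<iota> G n x = b" if G: "G \<in> Ob (complex_cat X)" and b: "b \<in> carrier (tw_grp G J a s n)" "?\<pi> b = \<one>\<^bsub>tw_grp G ?J a s n\<^esub>" for G n b
  proof (intro bexI)
    show e: "entry J i0 b \<in> carrier (?A G n)" by (rule tw_entry_closed[OF G Suc.prems b(1) i0(1)])
    have "entry J i b = \<one>\<^bsub>grp G (s i + n) (a i)\<^esub>" if "i \<in> ?J" for i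
      using arg_cong[OF b(2), of "entry ?J i"] that t(1) e\<pi>[OF that, of b] by (simp add: tw_grp_def)
    note z = this
    show "?\<iota> G n (entry J i0 b) = b"
    proof (rule prodgroup_eqI[OF t(1)])
      show "?\<iota> G n (entry J i0 b) \<in> carrier (prodgroup J (\<lambda>i. grp G (s i + n) (a i)))"
        using hom_in_carrier[OF \<iota>[OF G] e] unfolding tw_grp_def .
      show "b \<in> carrier (prodgroup J (\<lambda>i. grp G (s i + n) (a i)))" using b(1) unfolding tw_grp_def .
      fix i assume i: "i \<in> J"
      show "entry J i (?\<iota> G n (entry J i0 b)) = entry J i b" unfolding e\<iota>[OF i] using z[of i] i by auto
    qed
  qed
  show ?case
  proof (rule cone_acyclic_extension[where \<iota> = "?\<iota> F" and \<iota>' = "?\<iota> F'" and \<pi> = "\<lambda>_. ?\<pi>" and \<pi>' = "\<lambda>_. ?\<pi>" and \<alpha> = "\<lambda>n. \<phi> (s i0 + n) (a i0)"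
     and A = "?A F" and A' = "?A F'" and dA = "?dA F" and dA' = "?dA F'", OF _ _ _ _ _ _ _ _ _ _ _ _ _ _ _ _ _ _ _ _ _ _ _ _ _ _ _ _ _ _ _ cA cC])
    fix n x assume x: "x \<in> carrier (tw_grp F J a s n)"
    show "tw_mor ?J a s \<phi> n (?\<pi> x) = ?\<pi> (tw_mor J a s \<phi> n x)" unfolding tw_mor_def[of ?J]
      by (rule tuple_cong) (use t(1) in \<open>auto simp: entry_tw_mor[OF F Suc.prems]\<close>)
    show "tw_mor J a s \<phi> (n + 1) (tw_dif F J a s m n x) = tw_dif F' J a s m n (tw_mor J a s \<phi> n x)"
      by (rule tw_dif_mor[OF F Suc.prems F' \<phi>H x, symmetric])
  next
    fix n x assume x: "x \<in> carrier (?A F n)"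
    show "tw_mor J a s \<phi> n (?\<iota> F n x) = ?\<iota> F' n (\<phi> (s i0 + n) (a i0) x)"
    proof (rule prodgroup_eqI[OF t(1)])
      show "tw_mor J a s \<phi> n (?\<iota> F n x) \<in> carrier (prodgroup J (\<lambda>i. grp F' (s i + n) (a i)))"
        using hom_in_carrier[OF tw_mor_hom[OF F Suc.prems \<phi>H] hom_in_carrier[OF \<iota>[OF F] x]] by (simp add: tw_grp_def)
      show "?\<iota> F' n (\<phi> (s i0 + n) (a i0) x) \<in> carrier (prodgroup J (\<lambda>i. grp F' (s i + n) (a i)))"
        using hom_in_carrier[OF \<iota>[OF F'] mor_closed[OF \<phi>H ai x]] by (simp add: tw_grp_def)
      fix j assume j: "j \<in> J"
      have "\<phi> (s j + n) (a j) \<one>\<^bsub>grp F (s j + n) (a j)\<^esub> = \<one>\<^bsub>grp F' (s j + n) (a j)\<^esub>" by (rule mor_one[OF F F' \<phi>H t(2)[OF j]])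
      then show "entry J j (tw_mor J a s \<phi> n (?\<iota> F n x)) = entry J j (?\<iota> F' n (\<phi> (s i0 + n) (a i0) x))"
        using j by (simp add: entry_tw_mor[OF F Suc.prems] e\<iota>)
    qed
  qed (fact complex_grp[OF F ai] complex_grp[OF F' ai] comm_group_tw_grp[OF F Suc.prems] comm_group_tw_grp[OF F' Suc.prems]
    comm_group_tw_grp[OF F r(1)] comm_group_tw_grp[OF F' r(1)] dA[OF F] dA[OF F'] tw_dif_hom[OF F Suc.prems] tw_dif_hom[OF F' Suc.prems]
    tw_dif_dif[OF F Suc.prems] tw_dif_dif[OF F' Suc.prems] \<iota>[OF F] \<iota>[OF F'] d\<iota>[OF F] d\<iota>[OF F'] \<iota>_inj
    \<pi> d\<pi>[OF F] d\<pi>[OF F'] \<pi>_surj[OF F] \<pi>_surj[OF F'] ker[OF F] ker[OF F'] mor_hom[OF \<phi>H ai] tw_mor_hom[OF F Suc.prems \<phi>H])+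
qed

section \<open>Functors given by finite integer matrices\<close>

text \<open>
  A prekernel describes a functor from complexes on \<open>X\<close> to complexes on \<open>Y\<close> whose value at \<open>y\<close> is
  the direct sum of the stalks \<open>F\<^sub>x\<close>, \<open>x = pk_pt K i y\<close>, shifted by \<open>pk_deg K i\<close>, over the finite set
  \<open>pk_ind K y\<close> of indices \<open>i\<close>, with the differential of \<open>F\<close> perturbed by the integer matrix \<open>pk_mat K\<close>.
  For \<open>y \<le> y'\<close> the summands common to \<open>y\<close> and \<open>y'\<close> are mapped by the restriction maps of \<open>F\<close>, the others to zero.
\<close>

record ('i, 'a, 'b) prekernel =
  pk_ind :: "'b \<Rightarrow> 'i set"
  pk_pt  :: "'i \<Rightarrow> 'b \<Rightarrow> 'a"
  pk_deg :: "'i \<Rightarrow> int"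
  pk_mat :: "'i \<Rightarrow> 'i \<Rightarrow> int"

text \<open>The third clause lets the differential commute with restriction. From summand
  \<open>i\<close> at \<open>y\<close> to summand \<open>j\<close> at \<open>y'\<close> one may
  restrict first, which needs \<open>i\<close> at \<open>y'\<close>, or apply the matrix first,
  which needs \<open>j\<close> at \<open>y\<close>; both routes must exist or neither. The fourth
  clause, convexity of presence, makes restrictions compose: a summand that has disappeared may not
  come back.\<close>

definition is_prekernel :: "'a topology \<Rightarrow> 'b topology \<Rightarrow> ('i, 'a, 'b) prekernel \<Rightarrow> bool" where
  "is_prekernel X Y K \<longleftrightarrow>
     (\<forall>y\<in>topspace Y. twisted X (pk_ind K y) (\<lambda>i. pk_pt K i y) (pk_deg K) (pk_mat K)) \<and>
     (\<forall>y y'. spec_le Y y y' \<longrightarrow> (\<forall>i\<in>pk_ind K y \<inter> pk_ind K y'. spec_le X (pk_pt K i y) (pk_pt K i y'))) \<and>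
     (\<forall>y y'. spec_le Y y y' \<longrightarrow> (\<forall>i\<in>pk_ind K y. \<forall>j\<in>pk_ind K y'. pk_mat K i j \<noteq> 0 \<longrightarrow> (i \<in> pk_ind K y' \<longleftrightarrow> j \<in> pk_ind K y))) \<and>
     (\<forall>y y' y''. spec_le Y y y' \<longrightarrow> spec_le Y y' y'' \<longrightarrow> pk_ind K y \<inter> pk_ind K y'' \<subseteq> pk_ind K y')"

lemma prekernelD:
  assumes "is_prekernel X Y K"
  shows "y \<in> topspace Y \<Longrightarrow> twisted X (pk_ind K y) (\<lambda>i. pk_pt K i y) (pk_deg K) (pk_mat K)"
    "spec_le Y y y' \<Longrightarrow> i \<in> pk_ind K y \<Longrightarrow> i \<in> pk_ind K y' \<Longrightarrow> spec_le X (pk_pt K i y) (pk_pt K i y')"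
    "spec_le Y y y' \<Longrightarrow> i \<in> pk_ind K y \<Longrightarrow> j \<in> pk_ind K y' \<Longrightarrow> pk_mat K i j \<noteq> 0 \<Longrightarrow> i \<in> pk_ind K y' \<longleftrightarrow> j \<in> pk_ind K y"
    "spec_le Y y y' \<Longrightarrow> spec_le Y y' y'' \<Longrightarrow> i \<in> pk_ind K y \<Longrightarrow> i \<in> pk_ind K y'' \<Longrightarrow> i \<in> pk_ind K y'"
  using assms unfolding is_prekernel_def by blast+

definition pk_grp :: "('i, 'a, 'b) prekernel \<Rightarrow> ('a, 'u::infinite) cochain \<Rightarrow> int \<Rightarrow> 'b \<Rightarrow> 'u monoid" where
  "pk_grp K F n y = tw_grp F (pk_ind K y) (\<lambda>i. pk_pt K i y) (pk_deg K) n"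

definition pk_rst :: "('i, 'a, 'b) prekernel \<Rightarrow> ('a, 'u::infinite) cochain \<Rightarrow> int \<Rightarrow> 'b \<Rightarrow> 'b \<Rightarrow> 'u \<Rightarrow> 'u" where
  "pk_rst K F n y y' x = tuple (pk_ind K y') (\<lambda>i. if i \<in> pk_ind K y
     then rst F (pk_deg K i + n) (pk_pt K i y) (pk_pt K i y') (entry (pk_ind K y) i x)
     else \<one>\<^bsub>grp F (pk_deg K i + n) (pk_pt K i y')\<^esub>)"

definition pk_dif :: "('i, 'a, 'b) prekernel \<Rightarrow> ('a, 'u::infinite) cochain \<Rightarrow> int \<Rightarrow> 'b \<Rightarrow> 'u \<Rightarrow> 'u" where
  "pk_dif K F n y = tw_dif F (pk_ind K y) (\<lambda>i. pk_pt K i y) (pk_deg K) (pk_mat K) n"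

definition pk_mor :: "('i, 'a, 'b) prekernel \<Rightarrow> ('a, 'u::infinite) cmor \<Rightarrow> int \<Rightarrow> 'b \<Rightarrow> 'u \<Rightarrow> 'u" where
  "pk_mor K \<phi> n y = tw_mor (pk_ind K y) (\<lambda>i. pk_pt K i y) (pk_deg K) \<phi> n"

definition pk_ftor :: "'b topology \<Rightarrow> ('i, 'a, 'b) prekernel \<Rightarrow>
    (('a, 'u::infinite) cochain, ('a, 'u) cmor, ('b, 'u) cochain, ('b, 'u) cmor) ftor" where
  "pk_ftor Y K = \<lparr>fob = \<lambda>F. \<lparr>
       cterm = \<lambda>n. \<lparr>stalk = pk_grp K F n, res = \<lambda>y y'. restrict (pk_rst K F n y y') (carrier (pk_grp K F n y))\<rparr>,
       cdiff = \<lambda>n. \<lambda>y\<in>topspace Y. restrict (pk_dif K F n y) (carrier (pk_grp K F n y))\<rparr>,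
     far = \<lambda>F G \<phi> n. \<lambda>y\<in>topspace Y. restrict (pk_mor K \<phi> n y) (carrier (pk_grp K F n y))\<rparr>"

lemma pk_ftor_simps [simp]:
  "grp (fob (pk_ftor Y K) F) n y = pk_grp K F n y"
  "x \<in> carrier (pk_grp K F n y) \<Longrightarrow> rst (fob (pk_ftor Y K) F) n y y' x = pk_rst K F n y y' x"
  "y \<in> topspace Y \<Longrightarrow> x \<in> carrier (pk_grp K F n y) \<Longrightarrow> cdiff (fob (pk_ftor Y K) F) n y x = pk_dif K F n y x"
  "y \<in> topspace Y \<Longrightarrow> x \<in> carrier (pk_grp K F n y) \<Longrightarrow> far (pk_ftor Y K) F G \<phi> n y x = pk_mor K \<phi> n y x"
  by (simp_all add: pk_ftor_def)

lemma restrict_ghom: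
  assumes "h \<in> hom A B" "comm_group A" shows "restrict h (carrier A) \<in> ghom A B"
proof -
  have "x \<otimes>\<^bsub>A\<^esub> y \<in> carrier A" if "x \<in> carrier A" "y \<in> carrier A" for x y
    using assms(2) that by (simp add: comm_group_def comm_monoid_def monoid.m_closed)
  then show ?thesis using assms(1) by (auto simp: ghom_iff hom_def)
qed

context
  fixes X :: "'a topology" and Y :: "'b topology" and K :: "('i, 'a, 'b) prekernel" and F :: "('a, 'u::infinite) cochain"
  assumes K: "is_prekernel X Y K" and F: "F \<in> Ob (complex_cat X)"
begin

lemma pk_finite: "y \<in> topspace Y \<Longrightarrow> finite (pk_ind K y)"
  using twistedD(1)[OF prekernelD(1)[OF K]] .

lemma pk_pt_in: "y \<in> topspace Y \<Longrightarrow> i \<in> pk_ind K y \<Longrightarrow> pk_pt K i y \<in> topspace X"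
  using twistedD(2)[OF prekernelD(1)[OF K]] .

lemma comm_group_pk_grp: "y \<in> topspace Y \<Longrightarrow> comm_group (pk_grp K F n y)"
  unfolding pk_grp_def by (rule comm_group_tw_grp[OF F prekernelD(1)[OF K]])

lemma pk_entry_closed: "y \<in> topspace Y \<Longrightarrow> x \<in> carrier (pk_grp K F n y) \<Longrightarrow> i \<in> pk_ind K y \<Longrightarrow>
    entry (pk_ind K y) i x \<in> carrier (grp F (pk_deg K i + n) (pk_pt K i y))"
  unfolding pk_grp_def by (rule tw_entry_closed[OF F prekernelD(1)[OF K]])

lemma pk_eqI:
  assumes "y \<in> topspace Y" "x \<in> carrier (pk_grp K F n y)" "x' \<in> carrier (pk_grp K F n y)"
    "\<And>i. i \<in> pk_ind K y \<Longrightarrow> entry (pk_ind K y) i x = entry (pk_ind K y) i x'"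
  shows "x = x'"
  by (rule prodgroup_eqI[OF pk_finite[OF assms(1)] assms(2)[unfolded pk_grp_def tw_grp_def] assms(3)[unfolded pk_grp_def tw_grp_def] assms(4)])

lemma pk_tuple_closed:
  "(\<And>i. i \<in> pk_ind K y \<Longrightarrow> u i \<in> carrier (grp F (pk_deg K i + n) (pk_pt K i y))) \<Longrightarrow>
    tuple (pk_ind K y) u \<in> carrier (pk_grp K F n y)"
  unfolding pk_grp_def tw_grp_def by (rule tuple_closed)

lemma pk_rst_hom:
  assumes yy': "spec_le Y y y'" shows "pk_rst K F n y y' \<in> hom (pk_grp K F n y) (pk_grp K F n y')"
proof -
  have y: "y \<in> topspace Y" "y' \<in> topspace Y" using yy' by (auto dest: spec_leD)
  have "(\<lambda>x. tuple (pk_ind K y') (\<lambda>i. if i \<in> pk_ind K y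
     then rst F (pk_deg K i + n) (pk_pt K i y) (pk_pt K i y') (entry (pk_ind K y) i x)
     else \<one>\<^bsub>grp F (pk_deg K i + n) (pk_pt K i y')\<^esub>)) \<in> hom (pk_grp K F n y) (prodgroup (pk_ind K y') (\<lambda>i. grp F (pk_deg K i + n) (pk_pt K i y')))"
  proof (rule tuple_hom[OF pk_finite[OF y(2)]])
    fix i assume i: "i \<in> pk_ind K y'"
    interpret G: comm_group "grp F (pk_deg K i + n) (pk_pt K i y')" by (rule complex_grp[OF F pk_pt_in[OF y(2) i]])
    show "(\<lambda>x. if i \<in> pk_ind K y
     then rst F (pk_deg K i + n) (pk_pt K i y) (pk_pt K i y') (entry (pk_ind K y) i x)
     else \<one>\<^bsub>grp F (pk_deg K i + n) (pk_pt K i y')\<^esub>) \<in> hom (pk_grp K F n y) (grp F (pk_deg K i + n) (pk_pt K i y'))"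
    proof (cases "i \<in> pk_ind K y")
      case True
      note le = prekernelD(2)[OF K yy' True i]
      have "rst F (pk_deg K i + n) (pk_pt K i y) (pk_pt K i y') (entry (pk_ind K y) i (u \<otimes>\<^bsub>pk_grp K F n y\<^esub> v)) =
        rst F (pk_deg K i + n) (pk_pt K i y) (pk_pt K i y') (entry (pk_ind K y) i u) \<otimes>\<^bsub>grp F (pk_deg K i + n) (pk_pt K i y')\<^esub>
        rst F (pk_deg K i + n) (pk_pt K i y) (pk_pt K i y') (entry (pk_ind K y) i v)"
        if "u \<in> carrier (pk_grp K F n y)" "v \<in> carrier (pk_grp K F n y)" for u v
        using hom_mult[OF complex_rst_hom[OF F le] pk_entry_closed[OF y(1) that(1) True] pk_entry_closed[OF y(1) that(2) True]]
          pk_finite[OF y(1)] True by (simp add: pk_grp_def tw_grp_def)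
      then show ?thesis using True complex_rst_closed[OF F le] pk_entry_closed[OF y(1) _ True] by (auto intro!: homI)
    qed (auto intro!: homI)
  qed
  then show ?thesis by (simp add: pk_rst_def[abs_def] pk_grp_def tw_grp_def)
qed

lemma pk_rst_closed: "spec_le Y y y' \<Longrightarrow> x \<in> carrier (pk_grp K F n y) \<Longrightarrow> pk_rst K F n y y' x \<in> carrier (pk_grp K F n y')"
  by (rule hom_in_carrier[OF pk_rst_hom])

lemma pk_dif_hom: "y \<in> topspace Y \<Longrightarrow> pk_dif K F n y \<in> hom (pk_grp K F n y) (pk_grp K F (n + 1) y)"
  unfolding pk_dif_def pk_grp_def by (rule tw_dif_hom[OF F prekernelD(1)[OF K]])

lemma pk_dif_closed: "y \<in> topspace Y \<Longrightarrow> x \<in> carrier (pk_grp K F n y) \<Longrightarrow> pk_dif K F n y x \<in> carrier (pk_grp K F (n + 1) y)"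
  by (rule hom_in_carrier[OF pk_dif_hom])

lemma entry_pk_rst: "y' \<in> topspace Y \<Longrightarrow> i \<in> pk_ind K y' \<Longrightarrow> entry (pk_ind K y') i (pk_rst K F n y y' x) = (if i \<in> pk_ind K y
     then rst F (pk_deg K i + n) (pk_pt K i y) (pk_pt K i y') (entry (pk_ind K y) i x)
     else \<one>\<^bsub>grp F (pk_deg K i + n) (pk_pt K i y')\<^esub>)"
  unfolding pk_rst_def using pk_finite by simp

lemma entry_pk_dif: "y \<in> topspace Y \<Longrightarrow> j \<in> pk_ind K y \<Longrightarrow> entry (pk_ind K y) j (pk_dif K F n y x) =
    tw_comp F (pk_ind K y) (\<lambda>i. pk_pt K i y) (pk_deg K) (pk_mat K) n j x"
  unfolding pk_dif_def by (rule entry_tw_dif[OF F prekernelD(1)[OF K]])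

lemma pk_dif_rst:
  assumes yy': "spec_le Y y y'" and x: "x \<in> carrier (pk_grp K F n y)"
  shows "pk_rst K F (n + 1) y y' (pk_dif K F n y x) = pk_dif K F n y' (pk_rst K F n y y' x)"
proof -
  have y: "y \<in> topspace Y" "y' \<in> topspace Y" using yy' by (auto dest: spec_leD)
  let ?s = "pk_deg K" and ?m = "pk_mat K" and ?J = "pk_ind K y" and ?J' = "pk_ind K y'"
  let ?p = "\<lambda>i. pk_pt K i y" and ?p' = "\<lambda>i. pk_pt K i y'"
  note t = twistedD[OF prekernelD(1)[OF K y(1)]] and t' = twistedD[OF prekernelD(1)[OF K y(2)]]
  let ?z = "pk_rst K F n y y' x"
  note z = pk_rst_closed[OF yy' x]
  note x' = x[unfolded pk_grp_def] and z' = z[unfolded pk_grp_def]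
  have comp: "(if j \<in> ?J then rst F (?s j + n + 1) (?p j) (?p' j) (tw_comp F ?J ?p ?s ?m n j x) else \<one>\<^bsub>grp F (?s j + n + 1) (?p' j)\<^esub>) =
    tw_comp F ?J' ?p' ?s ?m n j ?z" if j: "j \<in> ?J'" for j
  proof -
    let ?G = "grp F (?s j + n + 1) (?p' j)"
    interpret G: comm_group ?G by (rule complex_grp[OF F t'(2)[OF j]])
    let ?v = "\<lambda>i. rst F (?s i + n) (?p' i) (?p' j) (entry ?J' i ?z)"
    have v1: "?v i = \<one>\<^bsub>?G\<^esub>" if i: "i \<in> ?J'" "i \<notin> ?J" "?m i j \<noteq> 0" for i
    proof -
      have "entry ?J' i ?z = \<one>\<^bsub>grp F (?s i + n) (?p' i)\<^esub>" using entry_pk_rst[OF y(2) i(1)] i(2) by simp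
      then show ?thesis using complex_rst_one[OF F t'(3)[OF i(1) j i(3)], of "?s i + n"] unfolding t'(5)[OF i(1) j i(3), of n] by simp
    qed
    have v2: "?v i = rst F (?s i + n) (?p i) (?p' j) (entry ?J i x)" if i: "i \<in> ?J'" "i \<in> ?J" "?m i j \<noteq> 0" for i
      using complex_rst_rst[OF F prekernelD(2)[OF K yy' i(2,1)] t'(3)[OF i(1) j i(3)] pk_entry_closed[OF y(1) x i(2)]]
        entry_pk_rst[OF y(2) i(1), of n y x] i(2) by simp
    have vc: "?v i \<in> carrier ?G" if i: "i \<in> ?J'" "?m i j \<noteq> 0" for i
      by (rule tw_rst_closed[OF F prekernelD(1)[OF K y(2)] z' i(1) j i(2)])
    have L: "lincomb ?G ?J' (\<lambda>i. ?m i j) ?v = lincomb ?G (?J \<inter> ?J') (\<lambda>i. ?m i j) ?v"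
      using t'(1) v1 vc by (intro G.lincomb_neutral) auto
    show ?thesis
    proof (cases "j \<in> ?J")
      case False
      \<comment> \<open>A summand \<open>j\<close> that is new at \<open>y'\<close> must receive
        nothing: an index present at both points with an entry into \<open>j\<close> would force
        \<open>j\<close> to be present at \<open>y\<close>.\<close>
      have "?m i j = 0" if "i \<in> ?J" "i \<in> ?J'" for i
        using prekernelD(3)[OF K yy' that(1) j] that(2) False by blast
      then have "lincomb ?G (?J \<inter> ?J') (\<lambda>i. ?m i j) ?v = \<one>\<^bsub>?G\<^esub>" by (intro G.lincomb_zero) auto
      moreover have "entry ?J' j ?z = \<one>\<^bsub>grp F (?s j + n) (?p' j)\<^esub>" using entry_pk_rst[OF y(2) j] False by simp
      ultimately show ?thesis using False complex_cdiff_one[OF F t'(2)[OF j], of "?s j + n"] unfolding tw_comp_def L by (simp add: G.int_pow_one')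
    next
      case True
      note le = prekernelD(2)[OF K yy' True j]
      let ?H = "grp F (?s j + n + 1) (?p j)"
      interpret H: comm_group ?H by (rule complex_grp[OF F t(2)[OF True]])
      interpret r: group_hom ?H ?G "rst F (?s j + n + 1) (?p j) (?p' j)" by unfold_locales (rule complex_rst_hom[OF F le])
      let ?w = "\<lambda>i. rst F (?s i + n) (?p i) (?p j) (entry ?J i x)"
      have wc: "?w i \<in> carrier ?H" if i: "i \<in> ?J" "?m i j \<noteq> 0" for i
        by (rule tw_rst_closed[OF F prekernelD(1)[OF K y(1)] x' i(1) True i(2)])
      have e: "entry ?J j x \<in> carrier (grp F (?s j + n) (?p j))" by (rule pk_entry_closed[OF y(1) x True])
      have e': "entry ?J' j ?z = rst F (?s j + n) (?p j) (?p' j) (entry ?J j x)" using entry_pk_rst[OF y(2) j] True by simp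
      have ij: "i \<in> ?J'" if "i \<in> ?J" "?m i j \<noteq> 0" for i using prekernelD(3)[OF K yy' that(1) j that(2)] True by blast
      have "rst F (?s j + n + 1) (?p j) (?p' j) (lincomb ?H ?J (\<lambda>i. ?m i j) ?w) =
        lincomb ?G ?J (\<lambda>i. ?m i j) (\<lambda>i. rst F (?s j + n + 1) (?p j) (?p' j) (?w i))"
        by (rule H.lincomb_hom[OF G.comm_group_axioms r.homh t(1) wc])
      also have "\<dots> = lincomb ?G ?J (\<lambda>i. ?m i j) ?v"
      proof (rule G.lincomb_cong)
        fix i assume i: "i \<in> ?J" "?m i j \<noteq> 0"
        show "rst F (?s j + n + 1) (?p j) (?p' j) (?w i) = ?v i"
          unfolding v2[OF ij[OF i] i] using complex_rst_rst[OF F t(3)[OF i(1) True i(2)] le pk_entry_closed[OF y(1) x i(1)]]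
          unfolding t(5)[OF i(1) True i(2), of n] .
      qed (use vc ij in auto)
      also have "\<dots> = lincomb ?G (?J \<inter> ?J') (\<lambda>i. ?m i j) ?v" using t(1) ij vc by (intro G.lincomb_neutral) auto
      finally have l: "rst F (?s j + n + 1) (?p j) (?p' j) (lincomb ?H ?J (\<lambda>i. ?m i j) ?w) = lincomb ?G ?J' (\<lambda>i. ?m i j) ?v" unfolding L .
      show ?thesis
        using True complex_cdiff_closed[OF F t(2)[OF True] e] H.lincomb_closed[of ?J "\<lambda>i. ?m i j" ?w] wc complex_rst_cdiff[OF F le e]
        by (simp add: tw_comp_def r.hom_int_pow l e')
    qed
  qed
  show ?thesis
  proof (rule pk_eqI[OF y(2)])
    show "pk_rst K F (n + 1) y y' (pk_dif K F n y x) \<in> carrier (pk_grp K F (n + 1) y')" by (rule pk_rst_closed[OF yy' pk_dif_closed[OF y(1) x]])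
    show "pk_dif K F n y' ?z \<in> carrier (pk_grp K F (n + 1) y')" by (rule pk_dif_closed[OF y(2) z])
    fix j assume j: "j \<in> ?J'"
    show "entry ?J' j (pk_rst K F (n + 1) y y' (pk_dif K F n y x)) = entry ?J' j (pk_dif K F n y' ?z)"
      unfolding entry_pk_rst[OF y(2) j] entry_pk_dif[OF y(2) j] comp[OF j, symmetric]
      by (simp add: entry_pk_dif[OF y(1)] add.assoc[symmetric])
  qed
qed

lemma pk_rst_rst:
  assumes le: "spec_le Y y y'" "spec_le Y y' y''" and x: "x \<in> carrier (pk_grp K F n y)"
  shows "pk_rst K F n y' y'' (pk_rst K F n y y' x) = pk_rst K F n y y'' x"
proof -
  have y: "y \<in> topspace Y" "y' \<in> topspace Y" "y'' \<in> topspace Y" and le': "spec_le Y y y''" using le by (auto simp: spec_le_def)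
  show ?thesis
  proof (rule pk_eqI[OF y(3)])
    show "pk_rst K F n y' y'' (pk_rst K F n y y' x) \<in> carrier (pk_grp K F n y'')" by (rule pk_rst_closed[OF le(2) pk_rst_closed[OF le(1) x]])
    show "pk_rst K F n y y'' x \<in> carrier (pk_grp K F n y'')" by (rule pk_rst_closed[OF le' x])
    fix i assume i: "i \<in> pk_ind K y''"
    show "entry (pk_ind K y'') i (pk_rst K F n y' y'' (pk_rst K F n y y' x)) = entry (pk_ind K y'') i (pk_rst K F n y y'' x)"
    proof (cases "i \<in> pk_ind K y'")
      case i': True
      show ?thesis
      proof (cases "i \<in> pk_ind K y")
        case True
        show ?thesis unfolding entry_pk_rst[OF y(3) i] entry_pk_rst[OF y(2) i'] using True i'
          complex_rst_rst[OF F prekernelD(2)[OF K le(1) True i'] prekernelD(2)[OF K le(2) i' i] pk_entry_closed[OF y(1) x True]] by simp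
      next
        case False
        show ?thesis unfolding entry_pk_rst[OF y(3) i] entry_pk_rst[OF y(2) i'] using False i'
          complex_rst_one[OF F prekernelD(2)[OF K le(2) i' i]] by simp
      qed
    next
      case False
      \<comment> \<open>Convexity: a summand of \<open>y''\<close> that is missing at
        \<open>y'\<close> is missing at \<open>y\<close> too, so both sides are neutral
        there.\<close>
      then have "i \<notin> pk_ind K y" using prekernelD(4)[OF K le _ i] by blast
      then show ?thesis unfolding entry_pk_rst[OF y(3) i] using False by simp
    qed
  qed
qed

lemma pk_rst_refl:
  assumes y: "y \<in> topspace Y" and x: "x \<in> carrier (pk_grp K F n y)"
  shows "pk_rst K F n y y x = x"
proof (rule pk_eqI[OF y pk_rst_closed[OF spec_le_refl[OF y] x] x])
  fix i assume i: "i \<in> pk_ind K y"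
  show "entry (pk_ind K y) i (pk_rst K F n y y x) = entry (pk_ind K y) i x"
    unfolding entry_pk_rst[OF y i] using i complex_rst_refl[OF F pk_pt_in[OF y i] pk_entry_closed[OF y x i]] by simp
qed

lemma pk_fob: "fob (pk_ftor Y K) F \<in> Ob (complex_cat Y)"
proof (rule complexI, goal_cases)
  case (1 n y) then show ?case by (simp add: comm_group_pk_grp)
next
  case (2 n y y') then show ?case using restrict_ghom[OF pk_rst_hom[OF 2] comm_group_pk_grp] by (auto simp: pk_ftor_def dest: spec_leD)
next
  case (3 n y x) then show ?case by (simp add: pk_rst_refl)
next
  case (4 n y y' y'' x) then show ?case using pk_rst_closed[OF 4(1)] by (simp add: pk_rst_rst)
next
  case (5 n) then show ?case by (simp add: pk_ftor_def)
next
  case (6 n y) then show ?case using restrict_ghom[OF pk_dif_hom[OF 6] comm_group_pk_grp[OF 6]] by (simp add: pk_ftor_def)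
next
  case (7 n y y' x)
  have y: "y \<in> topspace Y" "y' \<in> topspace Y" using 7 by (auto dest: spec_leD)
  then show ?case using 7 pk_rst_closed[OF 7(1)] pk_dif_closed[OF y(1)] by (simp add: pk_dif_rst)
next
  case (8 n y x)
  then show ?case using pk_dif_closed[OF 8(1)] tw_dif_dif[OF F prekernelD(1)[OF K 8(1)]]
    by (simp add: pk_grp_def pk_dif_def)
qed

lemma pk_mor_hom: "\<phi> \<in> Hom (complex_cat X) F G \<Longrightarrow> y \<in> topspace Y \<Longrightarrow> pk_mor K \<phi> n y \<in> hom (pk_grp K F n y) (pk_grp K G n y)"
  unfolding pk_mor_def pk_grp_def by (rule tw_mor_hom[OF F prekernelD(1)[OF K]])

lemma pk_mor_closed: "\<phi> \<in> Hom (complex_cat X) F G \<Longrightarrow> y \<in> topspace Y \<Longrightarrow> x \<in> carrier (pk_grp K F n y) \<Longrightarrow>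
    pk_mor K \<phi> n y x \<in> carrier (pk_grp K G n y)"
  by (rule hom_in_carrier[OF pk_mor_hom])

lemma entry_pk_mor: "y \<in> topspace Y \<Longrightarrow> i \<in> pk_ind K y \<Longrightarrow> entry (pk_ind K y) i (pk_mor K \<phi> n y x) = \<phi> (pk_deg K i + n) (pk_pt K i y) (entry (pk_ind K y) i x)"
  unfolding pk_mor_def by (rule entry_tw_mor[OF F prekernelD(1)[OF K]])

end

lemma pk_far:
  fixes F G :: "('a, 'u::infinite) cochain"
  assumes K: "is_prekernel X Y K" and F: "F \<in> Ob (complex_cat X)" and G: "G \<in> Ob (complex_cat X)"
    and \<phi>: "\<phi> \<in> Hom (complex_cat X) F G"
  shows "far (pk_ftor Y K) F G \<phi> \<in> Hom (complex_cat Y) (fob (pk_ftor Y K) F) (fob (pk_ftor Y K) G)"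
proof (rule complex_HomI, goal_cases)
  case (1 n) then show ?case by (simp add: pk_ftor_def)
next
  case (2 n y) then show ?case using restrict_ghom[OF pk_mor_hom[OF K F \<phi> 2] comm_group_pk_grp[OF K F 2]] by (simp add: pk_ftor_def)
next
  case (3 n y y' x)
  have y: "y \<in> topspace Y" "y' \<in> topspace Y" using 3 by (auto dest: spec_leD)
  have x: "x \<in> carrier (pk_grp K F n y)" using 3 by simp
  note xc = pk_mor_closed[OF K F \<phi> y(1) x] pk_rst_closed[OF K F 3(1) x]
  have "pk_rst K G n y y' (pk_mor K \<phi> n y x) = pk_mor K \<phi> n y' (pk_rst K F n y y' x)"
  proof (rule pk_eqI[OF K G y(2) pk_rst_closed[OF K G 3(1) xc(1)] pk_mor_closed[OF K F \<phi> y(2) xc(2)]])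
    fix i assume i: "i \<in> pk_ind K y'"
    have "\<phi> m (pk_pt K i y') \<one>\<^bsub>grp F m (pk_pt K i y')\<^esub> = \<one>\<^bsub>grp G m (pk_pt K i y')\<^esub>" for m by (rule mor_one[OF F G \<phi> pk_pt_in[OF K F y(2) i]])
    then show "entry (pk_ind K y') i (pk_rst K G n y y' (pk_mor K \<phi> n y x)) = entry (pk_ind K y') i (pk_mor K \<phi> n y' (pk_rst K F n y y' x))"
      unfolding entry_pk_rst[OF K G y(2) i] entry_pk_mor[OF K F y(2) i] entry_pk_rst[OF K F y(2) i]
      using mor_rst[OF \<phi> prekernelD(2)[OF K 3(1) _ i] pk_entry_closed[OF K F y(1) x]] by (simp add: entry_pk_mor[OF K F y(1)])
  qed
  then show ?case using xc x y by simp
next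
  case (4 n y x)
  have x: "x \<in> carrier (pk_grp K F n y)" using 4 by simp
  note xc = pk_mor_closed[OF K F \<phi> 4(1) x] pk_dif_closed[OF K F 4(1) x]
  show ?case using xc x 4(1) tw_dif_mor[OF F prekernelD(1)[OF K 4(1)] G \<phi> x[unfolded pk_grp_def]] by (simp add: pk_mor_def pk_dif_def)
qed

lemma pk_functor:
  assumes K: "is_prekernel X Y K"
  shows "is_functor (complex_cat X) (complex_cat Y) (pk_ftor Y K :: (('a, 'u::infinite) cochain, _, _, _) ftor)"
  unfolding is_functor_def
proof (intro conjI ballI pk_fob[OF K] pk_far[OF K])
  have cX: "is_category (complex_cat X)" and cY: "is_category (complex_cat Y)" by (rule is_category_complex_cat)+
  fix F :: "('a, 'u) cochain" assume F: "F \<in> Ob (complex_cat X)"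
  show "far (pk_ftor Y K) F F (Idn (complex_cat X) F) = Idn (complex_cat Y) (fob (pk_ftor Y K) F)"
  proof (rule complex_mor_eqI[OF pk_far[OF K F F cat_Idn[OF cX F]] cat_Idn[OF cY pk_fob[OF K F]]])
    fix n y x assume y: "y \<in> topspace Y" and "x \<in> carrier (grp (fob (pk_ftor Y K) F) n y)"
    then have x: "x \<in> carrier (pk_grp K F n y)" by simp
    have "pk_mor K (Idn (complex_cat X) F) n y x = x"
    proof (rule pk_eqI[OF K F y pk_mor_closed[OF K F cat_Idn[OF cX F] y x] x])
      fix i assume i: "i \<in> pk_ind K y"
      show "entry (pk_ind K y) i (pk_mor K (Idn (complex_cat X) F) n y x) = entry (pk_ind K y) i x"
        unfolding entry_pk_mor[OF K F y i] using pk_entry_closed[OF K F y x i] pk_pt_in[OF K F y i] by simp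
    qed
    then show "far (pk_ftor Y K) F F (Idn (complex_cat X) F) n y x = Idn (complex_cat Y) (fob (pk_ftor Y K) F) n y x" using y x by simp
  qed
  fix G H \<phi> \<psi> assume G: "G \<in> Ob (complex_cat X)" and H: "H \<in> Ob (complex_cat X)"
    and \<phi>: "\<phi> \<in> Hom (complex_cat X) F G" and \<psi>: "\<psi> \<in> Hom (complex_cat X) G H"
  let ?c = "Cmp (complex_cat X) F G H \<psi> \<phi>"
  note c = cat_Cmp[OF cX F G H \<phi> \<psi>] and f = pk_far[OF K F G \<phi>] and g = pk_far[OF K G H \<psi>]
  show "far (pk_ftor Y K) F H ?c = Cmp (complex_cat Y) (fob (pk_ftor Y K) F) (fob (pk_ftor Y K) G) (fob (pk_ftor Y K) H) (far (pk_ftor Y K) G H \<psi>) (far (pk_ftor Y K) F G \<phi>)"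
  proof (rule complex_mor_eqI[OF pk_far[OF K F H c] cat_Cmp[OF cY pk_fob[OF K F] pk_fob[OF K G] pk_fob[OF K H] f g]])
    fix n y x assume y: "y \<in> topspace Y" and x0: "x \<in> carrier (grp (fob (pk_ftor Y K) F) n y)"
    then have x: "x \<in> carrier (pk_grp K F n y)" by simp
    note fx = pk_mor_closed[OF K F \<phi> y x]
    have "pk_mor K ?c n y x = pk_mor K \<psi> n y (pk_mor K \<phi> n y x)"
    proof (rule pk_eqI[OF K H y pk_mor_closed[OF K F c y x] pk_mor_closed[OF K G \<psi> y fx]])
      fix i assume i: "i \<in> pk_ind K y"
      show "entry (pk_ind K y) i (pk_mor K ?c n y x) = entry (pk_ind K y) i (pk_mor K \<psi> n y (pk_mor K \<phi> n y x))"
        unfolding entry_pk_mor[OF K F y i] entry_pk_mor[OF K G y i] using pk_entry_closed[OF K F y x i] pk_pt_in[OF K F y i] by simp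
    qed
    then show "far (pk_ftor Y K) F H ?c n y x = Cmp (complex_cat Y) (fob (pk_ftor Y K) F) (fob (pk_ftor Y K) G) (fob (pk_ftor Y K) H) (far (pk_ftor Y K) G H \<psi>) (far (pk_ftor Y K) F G \<phi>) n y x"
      using y x fx by simp
  qed
qed

lemma cone_acyclic_cong:
  assumes "cone_acyclic K d L d' \<phi>" "\<And>n x. x \<in> carrier (K n) \<Longrightarrow> d2 n x = d n x" "\<And>n x. x \<in> carrier (L n) \<Longrightarrow> d2' n x = d' n x"
    "\<And>n x. x \<in> carrier (K n) \<Longrightarrow> \<phi>2 n x = \<phi> n x"
  shows "cone_acyclic K d2 L d2' \<phi>2"
  unfolding cone_acyclic_def
proof (intro allI ballI impI)
  fix n k l assume k: "k \<in> carrier (K (n + 1 + 1))" and l: "l \<in> carrier (L (n + 1))"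
    and "d2 (n + 1 + 1) k = \<one>\<^bsub>K (n + 1 + 1 + 1)\<^esub>" "\<phi>2 (n + 1 + 1) k = d2' (n + 1) l"
  then have "d (n + 1 + 1) k = \<one>\<^bsub>K (n + 1 + 1 + 1)\<^esub>" "\<phi> (n + 1 + 1) k = d' (n + 1) l" using assms(2-4) by simp_all
  from assms(1)[unfolded cone_acyclic_def, rule_format, OF k l this]
  show "\<exists>k'\<in>carrier (K (n + 1)). \<exists>l'\<in>carrier (L n). d2 (n + 1) k' = k \<and> l = \<phi>2 (n + 1) k' \<otimes>\<^bsub>L (n + 1)\<^esub> d2' n l'"
    using assms(2-4) by auto
qed

text \<open>Stalk by stalk this is \<open>cone_acyclic_twisted\<close>. Hence prekernels act on
  derived categories without any resolution of the argument.\<close>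

lemma pk_homotopical:
  assumes K: "is_prekernel X Y K"
  shows "homotopical (complex_cat X) (quasi_isos X) (quasi_isos Y) (pk_ftor Y K :: (('a, 'u::infinite) cochain, _, _, _) ftor)"
  unfolding homotopical_def
proof (intro ballI)
  fix F G :: "('a, 'u) cochain" and \<phi> assume F: "F \<in> Ob (complex_cat X)" and G: "G \<in> Ob (complex_cat X)" and \<phi>: "\<phi> \<in> quasi_isos X F G"
  have "\<phi> \<in> Hom (complex_cat X) F G" using \<phi> by (simp add: quasi_isos_def)
  note f = pk_far[OF K F G this]
  show "far (pk_ftor Y K) F G \<phi> \<in> quasi_isos Y (fob (pk_ftor Y K) F) (fob (pk_ftor Y K) G)"
    unfolding quasi_isos_iff[OF pk_fob[OF K F] pk_fob[OF K G]]
  proof (intro conjI ballI f)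
    fix y assume y: "y \<in> topspace Y"
    have "cone_acyclic (\<lambda>n. pk_grp K F n y) (\<lambda>n. pk_dif K F n y) (\<lambda>n. pk_grp K G n y) (\<lambda>n. pk_dif K G n y) (\<lambda>n. pk_mor K \<phi> n y)"
      unfolding pk_grp_def pk_dif_def pk_mor_def by (rule cone_acyclic_twisted[OF F G \<phi> prekernelD(1)[OF K y]])
    then show "cone_acyclic (\<lambda>n. grp (fob (pk_ftor Y K) F) n y) (\<lambda>n. cdiff (fob (pk_ftor Y K) F) n y)
      (\<lambda>n. grp (fob (pk_ftor Y K) G) n y) (\<lambda>n. cdiff (fob (pk_ftor Y K) G) n y) (\<lambda>n. far (pk_ftor Y K) F G \<phi> n y)"
      unfolding pk_ftor_simps(1) by (rule cone_acyclic_cong) (use y in simp_all)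
  qed
qed

lemma pk_relative_functor:
  assumes K: "is_prekernel X Y K"
  shows "relative_functor (complex_cat X) (quasi_isos X) (complex_cat Y) (quasi_isos Y) (pk_ftor Y K :: (('a, 'u::infinite) cochain, _, _, _) ftor)"
  by (simp add: relative_functor_def relative_functor_axioms_def relative_category_complex pk_functor[OF K] pk_homotopical[OF K])

section \<open>The adjunction between the two functors given by a kernel\<close>

lemma hom_comp: "h \<in> hom A B \<Longrightarrow> h' \<in> hom B C \<Longrightarrow> (\<lambda>x. h' (h x)) \<in> hom A C"
  using hom_compose[of h A B h' C] by (simp add: o_def)

text \<open>It solves the equation in \<open>components\<close> for the differential of
  \<open>F\<close>. Passing from one form to the other produces the sign in the matrix of
  \<open>Pk\<close>.\<close>

lemma (in comm_group) sign_transpose: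
  assumes S: "finite S" and u: "\<And>i. i \<in> S \<Longrightarrow> k i \<noteq> 0 \<Longrightarrow> u i \<in> carrier G" and C: "C \<in> carrier G" and D: "D \<in> carrier G" and e: "e * e = (1 :: int)"
  shows "D [^] e \<otimes> lincomb G S k u = C \<longleftrightarrow> D = C [^] e \<otimes> lincomb G S (\<lambda>i. - e * k i) u"
proof -
  have e': "e = 1 \<or> e = - 1" using e by (simp add: zmult_eq_1_iff)
  have l: "lincomb G S k u \<in> carrier G" by (rule lincomb_closed) (rule u)
  have "lincomb G S (\<lambda>i. (- e) * k i) u = lincomb G S k u [^] (- e)" by (rule lincomb_pow[OF S u, symmetric])
  then show ?thesis using e' C D l
    by (auto simp: int_pow_neg inv_solve_right inv_mult m_assoc inv_solve_left) (auto simp: m_comm[of "inv _"] m_assoc m_lcomm inv_mult)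
qed

text \<open>Summand \<open>i\<close> alone gives a functor \<open>Q_i\<close>, the stalk at
  \<open>a i\<close> placed on the points below \<open>b i\<close>, and a functor
  \<open>P_i\<close>, the stalk at \<open>b i\<close> placed on the points above \<open>a i\<close>.
  Morphisms from \<open>P_i G\<close> to \<open>F\<close> and from \<open>G\<close> to
  \<open>Q_i F\<close> are both homomorphisms from the stalk of \<open>G\<close> at
  \<open>b i\<close> to that of \<open>F\<close> at \<open>a i\<close>. The opposite variance of
  \<open>a\<close> and \<open>b\<close> along \<open>m\<close> lets one matrix twist both
  sums.\<close>

locale bikernel =
  fixes X :: "'a topology" and Y :: "'b topology" and I :: "'i set" and a :: "'i \<Rightarrow> 'a" and b :: "'i \<Rightarrow> 'b"
    and s :: "'i \<Rightarrow> int" and m :: "'i \<Rightarrow> 'i \<Rightarrow> int"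
  assumes fin: "finite I" and a: "\<And>i. i \<in> I \<Longrightarrow> a i \<in> topspace X" and b: "\<And>i. i \<in> I \<Longrightarrow> b i \<in> topspace Y"
    and ms: "\<And>i j. i \<in> I \<Longrightarrow> j \<in> I \<Longrightarrow> m i j \<noteq> 0 \<Longrightarrow> s i = s j + 1"
    and ma: "\<And>i j. i \<in> I \<Longrightarrow> j \<in> I \<Longrightarrow> m i j \<noteq> 0 \<Longrightarrow> spec_le X (a i) (a j)"
    and mb: "\<And>i j. i \<in> I \<Longrightarrow> j \<in> I \<Longrightarrow> m i j \<noteq> 0 \<Longrightarrow> spec_le Y (b j) (b i)"
    and mm: "\<And>i k. i \<in> I \<Longrightarrow> k \<in> I \<Longrightarrow> (\<Sum>j\<in>I. m i j * m j k) = 0"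
begin

definition Qk :: "('i, 'a, 'b) prekernel" where
  "Qk = \<lparr>pk_ind = \<lambda>y. {i \<in> I. spec_le Y y (b i)}, pk_pt = \<lambda>i y. a i, pk_deg = s, pk_mat = m\<rparr>"

text \<open>Shift and matrix are those of \<open>Qk\<close>, negated and transposed. The factor
  \<open>- parity_sign (s i)\<close> is dictated by \<open>components_boundary\<close>, where the
  sign of the shift moves to the other side of the equation.\<close>

definition Pk :: "('i, 'b, 'a) prekernel" where
  "Pk = \<lparr>pk_ind = \<lambda>x. {i \<in> I. spec_le X (a i) x}, pk_pt = \<lambda>i x. b i, pk_deg = \<lambda>i. - s i,
     pk_mat = \<lambda>i j. - parity_sign (s i) * m j i\<rparr>"

lemma Qk_simps [simp]: "pk_ind Qk y = {i \<in> I. spec_le Y y (b i)}" "pk_pt Qk i y = a i" "pk_deg Qk = s" "pk_mat Qk = m"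
  by (simp_all add: Qk_def)

lemma Pk_simps [simp]: "pk_ind Pk x = {i \<in> I. spec_le X (a i) x}" "pk_pt Pk i x = b i"
  "pk_mat Pk i j = - parity_sign (s i) * m j i"
  by (simp_all add: Pk_def)

lemma deg_Pk: "pk_deg Pk i = - s i" "s i + (pk_deg Pk i + n) = n" "pk_deg Pk i + (s i + n) = n"
  by (simp_all add: Pk_def)

lemma parity_sign_nonzero: "parity_sign k \<noteq> 0"
  by (simp add: parity_sign_def)

lemma parity_sign_sq: "parity_sign k * parity_sign k = 1"
  by (simp add: parity_sign_def)

lemma spec_le_trans: "spec_le Z p q \<Longrightarrow> spec_le Z q r \<Longrightarrow> spec_le Z p r"
  by (auto simp: spec_le_def)

lemma prekernel_Qk: "is_prekernel X Y Qk"
  unfolding is_prekernel_def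
proof (intro conjI ballI allI impI)
  fix y
  show "twisted X (pk_ind Qk y) (\<lambda>i. pk_pt Qk i y) (pk_deg Qk) (pk_mat Qk)" unfolding twisted_def
  proof (intro conjI ballI impI)
    fix i k assume i: "i \<in> pk_ind Qk y" and k: "k \<in> pk_ind Qk y"
    \<comment> \<open>The sum may be extended to all of \<open>I\<close>: if \<open>m j k\<close> is
      nonzero, then \<open>b k\<close> lies below \<open>b j\<close>, so \<open>j\<close> is present
      at \<open>y\<close> along with \<open>k\<close>.\<close>
    have "(\<Sum>j\<in>pk_ind Qk y. m i j * m j k) = (\<Sum>j\<in>I. m i j * m j k)"
      by (rule sum.mono_neutral_left) (use fin k mb spec_le_trans[of Y y "b k"] in auto)
    then show "(\<Sum>j\<in>pk_ind Qk y. pk_mat Qk i j * pk_mat Qk j k) = 0" using mm i k by simp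
  qed (use fin a ms ma in auto)
next
  fix y y' i j assume "spec_le Y y y'" "i \<in> pk_ind Qk y" "j \<in> pk_ind Qk y'" "pk_mat Qk i j \<noteq> 0"
  then show "(i \<in> pk_ind Qk y') = (j \<in> pk_ind Qk y)" using mb[of i j] by (auto intro: spec_le_trans)
qed (auto intro: spec_le_trans spec_le_refl a)

lemma prekernel_Pk: "is_prekernel Y X Pk"
  unfolding is_prekernel_def
proof (intro conjI ballI allI impI)
  fix x
  show "twisted Y (pk_ind Pk x) (\<lambda>i. pk_pt Pk i x) (pk_deg Pk) (pk_mat Pk)" unfolding twisted_def
  proof (intro conjI ballI impI)
    fix i k assume i: "i \<in> pk_ind Pk x" and k: "k \<in> pk_ind Pk x"
    \<comment> \<open>Consecutive signs multiply to -1 because \<open>s\<close> changes by one along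
      a nonzero entry. So the square is minus the transpose of the square of
      \<open>m\<close>.\<close>
    have "(\<Sum>j\<in>pk_ind Pk x. pk_mat Pk i j * pk_mat Pk j k) = (\<Sum>j\<in>pk_ind Pk x. - (m k j * m j i))"
    proof (rule sum.cong[OF refl])
      fix j assume j: "j \<in> pk_ind Pk x"
      show "pk_mat Pk i j * pk_mat Pk j k = - (m k j * m j i)"
      proof (cases "m j i = 0")
        case False
        then have "parity_sign (s j) = - parity_sign (s i)" using ms[of j i] i j by (simp add: parity_sign_Suc)
        moreover have "(- e * u) * (- (- e) * v) = - (v * u)" if "e * e = 1" for e u v :: int
        proof -
          have "(- e * u) * (- (- e) * v) = - ((e * e) * (v * u))" by (simp add: ac_simps)
          then show ?thesis by (simp add: that)
        qed
        ultimately show ?thesis using parity_sign_sq[of "s i"] by simp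
      qed simp
    qed
    also have "\<dots> = (\<Sum>j\<in>I. - (m k j * m j i))" by (rule sum.mono_neutral_left) (use fin i ma spec_le_trans[of X _ "a i" x] in auto)
    also have "\<dots> = 0" using mm[of k i] i k by (simp add: sum_negf)
    finally show "(\<Sum>j\<in>pk_ind Pk x. pk_mat Pk i j * pk_mat Pk j k) = 0" .
  qed (use fin b ms mb in \<open>auto simp: parity_sign_nonzero deg_Pk\<close>)
next
  fix x x' i j assume "spec_le X x x'" "i \<in> pk_ind Pk x" "j \<in> pk_ind Pk x'" "pk_mat Pk i j \<noteq> 0"
  then show "(i \<in> pk_ind Pk x') = (j \<in> pk_ind Pk x)" using ma[of j i] by (auto intro: spec_le_trans)
qed (auto intro: spec_le_trans spec_le_refl b)

section \<open>Morphisms on either side as families of components\<close>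

abbreviation "IQ \<equiv> pk_ind Qk"
abbreviation "IP \<equiv> pk_ind Pk"
abbreviation "s' \<equiv> pk_deg Pk"

context
  fixes G :: "('b, 'u::infinite) cochain" and F :: "('a, 'u) cochain"
  assumes G: "G \<in> Ob (complex_cat Y)" and F: "F \<in> Ob (complex_cat X)"
begin

text \<open>Morphisms \<open>P G \<rightarrow> F\<close> and morphisms \<open>G \<rightarrow> Q F\<close> both amount to such a family of homomorphisms.\<close>

definition components :: "('i \<Rightarrow> int \<Rightarrow> 'u \<Rightarrow> 'u) \<Rightarrow> bool" where
  "components c \<longleftrightarrow> (\<forall>i\<in>I. \<forall>n. c i n \<in> hom (grp G n (b i)) (grp F (s i + n) (a i)) \<and>
     (\<forall>g\<in>carrier (grp G n (b i)).
       cdiff F (s i + n) (a i) (c i n g) [^]\<^bsub>grp F (s i + n + 1) (a i)\<^esub> parity_sign (s i) \<otimes>\<^bsub>grp F (s i + n + 1) (a i)\<^esub>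
       lincomb (grp F (s i + n + 1) (a i)) I (\<lambda>j. m j i) (\<lambda>j. rst F (s j + n) (a j) (a i) (c j n (rst G n (b i) (b j) g)))
       = c i (n + 1) (cdiff G n (b i) g)))"

definition mkQ :: "('i \<Rightarrow> int \<Rightarrow> 'u \<Rightarrow> 'u) \<Rightarrow> ('b, 'u) cmor" where
  "mkQ c = (\<lambda>n. \<lambda>y\<in>topspace Y. \<lambda>g\<in>carrier (grp G n y). tuple (IQ y) (\<lambda>i. c i n (rst G n y (b i) g)))"

text \<open>Up to equivalence, \<open>b i\<close> is the largest point where summand
  \<open>i\<close> is present, and the entry there determines the others: \<open>compQ_rst\<close>
  recovers the entry at \<open>y\<close> by first restricting to \<open>b i\<close>.\<close>

definition compQ :: "('b, 'u) cmor \<Rightarrow> 'i \<Rightarrow> int \<Rightarrow> 'u \<Rightarrow> 'u" where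
  "compQ \<psi> i n g = entry (IQ (b i)) i (\<psi> n (b i) g)"

abbreviation incl :: "'a \<Rightarrow> int \<Rightarrow> 'i \<Rightarrow> 'u \<Rightarrow> 'u" where
  "incl x n \<equiv> inclusion (IP x) (\<lambda>i. grp G (s' i + n) (b i))"

definition mkP :: "('i \<Rightarrow> int \<Rightarrow> 'u \<Rightarrow> 'u) \<Rightarrow> ('a, 'u) cmor" where
  "mkP c = (\<lambda>n. \<lambda>x\<in>topspace X. \<lambda>u\<in>carrier (pk_grp Pk G n x).
     lincomb (grp F n x) (IP x) (\<lambda>_. 1) (\<lambda>i. rst F n (a i) x (c i (s' i + n) (entry (IP x) i u))))"

text \<open>Dually, summand \<open>i\<close> of \<open>Pk\<close> first appears at
  \<open>a i\<close>, and a morphism out of it is determined there. In degree \<open>s i + n\<close>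
  the shift \<open>s' i\<close>, which is \<open>- s i\<close>, cancels.\<close>

definition compP :: "('a, 'u) cmor \<Rightarrow> 'i \<Rightarrow> int \<Rightarrow> 'u \<Rightarrow> 'u" where
  "compP \<phi> i n g = \<phi> (s i + n) (a i) (incl (a i) (s i + n) i g)"

lemma m_deg: "i \<in> I \<Longrightarrow> j \<in> I \<Longrightarrow> m i j \<noteq> 0 \<Longrightarrow> s i + n = s j + n + 1"
  using ms[of i j] by simp

lemma mkQ_in:
  assumes c: "components c"
  shows "mkQ c \<in> Hom (complex_cat Y) G (fob (pk_ftor Y Qk) F)"
proof -
  have ch: "c i n \<in> hom (grp G n (b i)) (grp F (s i + n) (a i))" if "i \<in> I" for i n using c that by (simp add: components_def)
  have cc: "c i n g \<in> carrier (grp F (s i + n) (a i))" if "i \<in> I" "g \<in> carrier (grp G n (b i))" for i n g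
    using hom_in_carrier[OF ch[OF that(1)] that(2)] .
  have finQ: "finite (IQ y)" for y using fin by simp
  have ek: "entry (IQ y) i (mkQ c n y g) = c i n (rst G n y (b i) g)"
    if "y \<in> topspace Y" "g \<in> carrier (grp G n y)" "i \<in> IQ y" for y n g i
    unfolding mkQ_def using that entry_tuple[OF finQ that(3)] by simp
  have h: "(\<lambda>g. tuple (IQ y) (\<lambda>i. c i n (rst G n y (b i) g))) \<in> hom (grp G n y) (pk_grp Qk F n y)" if y: "y \<in> topspace Y" for n y
    unfolding pk_grp_def tw_grp_def
  proof (rule tuple_hom[OF finQ])
    fix i assume "i \<in> IQ y"
    then have i: "i \<in> I" "spec_le Y y (b i)" by auto
    show "(\<lambda>x. c i n (rst G n y (b i) x)) \<in> hom (grp G n y) (grp F (pk_deg Qk i + n) (pk_pt Qk i y))"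
      using hom_compose[OF complex_rst_hom[OF G i(2), of n] ch[OF i(1)]] by (simp add: o_def)
  qed
  have kc: "mkQ c n y g \<in> carrier (pk_grp Qk F n y)" if "y \<in> topspace Y" "g \<in> carrier (grp G n y)" for y n g
    using hom_in_carrier[OF h[OF that(1)] that(2)] that by (simp add: mkQ_def)
  show ?thesis
  proof (rule complex_HomI, goal_cases)
    case (1 n) then show ?case by (simp add: mkQ_def)
  next
    case (2 n y) then show ?case using restrict_ghom[OF h[OF 2] complex_grp[OF G 2]] by (simp add: mkQ_def)
  next
    case (3 n y y' g)
    have y: "y \<in> topspace Y" "y' \<in> topspace Y" using 3 by (auto dest: spec_leD)
    note rg = complex_rst_closed[OF G 3]
    have "pk_rst Qk F n y y' (mkQ c n y g) = mkQ c n y' (rst G n y y' g)"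
    proof (rule pk_eqI[OF prekernel_Qk F y(2) pk_rst_closed[OF prekernel_Qk F 3(1) kc[OF y(1) 3(2)]] kc[OF y(2) rg]])
      fix i assume i: "i \<in> IQ y'"
      then have i': "i \<in> IQ y" "i \<in> I" "spec_le Y y (b i)" "spec_le Y y' (b i)" using 3(1) by (auto intro: spec_le_trans)
      have "entry (IQ y') i (pk_rst Qk F n y y' (mkQ c n y g)) = rst F (s i + n) (a i) (a i) (c i n (rst G n y (b i) g))"
        unfolding entry_pk_rst[OF prekernel_Qk F y(2) i] ek[OF y(1) 3(2) i'(1)] using i' by simp
      also have "\<dots> = c i n (rst G n y (b i) g)" using complex_rst_refl[OF F a[OF i'(2)] cc[OF i'(2) complex_rst_closed[OF G i'(3) 3(2)]]] .
      also have "\<dots> = entry (IQ y') i (mkQ c n y' (rst G n y y' g))" unfolding ek[OF y(2) rg i] complex_rst_rst[OF G 3(1) i'(4) 3(2)] ..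
      finally show "entry (IQ y') i (pk_rst Qk F n y y' (mkQ c n y g)) = entry (IQ y') i (mkQ c n y' (rst G n y y' g))" .
    qed
    then show ?case using kc[OF y(1) 3(2)] by simp
  next
    case (4 n y g)
    note dg = complex_cdiff_closed[OF G 4]
    have "pk_dif Qk F n y (mkQ c n y g) = mkQ c (n + 1) y (cdiff G n y g)"
    proof (rule pk_eqI[OF prekernel_Qk F 4(1) pk_dif_closed[OF prekernel_Qk F 4(1) kc[OF 4]] kc[OF 4(1) dg]])
      fix i assume i: "i \<in> IQ y"
      then have i': "i \<in> I" "spec_le Y y (b i)" by auto
      let ?G = "grp F (s i + n + 1) (a i)"
      interpret A: comm_group ?G by (rule complex_grp[OF F a[OF i'(1)]])
      have rg: "rst G n y (b i) g \<in> carrier (grp G n (b i))" by (rule complex_rst_closed[OF G i'(2) 4(2)])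
      let ?v = "\<lambda>j. rst F (s j + n) (a j) (a i) (c j n (rst G n (b i) (b j) (rst G n y (b i) g)))"
      have v: "?v j \<in> carrier ?G" if j: "j \<in> I" "m j i \<noteq> 0" for j
        using complex_rst_closed[OF F ma[OF j(1) i'(1) j(2)] cc[OF j(1) complex_rst_closed[OF G mb[OF j(1) i'(1) j(2)] rg]]]
        unfolding m_deg[OF j(1) i'(1) j(2), of n] .
      \<comment> \<open>Every index with an entry into \<open>i\<close> is present at
        \<open>y\<close>, so the sum over \<open>IQ y\<close> in the differential agrees with the
        sum over \<open>I\<close> in \<open>components\<close>.\<close>
      have inQ: "j \<in> IQ y" if j: "j \<in> I" "m j i \<noteq> 0" for j
        using mb[OF j(1) i'(1) j(2)] i' j by (auto intro: spec_le_trans)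
      have "lincomb ?G (IQ y) (\<lambda>j. m j i) (\<lambda>j. rst F (s j + n) (a j) (a i) (entry (IQ y) j (mkQ c n y g))) =
        lincomb ?G (IQ y) (\<lambda>j. m j i) ?v"
      proof (rule A.lincomb_cong)
        fix j assume j: "j \<in> IQ y" "m j i \<noteq> 0"
        then have "j \<in> I" by simp
        then show "rst F (s j + n) (a j) (a i) (entry (IQ y) j (mkQ c n y g)) = ?v j"
          unfolding ek[OF 4 j(1)] using complex_rst_rst[OF G i'(2) mb[OF _ i'(1) j(2)] 4(2)] by simp
      qed (use v in auto)
      also have "\<dots> = lincomb ?G I (\<lambda>j. m j i) ?v" using fin inQ v by (intro A.lincomb_neutral[symmetric]) auto
      finally have l: "lincomb ?G (IQ y) (\<lambda>j. m j i) (\<lambda>j. rst F (s j + n) (a j) (a i) (entry (IQ y) j (mkQ c n y g))) = lincomb ?G I (\<lambda>j. m j i) ?v" .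
      have "entry (IQ y) i (pk_dif Qk F n y (mkQ c n y g)) = c i (n + 1) (cdiff G n (b i) (rst G n y (b i) g))"
        unfolding entry_pk_dif[OF prekernel_Qk F 4(1) i] tw_comp_def Qk_simps(2,3,4) l ek[OF 4 i]
        using c i'(1) rg by (simp add: components_def)
      also have "\<dots> = entry (IQ y) i (mkQ c (n + 1) y (cdiff G n y g))" unfolding ek[OF 4(1) dg i] complex_rst_cdiff[OF G i'(2) 4(2)] ..
      finally show "entry (IQ y) i (pk_dif Qk F n y (mkQ c n y g)) = entry (IQ y) i (mkQ c (n + 1) y (cdiff G n y g))" .
    qed
    then show ?case using kc[OF 4] 4(1) by simp
  qed
qed

lemma entry_mkQ: "y \<in> topspace Y \<Longrightarrow> g \<in> carrier (grp G n y) \<Longrightarrow> i \<in> IQ y \<Longrightarrow>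
    entry (IQ y) i (mkQ c n y g) = c i n (rst G n y (b i) g)"
  unfolding mkQ_def using entry_tuple[of "IQ y" i] fin by simp

lemma own_index: "i \<in> I \<Longrightarrow> i \<in> IQ (b i)" "i \<in> I \<Longrightarrow> i \<in> IP (a i)"
  using a b by (auto intro: spec_le_refl)

lemma compQ_mkQ: "components c \<Longrightarrow> i \<in> I \<Longrightarrow> g \<in> carrier (grp G n (b i)) \<Longrightarrow> compQ (mkQ c) i n g = c i n g"
  unfolding compQ_def using entry_mkQ[OF b _ own_index(1)] complex_rst_refl[OF G b] by simp

context
  fixes \<psi> assumes \<psi>: "\<psi> \<in> Hom (complex_cat Y) G (fob (pk_ftor Y Qk) F)"
begin

lemma mor_pk_closed: "y \<in> topspace Y \<Longrightarrow> g \<in> carrier (grp G n y) \<Longrightarrow> \<psi> n y g \<in> carrier (pk_grp Qk F n y)"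
  using mor_closed[OF \<psi>] by simp

lemma compQ_rst:
  assumes y: "y \<in> topspace Y" and g: "g \<in> carrier (grp G n y)" and i: "i \<in> IQ y"
  shows "compQ \<psi> i n (rst G n y (b i) g) = entry (IQ y) i (\<psi> n y g)"
proof -
  have i': "i \<in> I" "spec_le Y y (b i)" using i by auto
  have "\<psi> n (b i) (rst G n y (b i) g) = pk_rst Qk F n y (b i) (\<psi> n y g)" using mor_rst[OF \<psi> i'(2) g] mor_pk_closed[OF y g] by simp
  then have "compQ \<psi> i n (rst G n y (b i) g) = rst F (s i + n) (a i) (a i) (entry (IQ y) i (\<psi> n y g))"
    unfolding compQ_def using entry_pk_rst[OF prekernel_Qk F b[OF i'(1)] own_index(1)[OF i'(1)]] i by simp
  also have "\<dots> = entry (IQ y) i (\<psi> n y g)"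
    using complex_rst_refl[OF F a[OF i'(1)]] pk_entry_closed[OF prekernel_Qk F y mor_pk_closed[OF y g] i] by simp
  finally show ?thesis .
qed

lemma components_compQ: "components (compQ \<psi>)"
  unfolding components_def
proof (intro ballI allI conjI)
  fix i n assume i: "i \<in> I"
  note bi = b[OF i] and oi = own_index(1)[OF i]
  show "compQ \<psi> i n \<in> hom (grp G n (b i)) (grp F (s i + n) (a i))"
  proof (rule homI)
    fix g assume "g \<in> carrier (grp G n (b i))" then show "compQ \<psi> i n g \<in> carrier (grp F (s i + n) (a i))"
      unfolding compQ_def using pk_entry_closed[OF prekernel_Qk F bi mor_pk_closed[OF bi] oi] by simp
  next
    fix g h assume "g \<in> carrier (grp G n (b i))" "h \<in> carrier (grp G n (b i))"
    then have "\<psi> n (b i) (g \<otimes>\<^bsub>grp G n (b i)\<^esub> h) = \<psi> n (b i) g \<otimes>\<^bsub>pk_grp Qk F n (b i)\<^esub> \<psi> n (b i) h"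
      using hom_mult[OF mor_hom[OF \<psi> bi]] by simp
    then show "compQ \<psi> i n (g \<otimes>\<^bsub>grp G n (b i)\<^esub> h) = compQ \<psi> i n g \<otimes>\<^bsub>grp F (s i + n) (a i)\<^esub> compQ \<psi> i n h"
      unfolding compQ_def pk_grp_def tw_grp_def using entry_mult[of "IQ (b i)" i] fin oi by simp
  qed
  fix g assume g: "g \<in> carrier (grp G n (b i))"
  let ?G = "grp F (s i + n + 1) (a i)"
  interpret A: comm_group ?G by (rule complex_grp[OF F a[OF i]])
  let ?e = "\<lambda>j. entry (IQ (b i)) j (\<psi> n (b i) g)"
  have inQ: "j \<in> IQ (b i)" if "j \<in> I" "m j i \<noteq> 0" for j using mb[OF that(1) i that(2)] that by simp
  have ec: "rst F (s j + n) (a j) (a i) (?e j) \<in> carrier ?G" if j: "j \<in> I" "m j i \<noteq> 0" for j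
    using complex_rst_closed[OF F ma[OF j(1) i j(2)]] pk_entry_closed[OF prekernel_Qk F bi mor_pk_closed[OF bi g] inQ[OF j]]
    unfolding Qk_simps(2,3) m_deg[OF j(1) i j(2), of n] .
  have "lincomb ?G I (\<lambda>j. m j i) (\<lambda>j. rst F (s j + n) (a j) (a i) (compQ \<psi> j n (rst G n (b i) (b j) g))) =
    lincomb ?G I (\<lambda>j. m j i) (\<lambda>j. rst F (s j + n) (a j) (a i) (?e j))"
    by (rule A.lincomb_cong) (use compQ_rst[OF bi g inQ] ec in auto)
  also have "\<dots> = lincomb ?G (IQ (b i)) (\<lambda>j. m j i) (\<lambda>j. rst F (s j + n) (a j) (a i) (?e j))"
    using fin inQ ec by (intro A.lincomb_neutral) auto
  finally have "cdiff F (s i + n) (a i) (compQ \<psi> i n g) [^]\<^bsub>?G\<^esub> parity_sign (s i) \<otimes>\<^bsub>?G\<^esub>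
       lincomb ?G I (\<lambda>j. m j i) (\<lambda>j. rst F (s j + n) (a j) (a i) (compQ \<psi> j n (rst G n (b i) (b j) g))) =
       entry (IQ (b i)) i (pk_dif Qk F n (b i) (\<psi> n (b i) g))"
    unfolding entry_pk_dif[OF prekernel_Qk F bi oi] tw_comp_def compQ_def by simp
  also have "\<dots> = compQ \<psi> i (n + 1) (cdiff G n (b i) g)"
    unfolding compQ_def using mor_cdiff[OF \<psi> bi g] mor_pk_closed[OF bi g] bi by simp
  finally show "cdiff F (s i + n) (a i) (compQ \<psi> i n g) [^]\<^bsub>?G\<^esub> parity_sign (s i) \<otimes>\<^bsub>?G\<^esub>
       lincomb ?G I (\<lambda>j. m j i) (\<lambda>j. rst F (s j + n) (a j) (a i) (compQ \<psi> j n (rst G n (b i) (b j) g))) =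
       compQ \<psi> i (n + 1) (cdiff G n (b i) g)" .
qed

lemma mkQ_compQ: "mkQ (compQ \<psi>) = \<psi>"
proof (rule complex_mor_eqI[OF mkQ_in[OF components_compQ] \<psi>])
  fix n y g assume y: "y \<in> topspace Y" and g: "g \<in> carrier (grp G n y)"
  have "mkQ (compQ \<psi>) n y g \<in> carrier (pk_grp Qk F n y)" using mor_closed[OF mkQ_in[OF components_compQ] y g] by simp
  then show "mkQ (compQ \<psi>) n y g = \<psi> n y g"
    by (rule pk_eqI[OF prekernel_Qk F y _ mor_pk_closed[OF y g]]) (simp only: entry_mkQ[OF y g] compQ_rst[OF y g])
qed

end

lemma mkQ_cong:
  assumes eq: "\<And>i n g. i \<in> I \<Longrightarrow> g \<in> carrier (grp G n (b i)) \<Longrightarrow> c i n g = d i n g"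
  shows "mkQ c = mkQ d"
  unfolding mkQ_def
proof (rule ext, rule restrict_ext, rule restrict_ext, rule tuple_cong)
  fix n y g i assume "g \<in> carrier (grp G n y)" "i \<in> IQ y"
  then show "c i n (rst G n y (b i) g) = d i n (rst G n y (b i) g)" by (intro eq complex_rst_closed[OF G]) auto
qed

lemma Pk_mat_deg: "i \<in> I \<Longrightarrow> j \<in> I \<Longrightarrow> m j i \<noteq> 0 \<Longrightarrow> s' i + n = s' j + n + 1"
  using ms[of j i] by (simp add: deg_Pk)

lemma pk_grp_Pk: "pk_grp Pk G n x = prodgroup (IP x) (\<lambda>i. grp G (s' i + n) (b i))"
  by (simp add: pk_grp_def tw_grp_def)

lemma finP: "finite (IP x)"
  using fin by simp

lemma Pk_group: "i \<in> IP x \<Longrightarrow> comm_group (grp G (s' i + n) (b i))"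
  using complex_grp[OF G b] by simp

lemma incl_hom: "i \<in> IP x \<Longrightarrow> incl x n i \<in> hom (grp G (s' i + n) (b i)) (pk_grp Pk G n x)"
  unfolding pk_grp_Pk by (rule inclusion_hom[OF finP]) (rule Pk_group)

lemma incl_closed: "i \<in> IP x \<Longrightarrow> g \<in> carrier (grp G (s' i + n) (b i)) \<Longrightarrow> incl x n i g \<in> carrier (pk_grp Pk G n x)"
  by (rule hom_in_carrier[OF incl_hom])

lemma entry_incl: "k \<in> IP x \<Longrightarrow> entry (IP x) k (incl x n i g) = (if k = i then g else \<one>\<^bsub>grp G (s' k + n) (b k)\<^esub>)"
  unfolding inclusion_def by (rule entry_tuple[OF finP])

lemma Pk_entry_closed: "x \<in> topspace X \<Longrightarrow> u \<in> carrier (pk_grp Pk G n x) \<Longrightarrow> i \<in> IP x \<Longrightarrow>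
    entry (IP x) i u \<in> carrier (grp G (s' i + n) (b i))"
  using pk_entry_closed[OF prekernel_Pk G] by simp

lemma Pk_hom_eqI:
  assumes A: "comm_group A" and h: "h \<in> hom (pk_grp Pk G n x) A" "h' \<in> hom (pk_grp Pk G n x) A"
    and u: "u \<in> carrier (pk_grp Pk G n x)"
    and eq: "\<And>i g. i \<in> IP x \<Longrightarrow> g \<in> carrier (grp G (s' i + n) (b i)) \<Longrightarrow> h (incl x n i g) = h' (incl x n i g)"
  shows "h u = h' u"
proof (rule prodgroup_hom_eqI[of "IP x" "\<lambda>i. grp G (s' i + n) (b i)" A h h' u])
  show "finite (IP x)" by (rule finP)
qed (use A h u eq Pk_group in \<open>simp_all only: pk_grp_Pk\<close>)

lemma pk_rst_incl:
  assumes le: "spec_le X x x'" and i: "i \<in> IP x" and g: "g \<in> carrier (grp G (s' i + n) (b i))"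
  shows "pk_rst Pk G n x x' (incl x n i g) = incl x' n i g"
proof -
  have x: "x \<in> topspace X" "x' \<in> topspace X" using le by (auto dest: spec_leD)
  have i': "i \<in> IP x'" using i le by (auto intro: spec_le_trans)
  show ?thesis
  proof (rule pk_eqI[OF prekernel_Pk G x(2) pk_rst_closed[OF prekernel_Pk G le incl_closed[OF i g]] incl_closed[OF i' g]])
    fix k assume k: "k \<in> IP x'"
    then have bk: "b k \<in> topspace Y" using b by simp
    show "entry (IP x') k (pk_rst Pk G n x x' (incl x n i g)) = entry (IP x') k (incl x' n i g)"
      unfolding entry_pk_rst[OF prekernel_Pk G x(2) k] entry_incl[OF k]
      using entry_incl[of k x n i g] complex_rst_refl[OF G bk, of g "s' k + n"] complex_rst_refl[OF G bk complex_one_closed[OF G bk], of "s' k + n"] g i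
      by (cases "k \<in> IP x") (auto simp del: Pk_simps(1) simp: Pk_simps(2))
  qed
qed

text \<open>This is \<open>components\<close> without the differential equation. It is kept separate
  because a morphism \<open>\<phi>\<close> must be recognized as \<open>mkP (compP \<phi>)\<close>
  before the equation for \<open>compP \<phi>\<close> can be derived.\<close>

definition hom_family :: "('i \<Rightarrow> int \<Rightarrow> 'u \<Rightarrow> 'u) \<Rightarrow> bool" where
  "hom_family c \<longleftrightarrow> (\<forall>i\<in>I. \<forall>n. c i n \<in> hom (grp G n (b i)) (grp F (s i + n) (a i)))"

context
  fixes c assumes c: "hom_family c"
begin

lemma hom_family_hom: "i \<in> IP x \<Longrightarrow> (\<lambda>g. rst F n (a i) x (c i (s' i + n) g)) \<in> hom (grp G (s' i + n) (b i)) (grp F n x)"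
proof -
  assume i: "i \<in> IP x"
  have "\<forall>n. c i n \<in> hom (grp G n (b i)) (grp F (s i + n) (a i))" using c i by (simp add: hom_family_def)
  from this[rule_format, of "s' i + n"]
  have "c i (s' i + n) \<in> hom (grp G (s' i + n) (b i)) (grp F n (a i))" unfolding deg_Pk(2) .
  from hom_compose[OF this complex_rst_hom[OF F, of "a i" x n]] i show ?thesis by (simp add: o_def)
qed

lemma family_closed: "i \<in> I \<Longrightarrow> g \<in> carrier (grp G (s' i + n) (b i)) \<Longrightarrow> c i (s' i + n) g \<in> carrier (grp F n (a i))"
  using hom_in_carrier[of "c i (s' i + n)" "grp G (s' i + n) (b i)" "grp F (s i + (s' i + n)) (a i)" g] c
  unfolding hom_family_def deg_Pk(2) by (metis deg_Pk(2))

lemma mkP_copair: "x \<in> topspace X \<Longrightarrow> mkP c n x = restrict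
    (copair (IP x) (grp F n x) (\<lambda>i g. rst F n (a i) x (c i (s' i + n) g))) (carrier (pk_grp Pk G n x))"
  unfolding mkP_def copair_def by simp

lemma mkP_hom: "x \<in> topspace X \<Longrightarrow> mkP c n x \<in> ghom (pk_grp Pk G n x) (grp F n x)"
  unfolding mkP_copair
  by (rule restrict_ghom[OF _ comm_group_pk_grp[OF prekernel_Pk G]], unfold pk_grp_Pk)
    (rule copair_hom[OF finP Pk_group complex_grp[OF F] hom_family_hom])

lemma mkP_incl:
  assumes x: "x \<in> topspace X" and i: "i \<in> IP x" and g: "g \<in> carrier (grp G (s' i + n) (b i))"
  shows "mkP c n x (incl x n i g) = rst F n (a i) x (c i (s' i + n) g)"
  unfolding mkP_copair[OF x] restrict_apply'[OF incl_closed[OF i g]]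
  by (rule copair_inclusion[where A = "\<lambda>i. grp G (s' i + n) (b i)"])
    (use i g in \<open>auto intro: finP Pk_group complex_grp[OF F x] hom_family_hom simp del: Pk_simps\<close>)

text \<open>The image under \<open>mkP c\<close> of the differential of a generator.\<close>

abbreviation (input) boundary :: "'i \<Rightarrow> int \<Rightarrow> 'u \<Rightarrow> 'u" where
  "boundary i n g \<equiv> c i (s' i + n + 1) (cdiff G (s' i + n) (b i) g) [^]\<^bsub>grp F (n + 1) (a i)\<^esub> parity_sign (s i) \<otimes>\<^bsub>grp F (n + 1) (a i)\<^esub>
     lincomb (grp F (n + 1) (a i)) I (\<lambda>j. - parity_sign (s i) * m j i)
       (\<lambda>j. rst F (n + 1) (a j) (a i) (c j (s' i + n) (rst G (s' i + n) (b i) (b j) g)))"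

lemma boundary_summand_closed:
  assumes i: "i \<in> I" and g: "g \<in> carrier (grp G (s' i + n) (b i))" and j: "j \<in> I" "m j i \<noteq> 0"
  shows "c j (s' i + n) (rst G (s' i + n) (b i) (b j) g) \<in> carrier (grp F (n + 1) (a j))"
  using family_closed[OF j(1), of "rst G (s' i + n) (b i) (b j) g" "n + 1"] complex_rst_closed[OF G mb[OF j(1) i j(2)] g]
  unfolding add.assoc[symmetric] Pk_mat_deg[OF i j, of n] .

text \<open>Maps out of the sum are determined on generators, so compatibility with differentials is
  computed for \<open>incl x n i g\<close> only. Its differential has the differential of
  \<open>g\<close> in summand \<open>i\<close>, and restrictions of \<open>g\<close> in the summands
  reached by the transposed matrix.\<close>

lemma mkP_dif_incl:
  assumes x: "x \<in> topspace X" and i: "i \<in> IP x" and g: "g \<in> carrier (grp G (s' i + n) (b i))"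
  shows "mkP c (n + 1) x (pk_dif Pk G n x (incl x n i g)) = rst F (n + 1) (a i) x (boundary i n g)"
proof -
  have iI: "i \<in> I" and le: "spec_le X (a i) x" using i by auto
  let ?J = "IP x" and ?A = "grp F (n + 1) x" and ?d = "cdiff G (s' i + n) (b i) g"
  interpret A: comm_group ?A by (rule complex_grp[OF F x])
  interpret B: comm_group "grp F (n + 1) (a i)" by (rule complex_grp[OF F a[OF iI]])
  interpret r: group_hom "grp F (n + 1) (a i)" ?A "rst F (n + 1) (a i) x" by unfold_locales (rule complex_rst_hom[OF F le])
  have dc: "?d \<in> carrier (grp G (s' i + n + 1) (b i))" by (rule complex_cdiff_closed[OF G b[OF iI] g])
  have cd: "c i (s' i + n + 1) ?d \<in> carrier (grp F (n + 1) (a i))"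
    using family_closed[OF iI, of ?d "n + 1"] dc by (simp add: add.assoc[symmetric])
  let ?z = "\<lambda>j. rst F (n + 1) (a j) x (c j (s' i + n) (rst G (s' i + n) (b i) (b j) g))"
  note sc = boundary_summand_closed[OF iI g]
  have jle: "spec_le X (a j) x" if "j \<in> I" "m j i \<noteq> 0" for j using spec_le_trans[OF ma[OF that(1) iI that(2)] le] .
  have zc: "?z j \<in> carrier ?A" if "j \<in> I" "m j i \<noteq> 0" for j by (rule complex_rst_closed[OF F jle[OF that] sc[OF that]])
  let ?A1 = "rst F (n + 1) (a i) x (c i (s' i + n + 1) ?d) [^]\<^bsub>?A\<^esub> parity_sign (s i)"
  have A1: "?A1 \<in> carrier ?A" using cd by simp
  let ?w = "pk_dif Pk G n x (incl x n i g)"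
  have w: "?w \<in> carrier (pk_grp Pk G (n + 1) x)" by (rule pk_dif_closed[OF prekernel_Pk G x incl_closed[OF i g]])
  have e: "rst F (n + 1) (a j) x (c j (s' j + (n + 1)) (entry ?J j ?w)) = (if j = i then ?A1 else \<one>\<^bsub>?A\<^esub>) \<otimes>\<^bsub>?A\<^esub> ?z j [^]\<^bsub>?A\<^esub> pk_mat Pk i j"
    if j: "j \<in> ?J" for j
  proof -
    have jI: "j \<in> I" using j by simp
    let ?H = "grp G (s' j + n + 1) (b j)"
    interpret H: comm_group ?H by (rule complex_grp[OF G b[OF jI]])
    let ?rg = "rst G (s' i + n) (b i) (b j) g"
    have rg: "?rg \<in> carrier ?H" if "m j i \<noteq> 0"
      using complex_rst_closed[OF G mb[OF jI iI that] g] unfolding Pk_mat_deg[OF iI jI that, of n] .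
    let ?v = "\<lambda>k. rst G (s' k + n) (b k) (b j) (entry ?J k (incl x n i g))"
    have v1: "?v k = \<one>\<^bsub>?H\<^esub>" if k: "k \<in> ?J - {i}" "pk_mat Pk k j \<noteq> 0" for k
    proof -
      have k': "k \<in> ?J" "k \<in> I" "k \<noteq> i" "m j k \<noteq> 0" using k by auto
      show ?thesis unfolding entry_incl[OF k'(1)] using k'(3) complex_rst_one[OF G mb[OF jI k'(2,4)], of "s' k + n"]
        unfolding Pk_mat_deg[OF k'(2) jI k'(4), of n] by simp
    qed
    have "lincomb ?H ?J (\<lambda>k. pk_mat Pk k j) ?v = lincomb ?H {i} (\<lambda>k. pk_mat Pk k j) ?v"
      by (rule H.lincomb_neutral[OF finP]) (use i v1 rg entry_incl[OF i, of n i g] in auto)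
    also have "\<dots> = ?rg [^]\<^bsub>?H\<^esub> pk_mat Pk i j"
      using H.lincomb_single[of "{i}" i "\<lambda>k. pk_mat Pk k j" ?v] rg entry_incl[OF i, of n i g] by auto
    finally have l: "lincomb ?H ?J (\<lambda>k. pk_mat Pk k j) ?v = ?rg [^]\<^bsub>?H\<^esub> pk_mat Pk i j" .
    have par: "parity_sign (s' j) = parity_sign (s j)" by (simp add: deg_Pk parity_sign_def)
    let ?D = "if j = i then ?d [^]\<^bsub>?H\<^esub> parity_sign (s i) else \<one>\<^bsub>?H\<^esub>"
    have D: "cdiff G (s' j + n) (b j) (entry ?J j (incl x n i g)) [^]\<^bsub>?H\<^esub> parity_sign (s' j) = ?D"
      unfolding entry_incl[OF j] par using complex_cdiff_one[OF G b[OF jI]] H.int_pow_one' by auto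
    have ew: "entry ?J j ?w = ?D \<otimes>\<^bsub>?H\<^esub> ?rg [^]\<^bsub>?H\<^esub> pk_mat Pk i j"
      unfolding entry_pk_dif[OF prekernel_Pk G x j] tw_comp_def Pk_simps(2) l D ..
    let ?f = "\<lambda>g. rst F (n + 1) (a j) x (c j (s' j + n + 1) g)"
    interpret f: group_hom ?H ?A ?f using hom_family_hom[OF j, of "n + 1"]
      by unfold_locales (simp add: add.assoc[symmetric])
    interpret Hi: comm_group "grp G (s' i + n + 1) (b i)" by (rule complex_grp[OF G b[OF iI]])
    have Dc: "?D \<in> carrier ?H" using Hi.int_pow_closed[OF dc] by auto
    have mc: "?rg [^]\<^bsub>?H\<^esub> pk_mat Pk i j \<in> carrier ?H" using rg by (intro H.lincomb_term) auto
    have "?f (entry ?J j ?w) = ?f ?D \<otimes>\<^bsub>?A\<^esub> ?f (?rg [^]\<^bsub>?H\<^esub> pk_mat Pk i j)" unfolding ew by (rule f.hom_mult[OF Dc mc])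
    also have "?f ?D = (if j = i then ?A1 else \<one>\<^bsub>?A\<^esub>)" using f.hom_int_pow[of ?d "parity_sign (s i)"] dc f.hom_one by auto
    also have "?f (?rg [^]\<^bsub>?H\<^esub> pk_mat Pk i j) = ?z j [^]\<^bsub>?A\<^esub> pk_mat Pk i j"
    proof (cases "m j i = 0")
      case False
      then show ?thesis using f.hom_int_pow[OF rg[OF False], of "pk_mat Pk i j"] unfolding Pk_mat_deg[OF iI jI False, of n] by simp
    qed (use f.hom_one in simp)
    finally show ?thesis by (simp only: add.assoc[symmetric])
  qed
  have "mkP c (n + 1) x ?w = lincomb ?A ?J (\<lambda>_. 1) (\<lambda>j. rst F (n + 1) (a j) x (c j (s' j + (n + 1)) (entry ?J j ?w)))"
    unfolding mkP_def using x w by (simp del: Pk_simps(1))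
  also have "\<dots> = lincomb ?A ?J (\<lambda>_. 1) (\<lambda>j. (if j = i then ?A1 else \<one>\<^bsub>?A\<^esub>) \<otimes>\<^bsub>?A\<^esub> ?z j [^]\<^bsub>?A\<^esub> pk_mat Pk i j)"
  proof (rule A.lincomb_cong)
    fix j assume j: "j \<in> ?J"
    show "(if j = i then ?A1 else \<one>\<^bsub>?A\<^esub>) \<otimes>\<^bsub>?A\<^esub> ?z j [^]\<^bsub>?A\<^esub> pk_mat Pk i j \<in> carrier ?A"
      using A1 zc[of j] j by (intro A.m_closed A.lincomb_term) auto
  qed (use e in auto)
  also have "\<dots> = lincomb ?A ?J (\<lambda>_. 1) (\<lambda>j. if j = i then ?A1 else \<one>\<^bsub>?A\<^esub>) \<otimes>\<^bsub>?A\<^esub> lincomb ?A ?J (\<lambda>_. 1) (\<lambda>j. ?z j [^]\<^bsub>?A\<^esub> pk_mat Pk i j)"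
    by (rule A.lincomb_mult) (use A1 zc in \<open>auto intro!: A.lincomb_term\<close>)
  also have "lincomb ?A ?J (\<lambda>_. 1) (\<lambda>j. if j = i then ?A1 else \<one>\<^bsub>?A\<^esub>) = lincomb ?A {i} (\<lambda>_. 1) (\<lambda>j. if j = i then ?A1 else \<one>\<^bsub>?A\<^esub>)"
    by (rule A.lincomb_neutral[OF finP]) (use i A1 in auto)
  also have "\<dots> = ?A1" using A.lincomb_single[of "{i}" i "\<lambda>_. 1" "\<lambda>j. if j = i then ?A1 else \<one>\<^bsub>?A\<^esub>"] A1 by simp
  also have "lincomb ?A ?J (\<lambda>_. 1) (\<lambda>j. ?z j [^]\<^bsub>?A\<^esub> pk_mat Pk i j) = lincomb ?A ?J (\<lambda>j. pk_mat Pk i j) ?z"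
    unfolding lincomb_def by (rule A.finprod_cong') (use zc in \<open>auto intro!: A.lincomb_term A.int_pow_1\<close>)
  \<comment> \<open>An index \<open>j\<close> with nonzero coefficient has \<open>a j\<close> below
    \<open>a i\<close>, which is below \<open>x\<close>; so it already lies in
    \<open>IP x\<close>.\<close>
  also have "\<dots> = lincomb ?A I (\<lambda>j. pk_mat Pk i j) ?z" by (rule A.lincomb_neutral[OF fin, symmetric]) (use jle zc in auto)
  also have "\<dots> = lincomb ?A I (\<lambda>j. - parity_sign (s i) * m j i) (\<lambda>j. rst F (n + 1) (a i) x (rst F (n + 1) (a j) (a i) (c j (s' i + n) (rst G (s' i + n) (b i) (b j) g))))"
  proof (rule A.lincomb_cong)
    fix j assume j: "j \<in> I" "- parity_sign (s i) * m j i \<noteq> 0"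
    then have mj: "m j i \<noteq> 0" by auto
    show "?z j = rst F (n + 1) (a i) x (rst F (n + 1) (a j) (a i) (c j (s' i + n) (rst G (s' i + n) (b i) (b j) g)))"
      using complex_rst_rst[OF F ma[OF j(1) iI mj] le sc[OF j(1) mj]] by simp
    then show "rst F (n + 1) (a i) x (rst F (n + 1) (a j) (a i) (c j (s' i + n) (rst G (s' i + n) (b i) (b j) g))) \<in> carrier ?A"
      using zc[OF j(1) mj] by simp
  qed simp
  also have "\<dots> = rst F (n + 1) (a i) x (lincomb (grp F (n + 1) (a i)) I (\<lambda>j. - parity_sign (s i) * m j i)
       (\<lambda>j. rst F (n + 1) (a j) (a i) (c j (s' i + n) (rst G (s' i + n) (b i) (b j) g))))"
    by (rule B.lincomb_hom[OF A.comm_group_axioms r.homh fin, symmetric]) (auto intro: complex_rst_closed[OF F ma[OF _ iI] sc])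
  finally show ?thesis
    using cd B.lincomb_closed[of I "\<lambda>j. - parity_sign (s i) * m j i"] complex_rst_closed[OF F ma[OF _ iI] sc]
    by (simp add: r.hom_int_pow r.hom_mult)
qed

end

lemma components_family: "components c \<Longrightarrow> hom_family c"
  by (simp add: components_def hom_family_def)

text \<open>The equation of \<open>components\<close> is read in the degrees of \<open>Pk\<close>:
  with \<open>s' i + n\<close> for \<open>n\<close>, the degree \<open>s i + (s' i + n)\<close> is
  just \<open>n\<close>. Then it is solved for the differential of \<open>F\<close> by
  \<open>sign_transpose\<close>.\<close>

lemma components_boundary:
  assumes c: "hom_family c"
  shows "components c \<longleftrightarrow> (\<forall>i\<in>I. \<forall>n. \<forall>g\<in>carrier (grp G (s' i + n) (b i)).
    cdiff F n (a i) (c i (s' i + n) g) = boundary c i n g)"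
proof -
  have key: "(cdiff F n (a i) (c i (s' i + n) g) [^]\<^bsub>grp F (n + 1) (a i)\<^esub> parity_sign (s i) \<otimes>\<^bsub>grp F (n + 1) (a i)\<^esub>
       lincomb (grp F (n + 1) (a i)) I (\<lambda>j. m j i) (\<lambda>j. rst F (s j + (s' i + n)) (a j) (a i) (c j (s' i + n) (rst G (s' i + n) (b i) (b j) g)))
       = c i (s' i + n + 1) (cdiff G (s' i + n) (b i) g)) \<longleftrightarrow>
     cdiff F n (a i) (c i (s' i + n) g) = boundary c i n g"
    if i: "i \<in> I" and g: "g \<in> carrier (grp G (s' i + n) (b i))" for i n g
  proof -
    interpret A: comm_group "grp F (n + 1) (a i)" by (rule complex_grp[OF F a[OF i]])
    let ?u = "\<lambda>j. rst F (n + 1) (a j) (a i) (c j (s' i + n) (rst G (s' i + n) (b i) (b j) g))"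
    have u: "?u j \<in> carrier (grp F (n + 1) (a i))" if "j \<in> I" "m j i \<noteq> 0" for j
      by (rule complex_rst_closed[OF F ma[OF that(1) i that(2)] boundary_summand_closed[OF c i g that]])
    have l: "lincomb (grp F (n + 1) (a i)) I (\<lambda>j. m j i) (\<lambda>j. rst F (s j + (s' i + n)) (a j) (a i) (c j (s' i + n) (rst G (s' i + n) (b i) (b j) g)))
      = lincomb (grp F (n + 1) (a i)) I (\<lambda>j. m j i) ?u"
    proof (rule A.lincomb_cong)
      fix j assume j: "j \<in> I" "m j i \<noteq> 0"
      have "s j + (s' i + n) = n + 1" unfolding m_deg[OF j(1) i j(2)] deg_Pk(2) ..
      then show "rst F (s j + (s' i + n)) (a j) (a i) (c j (s' i + n) (rst G (s' i + n) (b i) (b j) g)) = ?u j" by (simp only:)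
    qed (use u in auto)
    have C: "c i (s' i + n + 1) (cdiff G (s' i + n) (b i) g) \<in> carrier (grp F (n + 1) (a i))"
      using family_closed[OF c i, of "cdiff G (s' i + n) (b i) g" "n + 1"] complex_cdiff_closed[OF G b[OF i] g]
      by (simp add: add.assoc[symmetric])
    have D: "cdiff F n (a i) (c i (s' i + n) g) \<in> carrier (grp F (n + 1) (a i))"
      by (rule complex_cdiff_closed[OF F a[OF i] family_closed[OF c i g]])
    show ?thesis unfolding l by (rule A.sign_transpose[OF fin u C D parity_sign_sq])
  qed
  show ?thesis (is "?l \<longleftrightarrow> ?r")
  proof
    assume l: ?l
    show ?r
    proof (intro ballI allI)
      fix i n g assume i: "i \<in> I" and g: "g \<in> carrier (grp G (s' i + n) (b i))"
      have "cdiff F (s i + (s' i + n)) (a i) (c i (s' i + n) g) [^]\<^bsub>grp F (s i + (s' i + n) + 1) (a i)\<^esub> parity_sign (s i) \<otimes>\<^bsub>grp F (s i + (s' i + n) + 1) (a i)\<^esub>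
       lincomb (grp F (s i + (s' i + n) + 1) (a i)) I (\<lambda>j. m j i) (\<lambda>j. rst F (s j + (s' i + n)) (a j) (a i) (c j (s' i + n) (rst G (s' i + n) (b i) (b j) g)))
       = c i (s' i + n + 1) (cdiff G (s' i + n) (b i) g)"
        using l i g unfolding components_def by blast
      then show "cdiff F n (a i) (c i (s' i + n) g) = boundary c i n g" unfolding deg_Pk(2) by (rule key[OF i g, THEN iffD1])
    qed
  next
    assume r: ?r
    show ?l unfolding components_def
    proof (intro ballI allI conjI)
      fix i n assume i: "i \<in> I"
      show "c i n \<in> hom (grp G n (b i)) (grp F (s i + n) (a i))" using c i unfolding hom_family_def by blast
      fix g assume g: "g \<in> carrier (grp G n (b i))"
      have g': "g \<in> carrier (grp G (s' i + (s i + n)) (b i))" unfolding deg_Pk(3) by (rule g)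
      have "cdiff F (s i + n) (a i) (c i (s' i + (s i + n)) g) [^]\<^bsub>grp F (s i + n + 1) (a i)\<^esub> parity_sign (s i) \<otimes>\<^bsub>grp F (s i + n + 1) (a i)\<^esub>
       lincomb (grp F (s i + n + 1) (a i)) I (\<lambda>j. m j i) (\<lambda>j. rst F (s j + (s' i + (s i + n))) (a j) (a i) (c j (s' i + (s i + n)) (rst G (s' i + (s i + n)) (b i) (b j) g)))
       = c i (s' i + (s i + n) + 1) (cdiff G (s' i + (s i + n)) (b i) g)"
        by (rule key[OF i g', THEN iffD2], rule r[rule_format, OF i g'])
      then show "cdiff F (s i + n) (a i) (c i n g) [^]\<^bsub>grp F (s i + n + 1) (a i)\<^esub> parity_sign (s i) \<otimes>\<^bsub>grp F (s i + n + 1) (a i)\<^esub>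
       lincomb (grp F (s i + n + 1) (a i)) I (\<lambda>j. m j i) (\<lambda>j. rst F (s j + n) (a j) (a i) (c j n (rst G n (b i) (b j) g)))
       = c i (n + 1) (cdiff G n (b i) g)"
        unfolding deg_Pk(3) .
    qed
  qed
qed

lemma mkP_in:
  assumes c: "components c"
  shows "mkP c \<in> Hom (complex_cat X) (fob (pk_ftor X Pk) G) F"
proof -
  note cf = components_family[OF c]
  note h = mkP_hom[OF cf]
  have hh: "mkP c n x \<in> hom (pk_grp Pk G n x) (grp F n x)" if "x \<in> topspace X" for n x using h[OF that] by (simp add: ghom_def)
  show ?thesis
  proof (rule complex_HomI, goal_cases)
    case (1 n) then show ?case by (simp add: mkP_def)
  next
    case (2 n x) then show ?case using h by simp
  next
    case (3 n x x' u)
    have x: "x \<in> topspace X" "x' \<in> topspace X" and u: "u \<in> carrier (pk_grp Pk G n x)" using 3 by (auto dest: spec_leD)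
    have "rst F n x x' (mkP c n x u) = mkP c n x' (pk_rst Pk G n x x' u)"
    proof (rule Pk_hom_eqI[OF complex_grp[OF F x(2)] hom_comp[OF hh[OF x(1)] complex_rst_hom[OF F 3(1)]]
         hom_comp[OF pk_rst_hom[OF prekernel_Pk G 3(1)] hh[OF x(2)]] u])
      fix i g assume i: "i \<in> IP x" and g: "g \<in> carrier (grp G (s' i + n) (b i))"
      then have i': "i \<in> IP x'" "i \<in> I" "spec_le X (a i) x" using 3(1) by (auto intro: spec_le_trans)
      show "rst F n x x' (mkP c n x (incl x n i g)) = mkP c n x' (pk_rst Pk G n x x' (incl x n i g))"
        unfolding pk_rst_incl[OF 3(1) i g] mkP_incl[OF cf x(1) i g] mkP_incl[OF cf x(2) i'(1) g]
        by (rule complex_rst_rst[OF F i'(3) 3(1) family_closed[OF cf i'(2) g]])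
    qed
    then show ?case using u by simp
  next
    case (4 n x u)
    have u: "u \<in> carrier (pk_grp Pk G n x)" using 4 by simp
    have "cdiff F n x (mkP c n x u) = mkP c (n + 1) x (pk_dif Pk G n x u)"
    proof (rule Pk_hom_eqI[OF complex_grp[OF F 4(1)] hom_comp[OF hh[OF 4(1)] complex_cdiff_hom[OF F 4(1)]]
         hom_comp[OF pk_dif_hom[OF prekernel_Pk G 4(1)] hh[OF 4(1)]] u])
      fix i g assume i: "i \<in> IP x" and g: "g \<in> carrier (grp G (s' i + n) (b i))"
      then have i': "i \<in> I" "spec_le X (a i) x" by auto
      show "cdiff F n x (mkP c n x (incl x n i g)) = mkP c (n + 1) x (pk_dif Pk G n x (incl x n i g))"
        unfolding mkP_incl[OF cf 4(1) i g] mkP_dif_incl[OF cf 4(1) i g]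
        using complex_rst_cdiff[OF F i'(2) family_closed[OF cf i'(1) g]] c[unfolded components_boundary[OF cf]] i'(1) g by simp
    qed
    then show ?case using u 4(1) by simp
  qed
qed

context
  fixes \<phi> assumes \<phi>: "\<phi> \<in> Hom (complex_cat X) (fob (pk_ftor X Pk) G) F"
begin

lemma mor_incl_hom: "x \<in> topspace X \<Longrightarrow> i \<in> IP x \<Longrightarrow> (\<lambda>g. \<phi> n x (incl x n i g)) \<in> hom (grp G (s' i + n) (b i)) (grp F n x)"
  using hom_comp[OF incl_hom mor_hom[OF \<phi>, unfolded pk_ftor_simps(1)]] .

lemma hom_family_compP: "hom_family (compP \<phi>)"
  unfolding hom_family_def
proof (intro ballI allI)
  fix i n assume i: "i \<in> I"
  show "compP \<phi> i n \<in> hom (grp G n (b i)) (grp F (s i + n) (a i))"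
    using mor_incl_hom[OF a[OF i] own_index(2)[OF i], of "s i + n"] unfolding deg_Pk(3) compP_def[abs_def] .
qed

lemma mor_eq_compP:
  assumes x: "x \<in> topspace X" and u: "u \<in> carrier (pk_grp Pk G n x)"
  shows "\<phi> n x u = mkP (compP \<phi>) n x u"
proof (rule Pk_hom_eqI[OF complex_grp[OF F x] mor_hom[OF \<phi> x, unfolded pk_ftor_simps(1)] _ u])
  show "mkP (compP \<phi>) n x \<in> hom (pk_grp Pk G n x) (grp F n x)" using mkP_hom[OF hom_family_compP x] by (simp add: ghom_def)
  fix i g assume i: "i \<in> IP x" and g: "g \<in> carrier (grp G (s' i + n) (b i))"
  then have i': "i \<in> I" "spec_le X (a i) x" by auto
  note oi = own_index(2)[OF i'(1)]
  have "\<phi> n x (incl x n i g) = rst F n (a i) x (\<phi> n (a i) (incl (a i) n i g))"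
    using mor_rst[OF \<phi> i'(2), of "incl (a i) n i g" n] incl_closed[OF oi g] pk_rst_incl[OF i'(2) oi g] by simp
  then show "\<phi> n x (incl x n i g) = mkP (compP \<phi>) n x (incl x n i g)" unfolding mkP_incl[OF hom_family_compP x i g] compP_def deg_Pk(2) .
qed

lemma components_compP: "components (compP \<phi>)"
  unfolding components_boundary[OF hom_family_compP]
proof (intro ballI allI)
  fix i n g assume i: "i \<in> I" and g: "g \<in> carrier (grp G (s' i + n) (b i))"
  note oi = own_index(2)[OF i] and ai = a[OF i] and f = hom_family_compP
  let ?R = "compP \<phi> i (s' i + n + 1) (cdiff G (s' i + n) (b i) g) [^]\<^bsub>grp F (n + 1) (a i)\<^esub> parity_sign (s i) \<otimes>\<^bsub>grp F (n + 1) (a i)\<^esub>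
     lincomb (grp F (n + 1) (a i)) I (\<lambda>j. - parity_sign (s i) * m j i)
       (\<lambda>j. rst F (n + 1) (a j) (a i) (compP \<phi> j (s' i + n) (rst G (s' i + n) (b i) (b j) g)))"
  interpret A: comm_group "grp F (n + 1) (a i)" by (rule complex_grp[OF F ai])
  have C: "compP \<phi> i (s' i + n + 1) (cdiff G (s' i + n) (b i) g) \<in> carrier (grp F (n + 1) (a i))"
    using family_closed[OF f i, of "cdiff G (s' i + n) (b i) g" "n + 1"] complex_cdiff_closed[OF G b[OF i] g]
    by (simp add: add.assoc[symmetric])
  have R: "?R \<in> carrier (grp F (n + 1) (a i))"
    using complex_rst_closed[OF F ma[OF _ i] boundary_summand_closed[OF f i g]]
    by (intro A.m_closed A.int_pow_closed C A.lincomb_closed) auto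
  have w: "incl (a i) n i g \<in> carrier (pk_grp Pk G n (a i))" by (rule incl_closed[OF oi g])
  have "cdiff F n (a i) (compP \<phi> i (s' i + n) g) = cdiff F n (a i) (\<phi> n (a i) (incl (a i) n i g))" unfolding compP_def deg_Pk(2) ..
  also have "\<dots> = \<phi> (n + 1) (a i) (pk_dif Pk G n (a i) (incl (a i) n i g))"
    using mor_cdiff[OF \<phi> ai, of "incl (a i) n i g" n] w ai by simp
  also have "\<dots> = mkP (compP \<phi>) (n + 1) (a i) (pk_dif Pk G n (a i) (incl (a i) n i g))"
    by (rule mor_eq_compP[OF ai pk_dif_closed[OF prekernel_Pk G ai w]])
  also have "\<dots> = rst F (n + 1) (a i) (a i) ?R" by (rule mkP_dif_incl[OF f ai oi g])
  also have "\<dots> = ?R" by (rule complex_rst_refl[OF F ai R])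
  finally show "cdiff F n (a i) (compP \<phi> i (s' i + n) g) = ?R" .
qed

lemma mkP_compP: "mkP (compP \<phi>) = \<phi>"
  by (rule complex_mor_eqI[OF mkP_in[OF components_compP] \<phi>]) (use mor_eq_compP in simp)

end

lemma compP_mkP:
  assumes c: "components c" and i: "i \<in> I" and g: "g \<in> carrier (grp G n (b i))"
  shows "compP (mkP c) i n g = c i n g"
proof -
  have g': "g \<in> carrier (grp G (s' i + (s i + n)) (b i))" unfolding deg_Pk(3) by (rule g)
  have "c i n g \<in> carrier (grp F (s i + n) (a i))" using family_closed[OF components_family[OF c] i g'] unfolding deg_Pk(3) .
  then show ?thesis unfolding compP_def mkP_incl[OF components_family[OF c] a[OF i] own_index(2)[OF i] g'] deg_Pk(3)
    by (rule complex_rst_refl[OF F a[OF i]])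
qed

lemma mkP_cong:
  assumes eq: "\<And>i n g. i \<in> I \<Longrightarrow> g \<in> carrier (grp G n (b i)) \<Longrightarrow> c i n g = d i n g"
    and d: "hom_family d"
  shows "mkP c = mkP d"
  unfolding mkP_def
proof (rule ext, rule restrict_ext, rule restrict_ext)
  fix n x u assume x: "x \<in> topspace X" and u: "u \<in> carrier (pk_grp Pk G n x)"
  interpret A: comm_group "grp F n x" by (rule complex_grp[OF F x])
  show "lincomb (grp F n x) (IP x) (\<lambda>_. 1) (\<lambda>i. rst F n (a i) x (c i (s' i + n) (entry (IP x) i u))) =
    lincomb (grp F n x) (IP x) (\<lambda>_. 1) (\<lambda>i. rst F n (a i) x (d i (s' i + n) (entry (IP x) i u)))"
  proof (rule A.lincomb_cong)
    fix i assume i: "i \<in> IP x"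
    note e = Pk_entry_closed[OF x u i]
    show "rst F n (a i) x (c i (s' i + n) (entry (IP x) i u)) = rst F n (a i) x (d i (s' i + n) (entry (IP x) i u))" using eq[OF _ e] i by simp
    show "rst F n (a i) x (d i (s' i + n) (entry (IP x) i u)) \<in> carrier (grp F n x)" by (rule hom_in_carrier[OF hom_family_hom[OF d i] e])
  qed simp
qed

text \<open>Both sides are compared with families of components. Such a family matters only on
  carriers, so the round trips go through \<open>mkP_cong\<close> and
  \<open>mkQ_cong\<close>.\<close>

lemma bij_mkQ_compP:
  "bij_betw (\<lambda>\<phi>. mkQ (compP \<phi>)) (Hom (complex_cat X) (fob (pk_ftor X Pk) G) F) (Hom (complex_cat Y) G (fob (pk_ftor Y Qk) F))"
proof (rule bij_betw_byWitness[of _ "\<lambda>\<psi>. mkP (compQ \<psi>)"])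
  show "\<forall>\<phi>\<in>Hom (complex_cat X) (fob (pk_ftor X Pk) G) F. mkP (compQ (mkQ (compP \<phi>))) = \<phi>"
  proof
    fix \<phi> assume \<phi>: "\<phi> \<in> Hom (complex_cat X) (fob (pk_ftor X Pk) G) F"
    have "mkP (compQ (mkQ (compP \<phi>))) = mkP (compP \<phi>)"
      by (rule mkP_cong[OF compQ_mkQ[OF components_compP[OF \<phi>]] hom_family_compP[OF \<phi>]])
    then show "mkP (compQ (mkQ (compP \<phi>))) = \<phi>" using mkP_compP[OF \<phi>] by simp
  qed
  show "\<forall>\<psi>\<in>Hom (complex_cat Y) G (fob (pk_ftor Y Qk) F). mkQ (compP (mkP (compQ \<psi>))) = \<psi>"
  proof
    fix \<psi> assume \<psi>: "\<psi> \<in> Hom (complex_cat Y) G (fob (pk_ftor Y Qk) F)"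
    have "mkQ (compP (mkP (compQ \<psi>))) = mkQ (compQ \<psi>)" by (rule mkQ_cong[OF compP_mkP[OF components_compQ[OF \<psi>]]])
    then show "mkQ (compP (mkP (compQ \<psi>))) = \<psi>" using mkQ_compQ[OF \<psi>] by simp
  qed
qed (auto intro: mkQ_in mkP_in components_compP components_compQ)

end

lemma pk_mor_incl:
  fixes G G' :: "('b, 'u::infinite) cochain" and F :: "('a, 'u) cochain"
  assumes F: "F \<in> Ob (complex_cat X)" and G: "G \<in> Ob (complex_cat Y)" and G': "G' \<in> Ob (complex_cat Y)" and u: "u \<in> Hom (complex_cat Y) G' G"
    and x: "x \<in> topspace X" and i: "i \<in> IP x" and g: "g \<in> carrier (grp G' (s' i + n) (b i))"
  shows "pk_mor Pk u n x (inclusion (IP x) (\<lambda>i. grp G' (s' i + n) (b i)) i g) =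
    inclusion (IP x) (\<lambda>i. grp G (s' i + n) (b i)) i (u (s' i + n) (b i) g)"
proof -
  have bi: "b i \<in> topspace Y" using i b by simp
  show ?thesis
  proof (rule pk_eqI[OF prekernel_Pk G x pk_mor_closed[OF prekernel_Pk G' u x incl_closed[OF G' F i g]]
        incl_closed[OF G F i mor_closed[OF u bi g]]])
    fix k assume k: "k \<in> IP x"
    then have bk: "b k \<in> topspace Y" using b by simp
    have "u (s' k + n) (b k) \<one>\<^bsub>grp G' (s' k + n) (b k)\<^esub> = \<one>\<^bsub>grp G (s' k + n) (b k)\<^esub>" by (rule mor_one[OF G' G u bk])
    then show "entry (IP x) k (pk_mor Pk u n x (inclusion (IP x) (\<lambda>i. grp G' (s' i + n) (b i)) i g)) =
      entry (IP x) k (inclusion (IP x) (\<lambda>i. grp G (s' i + n) (b i)) i (u (s' i + n) (b i) g))"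
      unfolding entry_pk_mor[OF prekernel_Pk G' x k] entry_incl[OF G' F k] entry_incl[OF G F k] by simp
  qed
qed

text \<open>Only naturality is left to check. Entry \<open>i\<close> of either side at
  \<open>y\<close> is read off at \<open>b i\<close>, where both become the value of
  \<open>v\<close> after \<open>h\<close> on one generator.\<close>

lemma left_adjoint_kernel:
  "left_adjoint (complex_cat Y) (complex_cat X) (pk_ftor X Pk) (pk_ftor Y Qk :: (('a, 'u::infinite) cochain, _, _, _) ftor)"
proof -
  have cX: "is_category (complex_cat X :: (('a, 'u) cochain, _) cat)" and cY: "is_category (complex_cat Y :: (('b, 'u) cochain, _) cat)"
    by (rule is_category_complex_cat)+
  note P = pk_functor[OF prekernel_Pk] and Q = pk_functor[OF prekernel_Qk]
  have nat: "mkQ G' (compP G' (Cmp (complex_cat X) (fob (pk_ftor X Pk) G') F F' v (Cmp (complex_cat X) (fob (pk_ftor X Pk) G') (fob (pk_ftor X Pk) G) F h (far (pk_ftor X Pk) G' G u)))) =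
    Cmp (complex_cat Y) G' (fob (pk_ftor Y Qk) F) (fob (pk_ftor Y Qk) F') (far (pk_ftor Y Qk) F F' v) (Cmp (complex_cat Y) G' G (fob (pk_ftor Y Qk) F) (mkQ G (compP G h)) u)"
    (is "mkQ G' (compP G' ?h) = ?r")
    if o: "G \<in> Ob (complex_cat Y)" "G' \<in> Ob (complex_cat Y)" "F \<in> Ob (complex_cat X)" "F' \<in> Ob (complex_cat X)"
      and u: "u \<in> Hom (complex_cat Y) G' G" and v: "v \<in> Hom (complex_cat X) F F'" and h: "h \<in> Hom (complex_cat X) (fob (pk_ftor X Pk) G) F"
    for G G' :: "('b, 'u) cochain" and F F' :: "('a, 'u) cochain" and u v h
  proof -
    have Pu: "far (pk_ftor X Pk) G' G u \<in> Hom (complex_cat X) (fob (pk_ftor X Pk) G') (fob (pk_ftor X Pk) G)" by (rule pk_far[OF prekernel_Pk o(2,1) u])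
    have Qv: "far (pk_ftor Y Qk) F F' v \<in> Hom (complex_cat Y) (fob (pk_ftor Y Qk) F) (fob (pk_ftor Y Qk) F')" by (rule pk_far[OF prekernel_Qk o(3,4) v])
    note PG = pk_fob[OF prekernel_Pk o(1)] and PG' = pk_fob[OF prekernel_Pk o(2)] and QF = pk_fob[OF prekernel_Qk o(3)] and QF' = pk_fob[OF prekernel_Qk o(4)]
    have hP: "Cmp (complex_cat X) (fob (pk_ftor X Pk) G') (fob (pk_ftor X Pk) G) F h (far (pk_ftor X Pk) G' G u) \<in> Hom (complex_cat X) (fob (pk_ftor X Pk) G') F"
      by (rule cat_Cmp[OF cX PG' PG o(3) Pu h])
    have h': "?h \<in> Hom (complex_cat X) (fob (pk_ftor X Pk) G') F'" by (rule cat_Cmp[OF cX PG' o(3,4) hP v])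
    have mh: "mkQ G (compP G h) \<in> Hom (complex_cat Y) G (fob (pk_ftor Y Qk) F)" by (rule mkQ_in[OF o(1,3) components_compP[OF o(1,3) h]])
    have mu: "Cmp (complex_cat Y) G' G (fob (pk_ftor Y Qk) F) (mkQ G (compP G h)) u \<in> Hom (complex_cat Y) G' (fob (pk_ftor Y Qk) F)"
      by (rule cat_Cmp[OF cY o(2,1) QF u mh])
    have l: "mkQ G' (compP G' ?h) \<in> Hom (complex_cat Y) G' (fob (pk_ftor Y Qk) F')" by (rule mkQ_in[OF o(2,4) components_compP[OF o(2,4) h']])
    have r: "?r \<in> Hom (complex_cat Y) G' (fob (pk_ftor Y Qk) F')" by (rule cat_Cmp[OF cY o(2) QF QF' mu Qv])
    show ?thesis
    proof (rule complex_mor_eqI[OF l r])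
      fix n y g assume y: "y \<in> topspace Y" and g: "g \<in> carrier (grp G' n y)"
      note ug = mor_closed[OF u y g]
      have mc: "mkQ G (compP G h) n y (u n y g) \<in> carrier (pk_grp Qk F n y)" using mor_closed[OF mh y ug] by simp
      have rr: "?r n y g = pk_mor Qk v n y (mkQ G (compP G h) n y (u n y g))" using y g mc by simp
      show "mkQ G' (compP G' ?h) n y g = ?r n y g"
      proof (rule pk_eqI[OF prekernel_Qk o(4) y mor_closed[OF l y g, unfolded pk_ftor_simps(1)] mor_closed[OF r y g, unfolded pk_ftor_simps(1)]])
        fix i assume i: "i \<in> IQ y"
        then have i': "i \<in> I" "spec_le Y y (b i)" by auto
        note ai = a[OF i'(1)] and oi = own_index(2)[OF o(1,3) i'(1)] and bi = b[OF i'(1)]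
        let ?g = "rst G' n y (b i) g" and ?N = "s i + n"
        have g2: "?g \<in> carrier (grp G' n (b i))" by (rule complex_rst_closed[OF o(2) i'(2) g])
        then have g3: "?g \<in> carrier (grp G' (s' i + ?N) (b i))" unfolding deg_Pk(3) .
        let ?w = "inclusion (IP (a i)) (\<lambda>i. grp G' (s' i + ?N) (b i)) i ?g"
        have w: "?w \<in> carrier (pk_grp Pk G' ?N (a i))" by (rule incl_closed[OF o(2,4) oi g3])
        have pw: "pk_mor Pk u ?N (a i) ?w = inclusion (IP (a i)) (\<lambda>i. grp G (s' i + ?N) (b i)) i (u n (b i) ?g)"
          using pk_mor_incl[OF o(3,1,2) u ai oi g3] unfolding deg_Pk(3) .
        have "entry (IQ y) i (mkQ G' (compP G' ?h) n y g) = v ?N (a i) (h ?N (a i) (pk_mor Pk u ?N (a i) ?w))"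
          unfolding entry_mkQ[OF o(2,4) y g i] compP_def[OF o(2,4)] using ai w by simp
        also have "\<dots> = v ?N (a i) (compP G h i n (u n (b i) ?g))" unfolding pw compP_def[OF o(1,3)] ..
        also have "\<dots> = v ?N (a i) (compP G h i n (rst G n y (b i) (u n y g)))" unfolding mor_rst[OF u i'(2) g] ..
        also have "\<dots> = entry (IQ y) i (?r n y g)" unfolding rr entry_pk_mor[OF prekernel_Qk o(3) y i] entry_mkQ[OF o(1,3) y ug i] by simp
        finally show "entry (IQ y) i (mkQ G' (compP G' ?h) n y g) = entry (IQ y) i (?r n y g)" .
      qed
    qed
  qed
  show ?thesis unfolding left_adjoint_def
    by (intro conjI P Q exI[of _ "\<lambda>G F \<phi>. mkQ G (compP G \<phi>)"] ballI bij_mkQ_compP nat)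
qed

end

section \<open>The cobar resolution\<close>

text \<open>Distinct points of a preorder may be equivalent. With one representative per class,
  chains are ordered antisymmetrically, so maxima, minima and positions of vertices are well
  defined.\<close>

definition spec_rep :: "'b topology \<Rightarrow> 'b \<Rightarrow> 'b" where
  "spec_rep Y y = (SOME z. spec_le Y y z \<and> spec_le Y z y)"

definition chains :: "'b topology \<Rightarrow> 'b set set" where
  "chains Y = {c. c \<subseteq> spec_rep Y ` topspace Y \<and> c \<noteq> {} \<and> (\<forall>z\<in>c. \<forall>w\<in>c. spec_le Y z w \<or> spec_le Y w z)}"

definition chain_max :: "'b topology \<Rightarrow> 'b set \<Rightarrow> 'b" where
  "chain_max Y c = (SOME z. z \<in> c \<and> (\<forall>w\<in>c. spec_le Y w z))"

definition chain_min :: "'b topology \<Rightarrow> 'b set \<Rightarrow> 'b" where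
  "chain_min Y c = (SOME z. z \<in> c \<and> (\<forall>w\<in>c. spec_le Y z w))"

definition face_sign :: "'b topology \<Rightarrow> 'b \<Rightarrow> 'b set \<Rightarrow> int" where
  "face_sign Y z c = (- 1) ^ card {w \<in> c. w \<noteq> z \<and> spec_le Y w z}"

text \<open>The incidence number of \<open>c\<close> and \<open>e\<close>. At most one
  \<open>z\<close> contributes; writing it as a sum turns the removed vertex into a summation
  variable.\<close>

definition face_coeff :: "'b topology \<Rightarrow> 'b set \<Rightarrow> 'b set \<Rightarrow> int" where
  "face_coeff Y c e = (\<Sum>z\<in>e. if c = e - {z} then face_sign Y z e else 0)"

lemma spec_trans: "spec_le Z p q \<Longrightarrow> spec_le Z q r \<Longrightarrow> spec_le Z p r"
  by (auto simp: spec_le_def)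

lemma spec_rep:
  assumes "y \<in> topspace Y"
  shows "spec_le Y y (spec_rep Y y)" "spec_le Y (spec_rep Y y) y"
proof -
  have "\<exists>z. spec_le Y y z \<and> spec_le Y z y" using spec_le_refl[OF assms] by blast
  from someI_ex[OF this] show "spec_le Y y (spec_rep Y y)" "spec_le Y (spec_rep Y y) y" by (auto simp: spec_rep_def)
qed

text \<open>Equivalent points present the same predicate to the choice operator, hence have the same
  representative.\<close>

lemma spec_rep_antisym:
  assumes "z \<in> spec_rep Y ` topspace Y" "w \<in> spec_rep Y ` topspace Y" "spec_le Y z w" "spec_le Y w z"
  shows "z = w"
proof -
  obtain p q where pq: "p \<in> topspace Y" "q \<in> topspace Y" "z = spec_rep Y p" "w = spec_rep Y q" using assms by blast
  have "spec_le Y p q" "spec_le Y q p" using pq assms spec_rep[OF pq(1)] spec_rep[OF pq(2)] spec_trans by metis+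
  then have "(\<lambda>z. spec_le Y p z \<and> spec_le Y z p) = (\<lambda>z. spec_le Y q z \<and> spec_le Y z q)" by (auto intro: spec_trans)
  then show ?thesis by (simp add: pq spec_rep_def)
qed

context
  fixes Y :: "'b topology"
  assumes finY: "finite (topspace Y)"
begin

lemma finite_chain: "c \<in> chains Y \<Longrightarrow> finite c"
  using finY by (auto simp: chains_def intro: finite_subset)

lemma finite_chains: "finite (chains Y)"
  using finY by (auto simp: chains_def intro: finite_subset[of _ "Pow (spec_rep Y ` topspace Y)"])

lemma chain_in: "c \<in> chains Y \<Longrightarrow> z \<in> c \<Longrightarrow> z \<in> topspace Y"
  using spec_rep(1) spec_leD by (fastforce simp: chains_def)

lemma chain_antisym: "c \<in> chains Y \<Longrightarrow> z \<in> c \<Longrightarrow> w \<in> c \<Longrightarrow> spec_le Y z w \<Longrightarrow> spec_le Y w z \<Longrightarrow> z = w"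
  using spec_rep_antisym[of z Y w] by (auto simp: chains_def)

lemma chain_total: "c \<in> chains Y \<Longrightarrow> z \<in> c \<Longrightarrow> w \<in> c \<Longrightarrow> spec_le Y z w \<or> spec_le Y w z"
  by (auto simp: chains_def)

lemma chain_subset: "c \<in> chains Y \<Longrightarrow> d \<subseteq> c \<Longrightarrow> d \<noteq> {} \<Longrightarrow> d \<in> chains Y"
  by (auto simp: chains_def)

lemma chain_max:
  assumes c: "c \<in> chains Y"
  shows "chain_max Y c \<in> c" "w \<in> c \<Longrightarrow> spec_le Y w (chain_max Y c)"
proof -
  have "\<exists>z. z \<in> c \<and> (\<forall>w\<in>c. spec_le Y w z)" if "finite c" "c \<noteq> {}" "c \<in> chains Y" for c
    using that
  proof (induction c rule: finite_ne_induct)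
    case (singleton x) then show ?case using chain_in spec_le_refl by fastforce
  next
    case (insert x F)
    have "F \<in> chains Y" by (rule chain_subset[OF insert.prems]) (use insert in auto)
    then obtain z where z: "z \<in> F" "\<forall>w\<in>F. spec_le Y w z" using insert by blast
    consider "spec_le Y x z" | "spec_le Y z x" using chain_total[OF insert.prems, of x z] z(1) by blast
    then show ?case
    proof cases
      case 1 then show ?thesis using z by blast
    next
      case 2 then show ?thesis using z spec_trans[of Y _ z x] spec_le_refl[OF chain_in[OF insert.prems, of x]] by blast
    qed
  qed
  from someI_ex[OF this[OF finite_chain[OF c] _ c]] c
  show "chain_max Y c \<in> c" "w \<in> c \<Longrightarrow> spec_le Y w (chain_max Y c)" by (auto simp: chain_max_def chains_def)
qed

lemma chain_min:
  assumes c: "c \<in> chains Y"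
  shows "chain_min Y c \<in> c" "w \<in> c \<Longrightarrow> spec_le Y (chain_min Y c) w"
proof -
  have "\<exists>z. z \<in> c \<and> (\<forall>w\<in>c. spec_le Y z w)" if "finite c" "c \<noteq> {}" "c \<in> chains Y" for c
    using that
  proof (induction c rule: finite_ne_induct)
    case (singleton x) then show ?case using chain_in spec_le_refl by fastforce
  next
    case (insert x F)
    have "F \<in> chains Y" by (rule chain_subset[OF insert.prems]) (use insert in auto)
    then obtain z where z: "z \<in> F" "\<forall>w\<in>F. spec_le Y z w" using insert by blast
    consider "spec_le Y z x" | "spec_le Y x z" using chain_total[OF insert.prems, of x z] z(1) by blast
    then show ?case
    proof cases
      case 1 then show ?thesis using z by blast
    next
      case 2 then show ?thesis using z spec_trans[of Y x z] spec_le_refl[OF chain_in[OF insert.prems, of x]] by blast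
    qed
  qed
  from someI_ex[OF this[OF finite_chain[OF c] _ c]] c
  show "chain_min Y c \<in> c" "w \<in> c \<Longrightarrow> spec_le Y (chain_min Y c) w" by (auto simp: chain_min_def chains_def)
qed

lemma chain_max_mono: "c \<in> chains Y \<Longrightarrow> e \<in> chains Y \<Longrightarrow> c \<subseteq> e \<Longrightarrow> spec_le Y (chain_max Y c) (chain_max Y e)"
  using chain_max[of c] chain_max[of e] by blast

lemma chain_min_mono: "c \<in> chains Y \<Longrightarrow> e \<in> chains Y \<Longrightarrow> c \<subseteq> e \<Longrightarrow> spec_le Y (chain_min Y e) (chain_min Y c)"
  using chain_min[of c] chain_min[of e] by blast

lemma chain_max_eqI: "c \<in> chains Y \<Longrightarrow> z \<in> c \<Longrightarrow> (\<And>w. w \<in> c \<Longrightarrow> spec_le Y w z) \<Longrightarrow> chain_max Y c = z"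
  using chain_max[of c] chain_antisym[of c z "chain_max Y c"] by blast

lemma face_coeff_nonzero: "face_coeff Y c e \<noteq> 0 \<Longrightarrow> \<exists>z\<in>e. c = e - {z}"
proof (rule ccontr)
  assume "face_coeff Y c e \<noteq> 0" "\<not> (\<exists>z\<in>e. c = e - {z})"
  moreover from this have "face_coeff Y c e = 0" unfolding face_coeff_def by (intro sum.neutral) auto
  ultimately show False by simp
qed

text \<open>The sign counts the vertices below: deleting the smaller vertex lowers the count for
  \<open>w\<close> by one, deleting the larger one does not affect the count for
  \<open>z\<close>.\<close>

lemma face_sign_remove:
  assumes e: "e \<in> chains Y" and zw: "z \<in> e" "w \<in> e" "z \<noteq> w" and le: "spec_le Y z w"
  shows "face_sign Y w (e - {z}) = - face_sign Y w e" "face_sign Y z (e - {w}) = face_sign Y z e"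
proof -
  let ?A = "{v \<in> e. v \<noteq> w \<and> spec_le Y v w}"
  have "{v \<in> e - {z}. v \<noteq> w \<and> spec_le Y v w} = ?A - {z}" by auto
  moreover have "z \<in> ?A" "finite ?A" using zw le finite_chain[OF e] by auto
  ultimately have "card ?A = Suc (card {v \<in> e - {z}. v \<noteq> w \<and> spec_le Y v w})"
    using card_Suc_Diff1[of ?A z] by simp
  then show "face_sign Y w (e - {z}) = - face_sign Y w e" unfolding face_sign_def by simp
  have "{v \<in> e - {w}. v \<noteq> z \<and> spec_le Y v z} = {v \<in> e. v \<noteq> z \<and> spec_le Y v z}"
    using chain_antisym[OF e zw(1,2) le] zw by auto
  then show "face_sign Y z (e - {w}) = face_sign Y z e" by (simp add: face_sign_def)
qed

lemma face_sign_swap: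
  assumes e: "e \<in> chains Y" and zw: "z \<in> e" "w \<in> e" "z \<noteq> w"
  shows "face_sign Y z e * face_sign Y w (e - {z}) = - (face_sign Y w e * face_sign Y z (e - {w}))"
proof (cases "spec_le Y z w")
  case True then show ?thesis using face_sign_remove[OF e zw] by simp
next
  case False
  then have "spec_le Y w z" using chain_total[OF e zw(1,2)] by blast
  then show ?thesis using face_sign_remove[OF e zw(2,1)] zw by simp
qed

text \<open>The boundary of a boundary. Removing \<open>z\<close> and \<open>w\<close> in either
  order gives the same face with opposite signs, so the double sum equals its own negative.\<close>

lemma face_face:
  assumes e: "e \<in> chains Y"
  shows "(\<Sum>z\<in>e. face_sign Y z e * face_coeff Y c (e - {z})) = 0"
proof -
  let ?t = "\<lambda>z w. if z \<noteq> w \<and> c = e - {z} - {w} then face_sign Y z e * face_sign Y w (e - {z}) else 0"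
  have "(\<Sum>z\<in>e. face_sign Y z e * face_coeff Y c (e - {z})) = (\<Sum>z\<in>e. \<Sum>w\<in>e. ?t z w)"
  proof (rule sum.cong[OF refl])
    fix z assume z: "z \<in> e"
    have "face_sign Y z e * face_coeff Y c (e - {z}) = (\<Sum>w\<in>e - {z}. ?t z w)"
      unfolding face_coeff_def sum_distrib_left by (rule sum.cong) auto
    also have "\<dots> = (\<Sum>w\<in>e. ?t z w)" by (rule sum.mono_neutral_left) (use finite_chain[OF e] in auto)
    finally show "face_sign Y z e * face_coeff Y c (e - {z}) = (\<Sum>w\<in>e. ?t z w)" .
  qed
  moreover have "(\<Sum>z\<in>e. \<Sum>w\<in>e. ?t z w) = - (\<Sum>z\<in>e. \<Sum>w\<in>e. ?t z w)"
  proof -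
    have "(\<Sum>z\<in>e. \<Sum>w\<in>e. ?t z w) = (\<Sum>w\<in>e. \<Sum>z\<in>e. ?t z w)" by (rule sum.swap)
    also have "\<dots> = (\<Sum>w\<in>e. \<Sum>z\<in>e. - ?t w z)"
    proof (intro sum.cong refl)
      fix w z assume wz: "w \<in> e" "z \<in> e"
      have "e - {z} - {w} = e - {w} - {z}" by auto
      then show "?t z w = - ?t w z" using face_sign_swap[OF e wz(2,1)] by auto
    qed
    finally show ?thesis by (simp only: sum_negf)
  qed
  ultimately show ?thesis by linarith
qed

end

text \<open>
  The summand of the cobar resolution with index \<open>(c, i)\<close>, \<open>c\<close> a chain, is present at the points below
  \<open>min c\<close> and is the \<open>i\<close>-th summand of the given functor at \<open>max c\<close>.
\<close>

locale cobar =
  fixes X :: "'a topology" and Y :: "'b topology" and K :: "('i, 'a, 'b) prekernel"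
  assumes finY: "finite (topspace Y)" and K: "is_prekernel X Y K"
begin

abbreviation "mx \<equiv> chain_max Y"
abbreviation "mn \<equiv> chain_min Y"

definition cb_ind :: "('b set \<times> 'i) set" where
  "cb_ind = {(c, i). c \<in> chains Y \<and> i \<in> pk_ind K (mx c)}"

definition cb_src :: "'b set \<times> 'i \<Rightarrow> 'a" where
  "cb_src = (\<lambda>(c, i). pk_pt K i (mx c))"

definition cb_tgt :: "'b set \<times> 'i \<Rightarrow> 'b" where
  "cb_tgt = (\<lambda>(c, i). mn c)"

text \<open>Each further vertex lowers the shift by one. The \<open>1\<close> leaves one-point
  chains, where the augmentation arrives, in the degree of the given functor.\<close>

definition cb_deg :: "'b set \<times> 'i \<Rightarrow> int" where
  "cb_deg = (\<lambda>(c, i). pk_deg K i + 1 - int (card c))"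

text \<open>This is -1 to the power \<open>card c - 1\<close>, the dimension of the chain. It flips
  when a vertex is removed, which makes the face part and the inner part of \<open>cb_mat\<close>
  anticommute, and it is 1 on points.\<close>

definition dim_sign :: "'b set \<Rightarrow> int" where
  "dim_sign c = - ((- 1) ^ card c)"

definition cb_mat :: "'b set \<times> 'i \<Rightarrow> 'b set \<times> 'i \<Rightarrow> int" where
  "cb_mat = (\<lambda>(c, i) (e, j). (if i = j then face_coeff Y c e else 0) + (if c = e then dim_sign c * pk_mat K i j else 0))"

lemmas cb_defs = cb_src_def cb_tgt_def cb_deg_def cb_mat_def

lemma mx_in: "c \<in> chains Y \<Longrightarrow> mx c \<in> topspace Y"
  using chain_max(1)[OF finY] chain_in[OF finY] by blast

lemma mn_in: "c \<in> chains Y \<Longrightarrow> mn c \<in> topspace Y"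
  using chain_min(1)[OF finY] chain_in[OF finY] by blast

lemma tw_mx: "c \<in> chains Y \<Longrightarrow> twisted X (pk_ind K (mx c)) (\<lambda>i. pk_pt K i (mx c)) (pk_deg K) (pk_mat K)"
  by (rule prekernelD(1)[OF K mx_in])

lemma finite_cb_ind: "finite cb_ind"
proof -
  have "cb_ind = (SIGMA c:chains Y. pk_ind K (mx c))" by (auto simp: cb_ind_def)
  then show ?thesis using finite_chains[OF finY] twistedD(1)[OF tw_mx] by auto
qed

lemma cb_mat_cases:
  assumes pt: "(c, i) \<in> cb_ind" "(e, j) \<in> cb_ind" and nz: "cb_mat (c, i) (e, j) \<noteq> 0"
  obtains (face) z where "i = j" "z \<in> e" "c = e - {z}" | (inner) "c = e" "pk_mat K i j \<noteq> 0"
proof (cases "c = e \<and> pk_mat K i j \<noteq> 0")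
  case True then show ?thesis using inner by blast
next
  case False
  then have "i = j" "face_coeff Y c e \<noteq> 0" using nz by (auto simp: cb_mat_def split: if_splits)
  then show ?thesis using face_coeff_nonzero[OF finY] face by blast
qed

lemma dim_sign_remove: "c \<in> chains Y \<Longrightarrow> z \<in> c \<Longrightarrow> dim_sign (c - {z}) = - dim_sign c"
proof -
  assume "c \<in> chains Y" "z \<in> c"
  then have "card c = Suc (card (c - {z}))" using card_Suc_Diff1[OF finite_chain[OF finY], of c z] by simp
  then show ?thesis unfolding dim_sign_def by simp
qed

text \<open>Only indices are summed, whereas \<open>face_face\<close> runs over all intermediate
  faces. The two agree by convexity of presence: \<open>i\<close> is present at the maxima of
  \<open>c\<close> and \<open>e\<close>, hence at the maximum of every chain in between.\<close>

lemma cb_face_sum: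
  assumes c: "(c, i) \<in> cb_ind" and e: "(e, i) \<in> cb_ind"
  shows "(\<Sum>f | (f, i) \<in> cb_ind. face_coeff Y c f * face_coeff Y f e) = 0"
proof -
  have ce: "c \<in> chains Y" "e \<in> chains Y" "i \<in> pk_ind K (mx c)" "i \<in> pk_ind K (mx e)" using c e by (auto simp: cb_ind_def)
  have fin: "finite {f. (f, i) \<in> cb_ind}" using finite_chains[OF finY] by (rule finite_subset[rotated]) (auto simp: cb_ind_def)
  have "(\<Sum>f | (f, i) \<in> cb_ind. face_coeff Y c f * face_coeff Y f e) =
    (\<Sum>f | (f, i) \<in> cb_ind. \<Sum>z\<in>e. if f = e - {z} then face_sign Y z e * face_coeff Y c (e - {z}) else 0)"
    unfolding face_coeff_def[of Y _ e] sum_distrib_left by (intro sum.cong refl) auto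
  also have "\<dots> = (\<Sum>z\<in>e. \<Sum>f | (f, i) \<in> cb_ind. if f = e - {z} then face_sign Y z e * face_coeff Y c (e - {z}) else 0)"
    by (rule sum.swap)
  also have "\<dots> = (\<Sum>z\<in>e. face_sign Y z e * face_coeff Y c (e - {z}))"
  proof (rule sum.cong[OF refl])
    fix z assume z: "z \<in> e"
    have "(\<Sum>f | (f, i) \<in> cb_ind. if f = e - {z} then face_sign Y z e * face_coeff Y c (e - {z}) else 0) =
      (if e - {z} \<in> {f. (f, i) \<in> cb_ind} then face_sign Y z e * face_coeff Y c (e - {z}) else 0)"
      using sum.delta[OF fin, of "e - {z}" "\<lambda>_. face_sign Y z e * face_coeff Y c (e - {z})"] by simp
    also have "\<dots> = face_sign Y z e * face_coeff Y c (e - {z})"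
    proof (cases "face_coeff Y c (e - {z}) = 0")
      case False
      then have sub: "c \<subseteq> e - {z}" using face_coeff_nonzero[OF finY] by blast
      have f: "e - {z} \<in> chains Y" by (rule chain_subset[OF finY ce(2)]) (use sub ce(1) in \<open>auto simp: chains_def\<close>)
      have "i \<in> pk_ind K (mx (e - {z}))"
        by (rule prekernelD(4)[OF K chain_max_mono[OF finY ce(1) f sub] chain_max_mono[OF finY f ce(2)] ce(3,4)]) auto
      then show ?thesis using f by (simp add: cb_ind_def)
    qed simp
    finally show "(\<Sum>f | (f, i) \<in> cb_ind. if f = e - {z} then face_sign Y z e * face_coeff Y c (e - {z}) else 0) = face_sign Y z e * face_coeff Y c (e - {z})" .
  qed
  also have "\<dots> = 0" by (rule face_face[OF finY ce(2)])
  finally show ?thesis .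
qed

text \<open>Squaring the sum of face part and inner part gives four terms. \<open>?T1\<close>
  vanishes by \<open>cb_face_sum\<close>, \<open>?T4\<close> because the matrix of \<open>K\<close>
  squares to zero at \<open>mx c\<close>, and the mixed terms \<open>?T2\<close> and
  \<open>?T3\<close> cancel through \<open>dim_sign\<close>.\<close>

lemma cb_mat_square:
  assumes p: "p \<in> cb_ind" and t: "t \<in> cb_ind"
  shows "(\<Sum>q\<in>cb_ind. cb_mat p q * cb_mat q t) = 0"
proof -
  obtain c i where pc: "p = (c, i)" by (cases p)
  obtain e k where te: "t = (e, k)" by (cases t)
  have ci: "(c, i) \<in> cb_ind" "c \<in> chains Y" "i \<in> pk_ind K (mx c)" using p by (auto simp: pc cb_ind_def)
  have ek: "(e, k) \<in> cb_ind" "e \<in> chains Y" "k \<in> pk_ind K (mx e)" using t by (auto simp: te cb_ind_def)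
  let ?D = "face_coeff Y" and ?m = "pk_mat K"
  let ?T1 = "\<lambda>q. if snd q = i \<and> i = k then ?D c (fst q) * ?D (fst q) e else 0"
  let ?T2 = "\<lambda>q. if q = (e, i) then ?D c e * (dim_sign e * ?m i k) else 0"
  let ?T3 = "\<lambda>q. if q = (c, k) then (dim_sign c * ?m i k) * ?D c e else 0"
  let ?T4 = "\<lambda>q. if c = e \<and> fst q = c then dim_sign c * dim_sign c * (?m i (snd q) * ?m (snd q) k) else 0"
  have "(\<Sum>q\<in>cb_ind. cb_mat p q * cb_mat q t) = (\<Sum>q\<in>cb_ind. ?T1 q + ?T2 q + ?T3 q + ?T4 q)"
  proof (rule sum.cong[OF refl])
    fix q :: "'b set \<times> 'i"
    obtain f j where q: "q = (f, j)" by (cases q)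
    show "cb_mat p q * cb_mat q t = ?T1 q + ?T2 q + ?T3 q + ?T4 q"
      unfolding q pc te cb_mat_def prod.case fst_conv snd_conv prod.inject
      by (cases "i = j"; cases "j = k"; cases "c = f"; cases "f = e") (simp_all add: algebra_simps)
  qed
  also have "\<dots> = (\<Sum>q\<in>cb_ind. ?T1 q) + (\<Sum>q\<in>cb_ind. ?T2 q) + (\<Sum>q\<in>cb_ind. ?T3 q) + (\<Sum>q\<in>cb_ind. ?T4 q)"
    by (simp add: sum.distrib)
  also have "(\<Sum>q\<in>cb_ind. ?T1 q) = 0"
  proof (cases "i = k")
    case True
    have "(\<Sum>q\<in>cb_ind. ?T1 q) = (\<Sum>q\<in>(\<lambda>f. (f, i)) ` {f. (f, i) \<in> cb_ind}. ?D c (fst q) * ?D (fst q) e)"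
      by (rule sum.mono_neutral_cong_right[OF finite_cb_ind]) (use True in auto)
    also have "\<dots> = (\<Sum>f | (f, i) \<in> cb_ind. ?D c f * ?D f e)" by (subst sum.reindex) (auto simp: inj_on_def)
    also have "\<dots> = 0" using cb_face_sum[OF ci(1)] ek(1) True by simp
    finally show ?thesis .
  qed simp
  also have "(\<Sum>q\<in>cb_ind. ?T4 q) = 0"
  proof (cases "c = e")
    case True
    have "(\<Sum>q\<in>cb_ind. ?T4 q) = (\<Sum>q\<in>Pair c ` pk_ind K (mx c). dim_sign c * dim_sign c * (?m i (snd q) * ?m (snd q) k))"
      by (rule sum.mono_neutral_cong_right[OF finite_cb_ind]) (use True ci(2) in \<open>auto simp: cb_ind_def\<close>)
    also have "\<dots> = (\<Sum>j\<in>pk_ind K (mx c). dim_sign c * dim_sign c * (?m i j * ?m j k))" by (subst sum.reindex) (auto simp: inj_on_def)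
    also have "\<dots> = 0" using twistedD(6)[OF tw_mx[OF ci(2)] ci(3), of k] ek(3) True by (simp flip: sum_distrib_left)
    finally show ?thesis .
  qed simp
  also have "(\<Sum>q\<in>cb_ind. ?T2 q) = (if (e, i) \<in> cb_ind then ?D c e * (dim_sign e * ?m i k) else 0)"
    using sum.delta[OF finite_cb_ind, of "(e, i)" "\<lambda>_. ?D c e * (dim_sign e * ?m i k)"] by simp
  also have "(\<Sum>q\<in>cb_ind. ?T3 q) = (if (c, k) \<in> cb_ind then (dim_sign c * ?m i k) * ?D c e else 0)"
    using sum.delta[OF finite_cb_ind, of "(c, k)" "\<lambda>_. (dim_sign c * ?m i k) * ?D c e"] by simp
  also have "0 + (if (e, i) \<in> cb_ind then ?D c e * (dim_sign e * ?m i k) else 0) + (if (c, k) \<in> cb_ind then (dim_sign c * ?m i k) * ?D c e else 0) + 0 = 0"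
  proof (cases "?D c e = 0 \<or> ?m i k = 0")
    case False
    then obtain z where z: "z \<in> e" "c = e - {z}" using face_coeff_nonzero[OF finY] by blast
    have "spec_le Y (mx c) (mx e)" using z by (intro chain_max_mono[OF finY ci(2) ek(2)]) auto
    \<comment> \<open>The third clause of \<open>is_prekernel\<close>: the two mixed paths, through
      \<open>(e, i)\<close> and through \<open>(c, k)\<close>, are both available or both
      not.\<close>
    then have "i \<in> pk_ind K (mx e) \<longleftrightarrow> k \<in> pk_ind K (mx c)" using prekernelD(3)[OF K _ ci(3) ek(3)] False by blast
    then show ?thesis using dim_sign_remove[OF ek(2) z(1)] z(2) ci(2) ek(2) by (auto simp: cb_ind_def)
  qed auto
  finally show ?thesis .
qed

text \<open>Enlarging a chain raises its maximum and lowers its minimum, which is the opposite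
  variance that \<open>bikernel\<close> asks of the points \<open>a\<close> and
  \<open>b\<close>.\<close>

sublocale bikernel X Y cb_ind cb_src cb_tgt cb_deg cb_mat
proof
  show "finite cb_ind" by (rule finite_cb_ind)
next
  fix p assume "p \<in> cb_ind" then show "cb_src p \<in> topspace X" "cb_tgt p \<in> topspace Y"
    using twistedD(2)[OF tw_mx] mn_in by (auto simp: cb_ind_def cb_defs)
next
  fix p t assume p: "p \<in> cb_ind" and t: "t \<in> cb_ind" and nz: "cb_mat p t \<noteq> 0"
  obtain c i where pc: "p = (c, i)" by (cases p)
  obtain e j where te: "t = (e, j)" by (cases t)
  have ci: "c \<in> chains Y" "i \<in> pk_ind K (mx c)" using p by (auto simp: pc cb_ind_def)
  have ej: "e \<in> chains Y" "j \<in> pk_ind K (mx e)" using t by (auto simp: te cb_ind_def)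
  have "cb_deg p = cb_deg t + 1 \<and> spec_le X (cb_src p) (cb_src t) \<and> spec_le Y (cb_tgt t) (cb_tgt p)"
    using p[unfolded pc] t[unfolded te] nz[unfolded pc te]
  proof (cases rule: cb_mat_cases)
    case (face z)
    have sub: "c \<subseteq> e" using face by auto
    have "Suc (card c) = card e" using card_Suc_Diff1[OF finite_chain[OF finY ej(1)] face(2)] face(3) by simp
    then show ?thesis
      using face chain_min_mono[OF finY ci(1) ej(1) sub] prekernelD(2)[OF K chain_max_mono[OF finY ci(1) ej(1) sub] ci(2)] ej(2)
      by (auto simp: pc te cb_defs)
  next
    case inner
    then show ?thesis using twistedD(3,4)[OF tw_mx[OF ci(1)] ci(2), of j] ej spec_le_refl[OF mn_in[OF ci(1)]]
      by (auto simp: pc te cb_defs)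
  qed
  then show "cb_deg p = cb_deg t + 1" "spec_le X (cb_src p) (cb_src t)" "spec_le Y (cb_tgt t) (cb_tgt p)" by blast+
qed (rule cb_mat_square)

end

context comm_group
begin

lemma lincomb_reindex:
  assumes "inj_on f S" "\<And>i. i \<in> S \<Longrightarrow> k (f i) \<noteq> 0 \<Longrightarrow> u (f i) \<in> carrier G"
  shows "lincomb G (f ` S) k u = lincomb G S (\<lambda>i. k (f i)) (\<lambda>i. u (f i))"
  unfolding lincomb_def using assms by (intro finprod_reindex) (auto intro!: lincomb_term)

lemma lincomb_const:
  assumes "finite S" "x \<in> carrier G" shows "lincomb G S k (\<lambda>_. x) = x [^] (\<Sum>i\<in>S. k i)"
  using assms(1)
proof (induction S rule: finite_induct)
  case (insert i S)
  then show ?case using assms(2) by (subst lincomb_insert) (auto simp: int_pow_mult)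
qed (simp add: lincomb_def)

end

text \<open>The two ends of an edge have positions 0 and 1. This cancellation makes the augmentation
  compatible with the differential on edges.\<close>

lemma face_sign_sum_two:
  assumes Y: "finite (topspace Y)" and e: "e \<in> chains Y" "card e = 2"
  shows "(\<Sum>z\<in>e. face_sign Y z e) = 0"
proof -
  obtain p q where pq: "e = {p, q}" "p \<noteq> q" using e(2) by (auto simp: card_2_iff)
  have s: "face_sign Y z {z, w} = 1" "face_sign Y w {z, w} = - 1" if c: "{z, w} \<in> chains Y" "z \<noteq> w" "spec_le Y z w" for z w
  proof -
    have "\<not> spec_le Y w z" using chain_antisym[OF Y c(1), of z w] c by auto
    then have "{v \<in> {z, w}. v \<noteq> z \<and> spec_le Y v z} = {}" by auto
    then show "face_sign Y z {z, w} = 1" unfolding face_sign_def by (simp only: card.empty power_0)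
    have "{v \<in> {z, w}. v \<noteq> w \<and> spec_le Y v w} = {z}" using c by auto
    then have "card {v \<in> {z, w}. v \<noteq> w \<and> spec_le Y v w} = 1" by (simp only:) simp
    then show "face_sign Y w {z, w} = - 1" unfolding face_sign_def by (simp only: power_one_right)
  qed
  show ?thesis
  proof (cases "spec_le Y p q")
    case True then show ?thesis using s[of p q] e pq by simp
  next
    case False
    then have "spec_le Y q p" using chain_total[OF Y e(1), of p q] pq by auto
    then show ?thesis using s[of q p] e pq by (simp add: insert_commute)
  qed
qed

section \<open>The augmentation from the given functor to its resolution\<close>

context cobar
begin

abbreviation "S y \<equiv> pk_ind Qk y"

lemma S_iff: "(c, i) \<in> S y \<longleftrightarrow> c \<in> chains Y \<and> i \<in> pk_ind K (mx c) \<and> spec_le Y y (mn c)"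
  unfolding Qk_simps by (auto simp: cb_ind_def cb_tgt_def)

lemma finite_S: "finite (S y)"
  using finite_cb_ind by simp

lemma SI: "q \<in> S y \<Longrightarrow> q \<in> cb_ind" by simp

lemma m_deg': "q \<in> cb_ind \<Longrightarrow> t \<in> cb_ind \<Longrightarrow> cb_mat q t \<noteq> 0 \<Longrightarrow> cb_deg q + n = cb_deg t + n + 1"
  by (simp add: ms)

lemma S_mx: "(c, i) \<in> S y \<Longrightarrow> spec_le Y y (mx c)"
  using chain_max(1)[OF finY] chain_min(2)[OF finY] spec_trans unfolding S_iff by metis

lemma S_le: "(c, i) \<in> S y \<Longrightarrow> z \<in> c \<Longrightarrow> spec_le Y y z"
  using chain_min(2)[OF finY] spec_trans unfolding S_iff by metis

context
  fixes F :: "('a, 'u::infinite) cochain" assumes F: "F \<in> Ob (complex_cat X)"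
begin

text \<open>The coaugmentation, concentrated in simplicial degree zero; for a one-point chain,
  \<open>mx c\<close> is that point.\<close>

definition aug_entry :: "int \<Rightarrow> 'b \<Rightarrow> 'u \<Rightarrow> 'b set \<times> 'i \<Rightarrow> 'u" where
  "aug_entry n y u = (\<lambda>(c, i). if card c = 1 then entry (pk_ind K (mx c)) i (pk_rst K F n y (mx c) u)
     else \<one>\<^bsub>grp F (cb_deg (c, i) + n) (cb_src (c, i))\<^esub>)"

definition augmentation :: "('b, 'u) cmor" where
  "augmentation = (\<lambda>n. \<lambda>y\<in>topspace Y. \<lambda>u\<in>carrier (pk_grp K F n y). tuple (S y) (aug_entry n y u))"

lemma aug_entry_closed:
  assumes q: "q \<in> S y" and u: "u \<in> carrier (pk_grp K F n y)"
  shows "aug_entry n y u q \<in> carrier (grp F (cb_deg q + n) (cb_src q))"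
proof -
  obtain c i where ci: "q = (c, i)" by (cases q)
  have c: "c \<in> chains Y" "i \<in> pk_ind K (mx c)" using q by (simp_all add: S_iff ci del: Qk_simps)
  note le = S_mx[OF q[unfolded ci]]
  have "q \<in> cb_ind" using q by simp
  note s = a[OF this]
  show ?thesis
  proof (cases "card c = 1")
    case True
    then show ?thesis
      using pk_entry_closed[OF K F mx_in[OF c(1)] pk_rst_closed[OF K F le u] c(2)]
      by (simp add: aug_entry_def ci cb_deg_def cb_src_def)
  next
    case False then show ?thesis using complex_one_closed[OF F s] by (simp add: aug_entry_def ci)
  qed
qed

lemma aug_hom: "y \<in> topspace Y \<Longrightarrow> (\<lambda>u. tuple (S y) (aug_entry n y u)) \<in> hom (pk_grp K F n y) (pk_grp Qk F n y)"
  unfolding pk_grp_def[of Qk] tw_grp_def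
proof (rule tuple_hom[OF finite_S])
  fix q assume y: "y \<in> topspace Y" and q: "q \<in> S y"
  obtain c i where ci: "q = (c, i)" by (cases q)
  have c: "c \<in> chains Y" "i \<in> pk_ind K (mx c)" using q by (simp_all add: S_iff ci del: Qk_simps)
  note le = S_mx[OF q[unfolded ci]]
  have "q \<in> cb_ind" using q by simp
  note s = a[OF this]
  interpret A: comm_group "grp F (cb_deg q + n) (cb_src q)" by (rule complex_grp[OF F s])
  show "(\<lambda>u. aug_entry n y u q) \<in> hom (pk_grp K F n y) (grp F (pk_deg Qk q + n) (pk_pt Qk q y))"
    unfolding Qk_simps
  proof (rule homI[OF aug_entry_closed[OF q]])
    fix u v assume u: "u \<in> carrier (pk_grp K F n y)" and v: "v \<in> carrier (pk_grp K F n y)"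
    show "aug_entry n y (u \<otimes>\<^bsub>pk_grp K F n y\<^esub> v) q = aug_entry n y u q \<otimes>\<^bsub>grp F (cb_deg q + n) (cb_src q)\<^esub> aug_entry n y v q"
    proof (cases "card c = 1")
      case True
      have "pk_rst K F n y (mx c) (u \<otimes>\<^bsub>pk_grp K F n y\<^esub> v) = pk_rst K F n y (mx c) u \<otimes>\<^bsub>pk_grp K F n (mx c)\<^esub> pk_rst K F n y (mx c) v"
        by (rule hom_mult[OF pk_rst_hom[OF K F le] u v])
      then show ?thesis
        using True entry_mult[OF pk_finite[OF K F mx_in[OF c(1)]] c(2)] unfolding pk_grp_def tw_grp_def
        by (simp add: aug_entry_def ci cb_deg_def cb_src_def)
    next
      case False
      have "\<one>\<^bsub>grp F (cb_deg (c, i) + n) (cb_src (c, i))\<^esub> = \<one>\<^bsub>grp F (cb_deg (c, i) + n) (cb_src (c, i))\<^esub> \<otimes>\<^bsub>grp F (cb_deg (c, i) + n) (cb_src (c, i))\<^esub> \<one>\<^bsub>grp F (cb_deg (c, i) + n) (cb_src (c, i))\<^esub>"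
        using A.l_one[OF A.one_closed] unfolding ci by (rule sym)
      then show ?thesis using False unfolding aug_entry_def ci prod.case by (simp only: if_False)
    qed
  qed
qed

lemma aug_closed: "y \<in> topspace Y \<Longrightarrow> u \<in> carrier (pk_grp K F n y) \<Longrightarrow> augmentation n y u \<in> carrier (pk_grp Qk F n y)"
  using hom_in_carrier[OF aug_hom] by (simp add: augmentation_def)

lemma entry_aug: "y \<in> topspace Y \<Longrightarrow> u \<in> carrier (pk_grp K F n y) \<Longrightarrow> q \<in> S y \<Longrightarrow> entry (S y) q (augmentation n y u) = aug_entry n y u q"
  unfolding augmentation_def using entry_tuple[OF finite_S] by simp

lemma Qk_entry_closed: "y \<in> topspace Y \<Longrightarrow> l \<in> carrier (pk_grp Qk F n y) \<Longrightarrow> q \<in> S y \<Longrightarrow>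
    entry (S y) q l \<in> carrier (grp F (cb_deg q + n) (cb_src q))"
  using pk_entry_closed[OF prekernel_Qk F, of y l n q] unfolding Qk_simps(2,3) .

lemma Qk_term_closed:
  assumes y: "y \<in> topspace Y" and l: "l \<in> carrier (pk_grp Qk F n y)" and q: "q \<in> S y" "t \<in> S y" "cb_mat q t \<noteq> 0"
  shows "rst F (cb_deg q + n) (cb_src q) (cb_src t) (entry (S y) q l) \<in> carrier (grp F (cb_deg t + n + 1) (cb_src t))"
  using complex_rst_closed[OF F ma[OF SI[OF q(1)] SI[OF q(2)] q(3)] Qk_entry_closed[OF y l q(1)]]
  unfolding m_deg'[OF SI[OF q(1)] SI[OF q(2)] q(3), of n] .

lemma entry_Qk_dif:
  assumes y: "y \<in> topspace Y" and t: "t \<in> S y"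
  shows "entry (S y) t (pk_dif Qk F n y l) =
    cdiff F (cb_deg t + n) (cb_src t) (entry (S y) t l) [^]\<^bsub>grp F (cb_deg t + n + 1) (cb_src t)\<^esub> parity_sign (cb_deg t)
    \<otimes>\<^bsub>grp F (cb_deg t + n + 1) (cb_src t)\<^esub> lincomb (grp F (cb_deg t + n + 1) (cb_src t)) (S y) (\<lambda>q. cb_mat q t)
      (\<lambda>q. rst F (cb_deg q + n) (cb_src q) (cb_src t) (entry (S y) q l))"
  unfolding entry_pk_dif[OF prekernel_Qk F y t] tw_comp_def Qk_simps(2,3,4) ..

text \<open>A one-point chain has no faces, the empty set not being a chain, and
  \<open>dim_sign\<close> is 1 on it. So only the matrix of \<open>K\<close> contributes, and on
  such chains the resolution behaves like the given functor at that point.\<close>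

lemma entry_Qk_dif_vertex:
  assumes y: "y \<in> topspace Y" and l: "l \<in> carrier (pk_grp Qk F n y)" and t: "(e, j) \<in> S y" and one: "card e = 1"
  shows "entry (S y) (e, j) (pk_dif Qk F n y l) =
    entry (pk_ind K (mx e)) j (pk_dif K F n (mx e) (tuple (pk_ind K (mx e)) (\<lambda>i. entry (S y) (e, i) l)))"
proof -
  let ?J = "pk_ind K (mx e)" and ?t = "(e, j)"
  let ?G = "grp F (cb_deg ?t + n + 1) (cb_src ?t)"
  have e: "e \<in> chains Y" "j \<in> ?J" "spec_le Y y (mn e)" using t by (simp_all add: S_iff del: Qk_simps)
  let ?w = "tuple ?J (\<lambda>i. entry (S y) (e, i) l)"
  let ?v = "\<lambda>q. rst F (cb_deg q + n) (cb_src q) (cb_src ?t) (entry (S y) q l)"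
  interpret A: comm_group ?G by (rule complex_grp[OF F a[OF SI[OF t]]])
  note vc = Qk_term_closed[OF y l _ t]
  note fin = pk_finite[OF K F mx_in[OF e(1)]]
  have sub: "Pair e ` ?J \<subseteq> S y" using e by (auto simp: S_iff simp del: Qk_simps)
  have "lincomb ?G (S y) (\<lambda>q. cb_mat q ?t) ?v = lincomb ?G (Pair e ` ?J) (\<lambda>q. cb_mat q ?t) ?v"
  proof (rule A.lincomb_neutral[OF finite_S sub])
    fix q assume q: "q \<in> S y - Pair e ` ?J" "cb_mat q ?t \<noteq> 0"
    obtain c i where ci: "q = (c, i)" by (cases q)
    have inn: "(c, i) \<in> cb_ind" "c \<in> chains Y" "(c, i) \<in> S y" "i \<in> pk_ind K (mx c)" using q SI[of q y] by (simp_all add: ci S_iff del: Qk_simps)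
    consider (face) z where "i = j" "z \<in> e" "c = e - {z}" | (inner) "c = e" "pk_mat K i j \<noteq> 0"
      by (rule cb_mat_cases[OF inn(1) SI[OF t] q(2)[unfolded ci]]) blast+
    then have False
    proof cases
      case (face z)
      then have "c = {}" using one by (auto simp: card_1_singleton_iff)
      then show ?thesis using \<open>c \<in> chains Y\<close> by (simp add: chains_def)
    next
      case inner
      then show ?thesis using q(1) \<open>i \<in> pk_ind K (mx c)\<close> by (simp add: ci image_iff)
    qed
    then show "?v q = \<one>\<^bsub>?G\<^esub>" ..
  qed (use vc sub in auto)
  also have "\<dots> = lincomb ?G ?J (\<lambda>i. cb_mat (e, i) ?t) (\<lambda>i. ?v (e, i))"
    by (rule A.lincomb_reindex) (use vc sub in \<open>auto simp: inj_on_def\<close>)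
  also have "\<dots> = lincomb ?G ?J (\<lambda>i. pk_mat K i j) (\<lambda>i. rst F (pk_deg K i + n) (pk_pt K i (mx e)) (pk_pt K j (mx e)) (entry ?J i ?w))"
  proof (rule A.lincomb_cong)
    have "face_coeff Y e e = 0" using face_coeff_nonzero[OF finY, of e e] by auto
    then show m: "cb_mat (e, i) ?t = pk_mat K i j" for i using one by (simp add: cb_mat_def dim_sign_def)
    fix i assume i: "i \<in> ?J" "pk_mat K i j \<noteq> 0"
    show eq: "?v (e, i) = rst F (pk_deg K i + n) (pk_pt K i (mx e)) (pk_pt K j (mx e)) (entry ?J i ?w)"
      using one i(1) fin by (simp add: cb_deg_def cb_src_def)
    show "rst F (pk_deg K i + n) (pk_pt K i (mx e)) (pk_pt K j (mx e)) (entry ?J i ?w) \<in> carrier ?G"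
      unfolding eq[symmetric] by (rule vc) (use sub i m in auto)
  qed
  finally have l: "lincomb ?G (S y) (\<lambda>q. cb_mat q ?t) ?v = lincomb ?G ?J (\<lambda>i. pk_mat K i j) (\<lambda>i. rst F (pk_deg K i + n) (pk_pt K i (mx e)) (pk_pt K j (mx e)) (entry ?J i ?w))" .
  show ?thesis
    unfolding entry_pk_dif[OF K F mx_in[OF e(1)] e(2)] entry_Qk_dif[OF y t] l
    unfolding tw_comp_def using one e(2) fin by (simp add: cb_deg_def cb_src_def)
qed

text \<open>Three cases for the chain \<open>e\<close>. On a point both sides are the differential
  of \<open>K\<close> after restriction. On an edge the two faces contribute one element with
  opposite signs. On longer chains everything is neutral, since all faces have more than one
  point.\<close>

lemma aug_cdiff:
  assumes y: "y \<in> topspace Y" and u: "u \<in> carrier (pk_grp K F n y)"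
  shows "pk_dif Qk F n y (augmentation n y u) = augmentation (n + 1) y (pk_dif K F n y u)"
proof (rule pk_eqI[OF prekernel_Qk F y pk_dif_closed[OF prekernel_Qk F y aug_closed[OF y u]]
      aug_closed[OF y pk_dif_closed[OF K F y u]]])
  fix t assume t: "t \<in> S y"
  obtain e j where te: "t = (e, j)" by (cases t)
  have e: "e \<in> chains Y" "j \<in> pk_ind K (mx e)" "spec_le Y y (mn e)" using t by (simp_all add: S_iff te del: Qk_simps)
  note le = S_mx[OF t[unfolded te]]
  have tI: "t \<in> cb_ind" using t by simp
  let ?G = "grp F (cb_deg t + n + 1) (cb_src t)"
  interpret A: comm_group ?G by (rule complex_grp[OF F a[OF tI]])
  note du = pk_dif_closed[OF K F y u]
  note au = aug_closed[OF y u]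
  define v where "v q = rst F (cb_deg q + n) (cb_src q) (cb_src t) (entry (S y) q (augmentation n y u))" for q
  note vc = Qk_term_closed[OF y au _ t, folded v_def]
  show "entry (S y) t (pk_dif Qk F n y (augmentation n y u)) = entry (S y) t (augmentation (n + 1) y (pk_dif K F n y u))"
  proof (cases "card e = 1")
    case one: True
    let ?w = "pk_rst K F n y (mx e) u" and ?J = "pk_ind K (mx e)"
    note fin = pk_finite[OF K F mx_in[OF e(1)]]
    have w: "?w \<in> carrier (pk_grp K F n (mx e))" by (rule pk_rst_closed[OF K F le u])
    have "tuple ?J (\<lambda>i. entry (S y) (e, i) (augmentation n y u)) = tuple ?J (\<lambda>i. entry ?J i ?w)"
    proof (rule tuple_cong)
      fix i assume "i \<in> ?J"
      then have "(e, i) \<in> S y" using e by (simp add: S_iff del: Qk_simps)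
      then show "entry (S y) (e, i) (augmentation n y u) = entry ?J i ?w"
        unfolding entry_aug[OF y u \<open>(e, i) \<in> S y\<close>] aug_entry_def using one by simp
    qed
    also have "\<dots> = ?w" using w unfolding pk_grp_def tw_grp_def by (rule tuple_entry[OF fin])
    finally have tup: "tuple ?J (\<lambda>i. entry (S y) (e, i) (augmentation n y u)) = ?w" .
    have "entry (S y) t (pk_dif Qk F n y (augmentation n y u)) = entry ?J j (pk_dif K F n (mx e) ?w)"
      unfolding te entry_Qk_dif_vertex[OF y aug_closed[OF y u] t[unfolded te] one] tup ..
    also have "\<dots> = entry ?J j (pk_rst K F (n + 1) y (mx e) (pk_dif K F n y u))" unfolding pk_dif_rst[OF K F le u] ..
    also have "\<dots> = entry (S y) t (augmentation (n + 1) y (pk_dif K F n y u))"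
      unfolding entry_aug[OF y du t] using one by (simp add: te aug_entry_def)
    finally show ?thesis .
  next
    case more: False
    have at: "aug_entry n y u t = \<one>\<^bsub>grp F (cb_deg t + n) (cb_src t)\<^esub>" using more by (simp add: aug_entry_def te)
    have v1: "v q = \<one>\<^bsub>?G\<^esub>" if q: "q \<in> S y" "cb_mat q t \<noteq> 0" "card (fst q) \<noteq> 1" for q
    proof -
      have qI: "q \<in> cb_ind" using q by simp
      have "aug_entry n y u q = \<one>\<^bsub>grp F (cb_deg q + n) (cb_src q)\<^esub>" using q(3) by (cases q) (simp add: aug_entry_def)
      then show ?thesis unfolding v_def entry_aug[OF y u q(1)] using complex_rst_one[OF F ma[OF qI tI q(2)], of "cb_deg q + n"]
        unfolding m_deg'[OF qI tI q(2), of n] by simp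
    qed
    have "lincomb ?G (S y) (\<lambda>q. cb_mat q t) v = \<one>\<^bsub>?G\<^esub>"
    proof (cases "card e = 2")
      case False
      show ?thesis
      proof (rule A.lincomb_one)
        fix q assume q: "q \<in> S y" "cb_mat q t \<noteq> 0"
        obtain c i where ci: "q = (c, i)" by (cases q)
        have nz: "(c, i) \<in> cb_ind" "cb_mat (c, i) (e, j) \<noteq> 0" using q SI[of q y] by (simp_all add: ci te del: Qk_simps)
        consider (face) z where "i = j" "z \<in> e" "c = e - {z}" | (inner) "c = e" "pk_mat K i j \<noteq> 0"
        by (rule cb_mat_cases[OF nz(1) tI[unfolded te] nz(2)]) blast+
      then have "card c \<noteq> 1"
      proof cases
          case (face z)
          then have "card e = Suc (card c)" using card_Suc_Diff1[OF finite_chain[OF finY e(1)] face(2)] by simp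
          then show ?thesis using False by simp
        next
          case inner
          then show ?thesis using more by simp
        qed
        then show "v q = \<one>\<^bsub>?G\<^esub>" using v1[OF q] by (simp add: ci)
      qed
    next
      case two: True
      have dg: "cb_deg t + n + 1 = pk_deg K j + n" using two by (simp add: te cb_deg_def)
      let ?T = "{q \<in> S y. fst q \<noteq> e}"
      have finT: "finite ?T" by (rule finite_subset[OF _ finite_S[of y]]) auto
      let ?\<tau> = "entry (pk_ind K (mx e)) j (pk_rst K F n y (mx e) u)"
      have \<tau>c: "?\<tau> \<in> carrier ?G"
        using pk_entry_closed[OF K F mx_in[OF e(1)] pk_rst_closed[OF K F le u] e(2)] unfolding dg by (simp add: te cb_src_def)
      have T: "\<exists>z\<in>e. q = (e - {z}, j) \<and> cb_mat q t = face_sign Y z e" if q: "q \<in> ?T" "cb_mat q t \<noteq> 0" for q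
      proof -
        obtain c i where ci: "q = (c, i)" by (cases q)
        have nz: "(c, i) \<in> cb_ind" "cb_mat (c, i) (e, j) \<noteq> 0" using q SI[of q y] by (simp_all add: ci te del: Qk_simps)
        consider (face) z where "i = j" "z \<in> e" "c = e - {z}" | (inner) "c = e" "pk_mat K i j \<noteq> 0"
        by (rule cb_mat_cases[OF nz(1) tI[unfolded te] nz(2)]) blast+
      then show ?thesis
      proof cases
          case (face z)
          have "face_coeff Y c e = (\<Sum>w\<in>e. if w = z then face_sign Y z e else 0)"
            unfolding face_coeff_def by (rule sum.cong) (use face(2,3) in auto)
          also have "\<dots> = face_sign Y z e" using finite_chain[OF finY e(1)] face(2) by simp
          finally show ?thesis using face q(1) by (auto simp: ci te cb_mat_def)
        next
          case inner
          then show ?thesis using q(1) by (simp add: ci)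
        qed
      qed
      \<comment> \<open>Restricting to the face first and then to the maximum of \<open>e\<close> is
        the same as restricting at once, so the contribution does not depend on the face.\<close>
      have vT: "v q = ?\<tau>" if q: "q \<in> ?T" "cb_mat q t \<noteq> 0" for q
      proof -
        obtain z where z: "z \<in> e" "q = (e - {z}, j)" using T[OF q] by blast
        have c1: "card (e - {z}) = 1" using two z(1) by simp
        have qS: "(e - {z}, j) \<in> S y" using q(1) z by simp
        then have c: "e - {z} \<in> chains Y" "j \<in> pk_ind K (mx (e - {z}))" by (simp_all add: S_iff del: Qk_simps)
        have le': "spec_le Y (mx (e - {z})) (mx e)" by (rule chain_max_mono[OF finY c(1) e(1)]) auto
        have "v q = rst F (pk_deg K j + n) (pk_pt K j (mx (e - {z}))) (pk_pt K j (mx e)) (entry (pk_ind K (mx (e - {z}))) j (pk_rst K F n y (mx (e - {z})) u))"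
          unfolding v_def z(2) entry_aug[OF y u qS] using c1 by (simp add: te aug_entry_def cb_deg_def cb_src_def)
        also have "\<dots> = entry (pk_ind K (mx e)) j (pk_rst K F n (mx (e - {z})) (mx e) (pk_rst K F n y (mx (e - {z})) u))"
          unfolding entry_pk_rst[OF K F mx_in[OF e(1)] e(2)] using c(2) by simp
        also have "\<dots> = ?\<tau>" unfolding pk_rst_rst[OF K F S_mx[OF qS] le' u] ..
        finally show ?thesis .
      qed
      have "lincomb ?G (S y) (\<lambda>q. cb_mat q t) v = lincomb ?G ?T (\<lambda>q. cb_mat q t) v"
        by (rule A.lincomb_neutral[OF finite_S]) (use v1 vc more in auto)
      also have "\<dots> = lincomb ?G ?T (\<lambda>q. cb_mat q t) (\<lambda>_. ?\<tau>)" by (rule A.lincomb_cong) (use vT \<tau>c in auto)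
      also have "\<dots> = \<one>\<^bsub>?G\<^esub>"
      \<comment> \<open>If \<open>j\<close> is absent at \<open>y\<close>, the common value
        \<open>?\<tau>\<close> is neutral. If it is present, convexity makes both faces of the edge
        indices, and their signs add up to zero.\<close>
      proof (cases "j \<in> pk_ind K y")
        case False
        then have "?\<tau> = \<one>\<^bsub>?G\<^esub>" unfolding entry_pk_rst[OF K F mx_in[OF e(1)] e(2)] dg by (simp add: te cb_src_def)
        then show ?thesis by (intro A.lincomb_one) simp
      next
        case True
        have ez: "(e - {z}, j) \<in> ?T" if z: "z \<in> e" for z
        proof -
          have ne: "e - {z} \<noteq> {}" using two z by (auto simp: card_2_iff)
          have c: "e - {z} \<in> chains Y" by (rule chain_subset[OF finY e(1) _ ne]) auto
          have l1: "spec_le Y y (mn (e - {z}))" using spec_trans[OF e(3) chain_min_mono[OF finY c e(1)]] by auto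
          have l2: "spec_le Y y (mx (e - {z}))" using spec_trans[OF l1] chain_max[OF finY c] chain_min[OF finY c] by blast
          have "spec_le Y (mx (e - {z})) (mx e)" by (rule chain_max_mono[OF finY c e(1)]) auto
          then have "j \<in> pk_ind K (mx (e - {z}))" using prekernelD(4)[OF K l2 _ True e(2)] by blast
          then show ?thesis using c l1 z by (auto simp: S_iff simp del: Qk_simps)
        qed
        have "(\<Sum>q\<in>?T. cb_mat q t) = (\<Sum>q\<in>(\<lambda>z. (e - {z}, j)) ` e. cb_mat q t)"
          by (rule sum.mono_neutral_right[OF finT]) (use T ez in auto)
        also have "\<dots> = (\<Sum>z\<in>e. cb_mat (e - {z}, j) t)" by (rule sum.reindex_cong[of "\<lambda>z. (e - {z}, j)"]) (auto simp: inj_on_def)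
        also have "\<dots> = (\<Sum>z\<in>e. face_sign Y z e)"
        proof (rule sum.cong[OF refl])
          fix z assume z: "z \<in> e"
          have "face_coeff Y (e - {z}) e = (\<Sum>w\<in>e. if w = z then face_sign Y z e else 0)"
            unfolding face_coeff_def by (rule sum.cong) (use z in auto)
          also have "\<dots> = face_sign Y z e" using finite_chain[OF finY e(1)] z by simp
          finally show "cb_mat (e - {z}, j) t = face_sign Y z e" using z by (auto simp: te cb_mat_def)
        qed
        also have "\<dots> = 0" by (rule face_sign_sum_two[OF finY e(1) two])
        finally have "(\<Sum>q\<in>?T. cb_mat q t) = 0" .
        then show ?thesis using A.lincomb_const[OF finT \<tau>c, of "\<lambda>q. cb_mat q t"] by simp
      qed
      finally show ?thesis .
    qed
    then have "entry (S y) t (pk_dif Qk F n y (augmentation n y u)) = \<one>\<^bsub>?G\<^esub>"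
      unfolding entry_Qk_dif[OF y t, of n "augmentation n y u", folded v_def] entry_aug[OF y u t] at using complex_cdiff_one[OF F a[OF tI], of "cb_deg t + n"] by (simp add: A.int_pow_one')
    then show ?thesis unfolding entry_aug[OF y du t] using more by (simp add: te aug_entry_def add.assoc)
  qed
qed

lemma augmentation_in: "augmentation \<in> Hom (complex_cat Y) (fob (pk_ftor Y K) F) (fob (pk_ftor Y Qk) F)"
proof (rule complex_HomI, goal_cases)
  case (1 n) then show ?case by (simp add: augmentation_def)
next
  case (2 n y) then show ?case using restrict_ghom[OF aug_hom[OF 2] comm_group_pk_grp[OF K F 2]] by (simp add: augmentation_def del: Qk_simps)
next
  case (3 n y y' u)
  have y: "y \<in> topspace Y" "y' \<in> topspace Y" and u: "u \<in> carrier (pk_grp K F n y)" using 3 by (auto dest: spec_leD)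
  note ru = pk_rst_closed[OF K F 3(1) u]
  have "pk_rst Qk F n y y' (augmentation n y u) = augmentation n y' (pk_rst K F n y y' u)"
  proof (rule pk_eqI[OF prekernel_Qk F y(2) pk_rst_closed[OF prekernel_Qk F 3(1) aug_closed[OF y(1) u]] aug_closed[OF y(2) ru]])
    fix q assume q': "q \<in> S y'"
    then have q: "q \<in> S y" "q \<in> cb_ind" using 3(1) by (auto intro: spec_trans)
    obtain c i where ci: "q = (c, i)" by (cases q)
    have "entry (S y') q (pk_rst Qk F n y y' (augmentation n y u)) = rst F (cb_deg q + n) (cb_src q) (cb_src q) (aug_entry n y u q)"
      unfolding entry_pk_rst[OF prekernel_Qk F y(2) q'] entry_aug[OF y(1) u q(1)] using q(1) by (simp del: Qk_simps(1))
    also have "\<dots> = aug_entry n y u q" by (rule complex_rst_refl[OF F a[OF q(2)] aug_entry_closed[OF q(1) u]])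
    also have "\<dots> = aug_entry n y' (pk_rst K F n y y' u) q"
      using pk_rst_rst[OF K F 3(1) S_mx[OF q'[unfolded ci]] u] by (simp add: aug_entry_def ci)
    also have "\<dots> = entry (S y') q (augmentation n y' (pk_rst K F n y y' u))" by (rule entry_aug[OF y(2) ru q', symmetric])
    finally show "entry (S y') q (pk_rst Qk F n y y' (augmentation n y u)) = entry (S y') q (augmentation n y' (pk_rst K F n y y' u))" .
  qed
  then show ?case using u aug_closed[OF y(1) u] by simp
next
  case (4 n y u)
  then have u: "u \<in> carrier (pk_grp K F n y)" by simp
  show ?case using aug_cdiff[OF 4(1) u] aug_closed[OF 4(1) u] u 4(1) by simp
qed

end

end

context cobar
begin

lemma natural_augmentation:
  "natural (complex_cat X :: (('a, 'u::infinite) cochain, _) cat) (complex_cat Y) (pk_ftor Y K) (pk_ftor Y Qk) augmentation"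
  unfolding natural_def
proof (intro conjI ballI augmentation_in)
  fix F F' :: "('a, 'u) cochain" and \<phi>
  assume F: "F \<in> Ob (complex_cat X)" and F': "F' \<in> Ob (complex_cat X)" and \<phi>: "\<phi> \<in> Hom (complex_cat X) F F'"
  have cY: "is_category (complex_cat Y :: (('b, 'u) cochain, _) cat)" by (rule is_category_complex_cat)
  note oK = pk_fob[OF K F] pk_fob[OF K F'] and oQ = pk_fob[OF prekernel_Qk F] pk_fob[OF prekernel_Qk F']
  note fK = pk_far[OF K F F' \<phi>] and fQ = pk_far[OF prekernel_Qk F F' \<phi>]
  show "Cmp (complex_cat Y) (fob (pk_ftor Y K) F) (fob (pk_ftor Y K) F') (fob (pk_ftor Y Qk) F') (augmentation F') (far (pk_ftor Y K) F F' \<phi>) =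
    Cmp (complex_cat Y) (fob (pk_ftor Y K) F) (fob (pk_ftor Y Qk) F) (fob (pk_ftor Y Qk) F') (far (pk_ftor Y Qk) F F' \<phi>) (augmentation F)"
  proof (rule complex_mor_eqI[OF cat_Cmp[OF cY oK oQ(2) fK augmentation_in[OF F']] cat_Cmp[OF cY oK(1) oQ augmentation_in[OF F] fQ]])
    fix n y u assume y: "y \<in> topspace Y" and "u \<in> carrier (grp (fob (pk_ftor Y K) F) n y)"
    then have u: "u \<in> carrier (pk_grp K F n y)" by simp
    note mu = pk_mor_closed[OF K F \<phi> y u]
    note au = aug_closed[OF F y u]
    have "augmentation F' n y (pk_mor K \<phi> n y u) = pk_mor Qk \<phi> n y (augmentation F n y u)"
    proof (rule pk_eqI[OF prekernel_Qk F' y aug_closed[OF F' y mu] pk_mor_closed[OF prekernel_Qk F \<phi> y au]])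
      fix q assume q: "q \<in> S y"
      obtain c i where ci: "q = (c, i)" by (cases q)
      have c: "c \<in> chains Y" "i \<in> pk_ind K (mx c)" using q by (simp_all add: S_iff ci del: Qk_simps)
      note le = S_mx[OF q[unfolded ci]]
      have s: "cb_src (c, i) \<in> topspace X" using a[OF SI[OF q]] unfolding ci .
      have one: "\<phi> (cb_deg (c, i) + n) (cb_src (c, i)) \<one>\<^bsub>grp F (cb_deg (c, i) + n) (cb_src (c, i))\<^esub> = \<one>\<^bsub>grp F' (cb_deg (c, i) + n) (cb_src (c, i))\<^esub>" by (rule mor_one[OF F F' \<phi> s])
      have r: "entry (pk_ind K (mx c)) i (pk_rst K F' n y (mx c) (pk_mor K \<phi> n y u)) =
          \<phi> (pk_deg K i + n) (pk_pt K i (mx c)) (entry (pk_ind K (mx c)) i (pk_rst K F n y (mx c) u))" if c1: "card c = 1"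
      proof (cases "i \<in> pk_ind K y")
        case True
        have "spec_le X (pk_pt K i y) (pk_pt K i (mx c))" by (rule prekernelD(2)[OF K le True c(2)])
        from mor_rst[OF \<phi> this pk_entry_closed[OF K F y u True]] show ?thesis
          using True unfolding entry_pk_rst[OF K F mx_in[OF c(1)] c(2)] entry_pk_rst[OF K F' mx_in[OF c(1)] c(2)]
          by (simp add: entry_pk_mor[OF K F y True])
      next
        case False
        then show ?thesis using one c1 unfolding entry_pk_rst[OF K F mx_in[OF c(1)] c(2)] entry_pk_rst[OF K F' mx_in[OF c(1)] c(2)]
          by (simp add: cb_deg_def cb_src_def)
      qed
      show "entry (S y) q (augmentation F' n y (pk_mor K \<phi> n y u)) = entry (S y) q (pk_mor Qk \<phi> n y (augmentation F n y u))"
        unfolding entry_aug[OF F' y mu q] entry_pk_mor[OF prekernel_Qk F y q] entry_aug[OF F y u q] Qk_simps(2,3)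
        unfolding aug_entry_def[OF F] aug_entry_def[OF F'] ci prod.case
        using r one by (cases "card c = 1") (simp_all add: cb_deg_def cb_src_def)
    qed
    then show "Cmp (complex_cat Y) (fob (pk_ftor Y K) F) (fob (pk_ftor Y K) F') (fob (pk_ftor Y Qk) F') (augmentation F') (far (pk_ftor Y K) F F' \<phi>) n y u =
      Cmp (complex_cat Y) (fob (pk_ftor Y K) F) (fob (pk_ftor Y Qk) F) (fob (pk_ftor Y Qk) F') (far (pk_ftor Y Qk) F F' \<phi>) (augmentation F) n y u"
      using y u au by (simp del: Qk_simps)
  qed
qed

lemma S_iff_all: "(c, i) \<in> S y \<longleftrightarrow> c \<in> chains Y \<and> i \<in> pk_ind K (mx c) \<and> (\<forall>z\<in>c. spec_le Y y z)"
  using S_le chain_min(1)[OF finY] by (auto simp: S_iff simp del: Qk_simps)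

section \<open>Contractibility of the chains above a point\<close>

context
  fixes y assumes y: "y \<in> topspace Y"
begin

abbreviation (input) "r \<equiv> spec_rep Y y"

lemma cone_chain: "(c, i) \<in> S y \<Longrightarrow> insert r c \<in> chains Y"
  using y spec_rep(2)[OF y] spec_trans[of Y r y] spec_le_refl[of r Y] spec_leD[OF spec_rep(1)[OF y]]
  unfolding S_iff_all by (auto simp: chains_def)

lemma vertex_chain: "{r} \<in> chains Y"
  using y spec_le_refl[of r Y] spec_leD[OF spec_rep(1)[OF y]] by (auto simp: chains_def)

lemma mx_vertex: "mx {r} = r"
  using chain_max(1)[OF finY vertex_chain] by simp

lemma vertex_S: "({r}, i) \<in> S y \<longleftrightarrow> i \<in> pk_ind K r"
  using vertex_chain spec_rep(1)[OF y] by (simp add: S_iff_all mx_vertex del: Qk_simps)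

text \<open>\<open>r\<close> is equivalent to \<open>y\<close> and hence lies below every chain
  counted at \<open>y\<close>. Joining it can change the minimum but not the maximum, so the summand
  keeps its stalk.\<close>

lemma mx_cone: "(c, i) \<in> S y \<Longrightarrow> mx (insert r c) = mx c"
  using chain_max[OF finY, of c] spec_rep(2)[OF y] S_mx spec_trans[of Y r y "mx c"]
  by (intro chain_max_eqI[OF finY cone_chain]) (auto simp: S_iff_all simp del: Qk_simps)

lemma cone_S: "(c, i) \<in> S y \<Longrightarrow> (insert r c, i) \<in> S y"
  using cone_chain mx_cone spec_rep(1)[OF y] by (auto simp: S_iff_all simp del: Qk_simps)

lemma uncone_S:
  assumes "(c, i) \<in> S y" "r \<in> c" "c \<noteq> {r}" shows "(c - {r}, i) \<in> S y"
proof -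
  have c: "c - {r} \<in> chains Y" by (rule chain_subset[OF finY, of c]) (use assms in \<open>auto simp: S_iff_all simp del: Qk_simps\<close>)
  have le: "spec_le Y y z" if "z \<in> c" for z using assms(1) that by (simp add: S_iff_all del: Qk_simps)
  have "mx c = mx (c - {r})"
  proof (rule chain_max_eqI[OF finY])
    show "c \<in> chains Y" using assms by (simp add: S_iff_all del: Qk_simps)
    show "mx (c - {r}) \<in> c" using chain_max(1)[OF finY c] by blast
    show "spec_le Y w (mx (c - {r}))" if "w \<in> c" for w
      using chain_max[OF finY c] that le spec_trans[OF spec_rep(2)[OF y]] by (cases "w = r") auto
  qed
  then show ?thesis using assms c by (auto simp: S_iff_all simp del: Qk_simps)
qed

lemma cone_deg: "(c, i) \<in> S y \<Longrightarrow> r \<notin> c \<Longrightarrow> cb_deg (insert r c, i) + n + 1 = cb_deg (c, i) + n"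
proof -
  assume "(c, i) \<in> S y" "r \<notin> c"
  then have "card (insert r c) = Suc (card c)" using finite_chain[OF finY, of c] by (simp add: S_iff_all del: Qk_simps)
  then show ?thesis by (simp add: cb_deg_def)
qed

lemma cone_src: "(c, i) \<in> S y \<Longrightarrow> cb_src (insert r c, i) = cb_src (c, i)"
  using mx_cone by (simp add: cb_src_def)

text \<open>The apex is the least vertex, so it has position 0. A new apex moves the other vertices
  up by one position, which is the origin of the minus signs in \<open>face_sign_cone\<close> and
  \<open>cb_mat_cone\<close>.\<close>

lemma face_sign_apex:
  assumes e: "(e, j) \<in> S y" shows "face_sign Y r (insert r e) = 1"
proof -
  have "{w \<in> insert r e. w \<noteq> r \<and> spec_le Y w r} = {}"
    using chain_antisym[OF finY cone_chain[OF e], of r] spec_trans[OF spec_rep(2)[OF y]] e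
    by (auto simp: S_iff_all simp del: Qk_simps)
  then show ?thesis unfolding face_sign_def by (simp only: card.empty power_0)
qed

lemma face_sign_cone:
  assumes e: "(e, j) \<in> S y" and z: "r \<notin> e" "z \<in> e"
  shows "face_sign Y z (insert r e) = - face_sign Y z e"
proof -
  have "face_sign Y z (insert r e - {r}) = - face_sign Y z (insert r e)"
    using face_sign_remove(1)[OF finY cone_chain[OF e], of r z] z spec_trans[OF spec_rep(2)[OF y] S_le[OF e z(2)]] by auto
  then show ?thesis using z by simp
qed

lemma face_coeff_cone:
  assumes c: "(c, i) \<in> S y" "r \<notin> c" and e: "(e, j) \<in> S y" "r \<notin> e"
  shows "face_coeff Y (insert r c) (insert r e) = - face_coeff Y c e"
proof -
  have fin: "finite e" using finite_chain[OF finY] e(1) by (simp add: S_iff_all del: Qk_simps)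
  have "face_coeff Y (insert r c) (insert r e) = (\<Sum>z\<in>e. if insert r c = insert r e - {z} then face_sign Y z (insert r e) else 0)"
    unfolding face_coeff_def using fin e(2) by (subst sum.insert) auto
  also have "\<dots> = (\<Sum>z\<in>e. - (if c = e - {z} then face_sign Y z e else 0))"
  proof (rule sum.cong[OF refl])
    fix z assume z: "z \<in> e"
    have "insert r e - {z} = insert r (e - {z})" using z e(2) by auto
    then have "insert r c = insert r e - {z} \<longleftrightarrow> c = e - {z}" using insert_ident[OF c(2), of "e - {z}"] e(2) by simp
    then show "(if insert r c = insert r e - {z} then face_sign Y z (insert r e) else 0) = - (if c = e - {z} then face_sign Y z e else 0)"
      using face_sign_cone[OF e z] by simp
  qed
  finally show ?thesis by (simp add: sum_negf face_coeff_def)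
qed

lemma cb_mat_cone:
  assumes c: "(c, i) \<in> S y" "r \<notin> c" and e: "(e, j) \<in> S y" "r \<notin> e"
  shows "cb_mat (insert r c, i) (insert r e, j) = - cb_mat (c, i) (e, j)"
proof -
  have "insert r c = insert r e \<longleftrightarrow> c = e" by (rule insert_ident[OF c(2) e(2)])
  moreover have "dim_sign (insert r c) = - dim_sign c" using dim_sign_remove[OF cone_chain[OF c(1)], of r] c(2) by simp
  ultimately show ?thesis using face_coeff_cone[OF assms] by (cases "c = e") (simp_all add: cb_mat_def)
qed

lemma cb_mat_apex:
  assumes e: "(e, j) \<in> S y" "r \<notin> e"
  shows "cb_mat (e, j) (insert r e, j) = 1"
proof -
  have fin: "finite e" using finite_chain[OF finY] e(1) by (simp add: S_iff_all del: Qk_simps)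
  have "face_coeff Y e (insert r e) = (\<Sum>z\<in>insert r e. if z = r then face_sign Y r (insert r e) else 0)"
    unfolding face_coeff_def by (rule sum.cong[OF refl]) (use e(2) in auto)
  also have "\<dots> = 1" using fin face_sign_apex[OF e(1)] by simp
  finally show ?thesis using e(2) by (auto simp: cb_mat_def)
qed

context
  fixes F :: "('a, 'u::infinite) cochain" assumes F: "F \<in> Ob (complex_cat X)"
begin

text \<open>
  Every chain of points above \<open>y\<close> can be extended by \<open>r\<close>, which makes the complex of chains a cone
  with apex \<open>r\<close>.
\<close>

definition contraction :: "int \<Rightarrow> 'u \<Rightarrow> 'u" where
  "contraction n v = tuple (S y) (\<lambda>(c, i). if r \<in> c then \<one>\<^bsub>grp F (cb_deg (c, i) + n) (cb_src (c, i))\<^esub> else entry (S y) (insert r c, i) v)"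

lemma entry_contraction: "(c, i) \<in> S y \<Longrightarrow> entry (S y) (c, i) (contraction n v) =
    (if r \<in> c then \<one>\<^bsub>grp F (cb_deg (c, i) + n) (cb_src (c, i))\<^esub> else entry (S y) (insert r c, i) v)"
  unfolding contraction_def by (subst entry_tuple[OF finite_S]) auto

lemma contraction_closed:
  assumes v: "v \<in> carrier (pk_grp Qk F (n + 1) y)" shows "contraction n v \<in> carrier (pk_grp Qk F n y)"
  unfolding contraction_def
proof (rule pk_tuple_closed[OF prekernel_Qk F])
  fix q assume q: "q \<in> S y"
  obtain c i where ci: "q = (c, i)" by (cases q)
  note q' = q[unfolded ci]
  have "entry (S y) (insert r c, i) v \<in> carrier (grp F (cb_deg (c, i) + n) (cb_src (c, i)))" if "r \<notin> c"
    using Qk_entry_closed[OF F y v cone_S[OF q']] unfolding cone_src[OF q'] add.assoc[symmetric] cone_deg[OF q' that] .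
  then show "(case q of (c, i) \<Rightarrow> if r \<in> c then \<one>\<^bsub>grp F (cb_deg (c, i) + n) (cb_src (c, i))\<^esub> else entry (S y) (insert r c, i) v)
      \<in> carrier (grp F (pk_deg Qk q + n) (pk_pt Qk q y))"
    using complex_one_closed[OF F a[OF SI[OF q]]] unfolding Qk_simps(2,3) ci by simp
qed

text \<open>The standard homotopy of a cone, applied to a cocycle. Neutrality at \<open>{r}\<close>
  has to be demanded because \<open>{r}\<close> is the cone over the empty set, which is not a
  chain.\<close>

lemma contraction:
  assumes v: "v \<in> carrier (pk_grp Qk F (n + 1) y)" and dv: "pk_dif Qk F (n + 1) y v = \<one>\<^bsub>pk_grp Qk F (n + 1 + 1) y\<^esub>"
    and v1: "\<And>i. i \<in> pk_ind K r \<Longrightarrow> entry (S y) ({r}, i) v = \<one>\<^bsub>grp F (cb_deg ({r}, i) + (n + 1)) (cb_src ({r}, i))\<^esub>"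
  shows "pk_dif Qk F n y (contraction n v) = v"
proof (rule pk_eqI[OF prekernel_Qk F y pk_dif_closed[OF prekernel_Qk F y contraction_closed[OF v]] v])
  fix t assume t: "t \<in> S y"
  obtain e j where te: "t = (e, j)" by (cases t)
  note e = t[unfolded te]
  note hv = contraction_closed[OF v]
  let ?G = "grp F (cb_deg t + n + 1) (cb_src t)"
  interpret A: comm_group ?G by (rule complex_grp[OF F a[OF SI[OF t]]])
  let ?T = "{q \<in> S y. r \<notin> fst q}" and ?\<psi> = "\<lambda>q. (insert r (fst q), snd q)"
  let ?u = "\<lambda>q. rst F (cb_deg q + n) (cb_src q) (cb_src t) (entry (S y) q (contraction n v))"
  have uc: "?u q \<in> carrier ?G" if "q \<in> S y" "cb_mat q t \<noteq> 0" for q by (rule Qk_term_closed[OF F y hv that(1) t that(2)])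
  have u1: "?u q = \<one>\<^bsub>?G\<^esub>" if q: "q \<in> S y - ?T" "cb_mat q t \<noteq> 0" for q
  proof -
    obtain c i where ci: "q = (c, i)" by (cases q)
    have "r \<in> c" "(c, i) \<in> S y" using q by (auto simp: ci simp del: Qk_simps)
    then have "?u q = rst F (cb_deg q + n) (cb_src q) (cb_src t) \<one>\<^bsub>grp F (cb_deg q + n) (cb_src q)\<^esub>"
      by (simp add: entry_contraction ci del: Qk_simps)
    also have "\<dots> = \<one>\<^bsub>grp F (cb_deg q + n) (cb_src t)\<^esub>" by (rule complex_rst_one[OF F ma[OF SI[of q y] SI[OF t] q(2)]]) (use q in simp)
    also have "\<dots> = \<one>\<^bsub>?G\<^esub>"
    proof -
      have eq: "cb_deg q + n = cb_deg t + n + 1" by (rule m_deg'[OF SI[of q y] SI[OF t] q(2)]) (use q in simp)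
      show ?thesis unfolding eq ..
    qed
    finally show ?thesis .
  qed
  have finT: "finite ?T" by (rule finite_subset[OF _ finite_S[of y]]) auto
  have sub: "?T \<subseteq> S y" by auto
  have L: "lincomb ?G (S y) (\<lambda>q. cb_mat q t) ?u = lincomb ?G ?T (\<lambda>q. cb_mat q t) ?u"
    by (rule A.lincomb_neutral[OF finite_S sub u1 uc]) (use sub in auto)
  note d = entry_Qk_dif[OF F y t, of n "contraction n v", unfolded L]
  have vt: "entry (S y) t v \<in> carrier ?G" using Qk_entry_closed[OF F y v t] by (simp add: add.assoc)
  show "entry (S y) t (pk_dif Qk F n y (contraction n v)) = entry (S y) t v"
  proof (cases "r \<in> e")
    \<comment> \<open>If \<open>e\<close> contains the apex, the only matrix entry from a chain
      without it comes from \<open>e - {r}\<close>; the coefficient is 1, and the contraction has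
      there the entry of \<open>v\<close> at \<open>e\<close>. For \<open>e = {r}\<close> there is
      no such chain, and \<open>v\<close> is neutral by assumption.\<close>
    case True
    have ht: "entry (S y) t (contraction n v) = \<one>\<^bsub>grp F (cb_deg t + n) (cb_src t)\<^esub>"
      using entry_contraction[OF e] True by (simp add: te)
    have src: "c = e - {r} \<and> i = j" if q: "(c, i) \<in> ?T" "cb_mat (c, i) t \<noteq> 0" for c i
    proof -
      have q': "(c, i) \<in> S y" "r \<notin> c" using q by auto
      consider (face) z where "i = j" "z \<in> e" "c = e - {z}" | (inner) "c = e" "pk_mat K i j \<noteq> 0"
        by (rule cb_mat_cases[OF SI[OF q'(1)] SI[OF e] q(2)[unfolded te]]) blast+
      then show ?thesis using q' True by cases auto
    qed
    have "lincomb ?G ?T (\<lambda>q. cb_mat q t) ?u = entry (S y) t v"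
    proof (cases "e = {r}")
      case er: True
      have "cb_mat q t = 0" if q: "q \<in> ?T" for q
      proof (rule ccontr)
        assume nz: "cb_mat q t \<noteq> 0"
        obtain c i where ci: "q = (c, i)" by (cases q)
        have "c = {}" using src[of c i] q nz er by (simp add: ci del: Qk_simps)
        then show False using q by (simp add: ci S_iff chains_def del: Qk_simps)
      qed
      then have "lincomb ?G ?T (\<lambda>q. cb_mat q t) ?u = \<one>\<^bsub>?G\<^esub>" by (rule A.lincomb_zero)
      moreover have "entry (S y) t v = \<one>\<^bsub>?G\<^esub>" using v1[of j] e by (simp add: te er vertex_S add.assoc del: Qk_simps)
      ultimately show ?thesis by simp
    next
      case False
      let ?p = "(e - {r}, j)"
      have p: "?p \<in> S y" "?p \<in> ?T" using uncone_S[OF e True False] by simp_all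
      have ie: "insert r e = e" using True by auto
      have m: "cb_mat ?p t = 1" using cb_mat_apex[OF p(1)] by (simp add: ie te)
      have "?u ?p = rst F (cb_deg ?p + n) (cb_src ?p) (cb_src t) (entry (S y) t v)" using entry_contraction[OF p(1)] by (simp add: ie te)
      also have "\<dots> = entry (S y) t v"
      proof -
        have eq: "cb_deg ?p + n = cb_deg t + n + 1" "cb_src ?p = cb_src t" using cone_deg[OF p(1), of n] cone_src[OF p(1)] by (simp_all add: ie te)
        show ?thesis unfolding eq by (rule complex_rst_refl[OF F a[OF SI[OF t]] vt])
      qed
      finally have up: "?u ?p = entry (S y) t v" .
      have "lincomb ?G ?T (\<lambda>q. cb_mat q t) ?u = ?u ?p [^]\<^bsub>?G\<^esub> cb_mat ?p t"
      proof (rule A.lincomb_single[OF finT p(2)])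
        fix q assume q: "q \<in> ?T" "q \<noteq> ?p"
        obtain c i where ci: "q = (c, i)" by (cases q)
        have "\<not> (c = e - {r} \<and> i = j)" using q(2) unfolding ci by blast
        then show "cb_mat q t = 0" using src[OF q(1)[unfolded ci]] unfolding ci by blast
      next
        show "?u ?p \<in> carrier ?G" unfolding up by (rule vt)
      qed
      then show ?thesis unfolding up m using vt by simp
    qed
    then show ?thesis unfolding d ht using complex_cdiff_one[OF F a[OF SI[OF t]], of "cb_deg t + n"] vt by (simp add: A.int_pow_one')
  next
    \<comment> \<open>Otherwise the cocycle equation of \<open>v\<close> at the cone
      \<open>?t\<close> over \<open>e\<close> is solved for the entry at \<open>t\<close>. Entries
      between cones are those of the bases with opposite sign (\<open>m\<close>), and the face
      opposite to the apex is \<open>e\<close> itself, with coefficient 1.\<close>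
    case False
    let ?t = "(insert r e, j)"
    have t': "?t \<in> S y" by (rule cone_S[OF e])
    have dg: "cb_deg ?t + n + 1 = cb_deg t + n" "cb_deg ?t + (n + 1) = cb_deg t + n" "cb_src ?t = cb_src t"
      using cone_deg[OF e False, of n] cone_src[OF e] by (simp_all add: te add.assoc)
    have ht: "entry (S y) t (contraction n v) = entry (S y) ?t v" using entry_contraction[OF e] False by (simp add: te)
    let ?w = "\<lambda>q. rst F (cb_deg q + (n + 1)) (cb_src q) (cb_src ?t) (entry (S y) q v)"
    have wc: "?w q \<in> carrier ?G" if "q \<in> S y" "cb_mat q ?t \<noteq> 0" for q
      using Qk_term_closed[OF F y v that(1) t' that(2)] unfolding dg .
    have \<psi>S: "?\<psi> q \<in> S y" if "q \<in> ?T" for q using that cone_S[of "fst q" "snd q"] by simp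
    have tn: "t \<notin> ?\<psi> ` ?T" using False by (auto simp: te simp del: Qk_simps)
    have m: "cb_mat (?\<psi> q) ?t = - cb_mat q t" if "q \<in> ?T" for q
      using cb_mat_cone[of "fst q" "snd q" e j] that e False by (auto simp: te simp del: Qk_simps)
    have "lincomb ?G (S y) (\<lambda>q. cb_mat q ?t) ?w = lincomb ?G (insert t (?\<psi> ` ?T)) (\<lambda>q. cb_mat q ?t) ?w"
    proof (rule A.lincomb_neutral[OF finite_S])
      show sub': "insert t (?\<psi> ` ?T) \<subseteq> S y" using t \<psi>S by blast
      fix q assume q: "q \<in> S y - insert t (?\<psi> ` ?T)" "cb_mat q ?t \<noteq> 0"
      obtain c i where ci: "q = (c, i)" by (cases q)
      have c: "(c, i) \<in> S y" using q by (simp add: ci del: Qk_simps)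
      have "r \<in> c"
      proof (rule ccontr)
        assume "r \<notin> c"
        consider (face) z where "i = j" "z \<in> insert r e" "c = insert r e - {z}" | (inner) "c = insert r e" "pk_mat K i j \<noteq> 0"
          by (rule cb_mat_cases[OF SI[OF c] SI[OF t'] q(2)[unfolded ci]]) blast+
        then show False using \<open>r \<notin> c\<close> q(1) False by cases (auto simp: ci te simp del: Qk_simps)
      qed
      \<comment> \<open>Any other chain with the apex is a cone over an index and was already
        counted in the image of \<open>?\<psi>\<close>. At \<open>{r}\<close> the entry of
        \<open>v\<close> is neutral.\<close>
      have "c = {r}"
      proof (rule ccontr)
        assume "c \<noteq> {r}"
        then have "(c - {r}, i) \<in> ?T" using uncone_S[OF c \<open>r \<in> c\<close>] by simp
        moreover have "q = ?\<psi> (c - {r}, i)" using \<open>r \<in> c\<close> by (auto simp: ci)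
        ultimately show False using q(1) by blast
      qed
      then have "?w q = rst F (cb_deg q + (n + 1)) (cb_src q) (cb_src ?t) \<one>\<^bsub>grp F (cb_deg q + (n + 1)) (cb_src q)\<^esub>"
        using v1[of i] c by (simp add: ci vertex_S del: Qk_simps)
      also have "\<dots> = \<one>\<^bsub>grp F (cb_deg q + (n + 1)) (cb_src ?t)\<^esub>"
        by (rule complex_rst_one[OF F ma[OF SI[of q y] SI[OF t'] q(2)]]) (use q in simp)
      also have "\<dots> = \<one>\<^bsub>?G\<^esub>"
      proof -
        have eq: "cb_deg q + (n + 1) = cb_deg ?t + (n + 1) + 1" by (rule m_deg'[OF SI[of q y] SI[OF t'] q(2)]) (use q in simp)
        show ?thesis unfolding eq dg ..
      qed
      finally show "?w q = \<one>\<^bsub>?G\<^esub>" .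
    next
      show "?w q \<in> carrier ?G" if "q \<in> insert t (?\<psi> ` ?T)" "cb_mat q ?t \<noteq> 0" for q
        by (rule wc[OF _ that(2)]) (use that(1) t \<psi>S in blast)
    qed
    also have "\<dots> = ?w t [^]\<^bsub>?G\<^esub> cb_mat t ?t \<otimes>\<^bsub>?G\<^esub> lincomb ?G (?\<psi> ` ?T) (\<lambda>q. cb_mat q ?t) ?w"
      by (rule A.lincomb_insert[OF finite_imageI[OF finT] tn wc]) (use t \<psi>S in blast)
    also have "?w t [^]\<^bsub>?G\<^esub> cb_mat t ?t = entry (S y) t v"
    proof -
      have "cb_mat t ?t = 1" using cb_mat_apex[OF e False] by (simp add: te)
      moreover have "?w t = entry (S y) t v" unfolding dg add.assoc[symmetric] by (rule complex_rst_refl[OF F a[OF SI[OF t]] vt])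
      ultimately show ?thesis using vt by simp
    qed
    also have "lincomb ?G (?\<psi> ` ?T) (\<lambda>q. cb_mat q ?t) ?w = lincomb ?G ?T (\<lambda>q. cb_mat (?\<psi> q) ?t) (\<lambda>q. ?w (?\<psi> q))"
    proof (rule A.lincomb_reindex)
      show "inj_on ?\<psi> ?T"
      proof (rule inj_onI)
        fix p q assume p: "p \<in> ?T" and q: "q \<in> ?T" and eq: "?\<psi> p = ?\<psi> q"
        have n: "r \<notin> fst p" "r \<notin> fst q" using p q by blast+
        have "fst p = fst q" using eq unfolding prod.inject insert_ident[OF n] by (rule conjunct1)
        then show "p = q" using eq by (simp add: prod_eq_iff)
      qed
      show "?w (?\<psi> q) \<in> carrier ?G" if "q \<in> ?T" "cb_mat (?\<psi> q) ?t \<noteq> 0" for q by (rule wc[OF \<psi>S[OF that(1)] that(2)])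
    qed
    also have "\<dots> = lincomb ?G ?T (\<lambda>q. - 1 * cb_mat q t) ?u"
    proof (rule A.lincomb_cong)
      fix q assume q: "q \<in> ?T" "- 1 * cb_mat q t \<noteq> 0"
      then have q': "(fst q, snd q) \<in> S y" "r \<notin> fst q" "cb_mat q t \<noteq> 0" by auto
      have eq: "cb_deg (?\<psi> q) + (n + 1) = cb_deg q + n" "cb_src (?\<psi> q) = cb_src q"
        using cone_deg[OF q'(1,2), of n] cone_src[OF q'(1)] by (simp_all add: add.assoc)
      have hq: "entry (S y) q (contraction n v) = entry (S y) (?\<psi> q) v"
        using entry_contraction[OF q'(1), of n v] q'(2) unfolding prod.collapse by (simp del: Qk_simps)
      show "?w (?\<psi> q) = ?u q" unfolding dg eq hq ..
      show "?u q \<in> carrier ?G" by (rule uc) (use q'(1,3) in simp_all)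
    qed (use m in simp)
    also have "\<dots> = inv\<^bsub>?G\<^esub> lincomb ?G ?T (\<lambda>q. cb_mat q t) ?u"
    proof -
      have uT: "?u q \<in> carrier ?G" if "q \<in> ?T" "cb_mat q t \<noteq> 0" for q by (rule uc) (use that in auto)
      have "lincomb ?G ?T (\<lambda>q. - 1 * cb_mat q t) ?u = lincomb ?G ?T (\<lambda>q. cb_mat q t) ?u [^]\<^bsub>?G\<^esub> (- 1 :: int)"
        by (rule A.lincomb_pow[OF finT uT, symmetric])
      moreover have "lincomb ?G ?T (\<lambda>q. cb_mat q t) ?u \<in> carrier ?G" by (rule A.lincomb_closed[OF uT])
      ultimately show ?thesis by (simp only: A.int_pow_neg A.int_pow_1)
    qed
    finally have W: "lincomb ?G (S y) (\<lambda>q. cb_mat q ?t) ?w = entry (S y) t v \<otimes>\<^bsub>?G\<^esub> inv\<^bsub>?G\<^esub> lincomb ?G ?T (\<lambda>q. cb_mat q t) ?u" .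
    let ?L = "lincomb ?G ?T (\<lambda>q. cb_mat q t) ?u" and ?D = "cdiff F (cb_deg t + n) (cb_src t) (entry (S y) ?t v)"
    have Lc: "?L \<in> carrier ?G" by (rule A.lincomb_closed, rule uc) blast+
    have Dc: "?D \<in> carrier ?G" using complex_cdiff_closed[OF F a[OF SI[OF t']] Qk_entry_closed[OF F y v t']] unfolding dg .
    \<comment> \<open>The cone has shift one lower. The resulting sign change is the one that
      appears when the differential term moves to the other side.\<close>
    have ps: "parity_sign (cb_deg t) = - parity_sign (cb_deg ?t)"
    proof -
      have "cb_deg t = cb_deg ?t + 1" using cone_deg[OF e False, of 0] by (simp add: te)
      then show ?thesis by (simp add: parity_sign_Suc)
    qed
    have "entry (S y) ?t (pk_dif Qk F (n + 1) y v) = \<one>\<^bsub>?G\<^esub>"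
    proof -
      have eq: "cb_deg ?t + (n + 1 + 1) = cb_deg t + n + 1" using dg(1) by linarith
      have "entry (S y) ?t \<one>\<^bsub>pk_grp Qk F (n + 1 + 1) y\<^esub> = \<one>\<^bsub>grp F (pk_deg Qk ?t + (n + 1 + 1)) (pk_pt Qk ?t y)\<^esub>"
        unfolding pk_grp_def tw_grp_def by (rule entry_one[OF finite_S t'])
      then show ?thesis unfolding dv Qk_simps(2,3) eq dg(3) .
    qed
    then have "?D [^]\<^bsub>?G\<^esub> parity_sign (cb_deg ?t) \<otimes>\<^bsub>?G\<^esub> (entry (S y) t v \<otimes>\<^bsub>?G\<^esub> inv\<^bsub>?G\<^esub> ?L) = \<one>\<^bsub>?G\<^esub>"
      unfolding entry_Qk_dif[OF F y t'] dg W[unfolded dg] .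
    moreover have "x \<otimes>\<^bsub>?G\<^esub> (b \<otimes>\<^bsub>?G\<^esub> inv\<^bsub>?G\<^esub> l) = \<one>\<^bsub>?G\<^esub> \<Longrightarrow> inv\<^bsub>?G\<^esub> x \<otimes>\<^bsub>?G\<^esub> l = b"
      if "x \<in> carrier ?G" "b \<in> carrier ?G" "l \<in> carrier ?G" for x b l
    proof -
      assume h: "x \<otimes>\<^bsub>?G\<^esub> (b \<otimes>\<^bsub>?G\<^esub> inv\<^bsub>?G\<^esub> l) = \<one>\<^bsub>?G\<^esub>"
      have "inv\<^bsub>?G\<^esub> x = b \<otimes>\<^bsub>?G\<^esub> inv\<^bsub>?G\<^esub> l" using A.inv_equality[of "b \<otimes>\<^bsub>?G\<^esub> inv\<^bsub>?G\<^esub> l" x] h that A.m_comm[of x] by simp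
      then show ?thesis using that by (simp add: A.m_assoc)
    qed
    ultimately have "inv\<^bsub>?G\<^esub> (?D [^]\<^bsub>?G\<^esub> parity_sign (cb_deg ?t)) \<otimes>\<^bsub>?G\<^esub> ?L = entry (S y) t v"
      using Dc Lc vt by simp
    then show ?thesis unfolding d ht ps using Dc by (simp add: A.int_pow_neg)
  qed
qed

text \<open>The entries of \<open>l\<close> at \<open>{r}\<close> form an element \<open>W\<close>
  of the given functor at \<open>r\<close>, which is transported to \<open>k'\<close> at the
  equivalent point \<open>y\<close>. By \<open>entry_Qk_dif_vertex\<close>, the equation for
  \<open>l\<close> at \<open>{r}\<close> says that \<open>k'\<close> has differential
  \<open>k\<close>. Subtracting the augmentation of \<open>k'\<close> from \<open>l\<close> leaves a
  cocycle neutral at \<open>{r}\<close>, and \<open>contraction\<close> yields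
  \<open>l'\<close>.\<close>

lemma augmentation_acyclic:
  "cone_acyclic (\<lambda>n. pk_grp K F n y) (\<lambda>n. pk_dif K F n y) (\<lambda>n. pk_grp Qk F n y) (\<lambda>n. pk_dif Qk F n y) (\<lambda>n. augmentation F n y)"
  unfolding cone_acyclic_def
proof (intro allI ballI impI)
  fix n k l
  assume k: "k \<in> carrier (pk_grp K F (n + 1 + 1) y)" and l: "l \<in> carrier (pk_grp Qk F (n + 1) y)"
    and kl: "augmentation F (n + 1 + 1) y k = pk_dif Qk F (n + 1) y l"
  note yr = spec_rep(1)[OF y] and ry = spec_rep(2)[OF y]
  have rY: "r \<in> topspace Y" using spec_leD[OF yr] by simp
  note fin = pk_finite[OF K F rY]
  let ?G = "pk_grp Qk F (n + 1) y" and ?G2 = "pk_grp Qk F (n + 1 + 1) y"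
  interpret A: comm_group ?G by (rule comm_group_pk_grp[OF prekernel_Qk F y])
  interpret B: comm_group ?G2 by (rule comm_group_pk_grp[OF prekernel_Qk F y])
  interpret d: group_hom ?G ?G2 "pk_dif Qk F (n + 1) y"
    by unfold_locales (rule pk_dif_hom[OF prekernel_Qk F y])
  define W where "W = tuple (pk_ind K r) (\<lambda>i. entry (S y) ({r}, i) l)"
  have W: "W \<in> carrier (pk_grp K F (n + 1) r)" unfolding W_def
  proof (rule pk_tuple_closed[OF K F])
    fix i assume "i \<in> pk_ind K r"
    then have "({r}, i) \<in> S y" by (simp only: vertex_S)
    from Qk_entry_closed[OF F y l this] show "entry (S y) ({r}, i) l \<in> carrier (grp F (pk_deg K i + (n + 1)) (pk_pt K i r))"
      by (simp add: cb_deg_def cb_src_def mx_vertex)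
  qed
  have eW: "entry (pk_ind K r) i W = entry (S y) ({r}, i) l" if "i \<in> pk_ind K r" for i
    unfolding W_def by (rule entry_tuple[OF fin that])
  have ea: "entry (S y) ({r}, i) (augmentation F m y u) = entry (pk_ind K r) i (pk_rst K F m y r u)"
    if "i \<in> pk_ind K r" "u \<in> carrier (pk_grp K F m y)" for i m u
  proof -
    have i: "({r}, i) \<in> S y" using that(1) by (simp only: vertex_S)
    show ?thesis unfolding entry_aug[OF F y that(2) i] aug_entry_def[OF F] by (simp add: mx_vertex)
  qed
  define k' where "k' = pk_rst K F (n + 1) r y W"
  have k': "k' \<in> carrier (pk_grp K F (n + 1) y)" unfolding k'_def by (rule pk_rst_closed[OF K F ry W])
  have rk: "pk_rst K F (n + 1) y r k' = W" unfolding k'_def pk_rst_rst[OF K F ry yr W] by (rule pk_rst_refl[OF K F rY W])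
  have dW: "pk_dif K F (n + 1) r W = pk_rst K F (n + 1 + 1) y r k"
  proof (rule pk_eqI[OF K F rY pk_dif_closed[OF K F rY W] pk_rst_closed[OF K F yr k]])
    fix j assume j: "j \<in> pk_ind K r"
    then have S: "({r}, j) \<in> S y" by (simp only: vertex_S)
    have "card {r} = 1" by simp
    from entry_Qk_dif_vertex[OF F y l S this]
    show "entry (pk_ind K r) j (pk_dif K F (n + 1) r W) = entry (pk_ind K r) j (pk_rst K F (n + 1 + 1) y r k)"
      unfolding mx_vertex W_def[symmetric] kl[symmetric] ea[OF j k] by (rule sym)
  qed
  have dk': "pk_dif K F (n + 1) y k' = k"
    unfolding k'_def pk_dif_rst[OF K F ry W, symmetric] dW pk_rst_rst[OF K F yr ry k] by (rule pk_rst_refl[OF K F y k])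
  note ak = aug_closed[OF F y k']
  define v where "v = l \<otimes>\<^bsub>?G\<^esub> inv\<^bsub>?G\<^esub> augmentation F (n + 1) y k'"
  have v: "v \<in> carrier ?G" unfolding v_def using l ak by blast
  have "pk_dif Qk F (n + 1) y v = augmentation F (n + 1 + 1) y k \<otimes>\<^bsub>?G2\<^esub> inv\<^bsub>?G2\<^esub> augmentation F (n + 1 + 1) y k"
    unfolding v_def d.hom_mult[OF l A.inv_closed[OF ak]] d.hom_inv[OF ak] kl[symmetric] aug_cdiff[OF F y k'] dk' ..
  then have dv: "pk_dif Qk F (n + 1) y v = \<one>\<^bsub>?G2\<^esub>" using B.r_inv[OF aug_closed[OF F y k]] by (simp only:)
  have v1: "entry (S y) ({r}, i) v = \<one>\<^bsub>grp F (cb_deg ({r}, i) + (n + 1)) (cb_src ({r}, i))\<^esub>" if i: "i \<in> pk_ind K r" for i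
  proof -
    have S: "({r}, i) \<in> S y" using i by (simp only: vertex_S)
    let ?H = "grp F (cb_deg ({r}, i) + (n + 1)) (cb_src ({r}, i))"
    interpret H: comm_group ?H by (rule complex_grp[OF F a[OF SI[OF S]]])
    have eh: "entry (S y) ({r}, i) \<in> hom ?G ?H"
      using entry_hom[OF finite_S S, of "\<lambda>q. grp F (pk_deg Qk q + (n + 1)) (pk_pt Qk q y)"]
      unfolding pk_grp_def tw_grp_def Qk_simps(2,3) .
    interpret e: group_hom ?G ?H "entry (S y) ({r}, i)" by unfold_locales (rule eh)
    have "entry (S y) ({r}, i) v = entry (S y) ({r}, i) l \<otimes>\<^bsub>?H\<^esub> inv\<^bsub>?H\<^esub> entry (S y) ({r}, i) l"
      unfolding v_def e.hom_mult[OF l A.inv_closed[OF ak]] e.hom_inv[OF ak] ea[OF i k'] rk eW[OF i] ..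
    then show ?thesis using H.r_inv[OF e.hom_closed[OF l]] by (simp only:)
  qed
  have "l = augmentation F (n + 1) y k' \<otimes>\<^bsub>?G\<^esub> v"
    unfolding v_def using A.m_lcomm[OF ak l A.inv_closed[OF ak]] A.r_inv[OF ak] A.r_one[OF l] by (simp only:)
  then show "\<exists>k'\<in>carrier (pk_grp K F (n + 1) y). \<exists>l'\<in>carrier (pk_grp Qk F n y).
      pk_dif K F (n + 1) y k' = k \<and> l = augmentation F (n + 1) y k' \<otimes>\<^bsub>?G\<^esub> pk_dif Qk F n y l'"
    using k' dk' contraction[OF v dv v1] contraction_closed[OF v] by metis
qed

end

end

lemma augmentation_quasi_iso:
  fixes F :: "('a, 'u::infinite) cochain" assumes F: "F \<in> Ob (complex_cat X)"
  shows "augmentation F \<in> quasi_isos Y (fob (pk_ftor Y K) F) (fob (pk_ftor Y Qk) F)"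
  unfolding quasi_isos_iff[OF pk_fob[OF K F] pk_fob[OF prekernel_Qk F]]
proof (intro conjI ballI augmentation_in[OF F])
  fix y assume y: "y \<in> topspace Y"
  show "cone_acyclic (\<lambda>n. grp (fob (pk_ftor Y K) F) n y) (\<lambda>n. cdiff (fob (pk_ftor Y K) F) n y)
      (\<lambda>n. grp (fob (pk_ftor Y Qk) F) n y) (\<lambda>n. cdiff (fob (pk_ftor Y Qk) F) n y) (\<lambda>n. augmentation F n y)"
    unfolding pk_ftor_simps(1)
    by (rule cone_acyclic_cong[OF augmentation_acyclic[OF y F]]) (simp_all only: pk_ftor_simps y)
qed

end

text \<open>The strict adjunction localizes because both of its functors preserve
  quasi-isomorphisms. The augmentation becomes invertible, so the right adjoint can be replaced by
  the given functor. The left adjoint is delivered as a prekernel, so that the lemma can be applied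
  again.\<close>

lemma left_adjoint_prekernel:
  fixes K :: "('i, 'a, 'b) prekernel"
  assumes K: "is_prekernel X Y K" and fin: "finite (topspace Y)"
  obtains L :: "('b set \<times> 'i, 'b, 'a) prekernel" where "is_prekernel Y X L"
    "left_adjoint (derived_cat Y) (derived_cat X)
       (localized_ftor (complex_cat Y) (quasi_isos Y) (complex_cat X) (quasi_isos X) (pk_ftor X L))
       (localized_ftor (complex_cat X) (quasi_isos X) (complex_cat Y) (quasi_isos Y)
         (pk_ftor Y K :: (('a, 'u::infinite) cochain, ('a, 'u) cmor, ('b, 'u) cochain, ('b, 'u) cmor) ftor))"
proof -
  interpret cobar X Y K by unfold_locales (rule fin, rule K)
  let ?CX = "complex_cat X :: (('a, 'u) cochain, ('a, 'u) cmor) cat" and ?CY = "complex_cat Y :: (('b, 'u) cochain, ('b, 'u) cmor) cat"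
  let ?locX = "localized_ftor ?CX (quasi_isos X) ?CY (quasi_isos Y)"
  let ?locY = "localized_ftor ?CY (quasi_isos Y) ?CX (quasi_isos X)"
  have cX: "is_category ?CX" and cY: "is_category ?CY" by (rule is_category_complex_cat)+
  interpret X: relative_category ?CX "quasi_isos X" by (rule relative_category_complex)
  interpret Y: relative_category ?CY "quasi_isos Y" by (rule relative_category_complex)
  interpret K: relative_functor ?CX "quasi_isos X" ?CY "quasi_isos Y" "pk_ftor Y K" by (rule pk_relative_functor[OF K])
  interpret Q: relative_functor ?CX "quasi_isos X" ?CY "quasi_isos Y" "pk_ftor Y Qk" by (rule pk_relative_functor[OF prekernel_Qk])
  interpret P: relative_functor ?CY "quasi_isos Y" ?CX "quasi_isos X" "pk_ftor X Pk" by (rule pk_relative_functor[OF prekernel_Pk])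
  obtain \<eta> \<epsilon> where "adjunction ?CY ?CX (pk_ftor X Pk) (pk_ftor Y Qk) \<eta> \<epsilon>"
    by (rule left_adjoint_imp_adjunction[OF cY cX left_adjoint_kernel])
  from adjunction_imp_left_adjoint[OF Y.loc X.loc adjunction_localized[OF P.relative_functor_axioms Q.relative_functor_axioms this]]
  have adj: "left_adjoint Y.loc X.loc (?locY (pk_ftor X Pk)) (?locX (pk_ftor Y Qk))" .
  note n = natural_localized[OF K.relative_functor_axioms Q.relative_functor_axioms natural_augmentation]
  have iso: "is_iso Y.loc (fob (?locX (pk_ftor Y K)) F) (fob (?locX (pk_ftor Y Qk)) F)
      (far Y.Q (fob (pk_ftor Y K) F) (fob (pk_ftor Y Qk) F) (augmentation F))" if "F \<in> Ob X.loc" for F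
  proof -
    have F: "F \<in> Ob ?CX" using that by (simp add: localization_def)
    show ?thesis using Y.Q_is_iso[OF _ _ augmentation_quasi_iso[OF F]] pk_fob[OF K F] pk_fob[OF prekernel_Qk F] by simp
  qed
  show ?thesis
  proof (rule natural_inverse[OF Y.loc K.locS Q.locS n iso])
    fix \<sigma> assume "natural X.loc Y.loc (?locX (pk_ftor Y Qk)) (?locX (pk_ftor Y K)) \<sigma>"
      "\<And>F. F \<in> Ob X.loc \<Longrightarrow> is_iso Y.loc (fob (?locX (pk_ftor Y Qk)) F) (fob (?locX (pk_ftor Y K)) F) (\<sigma> F)"
    from left_adjoint_iso[OF Y.loc X.loc adj K.locS this] show thesis
      using that[OF prekernel_Pk] by (simp add: derived_cat_def)
  qed
qed

section \<open>Colimits\<close>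

text \<open>Quotients are formed within the universe by choosing representatives of cosets.\<close>

lemma (in comm_group) ex_quotient:
  assumes N: "subgroup N G"
  obtains A :: "'a monoid" and \<pi> where "comm_group A" "\<pi> \<in> hom G A" "\<pi> ` carrier G = carrier A"
    "\<forall>x\<in>carrier G. \<forall>y\<in>carrier G. \<pi> x = \<pi> y \<longleftrightarrow> x \<otimes> inv y \<in> N"
proof -
  interpret N: normal N G by (rule subgroup_imp_normal[OF N])
  \<comment> \<open>\<open>\<rho> x\<close> depends only on the coset of \<open>x\<close>, so the
    set of chosen representatives can be the carrier of the quotient and stays inside the type of
    the group.\<close>
  define \<rho> where "\<rho> x = (SOME z. z \<in> N #> x)" for x
  have \<rho>: "\<rho> x \<in> carrier G" "N #> \<rho> x = N #> x" if x: "x \<in> carrier G" for x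
  proof -
    have "x \<in> N #> x" by (rule rcos_self[OF x N])
    then have "\<rho> x \<in> N #> x" unfolding \<rho>_def by (rule someI)
    then show "\<rho> x \<in> carrier G" "N #> \<rho> x = N #> x" using r_coset_subset_G[OF N.subset x] repr_independence[OF _ x N] by auto
  qed
  have eq: "\<rho> x = \<rho> y \<longleftrightarrow> N #> x = N #> y" if "x \<in> carrier G" "y \<in> carrier G" for x y
    using \<rho>(2)[OF that(1)] \<rho>(2)[OF that(2)] by (metis \<rho>_def)
  \<comment> \<open>With carrier \<open>UNIV\<close>, being a homomorphism into \<open>?H\<close>
    only concerns products; the group laws then come for free on the image
    \<open>?A\<close>.\<close>
  let ?H = "\<lparr>carrier = UNIV, mult = \<lambda>x y. \<rho> (x \<otimes> y), one = \<rho> \<one>\<rparr>"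
  let ?A = "?H\<lparr>carrier := \<rho> ` carrier G, one := \<rho> \<one>\<rparr>"
  have h: "\<rho> \<in> hom G ?H"
  proof (rule homI)
    fix x y assume xy: "x \<in> carrier G" "y \<in> carrier G"
    have "N #> (\<rho> x \<otimes> \<rho> y) = N #> (x \<otimes> y)"
      using N.rcos_sum[OF \<rho>(1)[OF xy(1)] \<rho>(1)[OF xy(2)]] N.rcos_sum[OF xy] \<rho>(2)[OF xy(1)] \<rho>(2)[OF xy(2)] by simp
    then have "\<rho> (x \<otimes> y) = \<rho> (\<rho> x \<otimes> \<rho> y)" using eq \<rho>(1) xy by simp
    then show "\<rho> (x \<otimes> y) = \<rho> x \<otimes>\<^bsub>?H\<^esub> \<rho> y" by simp
  qed simp
  have g: "group ?A" using hom_imp_img_group[OF h] by simp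
  have A: "comm_group ?A"
  proof (rule group.group_comm_groupI[OF g])
    fix a b assume "a \<in> carrier ?A" "b \<in> carrier ?A"
    then obtain x y where "x \<in> carrier G" "y \<in> carrier G" "a = \<rho> x" "b = \<rho> y" by auto
    then show "a \<otimes>\<^bsub>?A\<^esub> b = b \<otimes>\<^bsub>?A\<^esub> a" using m_comm[OF \<rho>(1) \<rho>(1), of x y] by simp
  qed
  show ?thesis
  proof (rule that[OF A])
    show "\<rho> \<in> hom G ?A" using h by (auto simp: hom_def)
    show "\<rho> ` carrier G = carrier ?A" by simp
    show "\<forall>x\<in>carrier G. \<forall>y\<in>carrier G. \<rho> x = \<rho> y \<longleftrightarrow> x \<otimes> inv y \<in> N"
    proof (intro ballI)
    fix x y assume xy: "x \<in> carrier G" "y \<in> carrier G"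
    have "N #> x = N #> y \<longleftrightarrow> x \<in> N #> y" using rcos_self[OF xy(1) N] repr_independence[OF _ xy(2) N] by auto
    also have "\<dots> \<longleftrightarrow> x \<otimes> inv y \<in> N" by (rule N.rcos_module[OF is_group xy(2,1)])
    finally show "\<rho> x = \<rho> y \<longleftrightarrow> x \<otimes> inv y \<in> N" using eq[OF xy] by simp
    qed
  qed
qed

context
  fixes X :: "'a topology" and I :: "'a set" and F :: "('a, 'u::infinite) abdata"
  assumes I: "finite I" "I \<subseteq> topspace X" and F: "abelian_data X F"
begin

lemma stalk_group: "p \<in> I \<Longrightarrow> comm_group (stalk F p)"
  using I F by (auto simp: abelian_data_def)

lemma is_cocone_app:
  assumes "is_cocone X I F A \<iota>"
  shows "p \<in> I \<Longrightarrow> \<iota> p \<in> hom (stalk F p) A"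
    "p \<in> I \<Longrightarrow> q \<in> I \<Longrightarrow> spec_le X p q \<Longrightarrow> x \<in> carrier (stalk F p) \<Longrightarrow> \<iota> q (res F p q x) = \<iota> p x"
proof -
  show "p \<in> I \<Longrightarrow> \<iota> p \<in> hom (stalk F p) A" using assms by (simp add: is_cocone_def ghom_def)
  assume "p \<in> I" "q \<in> I" "spec_le X p q" and x: "x \<in> carrier (stalk F p)"
  then have "compose (carrier (stalk F p)) (\<iota> q) (res F p q) = \<iota> p" using assms by (simp add: is_cocone_def)
  from fun_cong[OF this, of x] show "\<iota> q (res F p q x) = \<iota> p x" using x by (simp add: compose_def)
qed

abbreviation "coprod \<equiv> prodgroup I (stalk F)"

lemma comm_group_coprod: "comm_group coprod"
  by (rule comm_group_prodgroup[OF I(1) stalk_group])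

text \<open>The coproduct is divided by \<open>N\<close>, the common kernel of the maps induced by
  all cocones in the universe. With this choice, rather than the subgroup generated by the
  relations, every cocone factors by the definition of \<open>N\<close>, and the relations hold in
  the quotient because every cocone respects them (\<open>kill\<close>).\<close>

lemma ex_colimit: "\<exists>(A :: 'u monoid) \<iota>. is_colimit X I F A \<iota>"
proof -
  interpret P: comm_group coprod by (rule comm_group_coprod)
  define N where "N = {x \<in> carrier coprod. \<forall>(B :: 'u monoid) \<kappa>. is_cocone X I F B \<kappa> \<longrightarrow> copair I B \<kappa> x = \<one>\<^bsub>B\<^esub>}"
  have hom: "group_hom coprod B (copair I B \<kappa>)" if "is_cocone X I F B \<kappa>" for B :: "'u monoid" and \<kappa>
  proof -
    have "comm_group B" using that by (simp add: is_cocone_def)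
    then show ?thesis using copair_hom[OF I(1) stalk_group _ is_cocone_app(1)[OF that]] P.is_group
      by (simp add: group_hom_def group_hom_axioms_def comm_group_def)
  qed
  have N: "subgroup N coprod"
  proof (rule P.subgroupI)
    show "N \<subseteq> carrier coprod" by (auto simp: N_def)
    have "\<one>\<^bsub>coprod\<^esub> \<in> N" using group_hom.hom_one[OF hom] by (auto simp: N_def)
    then show "N \<noteq> {}" by auto
    show "inv\<^bsub>coprod\<^esub> x \<in> N" if "x \<in> N" for x
      using that group_hom.hom_inv[OF hom] monoid.inv_one[OF group.is_monoid[OF group_hom.axioms(2)[OF hom]]] by (auto simp: N_def)
    show "x \<otimes>\<^bsub>coprod\<^esub> y \<in> N" if "x \<in> N" "y \<in> N" for x y
      using that group_hom.hom_mult[OF hom] monoid.r_one[OF group.is_monoid[OF group_hom.axioms(2)[OF hom]]]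
        monoid.one_closed[OF group.is_monoid[OF group_hom.axioms(2)[OF hom]]] by (auto simp: N_def)
  qed
  obtain A :: "'u monoid" and \<pi> where A: "comm_group A" and \<pi>: "\<pi> \<in> hom coprod A" "\<pi> ` carrier coprod = carrier A"
    and eq: "\<forall>x\<in>carrier coprod. \<forall>y\<in>carrier coprod. \<pi> x = \<pi> y \<longleftrightarrow> x \<otimes>\<^bsub>coprod\<^esub> inv\<^bsub>coprod\<^esub> y \<in> N"
    by (rule P.ex_quotient[OF N])
  interpret A: comm_group A by fact
  let ?j = "inclusion I (stalk F)"
  have j: "?j p \<in> hom (stalk F p) coprod" if "p \<in> I" for p by (rule inclusion_hom[OF I(1) stalk_group])
  have kill: "\<pi> x = \<pi> y \<longleftrightarrow> (\<forall>(B :: 'u monoid) \<kappa>. is_cocone X I F B \<kappa> \<longrightarrow> copair I B \<kappa> x = copair I B \<kappa> y)"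
    if xy: "x \<in> carrier coprod" "y \<in> carrier coprod" for x y
  proof -
    have "copair I B \<kappa> (x \<otimes>\<^bsub>coprod\<^esub> inv\<^bsub>coprod\<^esub> y) = \<one>\<^bsub>B\<^esub> \<longleftrightarrow> copair I B \<kappa> x = copair I B \<kappa> y"
      if "is_cocone X I F B \<kappa>" for B :: "'u monoid" and \<kappa>
    proof -
      interpret group_hom coprod B "copair I B \<kappa>" by (rule hom[OF that])
      show ?thesis using xy H.inv_equality[of "copair I B \<kappa> x" "inv\<^bsub>B\<^esub> copair I B \<kappa> y"] H.inv_inv by auto
    qed
    then show ?thesis using eq xy by (auto simp: N_def)
  qed
  define \<iota> where "\<iota> p = restrict (\<lambda>x. \<pi> (?j p x)) (carrier (stalk F p))" for p
  have jc: "?j p x \<in> carrier coprod" if "p \<in> I" "x \<in> carrier (stalk F p)" for p x by (rule hom_in_carrier[OF j[OF that(1)] that(2)])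
  have \<iota>: "\<iota> p \<in> ghom (stalk F p) A" if p: "p \<in> I" for p unfolding \<iota>_def
  proof (rule restrict_ghom[OF _ stalk_group[OF p]], rule homI)
    show "\<pi> (?j p x) \<in> carrier A" if "x \<in> carrier (stalk F p)" for x by (rule hom_in_carrier[OF \<pi>(1) jc[OF p that]])
    show "\<pi> (?j p (x \<otimes>\<^bsub>stalk F p\<^esub> y)) = \<pi> (?j p x) \<otimes>\<^bsub>A\<^esub> \<pi> (?j p y)" if "x \<in> carrier (stalk F p)" "y \<in> carrier (stalk F p)" for x y
      unfolding hom_mult[OF j[OF p] that] by (rule hom_mult[OF \<pi>(1) jc[OF p that(1)] jc[OF p that(2)]])
  qed
  have co: "is_cocone X I F A \<iota>" unfolding is_cocone_def
  proof (intro conjI ballI impI A \<iota>)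
    fix p q assume p: "p \<in> I" and q: "q \<in> I" and pq: "spec_le X p q"
    show "compose (carrier (stalk F p)) (\<iota> q) (res F p q) = \<iota> p"
    proof (rule extensionalityI[of _ "carrier (stalk F p)"])
      fix x assume x: "x \<in> carrier (stalk F p)"
      have r: "res F p q x \<in> carrier (stalk F q)" using F pq x by (auto simp: abelian_data_def ghom_iff)
      have "\<pi> (?j q (res F p q x)) = \<pi> (?j p x)"
        unfolding kill[OF jc[OF q r] jc[OF p x]]
      proof (intro allI impI)
        fix B :: "'u monoid" and \<kappa> assume c: "is_cocone X I F B \<kappa>"
        have B: "comm_group B" using c by (simp add: is_cocone_def)
        show "copair I B \<kappa> (?j q (res F p q x)) = copair I B \<kappa> (?j p x)"
          using copair_inclusion[of I "stalk F", OF I(1) stalk_group B is_cocone_app(1)[OF c]] is_cocone_app(2)[OF c p q pq x] p q x r by simp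
      qed
      then show "compose (carrier (stalk F p)) (\<iota> q) (res F p q) x = \<iota> p x" using x r by (simp add: \<iota>_def compose_def)
    qed (simp_all add: \<iota>_def compose_def)
  qed
  have "is_colimit X I F A \<iota>" unfolding is_colimit_def
  proof (intro conjI co allI impI)
    fix B :: "'u monoid" and \<kappa> assume c: "is_cocone X I F B \<kappa>"
    have B: "comm_group B" using c by (simp add: is_cocone_def)
    interpret h: group_hom coprod B "copair I B \<kappa>" by (rule hom[OF c])
    \<comment> \<open>\<open>\<pi>\<close> is onto \<open>A\<close>, and by \<open>kill\<close> the
      choice of a preimage does not affect the value.\<close>
    define h where "h = restrict (\<lambda>a. copair I B \<kappa> (SOME x. x \<in> carrier coprod \<and> \<pi> x = a)) (carrier A)"
    have h\<pi>: "h (\<pi> x) = copair I B \<kappa> x" if x: "x \<in> carrier coprod" for x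
    proof -
      let ?z = "SOME z. z \<in> carrier coprod \<and> \<pi> z = \<pi> x"
      have z: "?z \<in> carrier coprod" "\<pi> ?z = \<pi> x" using someI[of "\<lambda>z. z \<in> carrier coprod \<and> \<pi> z = \<pi> x" x] x by blast+
      have "copair I B \<kappa> ?z = copair I B \<kappa> x" using kill[OF z(1) x] z(2) c by blast
      then show ?thesis using hom_in_carrier[OF \<pi>(1) x] by (simp add: h_def)
    qed
    show "\<exists>!h. cocone_map I F A \<iota> B \<kappa> h"
    proof (rule ex1I[of _ h])
      have "h \<in> ghom A B" unfolding ghom_iff
      proof (intro conjI ballI)
        show "h \<in> extensional (carrier A)" by (simp add: h_def)
        show "h a \<in> carrier B" if "a \<in> carrier A" for a
          using that h\<pi> h.hom_closed unfolding \<pi>(2)[symmetric] by auto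
        fix a b assume "a \<in> carrier A" "b \<in> carrier A"
        then obtain x y where xy: "x \<in> carrier coprod" "y \<in> carrier coprod" "a = \<pi> x" "b = \<pi> y" unfolding \<pi>(2)[symmetric] by blast
        show "h (a \<otimes>\<^bsub>A\<^esub> b) = h a \<otimes>\<^bsub>B\<^esub> h b"
          unfolding xy(3,4) hom_mult[OF \<pi>(1) xy(1,2), symmetric] h\<pi>[OF xy(1)] h\<pi>[OF xy(2)] h\<pi>[OF P.m_closed[OF xy(1,2)]]
          by (rule h.hom_mult[OF xy(1,2)])
      qed
      moreover have "compose (carrier (stalk F p)) h (\<iota> p) = \<kappa> p" if p: "p \<in> I" for p
      proof (rule extensionalityI[of _ "carrier (stalk F p)"])
        show "\<kappa> p \<in> extensional (carrier (stalk F p))" using c p by (simp add: is_cocone_def ghom_def)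
        fix x assume x: "x \<in> carrier (stalk F p)"
        show "compose (carrier (stalk F p)) h (\<iota> p) x = \<kappa> p x"
          using h\<pi>[OF jc[OF p x]] copair_inclusion[of I "stalk F", OF I(1) stalk_group B is_cocone_app(1)[OF c] p x] x by (simp add: compose_def \<iota>_def)
      qed (simp add: compose_def)
      ultimately show "cocone_map I F A \<iota> B \<kappa> h" by (simp add: cocone_map_def)
      fix h' assume h': "cocone_map I F A \<iota> B \<kappa> h'"
      show "h' = h"
      proof (rule extensionalityI[of _ "carrier A"])
        show "h' \<in> extensional (carrier A)" using h' by (simp add: cocone_map_def ghom_def)
        show "h \<in> extensional (carrier A)" by (simp add: h_def)
        fix a assume "a \<in> carrier A"
        then obtain x where x: "x \<in> carrier coprod" "a = \<pi> x" unfolding \<pi>(2)[symmetric] by blast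
        have h'h: "h' \<in> hom A B" using h' by (simp add: cocone_map_def ghom_def)
        have "h' (\<pi> x) = copair I B \<kappa> x"
        proof (rule prodgroup_hom_eqI[of I "stalk F", OF I(1) stalk_group B _ h.homh _ x(1)])
          show "(\<lambda>x. h' (\<pi> x)) \<in> hom coprod B" using hom_compose[OF \<pi>(1) h'h] by (simp add: comp_def)
          fix p y assume p: "p \<in> I" and y: "y \<in> carrier (stalk F p)"
          have "compose (carrier (stalk F p)) h' (\<iota> p) = \<kappa> p" using h' p by (simp add: cocone_map_def)
          from fun_cong[OF this, of y] show "h' (\<pi> (?j p y)) = copair I B \<kappa> (?j p y)"
            using y copair_inclusion[of I "stalk F" B \<kappa> p y, OF I(1) stalk_group B is_cocone_app(1)[OF c] p y]
            by (simp add: compose_def \<iota>_def)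
        qed
        then show "h' a = h a" unfolding x(2) h\<pi>[OF x(1)] .
      qed
    qed
  qed
  then show ?thesis by blast
qed

lemma colim: "is_colimit X I F (colim_obj X I F) (colim_in X I F)"
proof -
  have "\<exists>\<iota>. is_colimit X I F (colim_obj X I F) \<iota>" unfolding colim_obj_def using someI_ex[OF ex_colimit] .
  then show ?thesis unfolding colim_in_def by (rule someI_ex)
qed

lemma colim_group: "comm_group (colim_obj X I F)"
  using colim by (simp add: is_colimit_def is_cocone_def)

lemma colim_in_ghom: "p \<in> I \<Longrightarrow> colim_in X I F p \<in> ghom (stalk F p) (colim_obj X I F)"
  using colim by (simp add: is_colimit_def is_cocone_def)

lemma colim_in_hom: "p \<in> I \<Longrightarrow> colim_in X I F p \<in> hom (stalk F p) (colim_obj X I F)"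
  using colim_in_ghom by (simp add: ghom_def)

lemma colim_in_res: "p \<in> I \<Longrightarrow> q \<in> I \<Longrightarrow> spec_le X p q \<Longrightarrow> x \<in> carrier (stalk F p) \<Longrightarrow>
    colim_in X I F q (res F p q x) = colim_in X I F p x"
  using colim is_cocone_app(2) unfolding is_colimit_def by blast

lemma colim_desc:
  fixes B :: "'u monoid"
  assumes "is_cocone X I F B \<kappa>"
  shows "colim_desc X I F B \<kappa> \<in> ghom (colim_obj X I F) B"
    "p \<in> I \<Longrightarrow> x \<in> carrier (stalk F p) \<Longrightarrow> colim_desc X I F B \<kappa> (colim_in X I F p x) = \<kappa> p x"
proof -
  have "\<exists>!h. cocone_map I F (colim_obj X I F) (colim_in X I F) B \<kappa> h" using colim assms by (simp add: is_colimit_def)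
  from theI'[OF this] have c: "cocone_map I F (colim_obj X I F) (colim_in X I F) B \<kappa> (colim_desc X I F B \<kappa>)"
    by (simp add: colim_desc_def)
  then show "colim_desc X I F B \<kappa> \<in> ghom (colim_obj X I F) B" by (simp add: cocone_map_def)
  assume p: "p \<in> I" "x \<in> carrier (stalk F p)"
  have "compose (carrier (stalk F p)) (colim_desc X I F B \<kappa>) (colim_in X I F p) = \<kappa> p" using c p by (simp add: cocone_map_def)
  from fun_cong[OF this, of x] show "colim_desc X I F B \<kappa> (colim_in X I F p x) = \<kappa> p x" using p by (simp add: compose_def)
qed

lemma is_coconeI:
  assumes "comm_group B" "\<And>p. p \<in> I \<Longrightarrow> \<kappa> p \<in> ghom (stalk F p) B"
    "\<And>p q x. p \<in> I \<Longrightarrow> q \<in> I \<Longrightarrow> spec_le X p q \<Longrightarrow> x \<in> carrier (stalk F p) \<Longrightarrow> \<kappa> q (res F p q x) = \<kappa> p x"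
  shows "is_cocone X I F B \<kappa>"
  unfolding is_cocone_def
proof (intro conjI ballI impI assms(1,2))
  fix p q assume pq: "p \<in> I" "q \<in> I" "spec_le X p q"
  show "compose (carrier (stalk F p)) (\<kappa> q) (res F p q) = \<kappa> p"
    by (rule extensionalityI[of _ "carrier (stalk F p)"])
      (use assms(2)[OF pq(1)] assms(3)[OF pq] in \<open>auto simp: compose_def ghom_iff\<close>)
qed

text \<open>Both homomorphisms, restricted to the carrier so as to be extensional, mediate the same
  cocone, and the universal property allows only one. This reduces equations between maps out of a
  stalk of \<open>f_!\<close> to the structure maps.\<close>

lemma colim_eqI:
  fixes B :: "'u monoid"
  assumes B: "comm_group B" and h: "h \<in> hom (colim_obj X I F) B" "h' \<in> hom (colim_obj X I F) B"
    and eq: "\<And>p x. p \<in> I \<Longrightarrow> x \<in> carrier (stalk F p) \<Longrightarrow> h (colim_in X I F p x) = h' (colim_in X I F p x)"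
    and a: "a \<in> carrier (colim_obj X I F)"
  shows "h a = h' a"
proof -
  let ?C = "colim_obj X I F"
  define \<kappa> where "\<kappa> p = restrict (\<lambda>x. h (colim_in X I F p x)) (carrier (stalk F p))" for p
  note c = hom_in_carrier[OF colim_in_hom]
  have k: "is_cocone X I F B \<kappa>"
  proof (rule is_coconeI[OF B])
    fix p assume p: "p \<in> I"
    have "(\<lambda>x. h (colim_in X I F p x)) \<in> hom (stalk F p) B" using hom_compose[OF colim_in_hom[OF p] h(1)] by (simp add: comp_def)
    then show "\<kappa> p \<in> ghom (stalk F p) B" unfolding \<kappa>_def by (rule restrict_ghom[OF _ stalk_group[OF p]])
  next
    fix p q x assume pq: "p \<in> I" "q \<in> I" "spec_le X p q" and x: "x \<in> carrier (stalk F p)"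
    have "res F p q x \<in> carrier (stalk F q)" using F pq x by (auto simp: abelian_data_def ghom_iff)
    then show "\<kappa> q (res F p q x) = \<kappa> p x" using colim_in_res[OF pq x] x by (simp add: \<kappa>_def)
  qed
  have m: "cocone_map I F ?C (colim_in X I F) B \<kappa> (restrict g (carrier ?C))"
    if g: "g \<in> hom ?C B" "\<And>p x. p \<in> I \<Longrightarrow> x \<in> carrier (stalk F p) \<Longrightarrow> g (colim_in X I F p x) = h (colim_in X I F p x)" for g
    unfolding cocone_map_def
  proof (intro conjI ballI restrict_ghom[OF g(1) colim_group])
    fix p assume p: "p \<in> I"
    show "compose (carrier (stalk F p)) (restrict g (carrier ?C)) (colim_in X I F p) = \<kappa> p"
      by (rule extensionalityI[of _ "carrier (stalk F p)"]) (use g(2)[OF p] c[OF p] in \<open>simp_all add: compose_def \<kappa>_def\<close>)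
  qed
  have "\<exists>!g. cocone_map I F ?C (colim_in X I F) B \<kappa> g" using colim k by (simp add: is_colimit_def)
  then have "restrict h (carrier ?C) = restrict h' (carrier ?C)" using m[OF h(1) refl] m[OF h(2) eq[symmetric]] by blast
  from fun_cong[OF this, of a] show ?thesis using a by simp
qed

end

section \<open>The adjunction between \<open>f\<^sub>!\<close> and the inverse image\<close>

locale finite_map =
  fixes X :: "'a topology" and Y :: "'b topology" and f :: "'a \<Rightarrow> 'b"
  assumes finX: "finite (topspace X)" and finY: "finite (topspace Y)" and cont: "continuous_map X Y f"
begin

abbreviation "fib \<equiv> fibre_below X Y f"
abbreviation "cl F y \<equiv> colim_obj X (fib y) F"
abbreviation "cin F y \<equiv> colim_in X (fib y) F"
abbreviation "sres F y y' \<equiv> colim_desc X (fib y) F (cl F y') (cin F y')"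
abbreviation "smor F G \<phi> y \<equiv> colim_desc X (fib y) F (cl G y) (\<lambda>x. compose (carrier (stalk F x)) (cin G y x) (\<phi> x))"

lemma f_in: "x \<in> topspace X \<Longrightarrow> f x \<in> topspace Y"
  using cont by (auto simp: continuous_map_def)

lemma fib_iff: "y \<in> topspace Y \<Longrightarrow> x \<in> fib y \<longleftrightarrow> x \<in> topspace X \<and> spec_le Y (f x) y"
proof -
  assume y: "y \<in> topspace Y"
  have "f x \<in> Y closure_of {y} \<longleftrightarrow> Y closure_of {f x} \<subseteq> Y closure_of {y}" if "f x \<in> topspace Y"
  proof
    assume "f x \<in> Y closure_of {y}"
    then show "Y closure_of {f x} \<subseteq> Y closure_of {y}" by (intro closure_of_minimal) auto
  next
    assume "Y closure_of {f x} \<subseteq> Y closure_of {y}"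
    moreover have "f x \<in> Y closure_of {f x}" using closure_of_subset[of "{f x}" Y] that by simp
    ultimately show "f x \<in> Y closure_of {y}" by blast
  qed
  then show ?thesis using y f_in by (auto simp: fibre_below_def spec_le_def)
qed

text \<open>Continuity in the form that the image of a closure lies in the closure of the
  image.\<close>

lemma f_mono: "spec_le X x x' \<Longrightarrow> spec_le Y (f x) (f x')"
proof -
  assume le: "spec_le X x x'"
  then have x: "x \<in> topspace X" "x' \<in> topspace X" "X closure_of {x} \<subseteq> X closure_of {x'}" by (auto simp: spec_le_def)
  have "x \<in> X closure_of {x}" using closure_of_subset[of "{x}" X] x(1) by simp
  then have "f x \<in> f ` (X closure_of {x'})" using x(3) by blast
  then have "f x \<in> Y closure_of (f ` {x'})" using continuous_map_image_closure_subset[OF cont, of "{x'}"] by blast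
  then have "Y closure_of {f x} \<subseteq> Y closure_of {f x'}" by (intro closure_of_minimal) auto
  then show ?thesis using x f_in by (auto simp: spec_le_def)
qed

lemma fin_fib: "finite (fib y)" and fib_sub: "fib y \<subseteq> topspace X"
  using finX by (auto simp: fibre_below_def)

lemma fib_mono: "spec_le Y y y' \<Longrightarrow> x \<in> fib y \<Longrightarrow> x \<in> fib y'"
  using spec_leD[of Y y y'] spec_trans[of Y "f x" y y'] by (simp add: fib_iff)

lemma fib_self: "x \<in> topspace X \<Longrightarrow> x \<in> fib (f x)"
  using spec_le_refl[OF f_in] f_in by (simp add: fib_iff)

lemmas cl_group = colim_group[OF fin_fib fib_sub]
  and cin_ghom = colim_in_ghom[OF fin_fib fib_sub]
  and cin_hom = colim_in_hom[OF fin_fib fib_sub]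
  and cin_res = colim_in_res[OF fin_fib fib_sub]
  and cl_desc = colim_desc[OF fin_fib fib_sub]
  and cl_coconeI = is_coconeI[OF fin_fib fib_sub]
  and cl_eqI = colim_eqI[OF fin_fib fib_sub]

lemma shriek_simps [simp]:
  "stalk (fob (lower_shriek X Y f) F) y = cl F y"
  "res (fob (lower_shriek X Y f) F) y y' = sres F y y'"
  "y \<in> topspace Y \<Longrightarrow> far (lower_shriek X Y f) F G \<phi> y = smor F G \<phi> y"
  by (simp_all add: lower_shriek_def)

lemma sres:
  fixes F :: "('a, 'u::infinite) abdata" assumes F: "abelian_data X F" and le: "spec_le Y y y'"
  shows "sres F y y' \<in> ghom (cl F y) (cl F y')"
    "x \<in> fib y \<Longrightarrow> u \<in> carrier (stalk F x) \<Longrightarrow> sres F y y' (cin F y x u) = cin F y' x u"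
proof -
  have c: "is_cocone X (fib y) F (cl F y') (cin F y')"
    by (rule cl_coconeI[OF F cl_group[OF F] cin_ghom[OF F] cin_res[OF F]]) (use fib_mono[OF le] in auto)
  show "sres F y y' \<in> ghom (cl F y) (cl F y')" by (rule cl_desc(1)[OF F c])
  show "x \<in> fib y \<Longrightarrow> u \<in> carrier (stalk F x) \<Longrightarrow> sres F y y' (cin F y x u) = cin F y' x u" by (rule cl_desc(2)[OF F c])
qed

lemma smor:
  fixes F G :: "('a, 'u::infinite) abdata"
  assumes F: "abelian_data X F" and G: "abelian_data X G" and \<phi>: "\<phi> \<in> Hom (abdata_cat X) F G"
  shows "smor F G \<phi> y \<in> ghom (cl F y) (cl G y)"
    "x \<in> fib y \<Longrightarrow> u \<in> carrier (stalk F x) \<Longrightarrow> smor F G \<phi> y (cin F y x u) = cin G y x (\<phi> x u)"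
proof -
  have h: "\<phi> x \<in> ghom (stalk F x) (stalk G x)" "comm_group (stalk F x)" if "x \<in> fib y" for x
    using \<phi> F fib_sub[of y] that by (auto simp: Hom_abdata_cat_iff abelian_data_def)
  have c: "is_cocone X (fib y) F (cl G y) (\<lambda>x. compose (carrier (stalk F x)) (cin G y x) (\<phi> x))"
  proof (rule cl_coconeI[OF F cl_group[OF G] ghom_compose[OF h(2) h(1) cin_ghom[OF G]]])
    fix p q u assume pq: "p \<in> fib y" "q \<in> fib y" "spec_le X p q" and u: "u \<in> carrier (stalk F p)"
    have "res F p q u \<in> carrier (stalk F q)" using F pq(3) u by (auto simp: abelian_data_def ghom_iff)
    moreover have "\<phi> q (res F p q u) = res G p q (\<phi> p u)" using \<phi> pq(3) u by (simp add: Hom_abdata_cat_iff)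
    moreover have "\<phi> p u \<in> carrier (stalk G p)" using h(1)[OF pq(1)] u by (simp add: ghom_iff)
    ultimately show "compose (carrier (stalk F q)) (cin G y q) (\<phi> q) (res F p q u) = compose (carrier (stalk F p)) (cin G y p) (\<phi> p) u"
      using cin_res[OF G pq] u by (simp add: compose_def)
  qed
  show "smor F G \<phi> y \<in> ghom (cl F y) (cl G y)" by (rule cl_desc(1)[OF F c])
  show "smor F G \<phi> y (cin F y x u) = cin G y x (\<phi> x u)" if "x \<in> fib y" "u \<in> carrier (stalk F x)"
    using cl_desc(2)[OF F c that] that by (simp add: compose_def)
qed

lemma ghom_hom: "h \<in> ghom A B \<Longrightarrow> h \<in> hom A B" by (simp add: ghom_def)

context
  fixes F :: "('a, 'u::infinite) abdata" assumes F: "abelian_data X F"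
begin

lemma cin_closed: "x \<in> fib y \<Longrightarrow> u \<in> carrier (stalk F x) \<Longrightarrow> cin F y x u \<in> carrier (cl F y)"
  by (rule hom_in_carrier[OF cin_hom[OF F]])

lemma sres_refl: "y \<in> topspace Y \<Longrightarrow> a \<in> carrier (cl F y) \<Longrightarrow> sres F y y a = a"
  by (rule cl_eqI[OF F cl_group[OF F], where h' = "\<lambda>a. a"])
    (use sres[OF F spec_le_refl[of y Y]] in \<open>auto simp: hom_def ghom_iff\<close>)

lemma sres_sres:
  assumes le: "spec_le Y y y'" "spec_le Y y' y''" and a: "a \<in> carrier (cl F y)"
  shows "sres F y y'' a = sres F y' y'' (sres F y y' a)"
proof (rule cl_eqI[OF F cl_group[OF F] _ _ _ a])
  note le' = spec_trans[OF le]
  show "sres F y y'' \<in> hom (cl F y) (cl F y'')" by (rule ghom_hom[OF sres(1)[OF F le']])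
  show "(\<lambda>a. sres F y' y'' (sres F y y' a)) \<in> hom (cl F y) (cl F y'')"
    by (rule hom_comp[OF ghom_hom[OF sres(1)[OF F le(1)]] ghom_hom[OF sres(1)[OF F le(2)]]])
  show "sres F y y'' (cin F y x u) = sres F y' y'' (sres F y y' (cin F y x u))" if "x \<in> fib y" "u \<in> carrier (stalk F x)" for x u
    using that fib_mono[OF le(1)] by (simp add: sres(2)[OF F le'] sres(2)[OF F le(1)] sres(2)[OF F le(2)])
qed

lemma smor_sres:
  assumes G: "abelian_data X G" and \<phi>: "\<phi> \<in> Hom (abdata_cat X) F G" and le: "spec_le Y y y'" and a: "a \<in> carrier (cl F y)"
  shows "sres G y y' (smor F G \<phi> y a) = smor F G \<phi> y' (sres F y y' a)"
proof (rule cl_eqI[OF F cl_group[OF G] _ _ _ a])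
  note s = smor[OF F G \<phi>]
  show "(\<lambda>a. sres G y y' (smor F G \<phi> y a)) \<in> hom (cl F y) (cl G y')"
    by (rule hom_comp[OF ghom_hom[OF s(1)] ghom_hom[OF sres(1)[OF G le]]])
  show "(\<lambda>a. smor F G \<phi> y' (sres F y y' a)) \<in> hom (cl F y) (cl G y')"
    by (rule hom_comp[OF ghom_hom[OF sres(1)[OF F le]] ghom_hom[OF s(1)]])
  fix x u assume x: "x \<in> fib y" "u \<in> carrier (stalk F x)"
  have "\<phi> x u \<in> carrier (stalk G x)" using \<phi> x fib_sub[of y] by (auto simp: Hom_abdata_cat_iff ghom_iff)
  then show "sres G y y' (smor F G \<phi> y (cin F y x u)) = smor F G \<phi> y' (sres F y y' (cin F y x u))"
    using x fib_mono[OF le x(1)] by (simp add: s(2) sres(2)[OF F le] sres(2)[OF G le])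
qed

text \<open>Stated for any \<open>\<theta>\<close> that agrees with the composite on the fibre, so
  that it also covers commuting squares, not only literal composites.\<close>

lemma smor_Cmp:
  assumes G: "abelian_data X G" and H: "abelian_data X H" and \<phi>: "\<phi> \<in> Hom (abdata_cat X) F G" and \<psi>: "\<psi> \<in> Hom (abdata_cat X) G H"
    and \<theta>: "\<theta> \<in> Hom (abdata_cat X) F H" and eq: "\<And>x u. x \<in> fib y \<Longrightarrow> u \<in> carrier (stalk F x) \<Longrightarrow> \<theta> x u = \<psi> x (\<phi> x u)"
    and a: "a \<in> carrier (cl F y)"
  shows "smor F H \<theta> y a = smor G H \<psi> y (smor F G \<phi> y a)"
proof (rule cl_eqI[OF F cl_group[OF H] ghom_hom[OF smor(1)[OF F H \<theta>]] _ _ a])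
  show "(\<lambda>a. smor G H \<psi> y (smor F G \<phi> y a)) \<in> hom (cl F y) (cl H y)"
    by (rule hom_comp[OF ghom_hom[OF smor(1)[OF F G \<phi>]] ghom_hom[OF smor(1)[OF G H \<psi>]]])
  fix x u assume x: "x \<in> fib y" "u \<in> carrier (stalk F x)"
  have "\<phi> x u \<in> carrier (stalk G x)" using \<phi> x fib_sub[of y] by (auto simp: Hom_abdata_cat_iff ghom_iff)
  then show "smor F H \<theta> y (cin F y x u) = smor G H \<psi> y (smor F G \<phi> y (cin F y x u))"
    using x eq[OF x] by (simp add: smor(2)[OF F H \<theta>] smor(2)[OF F G \<phi>] smor(2)[OF G H \<psi>])
qed

end

section \<open>The functor \<open>f_!\<close> on complexes\<close>

abbreviation "shriek \<equiv> lower_shriek_complex X Y f"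

lemma shriek_complex_simps [simp]:
  "grp (fob shriek K) n y = cl (cterm K n) y"
  "rst (fob shriek K) n y y' = sres (cterm K n) y y'"
  "y \<in> topspace Y \<Longrightarrow> cdiff (fob shriek K) n y = smor (cterm K n) (cterm K (n + 1)) (cdiff K n) y"
  "y \<in> topspace Y \<Longrightarrow> far shriek K L \<phi> n y = smor (cterm K n) (cterm L n) (\<phi> n) y"
  by (simp_all add: lower_shriek_complex_def)

lemma shriek_fob:
  fixes K :: "('a, 'u::infinite) cochain" assumes K: "K \<in> Ob (complex_cat X)"
  shows "fob shriek K \<in> Ob (complex_cat Y)"
proof (rule complexI, goal_cases)
  note F = complex_cterm[OF K]
  {
    case (1 n p) then show ?case by (simp add: cl_group[OF F])
  next
    case (2 n p q) then show ?case by (simp add: sres[OF F])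
  next
    case (3 n p x) then show ?case by (simp add: sres_refl[OF F])
  next
    case (4 n p q r x) then show ?case using sres_sres[OF F 4(1,2), of x] by simp
  next
    case (5 n) then show ?case by (simp add: lower_shriek_complex_def lower_shriek_def)
  next
    case (6 n p) then show ?case by (simp add: smor[OF F F complex_cdiff[OF K]])
  next
    case (7 n p q x) then show ?case using smor_sres[OF F F complex_cdiff[OF K] 7(1), of x] by (auto dest: spec_leD)
  next
    case (8 n p x)
    let ?d = "\<lambda>n. smor (cterm K n) (cterm K (n + 1)) (cdiff K n) p"
    have C: "comm_group (cl (cterm K (n + 1 + 1)) p)" by (rule cl_group[OF F])
    note s = smor[OF F F complex_cdiff[OF K]]
    have "?d (n + 1) (?d n x) = (\<lambda>_. \<one>\<^bsub>cl (cterm K (n + 1 + 1)) p\<^esub>) x"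
    proof (rule cl_eqI[OF F C _ _ _ 8(2)[unfolded shriek_complex_simps]])
      show "(\<lambda>x. ?d (n + 1) (?d n x)) \<in> hom (cl (cterm K n) p) (cl (cterm K (n + 1 + 1)) p)"
        by (rule hom_comp[OF ghom_hom[OF s(1)] ghom_hom[OF s(1)]])
      show "(\<lambda>_. \<one>\<^bsub>cl (cterm K (n + 1 + 1)) p\<^esub>) \<in> hom (cl (cterm K n) p) (cl (cterm K (n + 1 + 1)) p)"
        using C by (auto simp: hom_def comm_group_def group_def monoid.one_closed)
      fix z u assume z: "z \<in> fib p" "u \<in> carrier (grp K n z)"
      have zX: "z \<in> topspace X" using z(1) fib_sub by blast
      have "?d (n + 1) (?d n (cin (cterm K n) p z u)) = cin (cterm K (n + 1 + 1)) p z (cdiff K (n + 1) z (cdiff K n z u))"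
        using z complex_cdiff_closed[OF K zX z(2)] by (simp add: s(2))
      also have "\<dots> = \<one>\<^bsub>cl (cterm K (n + 1 + 1)) p\<^esub>"
        unfolding complex_cdiff_cdiff[OF K zX z(2)]
        using hom_one[OF cin_hom[OF F z(1)]] complex_grp[OF K zX] C by (simp add: comm_group_def)
      finally show "?d (n + 1) (?d n (cin (cterm K n) p z u)) = \<one>\<^bsub>cl (cterm K (n + 1 + 1)) p\<^esub>" .
    qed
    then show ?case using 8(1) by simp
  }
qed

lemma shriek_far:
  fixes K L :: "('a, 'u::infinite) cochain"
  assumes K: "K \<in> Ob (complex_cat X)" and L: "L \<in> Ob (complex_cat X)" and \<phi>: "\<phi> \<in> Hom (complex_cat X) K L"
  shows "far shriek K L \<phi> \<in> Hom (complex_cat Y) (fob shriek K) (fob shriek L)"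
proof (rule complex_HomI, goal_cases)
  note FK = complex_cterm[OF K] and FL = complex_cterm[OF L] and m = mor_abdata[OF \<phi>]
  {
    case (1 n) then show ?case by (simp add: lower_shriek_complex_def lower_shriek_def)
  next
    case (2 n p) then show ?case by (simp add: smor[OF FK FL m])
  next
    case (3 n p q x) then show ?case using smor_sres[OF FK FL m 3(1), of x] by (auto dest: spec_leD)
  next
    case (4 n p x)
    note dK = complex_cdiff[OF K] and dL = complex_cdiff[OF L]
    have ab: "is_category (abdata_cat X :: (('a, 'u) abdata, _) cat)" by (rule is_category_abdata_cat)
    have Ob: "cterm K n \<in> Ob (abdata_cat X)" "cterm L n \<in> Ob (abdata_cat X)" for n using FK FL by (simp_all add: abdata_cat_def)
    \<comment> \<open>The diagonal of the square between \<open>\<phi>\<close> and the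
      differentials. Applying \<open>smor_Cmp\<close> to its two factorizations gives the square for
      \<open>f_!\<close>.\<close>
    let ?c = "Cmp (abdata_cat X) (cterm K n) (cterm L n) (cterm L (n + 1)) (cdiff L n) (\<phi> n)"
    have c: "?c \<in> Hom (abdata_cat X) (cterm K n) (cterm L (n + 1))" by (rule cat_Cmp[OF ab Ob(1) Ob(2) Ob(2) m dL])
    have v: "?c x u = cdiff L n x (\<phi> n x u)" if "x \<in> fib p" "u \<in> carrier (grp K n x)" for x u
      using that fib_sub[of p] by (auto simp: abdata_cat_def compose_def)
    have x: "x \<in> carrier (cl (cterm K n) p)" using 4(2) by simp
    have "smor (cterm K n) (cterm L (n + 1)) ?c p x = smor (cterm L n) (cterm L (n + 1)) (cdiff L n) p (smor (cterm K n) (cterm L n) (\<phi> n) p x)"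
      by (rule smor_Cmp[OF FK FL FL m dL c v x])
    moreover have "smor (cterm K n) (cterm L (n + 1)) ?c p x = smor (cterm K (n + 1)) (cterm L (n + 1)) (\<phi> (n + 1)) p (smor (cterm K n) (cterm K (n + 1)) (cdiff K n) p x)"
    proof (rule smor_Cmp[OF FK FK FL dK m c _ x])
      fix z u assume z: "z \<in> fib p" "u \<in> carrier (grp K n z)"
      then have "z \<in> topspace X" using fib_sub by blast
      then show "?c z u = \<phi> (n + 1) z (cdiff K n z u)" using v[OF z] mor_cdiff[OF \<phi> _ z(2)] by simp
    qed
    ultimately show ?case using 4(1) by simp
  }
qed

lemma shriek_functor: "is_functor (complex_cat X :: (('a, 'u::infinite) cochain, _) cat) (complex_cat Y) shriek"
  unfolding is_functor_def
proof (intro conjI ballI shriek_fob shriek_far)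
  have cX: "is_category (complex_cat X :: (('a, 'u) cochain, _) cat)" and cY: "is_category (complex_cat Y :: (('b, 'u) cochain, _) cat)"
    by (rule is_category_complex_cat)+
  {
    fix K :: "('a, 'u) cochain" assume K: "K \<in> Ob (complex_cat X)"
    note F = complex_cterm[OF K] and idK = cat_Idn[OF cX K]
    show "far shriek K K (Idn (complex_cat X) K) = Idn (complex_cat Y) (fob shriek K)"
    proof (rule complex_mor_eqI[OF shriek_far[OF K K idK] cat_Idn[OF cY shriek_fob[OF K]]])
      fix n p x assume p: "p \<in> topspace Y" and "x \<in> carrier (grp (fob shriek K) n p)"
      then have x: "x \<in> carrier (cl (cterm K n) p)" by simp
      have "smor (cterm K n) (cterm K n) (Idn (complex_cat X) K n) p x = (\<lambda>x. x) x"
      proof (rule cl_eqI[OF F cl_group[OF F] ghom_hom[OF smor(1)[OF F F mor_abdata[OF idK]]] _ _ x])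
        show "(\<lambda>x. x) \<in> hom (cl (cterm K n) p) (cl (cterm K n) p)" by (simp add: hom_def)
        fix z u assume z: "z \<in> fib p" "u \<in> carrier (grp K n z)"
        then have "z \<in> topspace X" using fib_sub by blast
        then show "smor (cterm K n) (cterm K n) (Idn (complex_cat X) K n) p (cin (cterm K n) p z u) = cin (cterm K n) p z u"
          using z by (simp add: smor(2)[OF F F mor_abdata[OF idK]])
      qed
      then show "far shriek K K (Idn (complex_cat X) K) n p x = Idn (complex_cat Y) (fob shriek K) n p x" using p x by simp
    qed
  }
  fix K L M :: "('a, 'u) cochain" and \<phi> \<psi>
  assume K: "K \<in> Ob (complex_cat X)" and L: "L \<in> Ob (complex_cat X)" and M: "M \<in> Ob (complex_cat X)"
    and \<phi>: "\<phi> \<in> Hom (complex_cat X) K L" and \<psi>: "\<psi> \<in> Hom (complex_cat X) L M"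
  note c = cat_Cmp[OF cX K L M \<phi> \<psi>]
  let ?c = "Cmp (complex_cat X) K L M \<psi> \<phi>"
  show "far shriek K M ?c = Cmp (complex_cat Y) (fob shriek K) (fob shriek L) (fob shriek M) (far shriek L M \<psi>) (far shriek K L \<phi>)"
  proof (rule complex_mor_eqI[OF shriek_far[OF K M c] cat_Cmp[OF cY shriek_fob[OF K] shriek_fob[OF L] shriek_fob[OF M] shriek_far[OF K L \<phi>] shriek_far[OF L M \<psi>]]])
    fix n p x assume p: "p \<in> topspace Y" and xx: "x \<in> carrier (grp (fob shriek K) n p)"
    then have x: "x \<in> carrier (cl (cterm K n) p)" by simp
    have "smor (cterm K n) (cterm M n) (?c n) p x = smor (cterm L n) (cterm M n) (\<psi> n) p (smor (cterm K n) (cterm L n) (\<phi> n) p x)"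
    proof (rule smor_Cmp[OF complex_cterm[OF K] complex_cterm[OF L] complex_cterm[OF M] mor_abdata[OF \<phi>] mor_abdata[OF \<psi>] mor_abdata[OF c] _ x])
      fix z u assume "z \<in> fib p" "u \<in> carrier (grp K n z)"
      then show "?c n z u = \<psi> n z (\<phi> n z u)" using fib_sub[of p] by auto
    qed
    then show "far shriek K M ?c n p x = Cmp (complex_cat Y) (fob shriek K) (fob shriek L) (fob shriek M) (far shriek L M \<psi>) (far shriek K L \<phi>) n p x"
      using p xx by simp
  qed
qed

end

section \<open>The inverse image as right adjoint of \<open>f_!\<close> on complexes\<close>

context finite_map
begin

text \<open>The inverse image functor as a prekernel with a single summand.\<close>

definition pull :: "(unit, 'b, 'a) prekernel" where
  "pull = \<lparr>pk_ind = \<lambda>_. {()}, pk_pt = \<lambda>_. f, pk_deg = \<lambda>_. 0, pk_mat = \<lambda>_ _. 0\<rparr>"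

lemma pull_simps [simp]: "pk_ind pull x = {()}" "pk_pt pull i x = f x" "pk_deg pull i = 0" "pk_mat pull i j = 0"
  by (simp_all add: pull_def)

lemma prekernel_pull: "is_prekernel Y X pull"
  by (auto simp: is_prekernel_def twisted_def f_in f_mono)

text \<open>A product with one factor is not the group itself but its coded copy;
  \<open>wrap\<close> and \<open>unwrap\<close> pass between the two.\<close>

abbreviation wrap :: "'u::infinite \<Rightarrow> 'u" where "wrap v \<equiv> tuple {()} (\<lambda>_. v)"
abbreviation unwrap :: "'u::infinite \<Rightarrow> 'u" where "unwrap \<equiv> entry {()} ()"

context
  fixes G :: "('b, 'u::infinite) cochain" assumes G: "G \<in> Ob (complex_cat Y)"
begin

lemma wrap_hom: "wrap \<in> hom (grp G n (f x)) (pk_grp pull G n x)"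
  using tuple_hom[of "{()}" "\<lambda>_ v. v" "grp G n (f x)" "\<lambda>_. grp G n (f x)"]
  by (simp add: pk_grp_def tw_grp_def hom_def)

lemma unwrap_hom: "unwrap \<in> hom (pk_grp pull G n x) (grp G n (f x))"
  using entry_hom[of "{()}" "()" "\<lambda>_. grp G n (f x)"] by (simp add: pk_grp_def tw_grp_def)

lemma wrap_unwrap: "w \<in> carrier (pk_grp pull G n x) \<Longrightarrow> wrap (unwrap w) = w"
  using tuple_entry[of "{()}" w "\<lambda>_. grp G n (f x)"] by (simp add: pk_grp_def tw_grp_def)

lemma pull_rst: "pk_rst pull G n x x' w = wrap (rst G n (f x) (f x') (unwrap w))"
  unfolding pk_rst_def pull_simps by (rule tuple_cong) simp

lemma unwrap_pull_dif:
  assumes x: "x \<in> topspace X" and w: "w \<in> carrier (pk_grp pull G n x)"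
  shows "unwrap (pk_dif pull G n x w) = cdiff G n (f x) (unwrap w)"
proof -
  interpret A: comm_group "grp G (n + 1) (f x)" by (rule complex_grp[OF G f_in[OF x]])
  have c: "cdiff G n (f x) (unwrap w) \<in> carrier (grp G (n + 1) (f x))"
    by (rule complex_cdiff_closed[OF G f_in[OF x] hom_in_carrier[OF unwrap_hom w]])
  show ?thesis
    using entry_pk_dif[OF prekernel_pull G x, of "()" n w] c A.lincomb_zero[of "{()}" "\<lambda>_. 0"]
    by (simp add: tw_comp_def parity_sign_def)
qed

lemma unwrap_pull_mor: "x \<in> topspace X \<Longrightarrow> unwrap (pk_mor pull \<phi> n x w) = \<phi> n (f x) (unwrap w)"
  using entry_pk_mor[OF prekernel_pull G, of x "()" \<phi> n w] by simp

end

context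
  fixes F :: "('a, 'u::infinite) cochain" and G :: "('b, 'u) cochain"
  assumes F: "F \<in> Ob (complex_cat X)" and G: "G \<in> Ob (complex_cat Y)"
begin

text \<open>\<open>x\<close> belongs to the fibre below \<open>f x\<close>, so its structure map
  sends the stalk of \<open>F\<close> at \<open>x\<close> into that of \<open>f_!\<close> at
  \<open>f x\<close>. This is the unit of the adjunction, here followed by
  \<open>\<psi>\<close>.\<close>

definition transpose :: "('b, 'u) cmor \<Rightarrow> ('a, 'u) cmor" where
  "transpose \<psi> = (\<lambda>n. \<lambda>x\<in>topspace X. \<lambda>u\<in>carrier (grp F n x). wrap (\<psi> n (f x) (cin (cterm F n) (f x) x u)))"

definition cotranspose :: "('a, 'u) cmor \<Rightarrow> ('b, 'u) cmor" where
  "cotranspose \<phi> = (\<lambda>n. \<lambda>y\<in>topspace Y. colim_desc X (fib y) (cterm F n) (grp G n y)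
     (\<lambda>x. \<lambda>u\<in>carrier (grp F n x). rst G n (f x) y (unwrap (\<phi> n x u))))"

lemma transpose_app: "x \<in> topspace X \<Longrightarrow> u \<in> carrier (grp F n x) \<Longrightarrow>
    transpose \<psi> n x u = wrap (\<psi> n (f x) (cin (cterm F n) (f x) x u))"
  by (simp add: transpose_def)

lemma transpose_in:
  assumes \<psi>: "\<psi> \<in> Hom (complex_cat Y) (fob shriek F) G"
  shows "transpose \<psi> \<in> Hom (complex_cat X) F (fob (pk_ftor X pull) G)"
proof -
  note c = cin_closed[OF complex_cterm[OF F] fib_self]
  have m: "\<psi> n (f x) (cin (cterm F n) (f x) x u) \<in> carrier (grp G n (f x))"
    if "x \<in> topspace X" "u \<in> carrier (grp F n x)" for n x u
    using mor_closed[OF \<psi> f_in[OF that(1)]] c[OF that] by simp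
  note wc = hom_in_carrier[OF wrap_hom[OF G] m]
  show ?thesis
  proof (rule complex_HomI, goal_cases)
    case (1 n) then show ?case by (simp add: transpose_def)
  next
    case (2 n x)
    have "(\<lambda>u. wrap (\<psi> n (f x) (cin (cterm F n) (f x) x u))) \<in> hom (grp F n x) (pk_grp pull G n x)"
      by (rule hom_comp[OF cin_hom[OF complex_cterm[OF F] fib_self[OF 2]] hom_comp[OF mor_hom[OF \<psi> f_in[OF 2], unfolded shriek_complex_simps] wrap_hom[OF G]]])
    then show ?case using restrict_ghom[OF _ complex_grp[OF F 2]] 2 by (simp add: transpose_def)
  next
    case (3 n x x' u)
    have x: "x \<in> topspace X" "x' \<in> topspace X" using spec_leD[OF 3(1)] by auto
    note le = f_mono[OF 3(1)] and u = 3(2)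
    have ru: "rst F n x x' u \<in> carrier (grp F n x')" by (rule complex_rst_closed[OF F 3])
    have x': "x \<in> fib (f x')" by (rule fib_mono[OF le fib_self[OF x(1)]])
    have "rst G n (f x) (f x') (\<psi> n (f x) (cin (cterm F n) (f x) x u)) = \<psi> n (f x') (sres (cterm F n) (f x) (f x') (cin (cterm F n) (f x) x u))"
      using mor_rst[OF \<psi> le] c[OF x(1) u] by simp
    also have "\<dots> = \<psi> n (f x') (cin (cterm F n) (f x') x' (rst F n x x' u))"
      unfolding sres(2)[OF complex_cterm[OF F] le fib_self[OF x(1)] u] cin_res[OF complex_cterm[OF F] x' fib_self[OF x(2)] 3(1) u] ..
    finally show ?case using wc[OF x(1) u] by (simp add: transpose_app[OF x(1) u] transpose_app[OF x(2) ru] pull_rst[OF G])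
  next
    case (4 n x u)
    note x = 4(1) and u = 4(2)
    note du = complex_cdiff_closed[OF F x u]
    have "unwrap (pk_dif pull G n x (transpose \<psi> n x u)) = cdiff G n (f x) (\<psi> n (f x) (cin (cterm F n) (f x) x u))"
      unfolding transpose_app[OF x u] unwrap_pull_dif[OF G x wc[OF x u]] by simp
    also have "\<dots> = \<psi> (n + 1) (f x) (smor (cterm F n) (cterm F (n + 1)) (cdiff F n) (f x) (cin (cterm F n) (f x) x u))"
      using mor_cdiff[OF \<psi> f_in[OF x]] c[OF x u] f_in[OF x] by simp
    also have "\<dots> = \<psi> (n + 1) (f x) (cin (cterm F (n + 1)) (f x) x (cdiff F n x u))"
      unfolding smor(2)[OF complex_cterm[OF F] complex_cterm[OF F] complex_cdiff[OF F] fib_self[OF x] u] ..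
    finally have "wrap (unwrap (pk_dif pull G n x (transpose \<psi> n x u))) = transpose \<psi> (n + 1) x (cdiff F n x u)"
      unfolding transpose_app[OF x du] by (rule arg_cong)
    then have "pk_dif pull G n x (transpose \<psi> n x u) = transpose \<psi> (n + 1) x (cdiff F n x u)"
      using wrap_unwrap[OF G pk_dif_closed[OF prekernel_pull G x wc[OF x u]]] unfolding transpose_app[OF x u] by simp
    then show ?case using x wc[OF x u] unfolding transpose_app[OF x u] by simp
  qed
qed

context
  fixes \<phi> assumes \<phi>: "\<phi> \<in> Hom (complex_cat X) F (fob (pk_ftor X pull) G)"
begin

lemma unwrap_closed: "x \<in> topspace X \<Longrightarrow> u \<in> carrier (grp F n x) \<Longrightarrow> unwrap (\<phi> n x u) \<in> carrier (grp G n (f x))"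
  using hom_in_carrier[OF unwrap_hom[OF G]] mor_closed[OF \<phi>] by simp

text \<open>Over the fibre below \<open>y\<close>, \<open>\<phi>\<close> leads from the stalk at
  \<open>x\<close> to the stalk of \<open>G\<close> at \<open>f x\<close>, and restriction leads on
  to \<open>y\<close>. Compatibility for \<open>x\<close> below \<open>x'\<close> uses that
  \<open>f\<close> is monotone and that \<open>\<phi>\<close> commutes with restrictions.\<close>

lemma cotranspose_cocone:
  assumes y: "y \<in> topspace Y"
  shows "is_cocone X (fib y) (cterm F n) (grp G n y) (\<lambda>x. \<lambda>u\<in>carrier (grp F n x). rst G n (f x) y (unwrap (\<phi> n x u)))"
proof (rule cl_coconeI[OF complex_cterm[OF F] complex_grp[OF G y]])
  fix x assume "x \<in> fib y"
  then have x: "x \<in> topspace X" "spec_le Y (f x) y" using y by (auto simp: fib_iff)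
  have "(\<lambda>u. rst G n (f x) y (unwrap (\<phi> n x u))) \<in> hom (grp F n x) (grp G n y)"
    by (rule hom_comp[OF mor_hom[OF \<phi> x(1), unfolded pk_ftor_simps] hom_comp[OF unwrap_hom[OF G] complex_rst_hom[OF G x(2)]]])
  then show "(\<lambda>u\<in>carrier (grp F n x). rst G n (f x) y (unwrap (\<phi> n x u))) \<in> ghom (grp F n x) (grp G n y)"
    by (rule restrict_ghom[OF _ complex_grp[OF F x(1)]])
next
  fix x x' u assume "x \<in> fib y" "x' \<in> fib y" and le: "spec_le X x x'" and u: "u \<in> carrier (grp F n x)"
  then have x: "x \<in> topspace X" "x' \<in> topspace X" "spec_le Y (f x') y" using y by (auto simp: fib_iff)
  have "\<phi> n x u \<in> carrier (pk_grp pull G n x)" using mor_closed[OF \<phi> x(1) u] by simp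
  then have "\<phi> n x' (rst F n x x' u) = wrap (rst G n (f x) (f x') (unwrap (\<phi> n x u)))"
    using mor_rst[OF \<phi> le u] by (simp add: pull_rst[OF G])
  then have "rst G n (f x') y (unwrap (\<phi> n x' (rst F n x x' u))) = rst G n (f x) y (unwrap (\<phi> n x u))"
    using complex_rst_rst[OF G f_mono[OF le] x(3) unwrap_closed[OF x(1) u]] by simp
  then show "(\<lambda>u\<in>carrier (grp F n x'). rst G n (f x') y (unwrap (\<phi> n x' u))) (rst F n x x' u) =
      (\<lambda>u\<in>carrier (grp F n x). rst G n (f x) y (unwrap (\<phi> n x u))) u"
    using u complex_rst_closed[OF F le u] by simp
qed

lemma cotranspose_ghom: "y \<in> topspace Y \<Longrightarrow> cotranspose \<phi> n y \<in> ghom (cl (cterm F n) y) (grp G n y)"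
  using cl_desc(1)[OF complex_cterm[OF F] cotranspose_cocone] by (simp add: cotranspose_def)

lemma cotranspose_cin: "y \<in> topspace Y \<Longrightarrow> x \<in> fib y \<Longrightarrow> u \<in> carrier (grp F n x) \<Longrightarrow>
    cotranspose \<phi> n y (cin (cterm F n) y x u) = rst G n (f x) y (unwrap (\<phi> n x u))"
  using cl_desc(2)[OF complex_cterm[OF F] cotranspose_cocone] by (simp add: cotranspose_def)

lemma cotranspose_in: "cotranspose \<phi> \<in> Hom (complex_cat Y) (fob shriek F) G"
proof (rule complex_HomI, goal_cases)
  note FF = complex_cterm[OF F]
  {
    case (1 n) then show ?case by (simp add: cotranspose_def)
  next
    case (2 n y) then show ?case by (simp add: cotranspose_ghom)
  next
    case (3 n y y' a)
    have y: "y \<in> topspace Y" "y' \<in> topspace Y" using spec_leD[OF 3(1)] by auto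
    have "rst G n y y' (cotranspose \<phi> n y a) = cotranspose \<phi> n y' (sres (cterm F n) y y' a)"
    proof (rule cl_eqI[OF FF complex_grp[OF G y(2)] _ _ _ 3(2)[unfolded shriek_complex_simps]])
      show "(\<lambda>a. rst G n y y' (cotranspose \<phi> n y a)) \<in> hom (cl (cterm F n) y) (grp G n y')"
        by (rule hom_comp[OF ghom_hom[OF cotranspose_ghom[OF y(1)]] complex_rst_hom[OF G 3(1)]])
      show "(\<lambda>a. cotranspose \<phi> n y' (sres (cterm F n) y y' a)) \<in> hom (cl (cterm F n) y) (grp G n y')"
        by (rule hom_comp[OF ghom_hom[OF sres(1)[OF FF 3(1)]] ghom_hom[OF cotranspose_ghom[OF y(2)]]])
      fix x u assume x: "x \<in> fib y" and u: "u \<in> carrier (grp F n x)"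
      have "x \<in> topspace X" "spec_le Y (f x) y" using x y(1) by (auto simp: fib_iff)
      then show "rst G n y y' (cotranspose \<phi> n y (cin (cterm F n) y x u)) = cotranspose \<phi> n y' (sres (cterm F n) y y' (cin (cterm F n) y x u))"
        unfolding sres(2)[OF FF 3(1) x u] cotranspose_cin[OF y(1) x u] cotranspose_cin[OF y(2) fib_mono[OF 3(1) x] u]
        by (intro complex_rst_rst[OF G _ 3(1)] unwrap_closed u)
    qed
    then show ?case by simp
  next
    case (4 n y a)
    note y = 4(1)
    let ?d = "smor (cterm F n) (cterm F (n + 1)) (cdiff F n) y"
    note s = smor[OF FF FF complex_cdiff[OF F]]
    have "cdiff G n y (cotranspose \<phi> n y a) = cotranspose \<phi> (n + 1) y (?d a)"
    proof (rule cl_eqI[OF FF complex_grp[OF G y] _ _ _ 4(2)[unfolded shriek_complex_simps]])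
      show "(\<lambda>a. cdiff G n y (cotranspose \<phi> n y a)) \<in> hom (cl (cterm F n) y) (grp G (n + 1) y)"
        by (rule hom_comp[OF ghom_hom[OF cotranspose_ghom[OF y]] complex_cdiff_hom[OF G y]])
      show "(\<lambda>a. cotranspose \<phi> (n + 1) y (?d a)) \<in> hom (cl (cterm F n) y) (grp G (n + 1) y)"
        by (rule hom_comp[OF ghom_hom[OF s(1)] ghom_hom[OF cotranspose_ghom[OF y]]])
      fix x u assume x: "x \<in> fib y" and u: "u \<in> carrier (grp F n x)"
      have x': "x \<in> topspace X" "spec_le Y (f x) y" using x y by (auto simp: fib_iff)
      note du = complex_cdiff_closed[OF F x'(1) u]
      have pc: "\<phi> n x u \<in> carrier (pk_grp pull G n x)" using mor_closed[OF \<phi> x'(1) u] by simp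
      have "unwrap (\<phi> (n + 1) x (cdiff F n x u)) = cdiff G n (f x) (unwrap (\<phi> n x u))"
        using mor_cdiff[OF \<phi> x'(1) u] unwrap_pull_dif[OF G x'(1) pc] pc x'(1) by simp
      then show "cdiff G n y (cotranspose \<phi> n y (cin (cterm F n) y x u)) = cotranspose \<phi> (n + 1) y (?d (cin (cterm F n) y x u))"
        unfolding s(2)[OF x u] cotranspose_cin[OF y x u] cotranspose_cin[OF y x du]
        using complex_rst_cdiff[OF G x'(2) unwrap_closed[OF x'(1) u]] by simp
    qed
    then show ?case using y by simp
  }
qed

lemma transpose_cotranspose: "transpose (cotranspose \<phi>) = \<phi>"
proof (rule complex_mor_eqI[OF transpose_in[OF cotranspose_in] \<phi>])
  fix n x u assume x: "x \<in> topspace X" and u: "u \<in> carrier (grp F n x)"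
  have "\<phi> n x u \<in> carrier (pk_grp pull G n x)" using mor_closed[OF \<phi> x u] by simp
  from wrap_unwrap[OF G this] show "transpose (cotranspose \<phi>) n x u = \<phi> n x u"
    unfolding transpose_app[OF x u] cotranspose_cin[OF f_in[OF x] fib_self[OF x] u]
      complex_rst_refl[OF G f_in[OF x] unwrap_closed[OF x u]] .
qed

end

lemma cotranspose_transpose:
  assumes \<psi>: "\<psi> \<in> Hom (complex_cat Y) (fob shriek F) G"
  shows "cotranspose (transpose \<psi>) = \<psi>"
proof (rule complex_mor_eqI[OF cotranspose_in[OF transpose_in[OF \<psi>]] \<psi>])
  fix n y a assume y: "y \<in> topspace Y" and a: "a \<in> carrier (grp (fob shriek F) n y)"
  note FF = complex_cterm[OF F]
  show "cotranspose (transpose \<psi>) n y a = \<psi> n y a"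
  proof (rule cl_eqI[OF FF complex_grp[OF G y] ghom_hom[OF cotranspose_ghom[OF transpose_in[OF \<psi>] y]] _ _ a[unfolded shriek_complex_simps]])
    show "\<psi> n y \<in> hom (cl (cterm F n) y) (grp G n y)" using mor_hom[OF \<psi> y] by simp
    fix x u assume x: "x \<in> fib y" and u: "u \<in> carrier (grp F n x)"
    have x': "x \<in> topspace X" "spec_le Y (f x) y" using x y by (auto simp: fib_iff)
    have "rst G n (f x) y (\<psi> n (f x) (cin (cterm F n) (f x) x u)) = \<psi> n y (sres (cterm F n) (f x) y (cin (cterm F n) (f x) x u))"
      using mor_rst[OF \<psi> x'(2)] cin_closed[OF FF fib_self[OF x'(1)] u] by simp
    then show "cotranspose (transpose \<psi>) n y (cin (cterm F n) y x u) = \<psi> n y (cin (cterm F n) y x u)"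
      unfolding cotranspose_cin[OF transpose_in[OF \<psi>] y x u] transpose_app[OF x'(1) u] sres(2)[OF FF x'(2) fib_self[OF x'(1)] u] by simp
  qed
qed

lemma bij_transpose: "bij_betw transpose (Hom (complex_cat Y) (fob shriek F) G) (Hom (complex_cat X) F (fob (pk_ftor X pull) G))"
  by (rule bij_betw_byWitness[where f' = cotranspose])
    (auto simp: cotranspose_transpose transpose_cotranspose transpose_in cotranspose_in)

end

lemma left_adjoint_shriek:
  "left_adjoint (complex_cat X :: (('a, 'u::infinite) cochain, _) cat) (complex_cat Y) shriek (pk_ftor X pull)"
  unfolding left_adjoint_def
proof (intro conjI exI[of _ "\<lambda>F G. transpose F"] ballI)
  let ?CX = "complex_cat X :: (('a, 'u) cochain, _) cat" and ?CY = "complex_cat Y :: (('b, 'u) cochain, _) cat"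
  let ?E = "pk_ftor X pull :: (('b, 'u) cochain, _, ('a, 'u) cochain, _) ftor"
  have cX: "is_category ?CX" and cY: "is_category ?CY" by (rule is_category_complex_cat)+
  show "is_functor ?CX ?CY shriek" by (rule shriek_functor)
  show E: "is_functor ?CY ?CX ?E" by (rule pk_functor[OF prekernel_pull])
  show "bij_betw (transpose F) (Hom ?CY (fob shriek F) G) (Hom ?CX F (fob ?E G))" if "F \<in> Ob ?CX" "G \<in> Ob ?CY" for F G
    by (rule bij_transpose[OF that])
  fix F F' G G' u v h
  assume F: "F \<in> Ob ?CX" and F': "F' \<in> Ob ?CX" and G: "G \<in> Ob ?CY" and G': "G' \<in> Ob ?CY"
    and u: "u \<in> Hom ?CX F' F" and v: "v \<in> Hom ?CY G G'" and h: "h \<in> Hom ?CY (fob shriek F) G"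
  let ?hu = "Cmp ?CY (fob shriek F') (fob shriek F) G h (far shriek F' F u)"
  let ?vhu = "Cmp ?CY (fob shriek F') G G' v ?hu"
  have hu: "?hu \<in> Hom ?CY (fob shriek F') G" by (rule cat_Cmp[OF cY shriek_fob[OF F'] shriek_fob[OF F] G shriek_far[OF F' F u] h])
  have vhu: "?vhu \<in> Hom ?CY (fob shriek F') G'" by (rule cat_Cmp[OF cY shriek_fob[OF F'] G G' hu v])
  note EG = pk_fob[OF prekernel_pull G] and EG' = pk_fob[OF prekernel_pull G'] and Ev = pk_far[OF prekernel_pull G G' v]
  note th = transpose_in[OF F G h]
  let ?t = "Cmp ?CX F' F (fob ?E G) (transpose F h) u"
  have t: "?t \<in> Hom ?CX F' (fob ?E G)" by (rule cat_Cmp[OF cX F' F EG u th])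
  show "transpose F' ?vhu = Cmp ?CX F' (fob ?E G) (fob ?E G') (far ?E G G' v) ?t"
  proof (rule complex_mor_eqI[OF transpose_in[OF F' G' vhu] cat_Cmp[OF cX F' EG EG' t Ev]])
    fix n x w assume x: "x \<in> topspace X" and w: "w \<in> carrier (grp F' n x)"
    let ?y = "f x"
    have y: "?y \<in> topspace Y" by (rule f_in[OF x])
    have uw: "u n x w \<in> carrier (grp F n x)" by (rule mor_closed[OF u x w])
    let ?z = "h n ?y (cin (cterm F n) ?y x (u n x w))"
    have cu: "cin (cterm F n) ?y x (u n x w) \<in> carrier (grp (fob shriek F) n ?y)"
      using cin_closed[OF complex_cterm[OF F] fib_self[OF x] uw] by simp
    have cw: "cin (cterm F' n) ?y x w \<in> carrier (grp (fob shriek F') n ?y)" using cin_closed[OF complex_cterm[OF F'] fib_self[OF x] w] by simp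
    have z: "?z \<in> carrier (grp G n ?y)" by (rule mor_closed[OF h y cu])
    have wz: "wrap ?z \<in> carrier (pk_grp pull G n x)" by (rule hom_in_carrier[OF wrap_hom[OF G] z])
    have "transpose F' ?vhu n x w = wrap (v n ?y (h n ?y (smor (cterm F' n) (cterm F n) (u n) ?y (cin (cterm F' n) ?y x w))))"
      unfolding transpose_app[OF F' G' x w] using y cw by simp
    also have "\<dots> = wrap (v n ?y ?z)" unfolding smor(2)[OF complex_cterm[OF F'] complex_cterm[OF F] mor_abdata[OF u] fib_self[OF x] w] ..
    also have "\<dots> = pk_mor pull v n x (wrap ?z)"
      using wrap_unwrap[OF G' pk_mor_closed[OF prekernel_pull G v x wz]] unwrap_pull_mor[OF G x, of v n "wrap ?z"] by simp
    also have "\<dots> = Cmp ?CX F' (fob ?E G) (fob ?E G') (far ?E G G' v) ?t n x w" using x w uw wz by (simp add: transpose_app[OF F G x uw])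
    finally show "transpose F' ?vhu n x w = Cmp ?CX F' (fob ?E G) (fob ?E G') (far ?E G G' v) ?t n x w" .
  qed
qed

end

theorem theorem4p3p10:
  fixes X :: "'a topology" and Y :: "'b topology" and f :: "'a \<Rightarrow> 'b"
  assumes "finite (topspace X)" and "finite (topspace Y)" and "continuous_map X Y f"
  shows "\<exists>f_sharp :: (('b, 'u::infinite) cochain, ('b, 'u) dmor, ('a, 'u) cochain, ('a, 'u) dmor) ftor.
    left_adjoint (derived_cat Y) (derived_cat X) f_sharp (L_lower_shriek X Y f)"
proof -
  interpret finite_map X Y f by unfold_locales (rule assms)+
  let ?CX = "complex_cat X :: (('a, 'u) cochain, ('a, 'u) cmor) cat" and ?CY = "complex_cat Y :: (('b, 'u) cochain, ('b, 'u) cmor) cat"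
  let ?locX = "localized_ftor ?CX (quasi_isos X) ?CY (quasi_isos Y)"
  let ?locY = "localized_ftor ?CY (quasi_isos Y) ?CX (quasi_isos X)"
  let ?E = "pk_ftor X pull :: (('b, 'u) cochain, _, ('a, 'u) cochain, _) ftor"
  interpret X: relative_category ?CX "quasi_isos X" by (rule relative_category_complex)
  interpret Y: relative_category ?CY "quasi_isos Y" by (rule relative_category_complex)
  note dX = derived_cat_def[of X] and dY = derived_cat_def[of Y]
  have E: "relative_functor ?CY (quasi_isos Y) ?CX (quasi_isos X) ?E" by (rule pk_relative_functor[OF prekernel_pull])
  \<comment> \<open>At this stage \<open>L\<close> is only known as left adjoint of the localized
    inverse image; its relation to \<open>f_!\<close> comes with \<open>ex\<close>.\<close>
  obtain L :: "('a set \<times> unit, 'a, 'b) prekernel" where L: "is_prekernel X Y L"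
    "left_adjoint X.loc Y.loc (?locX (pk_ftor Y L)) (?locY ?E)"
    by (rule left_adjoint_prekernel[OF prekernel_pull finX, unfolded dX dY])
  \<comment> \<open>The second round is possible because \<open>L\<close> is itself given by a
    prekernel, now over the finite space \<open>Y\<close>. \<open>M\<close> gives the functor that
    will be the answer.\<close>
  obtain M :: "('b set \<times> 'a set \<times> unit, 'b, 'a) prekernel" where M: "is_prekernel Y X M"
    "left_adjoint Y.loc X.loc (?locY (pk_ftor X M)) (?locX (pk_ftor Y L))"
    by (rule left_adjoint_prekernel[OF L(1) finY, unfolded dX dY])
  obtain \<eta> e where adj: "adjunction ?CX ?CY shriek ?E \<eta> e"
    by (rule left_adjoint_imp_adjunction[OF X.C Y.C left_adjoint_shriek])
  obtain \<eta>' e' where adj': "adjunction X.loc Y.loc (?locX (pk_ftor Y L)) (?locY ?E) \<eta>' e'"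
    by (rule left_adjoint_imp_adjunction[OF X.loc Y.loc L(2)])
  \<comment> \<open>On complexes \<open>f_!\<close> is left adjoint to the inverse image, and on
    derived categories \<open>L\<close> is. Comparing mates for the two adjunctions identifies
    \<open>L\<close> as a left derived functor.\<close>
  have ex: "\<exists>\<epsilon>. is_left_derived ?CX (quasi_isos X) ?CY (quasi_isos Y) shriek (?locX (pk_ftor Y L)) \<epsilon>"
    by (rule left_derived_of_adjoint[OF shriek_functor E adj adj'])
  then obtain \<epsilon> where \<epsilon>: "is_left_derived ?CX (quasi_isos X) ?CY (quasi_isos Y) shriek (?locX (pk_ftor Y L)) \<epsilon>" ..
  \<comment> \<open>Existence turns the choice in \<open>L_lower_shriek\<close> into an actual left
    derived functor, which need not equal \<open>L\<close> but is isomorphic to it.\<close>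
  obtain \<epsilon>' where \<epsilon>': "is_left_derived ?CX (quasi_isos X) ?CY (quasi_isos Y) shriek (L_lower_shriek X Y f) \<epsilon>'"
  proof -
    have "\<exists>L \<epsilon>. is_left_derived ?CX (quasi_isos X) ?CY (quasi_isos Y) shriek L \<epsilon>" using \<epsilon> by blast
    from someI_ex[OF this] show ?thesis using that unfolding L_lower_shriek_def[symmetric] by blast
  qed
  show ?thesis
  proof (rule left_derived_unique[OF X.relative_category_axioms Y.relative_category_axioms shriek_functor \<epsilon> \<epsilon>'])
    fix \<tau> assume \<tau>: "natural X.loc Y.loc (?locX (pk_ftor Y L)) (L_lower_shriek X Y f) \<tau>"
      "\<And>a. a \<in> Ob ?CX \<Longrightarrow> is_iso Y.loc (fob (?locX (pk_ftor Y L)) a) (fob (L_lower_shriek X Y f) a) (\<tau> a)"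
    \<comment> \<open>The left adjoint of \<open>L\<close> stays a left adjoint when
      \<open>L\<close> is replaced by the isomorphic chosen derived functor.\<close>
    have "left_adjoint Y.loc X.loc (?locY (pk_ftor X M)) (L_lower_shriek X Y f)"
      by (rule left_adjoint_iso[OF Y.loc X.loc M(2) _ \<tau>(1)])
        (use \<epsilon>' \<tau>(2) in \<open>simp_all add: is_left_derived_def localization_def\<close>)
    then show ?thesis unfolding dX dY by blast
  qed
qed

end
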